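(* Let $\lambda>\lambda_c$, where $\lambda_c$ is the critical intensity of Gilbert's graph $G(\mathscr{P}_\lambda,1)$, and let $\mathcal{C}$ be the (almost surely unique) infinite connected component of $G(\mathscr{P}_\lambda,1)$. Then the critical probabilities for site and bond percolation on $\mathcal{C}$ satisfy the strict inequality $p_c^{\rm site} > p_c^{\rm bond}$.
   Context: For $\lambda>0$, $\mathscr{P}_\lambda$ denotes a homogeneous Poisson point process of intensity $\lambda$ in $\mathbb{R}^2$. Gilbert's graph $G(\mathscr{P}_\lambda,1)$ has vertex set $\mathscr{P}_\lambda$ and joins two vertices $x,y$ by an edge iff $|x-y|\le 1$. Its critical intensity $\lambda_c\in(0,\infty)$ is such that for $\lambda>\lambda_c$ there is almost surely a unique infinite connected component $\mathcal{C}$, and for $\lambda<\lambda_c$ almost surely none. Site percolation on $\mathcal{C}$ with parameter $p$: each vertex of $\mathcal{C}$ is independently open with probability $p$; $p_c^{\rm site}$ is the critical value of $p$ such that for $p>p_c^{\rm site}$ the subgraph induced by open vertices has an infinite component a.s. and for $p<p_c^{\rm site}$ it has none a.s. Bond percolation on $\mathcal{C}$: each edge of $\mathcal{C}$ is independently open with probability $p$; $p_c^{\rm bond}$ is the analogous critical value for the subgraph of open edges. *)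

theory Defs
  imports "HOL-Probability.Probability"
begin

type_synonym pt = "real ^ 2"

definition gadj :: "pt set \<Rightarrow> pt \<Rightarrow> pt \<Rightarrow> bool" where
  "gadj V x y \<longleftrightarrow> x \<in> V \<and> y \<in> V \<and> x \<noteq> y \<and> dist x y \<le> 1"

definition has_inf_comp :: "pt set \<Rightarrow> bool" where
  "has_inf_comp V \<longleftrightarrow> (\<exists>x\<in>V. infinite {y. (gadj V)\<^sup>*\<^sup>* x y})"

definition is_inf_component :: "pt set \<Rightarrow> pt set \<Rightarrow> bool" where
  "is_inf_component S C \<longleftrightarrow> (\<exists>x\<in>S. C = {y. (gadj S)\<^sup>*\<^sup>* x y} \<and> infinite C)"

definition poisson_pp :: "'a measure \<Rightarrow> real \<Rightarrow> ('a \<Rightarrow> pt set) \<Rightarrow> bool" where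
  "poisson_pp M lam P \<longleftrightarrow> prob_space M \<and> lam > 0 \<and>
     (AE \<omega> in M. \<forall>A. bounded A \<longrightarrow> finite (P \<omega> \<inter> A)) \<and>
     (\<forall>A. A \<in> sets lborel \<and> bounded A \<longrightarrow>
        (\<lambda>\<omega>. card (P \<omega> \<inter> A)) \<in> measurable M (count_space UNIV) \<and>
        (\<forall>k::nat. measure M {\<omega> \<in> space M. card (P \<omega> \<inter> A) = k}
            = exp (- (lam * measure lborel A)) * (lam * measure lborel A) ^ k / fact k)) \<and>
     (\<forall>(n::nat) (A :: nat \<Rightarrow> pt set).
        (\<forall>i<n. A i \<in> sets lborel \<and> bounded (A i)) \<and> disjoint_family_on A {..<n} \<longrightarrow>
        prob_space.indep_vars M (\<lambda>_. count_space UNIV) (\<lambda>i \<omega>. card (P \<omega> \<inter> A i)) {..<n})"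

definition gilbert_lambda_c :: real where
  "gilbert_lambda_c = Inf {lam. lam > 0 \<and>
     (\<exists>M :: pt set measure. poisson_pp M lam (\<lambda>S. S) \<and> (AE S in M. has_inf_comp S))}"

definition pc_site :: "pt set \<Rightarrow> real" where
  "pc_site C = Sup {p \<in> {0..1}.
     AE \<xi> in PiM C (\<lambda>_. measure_pmf (bernoulli_pmf p)). \<not> has_inf_comp {v \<in> C. \<xi> v}}"

definition gedges :: "pt set \<Rightarrow> pt set set" where
  "gedges C = {{x, y} | x y. gadj C x y}"

definition bond_perc :: "pt set \<Rightarrow> (pt set \<Rightarrow> bool) \<Rightarrow> bool" where
  "bond_perc C \<eta> \<longleftrightarrow> (\<exists>x\<in>C. infinite {y. (\<lambda>a b. gadj C a b \<and> \<eta> {a, b})\<^sup>*\<^sup>* x y})"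

definition pc_bond :: "pt set \<Rightarrow> real" where
  "pc_bond C = Sup {p \<in> {0..1}.
     AE \<eta> in PiM (gedges C) (\<lambda>_. measure_pmf (bernoulli_pmf p)). \<not> bond_perc C \<eta>}"

end

theory Submission
  imports Defs "HOL-Real_Asymp.Real_Asymp"
begin

text \<open>Site percolation on an infinite component with retention probability \<open>p\<close> is the Gilbert graph of intensity
  \<open>lam * p\<close>, so its threshold is at least \<open>gilbert_lambda_c / lam\<close>. It remains to find
  \<open>q < gilbert_lambda_c / lam\<close> such that bond percolation with parameter \<open>q\<close> occurs on every infinite component.

  Discretise the plane into cells of side about \<open>1 / (4 * N)\<close>; the Gilbert graph becomes mixed site-bond percolation
  on a lattice whose sites are the occupied cells. By Russo's formula, the derivatives of a connection
  probability in the site density and in the bond parameter count pivotal sites and pivotal bonds. A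
  pivotal bond joins pivotal sites, and only bad pivotal sites, those with a single open bond towards either
  terminal, lie on two pivotal bonds. A local modification whose cost is bounded uniformly in \<open>N\<close> turns bad
  pivotal sites into good ones, so pivotal bonds are scarcer than pivotal sites by a uniform factor.
  Hence lowering the bond parameter from 1 to \<open>q\<close> is compensated by a raise of the site density by a factor
  strictly smaller than \<open>1 / q\<close>, uniformly in \<open>N\<close>. So for large \<open>N\<close> and some \<open>q < gilbert_lambda_c / lam\<close>, a slightly
  thinned process already bond-percolates at \<open>q\<close>; a zero-one law makes this almost sure.

  It remains to see that every infinite component meets the cells \<open>I\<close> from which the thinned process
  bond-percolates. Restore the removed points. A component at positive distance from \<open>I\<close> that has infinitely
  many closest cells to \<open>I\<close> would almost surely be joined to \<open>I\<close> by restored points, and one with finitely many is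
  excluded by mass transport.\<close>


section \<open>Finite site-bond percolation\<close>

text \<open>The obstacle is uniformity in \<open>N\<close>. A cell is occupied with probability of
  order \<open>1 / N ^ 2\<close> and has of order \<open>N ^ 2\<close> neighbours, so opening one
  prescribed cell costs a factor of order \<open>N ^ 2\<close>. Near a bad pivotal site
  \<open>x\<close> the modification must therefore leave the cell free: any cell in the lens common
  to \<open>x\<close> and its only entrance \<open>u\<close> is offered, and these at least
  \<open>N ^ 2 - 2\<close> choices pay for the cost. Changing a bond costs a bounded factor only
  while the bond parameter stays away from 0 and 1. So the descent has two stages: from 1 to some
  \<open>p2 < 1\<close> with the trivial bound of pivotal bonds by pivotal sites, from
  \<open>p2\<close> to \<open>q\<close> with a ratio \<open>\<alpha> < 1\<close>. If the site
  density is proportional to \<open>t powr (- \<alpha>)\<close> at bond parameter \<open>t\<close>,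
  such a ratio makes connection probabilities nonincreasing in \<open>t\<close>. At
  \<open>q = ps\<close>, with \<open>ps = gilbert_lambda_c / lam\<close>, the two stages multiply
  the density by \<open>(p2 / ps) powr \<alpha> / p2\<close>, strictly less than
  \<open>1 / ps\<close>. This gap leaves room to move \<open>q\<close> below \<open>ps\<close>, to
  thin the process, and to absorb the error of discretisation.\<close>

definition bern_weight :: "'k set \<Rightarrow> ('k \<Rightarrow> real) \<Rightarrow> 'k set \<Rightarrow> real" where
  "bern_weight K \<pi> S = (\<Prod>k\<in>K. if k \<in> S then \<pi> k else 1 - \<pi> k)"

definition bern_expect :: "'k set \<Rightarrow> ('k \<Rightarrow> real) \<Rightarrow> ('k set \<Rightarrow> real) \<Rightarrow> real" where
  "bern_expect K \<pi> F = (\<Sum>S\<in>Pow K. bern_weight K \<pi> S * F S)"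

lemma bern_weight_cong: "S \<inter> K = S' \<inter> K \<Longrightarrow> bern_weight K \<pi> S = bern_weight K \<pi> S'"
  unfolding bern_weight_def by (intro prod.cong) auto

lemma bern_weight_nonneg:
  assumes "\<And>k. k \<in> K \<Longrightarrow> 0 \<le> \<pi> k \<and> \<pi> k \<le> 1"
  shows "0 \<le> bern_weight K \<pi> S"
  unfolding bern_weight_def using assms by (intro prod_nonneg) auto

lemma bern_weight_remove:
  assumes "finite K" "k \<in> K"
  shows "bern_weight K \<pi> S = (if k \<in> S then \<pi> k else 1 - \<pi> k) * bern_weight (K - {k}) \<pi> S"
  unfolding bern_weight_def by (subst prod.remove[OF assms]) simp

lemma bern_expect_split:
  assumes "finite K" "k \<in> K"
  shows "(\<Sum>S\<in>Pow K. F S) = (\<Sum>S\<in>Pow (K - {k}). F (insert k S) + F S)"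
proof -
  have eq: "Pow K = insert k ` Pow (K - {k}) \<union> Pow (K - {k})"
    using assms(2) Pow_insert[of k "K - {k}"] by (auto simp: insert_absorb)
  have inj: "inj_on (insert k) (Pow (K - {k}))"
    by (auto simp: inj_on_def)
  show ?thesis
    unfolding eq using assms
    by (subst sum.union_disjoint) (auto simp: sum.reindex[OF inj] sum.distrib)
qed

lemma bern_expect_remove:
  assumes "finite K" "k \<in> K"
  shows "bern_expect K \<pi> F =
    bern_expect (K - {k}) \<pi> (\<lambda>S. \<pi> k * F (insert k S) + (1 - \<pi> k) * F S)"
proof -
  have w: "bern_weight (K - {k}) \<pi> (insert k S) = bern_weight (K - {k}) \<pi> S" for S
    by (rule bern_weight_cong) auto
  show ?thesis
    unfolding bern_expect_def bern_expect_split[OF assms]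
    by (intro sum.cong) (auto simp: bern_weight_remove[OF assms] w algebra_simps)
qed

lemma bern_expect_indep:
  assumes "finite K" "k \<in> K" "\<And>S. S \<subseteq> K - {k} \<Longrightarrow> F (insert k S) = F S"
  shows "bern_expect K \<pi> F = bern_expect (K - {k}) \<pi> F"
  unfolding bern_expect_remove[OF assms(1,2)] unfolding bern_expect_def
  by (intro sum.cong) (auto simp: assms(3) algebra_simps)

text \<open>Russo's formula, as the product rule for a polynomial: expectations are finite sums
  here, and pairing each \<open>S\<close> with \<open>insert k S\<close> turns the signed weights of
  coordinate \<open>k\<close> into its influence. One parameter per coordinate allows the site
  density and the bond parameter to move together.\<close>

lemma bern_expect_has_derivative:
  fixes \<pi> :: "real \<Rightarrow> 'k \<Rightarrow> real"
  assumes K: "finite K"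
    and d: "\<And>k. k \<in> K \<Longrightarrow> ((\<lambda>t. \<pi> t k) has_real_derivative \<pi>' k) (at t)"
  shows "((\<lambda>t. bern_expect K (\<pi> t) F) has_real_derivative
    (\<Sum>k\<in>K. \<pi>' k * bern_expect K (\<pi> t) (\<lambda>S. F (insert k S) - F (S - {k})))) (at t)"
proof -
  have "((\<lambda>t. bern_expect K (\<pi> t) F) has_real_derivative
     (\<Sum>S\<in>Pow K. (\<Sum>k\<in>K. (if k \<in> S then \<pi>' k else - \<pi>' k) * 
        (\<Prod>j\<in>K - {k}. if j \<in> S then \<pi> t j else 1 - \<pi> t j)) * F S)) (at t)"
    unfolding bern_expect_def bern_weight_def
    by (auto intro!: derivative_eq_intros has_field_derivative_prod d)
  moreover have "(\<Sum>S\<in>Pow K. (\<Sum>k\<in>K. (if k \<in> S then \<pi>' k else - \<pi>' k) * 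
        (\<Prod>j\<in>K - {k}. if j \<in> S then \<pi> t j else 1 - \<pi> t j)) * F S)
     = (\<Sum>k\<in>K. \<Sum>S\<in>Pow K. (if k \<in> S then \<pi>' k else - \<pi>' k) * bern_weight (K - {k}) (\<pi> t) S * F S)"
    unfolding bern_weight_def sum_distrib_right by (rule sum.swap)
  moreover have "(\<Sum>S\<in>Pow K. (if k \<in> S then \<pi>' k else - \<pi>' k) * bern_weight (K - {k}) (\<pi> t) S * F S)
    = \<pi>' k * bern_expect K (\<pi> t) (\<lambda>S. F (insert k S) - F (S - {k}))" if k: "k \<in> K" for k
  proof -
    have w: "bern_weight (K - {k}) (\<pi> t) (insert k S) = bern_weight (K - {k}) (\<pi> t) S" for S
      by (rule bern_weight_cong) auto
    have "bern_expect K (\<pi> t) (\<lambda>S. F (insert k S) - F (S - {k})) 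
        = bern_expect (K - {k}) (\<pi> t) (\<lambda>S. F (insert k S) - F (S - {k}))"
      by (rule bern_expect_indep[OF K k]) auto
    then show ?thesis
      unfolding bern_expect_split[OF K k]
      by (auto simp: bern_expect_def w sum_distrib_left algebra_simps intro!: sum.cong)
  qed
  ultimately show ?thesis by simp
qed

text \<open>The influence of \<open>k\<close> ignores the state of \<open>k\<close>, so the factor
  \<open>\<pi> k\<close> may be spent on asking that \<open>k\<close> be open. This turns
  derivatives into expected numbers of open pivotal coordinates.\<close>

lemma bern_expect_pivotal:
  assumes "finite K" "k \<in> K"
  shows "\<pi> k * bern_expect K \<pi> (\<lambda>S. F (insert k S) - F (S - {k})) =
     bern_expect K \<pi> (\<lambda>S. if k \<in> S then F S - F (S - {k}) else 0)"
proof -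
  have 1: "bern_expect K \<pi> (\<lambda>S. F (insert k S) - F (S - {k})) = 
     bern_expect (K - {k}) \<pi> (\<lambda>S. F (insert k S) - F (S - {k}))"
    by (rule bern_expect_indep[OF assms]) auto
  show ?thesis unfolding 1 unfolding bern_expect_remove[OF assms] 
    unfolding bern_expect_def sum_distrib_left
    by (intro sum.cong) (auto simp: Diff_insert0)
qed

lemma bern_expect_mono:
  assumes "\<And>k. k \<in> K \<Longrightarrow> 0 \<le> \<pi> k \<and> \<pi> k \<le> 1" "\<And>S. S \<subseteq> K \<Longrightarrow> F S \<le> G S"
  shows "bern_expect K \<pi> F \<le> bern_expect K \<pi> G"
  unfolding bern_expect_def
  by (intro sum_mono mult_left_mono bern_weight_nonneg assms) (use assms in auto)

lemma bern_expect_sum: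
  "bern_expect K \<pi> (\<lambda>S. \<Sum>a\<in>A. F a S) = (\<Sum>a\<in>A. bern_expect K \<pi> (F a))"
  unfolding bern_expect_def sum_distrib_left by (rule sum.swap)

lemma bern_expect_add:
  "bern_expect K \<pi> (\<lambda>S. F S + G S) = bern_expect K \<pi> F + bern_expect K \<pi> G"
  unfolding bern_expect_def by (simp add: algebra_simps sum.distrib)

lemma bern_expect_cmult:
  "bern_expect K \<pi> (\<lambda>S. c * F S) = c * bern_expect K \<pi> F"
  unfolding bern_expect_def by (simp add: algebra_simps sum_distrib_left)

text \<open>Pairs of a configuration and a marked vertex are the objects on which the local
  modifications act.\<close>

lemma bern_expect_card:
  assumes "finite K" "finite V"
  shows "bern_expect K \<pi> (\<lambda>S. real (card {x\<in>V. Q S x})) =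
    (\<Sum>z\<in>{(S, x). S \<subseteq> K \<and> x \<in> V \<and> Q S x}. bern_weight K \<pi> (fst z))"
proof -
  have e: "{(S, x). S \<subseteq> K \<and> x \<in> V \<and> Q S x} = Sigma (Pow K) (\<lambda>S. {x\<in>V. Q S x})" by auto
  have "bern_expect K \<pi> (\<lambda>S. real (card {x\<in>V. Q S x})) =
      (\<Sum>S\<in>Pow K. \<Sum>x\<in>{x\<in>V. Q S x}. bern_weight K \<pi> S)"
    unfolding bern_expect_def by (simp add: mult.commute)
  also have "\<dots> = (\<Sum>z\<in>Sigma (Pow K) (\<lambda>S. {x\<in>V. Q S x}). bern_weight K \<pi> (fst z))"
    by (subst sum.Sigma) (use assms in \<open>auto simp: case_prod_unfold\<close>)
  finally show ?thesis unfolding e .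
qed

text \<open>The common bound for all local modifications: each loses at most a factor
  \<open>c\<close> of weight, and at most \<open>N\<close> pairs are modified to the same
  one.\<close>

lemma weight_sum_le_by_map:
  fixes w :: "'s \<Rightarrow> real"
  assumes fin: "finite X" "finite Y" and map: "\<phi> ` X \<subseteq> Y"
    and ratio: "\<And>z. z \<in> X \<Longrightarrow> w (fst z) \<le> c * w (fst (\<phi> z))"
    and fibre: "\<And>y. y \<in> Y \<Longrightarrow> card {z\<in>X. \<phi> z = y} \<le> N"
    and nn: "\<And>S. 0 \<le> w S" "0 \<le> c"
  shows "(\<Sum>z\<in>X. w (fst z)) \<le> c * real N * (\<Sum>y\<in>Y. w (fst y))"
proof -
  have "(\<Sum>z\<in>X. w (fst z)) \<le> (\<Sum>z\<in>X. c * w (fst (\<phi> z)))"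
    by (intro sum_mono ratio)
  also have "\<dots> = (\<Sum>y\<in>Y. \<Sum>z\<in>{z\<in>X. \<phi> z = y}. c * w (fst (\<phi> z)))"
    using sum.group[OF fin map, of "\<lambda>z. c * w (fst (\<phi> z))"] by simp
  also have "\<dots> = (\<Sum>y\<in>Y. real (card {z\<in>X. \<phi> z = y}) * (c * w (fst y)))"
    by (intro sum.cong) auto
  also have "\<dots> \<le> (\<Sum>y\<in>Y. real N * (c * w (fst y)))"
    by (intro sum_mono mult_right_mono) (use fibre nn in auto)
  also have "\<dots> = c * real N * (\<Sum>y\<in>Y. w (fst y))"
    by (simp add: sum_distrib_left algebra_simps)
  finally show ?thesis .
qed

section \<open>Clusters in site-bond percolation\<close>

locale site_bond =
  fixes V :: "'v set" and adj :: "'v \<Rightarrow> 'v \<Rightarrow> bool"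
  assumes adj_sym: "adj u v \<Longrightarrow> adj v u"
    and adj_irrefl: "\<not> adj u u"
begin

text \<open>Sites and bonds are coordinates of one configuration, \<open>Inl v\<close> for sites and
  \<open>Inr {u, v}\<close> for bonds, so that both fit into a single Bernoulli weight.\<close>

definition stp :: "('v + 'v set) set \<Rightarrow> 'v \<Rightarrow> 'v \<Rightarrow> bool" where
  "stp S u v \<longleftrightarrow> u \<in> V \<and> v \<in> V \<and> adj u v \<and> Inl u \<in> S \<and> Inl v \<in> S \<and> Inr {u, v} \<in> S"

inductive_set reach :: "'v set \<Rightarrow> ('v + 'v set) set \<Rightarrow> 'v set" for X S where
  base: "u \<in> X \<Longrightarrow> u \<in> V \<Longrightarrow> Inl u \<in> S \<Longrightarrow> u \<in> reach X S"
| step: "u \<in> reach X S \<Longrightarrow> stp S u v \<Longrightarrow> v \<in> reach X S"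

lemma stp_sym: "stp S u v \<Longrightarrow> stp S v u"
  unfolding stp_def using adj_sym by (auto simp: insert_commute)

lemma reach_open: "v \<in> reach X S \<Longrightarrow> v \<in> V \<and> Inl v \<in> S"
  by (induction rule: reach.induct) (auto simp: stp_def)

lemma reach_least:
  assumes "\<And>u. u \<in> X \<Longrightarrow> u \<in> V \<Longrightarrow> Inl u \<in> S \<Longrightarrow> u \<in> Z"
    and "\<And>u v. u \<in> Z \<Longrightarrow> stp S u v \<Longrightarrow> v \<in> Z"
  shows "reach X S \<subseteq> Z"
proof
  fix v assume "v \<in> reach X S"
  then show "v \<in> Z" by (induction rule: reach.induct) (use assms in auto)
qed

lemma reach_mono: "S \<subseteq> S' \<Longrightarrow> reach X S \<subseteq> reach X S'"
  by (rule reach_least) (auto intro: reach.base reach.step simp: stp_def subset_iff)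

lemma reach_cong_le:
  assumes "\<And>u. u \<in> V \<Longrightarrow> Inl u \<in> S \<longleftrightarrow> Inl u \<in> S'"
    and "\<And>u v. u \<in> V \<Longrightarrow> v \<in> V \<Longrightarrow> adj u v \<Longrightarrow> Inl u \<in> S \<Longrightarrow> Inl v \<in> S \<Longrightarrow>
            Inr {u, v} \<in> S \<longleftrightarrow> Inr {u, v} \<in> S'"
  shows "reach X S \<subseteq> reach X S'"
  by (rule reach_least) (auto intro: reach.base reach.step simp: stp_def assms)

lemma reach_cong:
  assumes "\<And>u. u \<in> V \<Longrightarrow> Inl u \<in> S \<longleftrightarrow> Inl u \<in> S'"
    and "\<And>u v. u \<in> V \<Longrightarrow> v \<in> V \<Longrightarrow> adj u v \<Longrightarrow> Inl u \<in> S \<Longrightarrow> Inl v \<in> S \<Longrightarrow>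
            Inr {u, v} \<in> S \<longleftrightarrow> Inr {u, v} \<in> S'"
  shows "reach X S = reach X S'"
  by (intro equalityI reach_cong_le) (auto simp: assms)

lemma reach_avoid:
  assumes "v \<notin> reach X S"
  shows "reach X (S - {Inl v}) = reach X S"
proof
  show "reach X (S - {Inl v}) \<subseteq> reach X S" by (rule reach_mono) auto
  have "w \<in> reach X (S - {Inl v})" if "w \<in> reach X S" for w
    using that
  proof (induction rule: reach.induct)
    case (base u)
    then have "u \<noteq> v" using assms reach.base by blast
    then show ?case using base by (auto intro: reach.base)
  next
    case (step u w)
    then have "w \<noteq> v" "u \<noteq> v" using assms reach.step by blast+
    then show ?case using step by (auto intro!: reach.step[of u] simp: stp_def)
  qed
  then show "reach X S \<subseteq> reach X (S - {Inl v})" by auto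
qed

lemma reach_meet:
  assumes "u \<in> reach Y S" "u \<in> reach X S"
  shows "reach X S \<inter> Y \<noteq> {}"
  using assms
proof (induction rule: reach.induct)
  case (step u v)
  then show ?case using stp_sym reach.step by blast
qed auto

text \<open>Cut a path at its first visit to \<open>x\<close>: what precedes it avoids
  \<open>x\<close>, and the last bond leads from the cluster grown without \<open>x\<close>.\<close>

lemma reach_self_iff:
  assumes "x \<in> V" "Inl x \<in> S"
  shows "x \<in> reach X S \<longleftrightarrow> x \<in> X \<or> (\<exists>u\<in>reach X (S - {Inl x}). adj u x \<and> Inr {u, x} \<in> S)"
proof
  assume x: "x \<in> reach X S"
  show "x \<in> X \<or> (\<exists>u\<in>reach X (S - {Inl x}). adj u x \<and> Inr {u, x} \<in> S)"
  proof (rule ccontr)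
    assume n: "\<not> ?thesis"
    have "reach X S \<subseteq> reach X (S - {Inl x})"
    proof (rule reach_least)
      fix u assume "u \<in> X" "u \<in> V" "Inl u \<in> S"
      then show "u \<in> reach X (S - {Inl x})" using n by (intro reach.base) auto
    next
      fix u v assume a: "u \<in> reach X (S - {Inl x})" "stp S u v"
      then have "v \<noteq> x" using n by (auto simp: stp_def)
      moreover have "u \<noteq> x" using reach_open[OF a(1)] by auto
      ultimately show "v \<in> reach X (S - {Inl x})"
        using a by (auto intro!: reach.step[OF a(1)] simp: stp_def)
    qed
    then show False using x reach_open[of x X "S - {Inl x}"] by auto
  qed
next
  assume "x \<in> X \<or> (\<exists>u\<in>reach X (S - {Inl x}). adj u x \<and> Inr {u, x} \<in> S)"
  then show "x \<in> reach X S"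
  proof
    assume "\<exists>u\<in>reach X (S - {Inl x}). adj u x \<and> Inr {u, x} \<in> S"
    then obtain u where u: "u \<in> reach X (S - {Inl x})" "adj u x" "Inr {u, x} \<in> S" by auto
    then have "u \<in> reach X S" "stp S u x"
      using reach_mono[of "S - {Inl x}" S X] reach_open[OF u(1)] assms by (auto simp: stp_def)
    then show ?thesis by (rule reach.step)
  qed (use assms in \<open>auto intro: reach.base\<close>)
qed

text \<open>Whichever of the two is met first by a path from \<open>X\<close> is reached without the
  other. In the proof, if each cut off the other, deleting either would leave the cluster of
  \<open>S0\<close>, and no open bond could lead out of that cluster at all.\<close>

lemma cut_pair:
  assumes y: "y1 \<in> reach X S" "y2 \<in> reach X S"
    and n: "y2 \<notin> reach X (S - {Inl y1})"
    and "y1 \<noteq> y2"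
  shows "y1 \<in> reach X (S - {Inl y2})"
proof (rule ccontr)
  assume n': "y1 \<notin> reach X (S - {Inl y2})"
  define S0 where "S0 = S - {Inl y1} - {Inl y2}"
  have e1: "reach X S0 = reach X (S - {Inl y1})" unfolding S0_def by (rule reach_avoid[OF n])
  have "S0 = S - {Inl y2} - {Inl y1}" unfolding S0_def by auto
  then have e2: "reach X S0 = reach X (S - {Inl y2})" using reach_avoid[OF n'] by simp
  have "reach X S \<subseteq> reach X S0"
  proof (rule reach_least)
    fix u assume u: "u \<in> X" "u \<in> V" "Inl u \<in> S"
    then have "u \<noteq> y1" "u \<noteq> y2" using n n' \<open>y1 \<noteq> y2\<close> by (auto intro: reach.base)
    then show "u \<in> reach X S0" using u by (auto intro: reach.base simp: S0_def)
  next
    fix u v assume u: "u \<in> reach X S0" and st: "stp S u v"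
    have uo: "Inl u \<in> S0" using reach_open[OF u] by auto
    have "v \<noteq> y1"
    proof
      assume "v = y1"
      then have "stp (S - {Inl y2}) u v" using st uo \<open>y1 \<noteq> y2\<close> by (auto simp: stp_def S0_def)
      then show False using n' u e2 \<open>v = y1\<close> reach.step by auto
    qed
    moreover have "v \<noteq> y2"
    proof
      assume "v = y2"
      then have "stp (S - {Inl y1}) u v" using st uo \<open>y1 \<noteq> y2\<close> by (auto simp: stp_def S0_def)
      then show False using n u e1 \<open>v = y2\<close> reach.step by auto
    qed
    ultimately have "stp S0 u v" using st uo by (auto simp: stp_def S0_def)
    then show "v \<in> reach X S0" using u by (rule reach.step[rotated])
  qed
  then show False using y(1) n e1 reach_open[of y1 X S0] unfolding S0_def by auto
qed

definition nb :: "'v set \<Rightarrow> ('v + 'v set) set \<Rightarrow> 'v \<Rightarrow> 'v set" where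
  "nb X S x = {u \<in> reach X (S - {Inl x}). adj u x \<and> Inr {u, x} \<in> S}"

definition edges :: "'v set set" where
  "edges = {{u, v} | u v. u \<in> V \<and> v \<in> V \<and> adj u v}"

end

section \<open>Pivotal sites and pivotal bonds between two terminals\<close>

locale two_terminal = site_bond +
  fixes Src Tgt :: "'a set"
begin

definition conn :: "('a + 'a set) set \<Rightarrow> bool" where
  "conn S \<longleftrightarrow> reach Src S \<inter> Tgt \<noteq> {}"

lemma conn_iff: "conn S \<longleftrightarrow> reach Src S \<inter> reach Tgt S \<noteq> {}"
  unfolding conn_def using reach_meet[of _ Tgt S Src] reach_open by (fastforce intro: reach.base)

lemma conn_iff_Tgt: "conn S \<longleftrightarrow> reach Tgt S \<inter> Src \<noteq> {}"
  unfolding conn_iff using reach_meet[of _ Src S Tgt] reach_open by (fastforce intro: reach.base)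

lemma conn_mono: "S \<subseteq> S' \<Longrightarrow> conn S \<Longrightarrow> conn S'"
  unfolding conn_def using reach_mono[of S S' Src] by auto

text \<open>Pivotality of an open site in a connected configuration: with this convention the
  expected count is the density times the derivative, see \<open>exp_piv_eq\<close>.\<close>

definition piv :: "('a + 'a set) set \<Rightarrow> 'a \<Rightarrow> bool" where
  "piv S x \<longleftrightarrow> conn S \<and> \<not> conn (S - {Inl x})"

definition epiv :: "('a + 'a set) set \<Rightarrow> 'a set \<Rightarrow> bool" where
  "epiv S e \<longleftrightarrow> conn S \<and> \<not> conn (S - {Inr e})"

lemma piv_open: "piv S x \<Longrightarrow> Inl x \<in> S"
  unfolding piv_def by (cases "Inl x \<in> S") auto

lemma piv_reach:
  assumes "\<not> conn (S - {Inl x})"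
  shows "conn S \<longleftrightarrow> x \<in> reach Src S \<and> x \<in> reach Tgt S"
proof
  assume c: "conn S"
  have "x \<in> reach Src S"
    using c assms reach_avoid[of x Src S] by (auto simp: conn_def)
  moreover have "x \<in> reach Tgt S"
    using c assms reach_avoid[of x Tgt S] by (auto simp: conn_iff_Tgt)
  ultimately show "x \<in> reach Src S \<and> x \<in> reach Tgt S" by simp
qed (auto simp: conn_iff)

lemma piv_iff:
  assumes "x \<in> V" "Inl x \<in> S"
  shows "piv S x \<longleftrightarrow> \<not> conn (S - {Inl x}) \<and>
    (x \<in> Src \<or> nb Src S x \<noteq> {}) \<and> (x \<in> Tgt \<or> nb Tgt S x \<noteq> {})"
  unfolding piv_def using piv_reach[of S x] reach_self_iff[OF assms] by (auto simp: nb_def)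

text \<open>Without \<open>e\<close> the clusters of the two terminals are disjoint, and
  \<open>e\<close> is the only open crossing between them. Each end therefore cuts the connection,
  and its only open neighbour on the opposite side is the other end.\<close>

lemma epiv_ends:
  assumes e: "epiv S e" "e \<in> edges"
  obtains u v where "e = {u, v}" "u \<in> V" "v \<in> V"
    "piv S v" "v \<notin> Src" "nb Src S v = {u}"
    "piv S u" "u \<notin> Tgt" "nb Tgt S u = {v}"
proof -
  define S1 where "S1 = S - {Inr e}"
  have c: "conn S" "\<not> conn S1" using e by (auto simp: epiv_def S1_def)
  have sub: "S1 \<subseteq> S" by (auto simp: S1_def)
  \<comment> \<open>A cluster that grows when \<open>e\<close> is restored must have stepped across
    \<open>e\<close>, so it contains an end of \<open>e\<close> already.\<close>
  have half: "\<exists>u v. e = {u, v} \<and> u \<in> V \<and> v \<in> V \<and> adj u v \<and> Inl u \<in> S \<and> Inl v \<in> S \<and> u \<in> reach X S1"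
    if X: "\<not> reach X S \<subseteq> reach X S1" for X
  proof (rule ccontr)
    assume n: "\<not> ?thesis"
    have "reach X S \<subseteq> reach X S1"
    proof (rule reach_least)
      fix u assume "u \<in> X" "u \<in> V" "Inl u \<in> S"
      then show "u \<in> reach X S1" by (auto intro: reach.base simp: S1_def)
    next
      fix u v assume a: "u \<in> reach X S1" "stp S u v"
      then have "e \<noteq> {u, v}" using n by (auto simp: stp_def)
      then have "stp S1 u v" using a(2) by (simp add: stp_def S1_def)
      then show "v \<in> reach X S1" by (rule reach.step[OF a(1)])
    qed
    then show False using X by simp
  qed
  have "\<not> reach Src S \<subseteq> reach Src S1" using c by (auto simp: conn_def)
  from half[OF this] obtain u v where uv: "e = {u, v}" "u \<in> V" "v \<in> V" "adj u v"
    "Inl u \<in> S" "Inl v \<in> S" "u \<in> reach Src S1" by blast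
  have dj: "reach Src S1 \<inter> reach Tgt S1 = {}" using c by (simp add: conn_iff)
  have "\<not> reach Tgt S \<subseteq> reach Tgt S1" using c by (auto simp: conn_iff_Tgt)
  from half[OF this] obtain u' v' where uv': "e = {u', v'}" "u' \<in> reach Tgt S1" by blast
  have vB: "v \<in> reach Tgt S1" using uv uv' dj by (auto simp: doubleton_eq_iff)
  have e_in: "Inr e \<in> S" using c by (cases "Inr e \<in> S") (auto simp: S1_def)
  have uA: "u \<in> reach Src S1" by fact
  have uv_ne: "u \<noteq> v" using uv adj_irrefl by auto
  \<comment> \<open>Stated for either order of the terminals, since each end of \<open>e\<close>
    faces one of them.\<close>
  have key: "piv S y \<and> y \<notin> X \<and> nb X S y = {x}"
    if xy: "e = {x, y}" "x \<noteq> y" "x \<in> reach X S1" "y \<in> reach Y S1" and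
      dXY: "reach X S1 \<inter> reach Y S1 = {}" and
      XY: "(X = Src \<and> Y = Tgt) \<or> (X = Tgt \<and> Y = Src)" for x y X Y
  proof -
    have xyV: "x \<in> V" "y \<in> V" "Inl x \<in> S" "Inl y \<in> S" "adj x y"
      using xy uv adj_sym by (auto simp: doubleton_eq_iff)
    have le: "reach Z (S - {Inl y}) \<subseteq> reach Z S1" for Z
    proof -
      have "reach Z (S - {Inl y}) = reach Z (S - {Inl y} - {Inr e})"
        by (rule reach_cong) (use xy in \<open>auto\<close>)
      also have "\<dots> \<subseteq> reach Z S1" by (rule reach_mono) (auto simp: S1_def)
      finally show ?thesis .
    qed
    have ynX: "y \<notin> reach X S1" using dXY xy by auto
    have "reach X S1 = reach X (S1 - {Inl y})" using reach_avoid[OF ynX] by simp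
    also have "\<dots> \<subseteq> reach X (S - {Inl y})" by (rule reach_mono) (auto simp: S1_def)
    finally have ge: "reach X S1 \<subseteq> reach X (S - {Inl y})" .
    have "\<not> conn (S - {Inl y})"
      using le[of Src] c(2) by (auto simp: conn_def)
    then have "piv S y" using c by (simp add: piv_def)
    moreover have "y \<notin> X" using ynX xyV reach.base[of y X S1] by (auto simp: S1_def)
    moreover have "nb X S y = {x}"
    proof
      show "{x} \<subseteq> nb X S y" using ge xy xyV e_in by (auto simp: nb_def)
      show "nb X S y \<subseteq> {x}"
      proof
        fix w assume w: "w \<in> nb X S y"
        then have wr: "w \<in> reach X S1" "adj w y" "Inr {w, y} \<in> S" using le by (auto simp: nb_def)
        show "w \<in> {x}"
        proof (rule ccontr)
          assume "w \<notin> {x}"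
          then have "{w, y} \<noteq> e" using xy by (auto simp: doubleton_eq_iff)
          then have "stp S1 w y" using wr xyV reach_open[OF wr(1)] by (auto simp: stp_def S1_def)
          then show False using wr ynX reach.step by blast
        qed
      qed
    qed
    ultimately show ?thesis by simp
  qed
  have k1: "piv S v \<and> v \<notin> Src \<and> nb Src S v = {u}"
    by (rule key[where Y = Tgt]) (use uv uv_ne vB uA dj in simp_all)
  have k2: "piv S u \<and> u \<notin> Tgt \<and> nb Tgt S u = {v}"
    by (rule key[where Y = Src])
      (use uv uv_ne vB uA dj in \<open>simp_all add: insert_commute Int_commute\<close>)
  show ?thesis by (rule that[of u v]) (use uv k1 k2 in simp_all)
qed

definition bad :: "('a + 'a set) set \<Rightarrow> 'a \<Rightarrow> bool" where
  "bad S x \<longleftrightarrow> piv S x \<and> x \<notin> Src \<and> x \<notin> Tgt \<and> card (nb Src S x) = 1 \<and> card (nb Tgt S x) = 1"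

definition good :: "('a + 'a set) set \<Rightarrow> 'a \<Rightarrow> bool" where
  "good S x \<longleftrightarrow> piv S x \<and> \<not> bad S x"

end

locale finite_two_terminal = two_terminal +
  assumes finV: "finite V"
begin

lemma finite_edges: "finite edges"
proof -
  have "edges \<subseteq> Pow V" by (auto simp: edges_def)
  then show ?thesis using finV by (meson finite_Pow_iff finite_subset)
qed

lemma finite_nb: "finite (nb X S x)"
  using finV reach_open by (auto simp: nb_def intro: finite_subset[of _ V])

text \<open>A bond is recovered from an end \<open>v\<close> whose \<open>nb\<close> is a singleton,
  so pivotal bonds inject into such ends.\<close>

lemma card_epiv_le:
  assumes ex: "\<And>e. epiv S e \<Longrightarrow> e \<in> edges \<Longrightarrow> \<exists>v u. e = {u, v} \<and> v \<in> Q \<and> nb X S v = {u}"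
    and "Q \<subseteq> V"
  shows "card {e\<in>edges. epiv S e} \<le> card Q"
proof -
  have "{e\<in>edges. epiv S e} \<subseteq> (\<lambda>v. {the_elem (nb X S v), v}) ` Q"
  proof
    fix e assume "e \<in> {e\<in>edges. epiv S e}"
    then obtain u v where "e = {u, v}" "v \<in> Q" "nb X S v = {u}" using ex by blast
    then show "e \<in> (\<lambda>v. {the_elem (nb X S v), v}) ` Q" by (intro image_eqI[of _ _ v]) auto
  qed
  then show ?thesis using assms(2) finV by (meson finite_subset surj_card_le)
qed

lemma card_epiv_le_piv: "card {e\<in>edges. epiv S e} \<le> card {x\<in>V. piv S x}"
proof (rule card_epiv_le[where X = Src])
  fix e assume "epiv S e" "e \<in> edges"
  then obtain u v where "e = {u, v}" "v \<in> V" "piv S v" "nb Src S v = {u}" by (rule epiv_ends)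
  then show "\<exists>v u. e = {u, v} \<and> v \<in> {x\<in>V. piv S x} \<and> nb Src S v = {u}" by blast
qed auto

text \<open>Each pivotal bond has one end in \<open>Q1\<close> and one in \<open>Q2\<close>, and
  either end determines it. Bad sites are those counted twice by
  \<open>card Q1 + card Q2\<close>.\<close>

lemma card_epiv_bad: "2 * card {e\<in>edges. epiv S e} \<le> card {x\<in>V. piv S x} + card {x\<in>V. bad S x}"
proof -
  define Q1 where "Q1 = {v\<in>V. piv S v \<and> v \<notin> Src \<and> card (nb Src S v) = 1}"
  define Q2 where "Q2 = {v\<in>V. piv S v \<and> v \<notin> Tgt \<and> card (nb Tgt S v) = 1}"
  have 1: "card {e\<in>edges. epiv S e} \<le> card Q1"
  proof (rule card_epiv_le[where X = Src])
    fix e assume "epiv S e" "e \<in> edges"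
    then obtain u v where uv: "e = {u, v}" "v \<in> V" "piv S v" "v \<notin> Src" "nb Src S v = {u}"
      by (rule epiv_ends)
    then have "v \<in> Q1" unfolding Q1_def by simp
    then show "\<exists>v u. e = {u, v} \<and> v \<in> Q1 \<and> nb Src S v = {u}" using uv by blast
  qed (auto simp: Q1_def)
  have 2: "card {e\<in>edges. epiv S e} \<le> card Q2"
  proof (rule card_epiv_le[where X = Tgt])
    fix e assume "epiv S e" "e \<in> edges"
    then obtain u v where uv: "e = {v, u}" "v \<in> V" "piv S v" "v \<notin> Tgt" "nb Tgt S v = {u}"
      by (rule epiv_ends)
    then have "v \<in> Q2" unfolding Q2_def by simp
    then show "\<exists>v u. e = {u, v} \<and> v \<in> Q2 \<and> nb Tgt S v = {u}" 
      using uv(1,5) insert_commute[of v u "{}"] by blast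
  qed (auto simp: Q2_def)
  have fin: "finite Q1" "finite Q2" using finV by (auto simp: Q1_def Q2_def)
  have "card Q1 + card Q2 = card (Q1 \<union> Q2) + card (Q1 \<inter> Q2)"
    using card_Un_Int[OF fin] by simp
  moreover have "card (Q1 \<union> Q2) \<le> card {x\<in>V. piv S x}"
    by (intro card_mono) (use finV in \<open>auto simp: Q1_def Q2_def\<close>)
  moreover have "Q1 \<inter> Q2 = {x\<in>V. bad S x}" by (auto simp: Q1_def Q2_def bad_def)
  ultimately show ?thesis using 1 2 by simp
qed

lemma card_piv_split: "card {x\<in>V. piv S x} = card {x\<in>V. good S x} + card {x\<in>V. bad S x}"
proof -
  have "{x\<in>V. piv S x} = {x\<in>V. good S x} \<union> {x\<in>V. bad S x}" by (auto simp: good_def bad_def)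
  then show ?thesis using finV by (simp add: card_Un_disjoint good_def disjoint_iff)
qed

end

section \<open>The gain inequality\<close>

text \<open>Counts preimages of a modification: such a preimage is determined by the site
  \<open>y\<close> used and by the former states of the bonds in \<open>Q y\<close>.\<close>

lemma card_UN_Pow_le:
  assumes "finite Y" "card Y \<le> a" "\<And>y. y \<in> Y \<Longrightarrow> finite (Q y) \<and> card (Q y) \<le> b"
  shows "finite (\<Union>y\<in>Y. f y ` Pow (Q y))" "card (\<Union>y\<in>Y. f y ` Pow (Q y)) \<le> a * 2 ^ b"
proof -
  show "finite (\<Union>y\<in>Y. f y ` Pow (Q y))" using assms by auto
  have "card (\<Union>y\<in>Y. f y ` Pow (Q y)) \<le> (\<Sum>y\<in>Y. card (f y ` Pow (Q y)))"
    by (rule card_UN_le[OF assms(1)])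
  also have "\<dots> \<le> (\<Sum>y\<in>Y. 2 ^ b)"
  proof (rule sum_mono)
    fix y assume y: "y \<in> Y"
    have "card (f y ` Pow (Q y)) \<le> card (Pow (Q y))" using assms(3)[OF y] by (intro card_image_le) auto
    also have "\<dots> = 2 ^ card (Q y)" using assms(3)[OF y] by (simp add: card_Pow)
    also have "\<dots> \<le> 2 ^ b" using assms(3)[OF y] by (intro power_increasing) auto
    finally show "card (f y ` Pow (Q y)) \<le> 2 ^ b" .
  qed
  also have "\<dots> \<le> a * 2 ^ b" using assms(2) by simp
  finally show "card (\<Union>y\<in>Y. f y ` Pow (Q y)) \<le> a * 2 ^ b" .
qed

lemma card_le_2I:
  assumes "\<And>a b c. a \<in> A \<Longrightarrow> b \<in> A \<Longrightarrow> c \<in> A \<Longrightarrow> a = b \<or> a = c \<or> b = c"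
  shows "card A \<le> 2"
proof (rule ccontr)
  assume "\<not> card A \<le> 2"
  then have "3 \<le> card A" by simp
  then obtain T where T: "T \<subseteq> A" "card T = 3" using obtain_subset_with_card_n by metis
  then obtain a b c where "T = {a, b, c}" "a \<noteq> b" "b \<noteq> c" "a \<noteq> c" by (auto simp: card_3_iff)
  then show False using assms[of a b c] T by auto
qed

lemma reconstruct:
  assumes "\<And>k. k \<notin> Inr ` Q \<Longrightarrow> k \<in> S \<longleftrightarrow> k \<in> T"
  shows "S = (T - Inr ` Q) \<union> Inr ` {e\<in>Q. Inr e \<in> S}"
proof (rule set_eqI)
  fix k show "k \<in> S \<longleftrightarrow> k \<in> (T - Inr ` Q) \<union> Inr ` {e\<in>Q. Inr e \<in> S}"
    using assms[of k] by (cases "k \<in> Inr ` Q") auto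
qed

context site_bond
begin

text \<open>In contrast to \<open>nb\<close>, the states of the bonds at \<open>x\<close> do not
  enter. Opening a bond from such a neighbour to \<open>x\<close> adds an entrance and leaves all
  clusters avoiding \<open>x\<close> as they are.\<close>

definition pot :: "'v set \<Rightarrow> ('v + 'v set) set \<Rightarrow> 'v \<Rightarrow> 'v set" where
  "pot X S x = {u \<in> reach X (S - {Inl x}). adj u x}"

lemma nb_pot: "nb X S x = {u \<in> pot X S x. Inr {u, x} \<in> S}"
  by (auto simp: nb_def pot_def)

text \<open>For decoding in \<open>cand_entrance\<close>: the new entrance \<open>y\<close> is a
  neighbour of \<open>x\<close> after whose removal exactly one neighbour remains in the cluster. If
  \<open>y\<close> and \<open>z\<close> are two such vertices, \<open>cut_pair\<close> shows that
  \<open>z\<close> is the one that remains after removing \<open>y\<close>; hence a third cannot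
  exist.\<close>

lemma card_cut_vertices_le:
  "card {y \<in> reach X S. adj y x \<and> (\<exists>u. {v \<in> reach X (S - {Inl y}). adj v x} = {u})} \<le> 2"
  (is "card ?Y \<le> 2")
proof (rule card_le_2I)
  have key: "{v \<in> reach X (S - {Inl y}). adj v x} = {z}"
    if y: "y \<in> ?Y" and z: "z \<in> ?Y" and ne: "y \<noteq> z" for y z
  proof -
    obtain u where u: "{v \<in> reach X (S - {Inl y}). adj v x} = {u}" using y by auto
    obtain w where w: "{v \<in> reach X (S - {Inl z}). adj v x} = {w}" using z by auto
    have "z \<in> reach X (S - {Inl y})"
    proof (rule ccontr)
      assume n: "z \<notin> reach X (S - {Inl y})"
      have "y \<in> reach X (S - {Inl z})" by (rule cut_pair) (use y z n ne in auto)
      then have yw: "y = w" using w y by auto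
      have "u \<in> reach X (S - {Inl y})" using u by auto
      also have "\<dots> = reach X (S - {Inl y} - {Inl z})" using reach_avoid[OF n] by simp
      also have "\<dots> \<subseteq> reach X (S - {Inl z})" by (rule reach_mono) auto
      finally have "u = w" using u w by auto
      then show False using yw u reach_open[of u X "S - {Inl y}"] by auto
    qed
    then show ?thesis using u z by auto
  qed
  fix a b c assume abc: "a \<in> ?Y" "b \<in> ?Y" "c \<in> ?Y"
  show "a = b \<or> a = c \<or> b = c"
  proof (rule ccontr)
    assume n: "\<not> ?thesis"
    then have "a \<noteq> b" "a \<noteq> c" by blast+
    from trans[OF key[OF abc(1,2) this(1), symmetric] key[OF abc(1,3) this(2)]]
    show False using n by simp
  qed
qed

end

context finite_two_terminal
begin

definition coords :: "('a + 'a set) set" where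
  "coords = Inl ` V \<union> Inr ` edges"

lemma finite_coords: "finite coords"
  unfolding coords_def using finV finite_edges by simp

lemma edge_in_coords: "x \<in> V \<Longrightarrow> y \<in> V \<Longrightarrow> adj x y \<Longrightarrow> Inr {x, y} \<in> coords"
  unfolding coords_def edges_def by auto

end

text \<open>\<open>C\<close> bounds the odds of a bond in both directions, so that changing one bond
  costs at most a factor \<open>C\<close>. The lens bound spares \<open>x \<in> Tgt\<close>, because
  in the application \<open>Tgt\<close> is the outer layer of the window, where neighbours may be
  missing.\<close>

locale percolation_gain = finite_two_terminal +
  fixes \<rho> p C :: real and D :: nat and m :: nat
  assumes \<rho>: "0 < \<rho>" "\<rho> \<le> 1 / 2" and p: "0 < p" "p < 1"
    and C: "1 \<le> C" "1 - p \<le> C * p" "p \<le> C * (1 - p)"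
    and degree: "\<And>x. x \<in> V \<Longrightarrow> card {y\<in>V. adj x y} \<le> D"
    and lens: "\<And>x u. x \<in> V \<Longrightarrow> u \<in> V \<Longrightarrow> x \<notin> Tgt \<Longrightarrow> adj x u \<Longrightarrow>
        m \<le> card {y\<in>V. adj x y \<and> adj y u}"
    and m: "2 \<le> m"
begin

definition W :: "('a + 'a set) set \<Rightarrow> real" where
  "W S = bern_weight coords (case_sum (\<lambda>_. \<rho>) (\<lambda>_. p)) S"

lemma W_nonneg: "0 \<le> W S"
  unfolding W_def using \<rho> p by (intro bern_weight_nonneg) (auto split: sum.split)

lemma W_edge:
  assumes "S - {Inr e} = S' - {Inr e}"
  shows "W S \<le> C * W S'"
proof (cases "Inr e \<in> coords")
  case True
  have r: "bern_weight (coords - {Inr e}) \<pi> S = bern_weight (coords - {Inr e}) \<pi> S'" for \<pi>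
    by (rule bern_weight_cong) (use assms in auto)
  define B where "B = bern_weight (coords - {Inr e}) (case_sum (\<lambda>_. \<rho>) (\<lambda>_. p)) S'"
  have B: "0 \<le> B" unfolding B_def
    using \<rho> p by (intro bern_weight_nonneg) (auto split: sum.split)
  have w: "W S = (if Inr e \<in> S then p else 1 - p) * B" "W S' = (if Inr e \<in> S' then p else 1 - p) * B"
    unfolding W_def B_def by (simp_all add: bern_weight_remove[OF finite_coords True] r)
  have "(if Inr e \<in> S then p else 1 - p) \<le> C * (if Inr e \<in> S' then p else 1 - p)"
    using C p mult_mono[of 1 C p p] mult_mono[of 1 C "1 - p" "1 - p"] by auto
  from mult_right_mono[OF this B] show ?thesis unfolding w by (simp add: mult.assoc)
next
  case False
  have "W S = W S'" unfolding W_def by (rule bern_weight_cong) (use assms False in blast)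
  then show ?thesis using mult_right_mono[OF C(1) W_nonneg[of S']] by simp
qed

lemma W_edges:
  assumes "finite Q" "card Q \<le> n" "S - Inr ` Q = S' - Inr ` Q"
  shows "W S \<le> C ^ n * W S'"
proof -
  have "W S \<le> C ^ card Q * W S'"
    using assms(1,3)
  proof (induction Q arbitrary: S')
    case empty
    then show ?case by simp
  next
    case (insert e Q)
    define T where "T = (S' - {Inr e}) \<union> (S \<inter> {Inr e})"
    have "S - Inr ` Q = T - Inr ` Q" using insert.prems unfolding T_def by auto
    then have "W S \<le> C ^ card Q * W T" by (rule insert.IH)
    also have "W T \<le> C * W S'" by (rule W_edge) (auto simp: T_def)
    finally show ?case using insert C by (simp add: mult_left_mono algebra_simps)
  qed
  also have "\<dots> \<le> C ^ n * W S'"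
    using C assms(2) W_nonneg by (intro mult_right_mono power_increasing) auto
  finally show ?thesis .
qed

text \<open>Kept as an exact ratio: the density is of order \<open>1 / N ^ 2\<close> in the
  application, so a site must not be opened at the price of an unspecified constant.\<close>

lemma W_insert:
  assumes "x \<in> V" "Inl x \<notin> S"
  shows "\<rho> * W S = (1 - \<rho>) * W (insert (Inl x) S)"
proof -
  have x: "Inl x \<in> coords" using assms by (simp add: coords_def)
  have r: "bern_weight (coords - {Inl x}) \<pi> (insert (Inl x) S) = bern_weight (coords - {Inl x}) \<pi> S" for \<pi>
    by (rule bern_weight_cong) auto
  show ?thesis using assms unfolding W_def by (simp add: bern_weight_remove[OF finite_coords x] r)
qed

abbreviation wsum :: "(('a + 'a set) set \<times> 'b) set \<Rightarrow> real" where
  "wsum X \<equiv> (\<Sum>z\<in>X. W (fst z))"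

lemma finite_pairs: "finite {(S, x). S \<subseteq> coords \<and> x \<in> V \<and> P S x}"
  by (rule finite_subset[of _ "Pow coords \<times> V"]) (use finite_coords finV in auto)

lemma finite_triples: "finite {(S, x, y). S \<subseteq> coords \<and> x \<in> V \<and> y \<in> V \<and> P S x y}"
  by (rule finite_subset[of _ "Pow coords \<times> V \<times> V"]) (use finite_coords finV in auto)

lemma finite_reach: "finite (reach X S)"
  by (rule finite_subset[OF _ finV]) (use reach_open in blast)

definition Good :: "(('a + 'a set) set \<times> 'a) set" where
  "Good = {(S, x). S \<subseteq> coords \<and> x \<in> V \<and> good S x}"

lemma finite_Good: "finite Good" unfolding Good_def by (rule finite_pairs)

lemma goodI:
  assumes "x \<in> V" "Inl x \<in> S" "\<not> conn (S - {Inl x})"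
    "x \<in> Src \<or> nb Src S x \<noteq> {}" "x \<in> Tgt \<or> nb Tgt S x \<noteq> {}"
    "x \<in> Src \<or> x \<in> Tgt \<or> card (nb Src S x) \<noteq> 1 \<or> card (nb Tgt S x) \<noteq> 1"
  shows "good S x"
  using assms by (auto simp: good_def bad_def piv_iff)

lemma conn_cong:
  assumes "reach Src S = reach Src S'" shows "conn S = conn S'"
  using assms by (simp add: conn_def)

lemma many_potential:
  assumes X: "X = Src \<or> X = Tgt"
  shows "wsum {(S, x). S \<subseteq> coords \<and> x \<in> V \<and> bad S x \<and> pot X S x \<noteq> nb X S x} \<le> C * real 2 * wsum Good"
    (is "wsum ?B \<le> _")
proof -
  define f where "f S x = (SOME u. u \<in> pot X S x - nb X S x)" for S x
  define \<phi> where "\<phi> = (\<lambda>(S, x). (insert (Inr {f S x, x}) S, x))"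
  have fp: "f S x \<in> pot X S x - nb X S x" if "pot X S x \<noteq> nb X S x" for S x
  proof -
    have "\<exists>u. u \<in> pot X S x - nb X S x" using that by (auto simp: nb_pot)
    then show ?thesis unfolding f_def by (rule someI_ex)
  qed
  have main: "(insert (Inr {f S x, x}) S, x) \<in> Good \<and> card (nb X (insert (Inr {f S x, x}) S) x) = 2
      \<and> f S x \<in> nb X (insert (Inr {f S x, x}) S) x \<and> Inr {f S x, x} \<notin> S"
    if z: "S \<subseteq> coords" "x \<in> V" "bad S x" "pot X S x \<noteq> nb X S x" for S x
  proof -
    define u where "u = f S x"
    define S' where "S' = insert (Inr {u, x}) S"
    have u: "u \<in> pot X S x" "u \<notin> nb X S x" using fp[OF z(4)] by (auto simp: u_def)
    have uS: "Inr {u, x} \<notin> S" using u by (auto simp: nb_pot)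
    have r: "reach Z (S' - {Inl x}) = reach Z (S - {Inl x})" for Z
      by (rule reach_cong) (auto simp: S'_def doubleton_eq_iff)
    have p': "pot Z S' x = pot Z S x" for Z by (simp add: pot_def r)
    have "Inr {v, x} \<in> S' \<longleftrightarrow> v = u \<or> Inr {v, x} \<in> S" for v
      by (auto simp: S'_def doubleton_eq_iff)
    then have nbX: "nb X S' x = insert u (nb X S x)" using u(1) by (auto simp: nb_pot p')
    have nbs: "nb Z S x \<subseteq> nb Z S' x" for Z
      unfolding nb_pot p' by (auto simp: S'_def)
    have c1: "card (nb X S x) = 1" using z X by (auto simp: bad_def)
    then have c2: "card (nb X S' x) = 2" using u finite_nb by (simp add: nbX)
    have b: "piv S x" "Inl x \<in> S" using z piv_open by (auto simp: bad_def)
    have uV: "u \<in> V" "adj u x" using u reach_open by (auto simp: pot_def)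
    have "nb Src S x \<noteq> {}" "nb Tgt S x \<noteq> {}" using z(3) by (auto simp: bad_def)
    then have ne: "nb Src S' x \<noteq> {}" "nb Tgt S' x \<noteq> {}" using nbs by blast+
    have nc: "\<not> conn (S' - {Inl x})" using b conn_cong[OF r] by (simp add: piv_def)
    have "good S' x"
      by (rule goodI) (use z(2) b ne nc c2 X in \<open>auto simp: S'_def\<close>)
    moreover have "S' \<subseteq> coords" using z edge_in_coords[OF uV(1) z(2) uV(2)] by (auto simp: S'_def)
    ultimately show ?thesis using z c2 uS nbX unfolding Good_def S'_def u_def by auto
  qed
  show ?thesis
  proof (rule weight_sum_le_by_map[where \<phi> = \<phi>])
    show "\<phi> ` ?B \<subseteq> Good" using main by (auto simp: \<phi>_def)
    show "finite ?B" by (rule finite_pairs)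
    fix z assume "z \<in> ?B"
    obtain S x where z: "z = (S, x)" by (cases z)
    have "W S \<le> C * W (insert (Inr {f S x, x}) S)"
      by (rule W_edge[of _ "{f S x, x}"]) auto
    then show "W (fst z) \<le> C * W (fst (\<phi> z))" by (simp add: \<phi>_def z)
  next
    fix y assume "y \<in> Good"
    obtain S' x where y: "y = (S', x)" by (cases y)
    show "card {z\<in>?B. \<phi> z = y} \<le> 2"
    proof (cases "{z\<in>?B. \<phi> z = y} = {}")
      case False
      have "card (nb X S' x) = 2" using False main by (auto simp: \<phi>_def y)
      moreover have "{z\<in>?B. \<phi> z = y} \<subseteq> (\<lambda>u. (S' - {Inr {u, x}}, x)) ` nb X S' x"
      proof
        fix z assume z: "z \<in> {z\<in>?B. \<phi> z = y}"
        then obtain S where S: "z = (S, x)" "S' = insert (Inr {f S x, x}) S" by (auto simp: \<phi>_def y)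
        have "f S x \<in> nb X S' x \<and> Inr {f S x, x} \<notin> S" using main[of S x] z S by auto
        then show "z \<in> (\<lambda>u. (S' - {Inr {u, x}}, x)) ` nb X S' x"
          using S by (intro image_eqI[of _ _ "f S x"]) auto
      qed
      ultimately show ?thesis
        using surj_card_le[OF finite_nb, of "{z\<in>?B. \<phi> z = y}" "\<lambda>u. (S' - {Inr {u, x}}, x)" X S' x] by simp
    qed (simp only: card.empty)
  qed (use finite_Good W_nonneg C in auto)
qed

text \<open>The remaining bad sites: all bonds from potential neighbours are open already, so a
  second entrance requires a new site.\<close>

definition thin :: "('a + 'a set) set \<Rightarrow> 'a \<Rightarrow> 'a \<Rightarrow> 'a \<Rightarrow> bool" where
  "thin S x u u' \<longleftrightarrow> Inl x \<in> S \<and> x \<notin> Src \<and> x \<notin> Tgt \<and> \<not> conn (S - {Inl x}) \<and>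
     pot Src S x = {u} \<and> pot Tgt S x = {u'} \<and> Inr {u, x} \<in> S \<and> Inr {u', x} \<in> S"

lemma bad_cases:
  assumes "bad S x"
  shows "(\<exists>u u'. thin S x u u') \<or> pot Src S x \<noteq> nb Src S x \<or> pot Tgt S x \<noteq> nb Tgt S x"
proof (rule ccontr)
  assume n: "\<not> ?thesis"
  obtain u u' where u: "nb Src S x = {u}" "nb Tgt S x = {u'}"
    using assms by (auto simp: bad_def card_1_singleton_iff)
  then have "pot Src S x = {u}" "pot Tgt S x = {u'}" using n by auto
  then have "thin S x u u'" using assms u piv_open by (auto simp: thin_def bad_def piv_def nb_def)
  then show False using n by auto
qed

text \<open>Where a second entrance may be built. Since both sets \<open>pot\<close> are singletons
  and \<open>y\<close> differs from \<open>u\<close> by \<open>adj y u\<close>, excluding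
  \<open>u'\<close> puts \<open>y\<close> outside both clusters that avoid \<open>x\<close>, whether
  it is open or closed.\<close>

definition cand :: "('a + 'a set) set \<Rightarrow> 'a \<Rightarrow> 'a \<Rightarrow> bool" where
  "cand S x y \<longleftrightarrow> (\<exists>u u'. thin S x u u' \<and> adj x y \<and> adj y u \<and> y \<noteq> u')"

text \<open>The lens of \<open>x\<close> and \<open>u\<close> without \<open>u'\<close> still offers
  \<open>m - 1\<close> candidates. Counting all of them instead of choosing one is what later pays
  for opening a site.\<close>

lemma thin_bound:
  "real (m - 1) * wsum {(S, x). S \<subseteq> coords \<and> x \<in> V \<and> (\<exists>u u'. thin S x u u')}
     \<le> wsum {(S, x, y). S \<subseteq> coords \<and> x \<in> V \<and> y \<in> V \<and> cand S x y}"
proof -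
  let ?T = "{(S, x). S \<subseteq> coords \<and> x \<in> V \<and> (\<exists>u u'. thin S x u u')}"
  let ?Y = "\<lambda>z. {y\<in>V. cand (fst z) (snd z) y}"
  have eq: "{(S, x, y). S \<subseteq> coords \<and> x \<in> V \<and> y \<in> V \<and> cand S x y}
     = (\<lambda>(z, y). (fst z, snd z, y)) ` Sigma ?T ?Y"
    by (auto simp: cand_def image_iff split: prod.splits) blast+
  have inj: "inj_on (\<lambda>(z, y). (fst z, snd z, y)) (Sigma ?T ?Y)"
    by (auto simp: inj_on_def)
  have fin: "finite ?T" by (rule finite_pairs)
  have "real (m - 1) * wsum ?T = (\<Sum>z\<in>?T. real (m - 1) * W (fst z))" by (simp add: sum_distrib_left)
  also have "\<dots> \<le> (\<Sum>z\<in>?T. real (card (?Y z)) * W (fst z))"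
  proof (intro sum_mono mult_right_mono W_nonneg)
    fix z assume "z \<in> ?T"
    then obtain S x u u' where z: "z = (S, x)" "x \<in> V" "thin S x u u'" by auto
    have "u \<in> pot Src S x" using z by (simp add: thin_def)
    then have u: "u \<in> V" "adj x u" using reach_open adj_sym unfolding pot_def by blast+
    have "{y\<in>V. adj x y \<and> adj y u} - {u'} \<subseteq> ?Y z" using z by (auto simp: cand_def)
    then have "card ({y\<in>V. adj x y \<and> adj y u} - {u'}) \<le> card (?Y z)"
      using finV by (intro card_mono) auto
    moreover have "card {y\<in>V. adj x y \<and> adj y u} - card {u'} \<le> card ({y\<in>V. adj x y \<and> adj y u} - {u'})"
      by (rule diff_card_le_card_Diff) simp
    moreover have "m \<le> card {y\<in>V. adj x y \<and> adj y u}"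
      using lens[of x u] z u by (auto simp: thin_def)
    ultimately show "real (m - 1) \<le> real (card (?Y z))" by simp
  qed
  also have "\<dots> = (\<Sum>z\<in>?T. \<Sum>y\<in>?Y z. W (fst z))" by simp
  also have "\<dots> = (\<Sum>(z, y)\<in>Sigma ?T ?Y. W (fst z))"
    by (rule sum.Sigma) (use fin finV in auto)
  also have "\<dots> = wsum ((\<lambda>(z, y). (fst z, snd z, y)) ` Sigma ?T ?Y)"
    by (subst sum.reindex[OF inj]) (auto intro!: sum.cong)
  finally show ?thesis unfolding eq .
qed

text \<open>A candidate lies in neither cluster avoiding \<open>x\<close>, so it remains a candidate
  when closed, and its own state contributes just the odds \<open>\<rho> / (1 - \<rho>)\<close>.
  Only closed candidates remain to be treated.\<close>

lemma cand_open:
  "(1 - \<rho>) * wsum {(S, x, y). S \<subseteq> coords \<and> x \<in> V \<and> y \<in> V \<and> cand S x y \<and> Inl y \<in> S}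
     \<le> \<rho> * wsum {(S, x, y). S \<subseteq> coords \<and> x \<in> V \<and> y \<in> V \<and> cand S x y \<and> Inl y \<notin> S}"
  (is "_ * wsum ?A \<le> _ * wsum ?B")
proof -
  define \<phi> where "\<phi> = (\<lambda>(S :: ('a + 'a set) set, x :: 'a, y :: 'a). (S - {Inl y}, x, y))"
  have main: "cand (S - {Inl y}) x y" if cd: "cand S x y" for S x y
  proof -
    obtain u u' where t: "thin S x u u'" "adj x y" "adj y u" "y \<noteq> u'"
      using cd unfolding cand_def by blast
    have yx: "y \<noteq> x" "y \<noteq> u" using t adj_irrefl by auto
    have "adj y x" using t(2) by (rule adj_sym)
    moreover have "y \<notin> pot Src S x" "y \<notin> pot Tgt S x" using t(1,4) yx by (auto simp: thin_def)
    ultimately have "y \<notin> reach Src (S - {Inl x})" "y \<notin> reach Tgt (S - {Inl x})"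
      unfolding pot_def by blast+
    then have r: "reach Src (S - {Inl y} - {Inl x}) = reach Src (S - {Inl x})"
       "reach Tgt (S - {Inl y} - {Inl x}) = reach Tgt (S - {Inl x})"
      using reach_avoid[of y _ "S - {Inl x}"] by (simp_all add: Diff_insert2[symmetric] insert_commute)
    then have p': "pot Src (S - {Inl y}) x = pot Src S x" "pot Tgt (S - {Inl y}) x = pot Tgt S x"
      by (simp_all add: pot_def)
    have "thin (S - {Inl y}) x u u'"
      using t(1) yx conn_cong[OF r(1)] unfolding thin_def p' by simp
    then show ?thesis using t unfolding cand_def by blast
  qed
  have "wsum ?A \<le> \<rho> / (1 - \<rho>) * real 1 * wsum ?B"
  proof (rule weight_sum_le_by_map[where \<phi> = \<phi>])
    show "\<phi> ` ?A \<subseteq> ?B"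
    proof
      fix z assume "z \<in> \<phi> ` ?A"
      then obtain S x y where z: "z = (S - {Inl y}, x, y)" "S \<subseteq> coords" "x \<in> V" "y \<in> V" "cand S x y"
        by (auto simp: \<phi>_def)
      then show "z \<in> ?B" using main[OF z(5)] by auto
    qed
    show "finite ?A" by (rule finite_triples)
    show "finite ?B" by (rule finite_triples)
    fix z assume "z \<in> ?A"
    then obtain S x y where z: "z = (S, x, y)" "y \<in> V" "Inl y \<in> S" by auto
    have "\<rho> * W (S - {Inl y}) = (1 - \<rho>) * W S"
      using W_insert[of y "S - {Inl y}"] z by (simp add: insert_absorb)
    then show "W (fst z) \<le> \<rho> / (1 - \<rho>) * W (fst (\<phi> z))"
      using \<rho> z by (simp add: \<phi>_def field_simps)
  next
    fix y assume "y \<in> ?B"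
    obtain S' x y' where y: "y = (S', x, y')" by (cases y)
    have "{z\<in>?A. \<phi> z = y} \<subseteq> {(insert (Inl y') S', x, y')}" by (auto simp: \<phi>_def y)
    then show "card {z\<in>?A. \<phi> z = y} \<le> 1"
      using card_mono[of "{(insert (Inl y') S', x, y')}"] by fastforce
  qed (use W_nonneg \<rho> in auto)
  then show ?thesis using \<rho> by (simp add: field_simps)
qed

lemma thin_facts:
  assumes "thin S x u u'" "x \<in> V"
  shows "u \<in> V" "u' \<in> V" "adj u x" "adj u' x" "u \<in> reach Src (S - {Inl x})"
    "u' \<in> reach Tgt (S - {Inl x})" "u \<noteq> x" "u' \<noteq> x"
    "reach Src (S - {Inl x}) \<inter> reach Tgt (S - {Inl x}) = {}"
proof -
  have "u \<in> pot Src S x" "u' \<in> pot Tgt S x" using assms by (auto simp: thin_def)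
  then show "adj u x" "adj u' x" and r: "u \<in> reach Src (S - {Inl x})" "u' \<in> reach Tgt (S - {Inl x})"
    unfolding pot_def by blast+
  then show "u \<noteq> x" "u' \<noteq> x" using adj_irrefl by auto
  show "u \<in> V" "u' \<in> V" using r reach_open by blast+
  show "reach Src (S - {Inl x}) \<inter> reach Tgt (S - {Inl x}) = {}"
    using assms(1) by (auto simp: thin_def conn_iff)
qed

text \<open>A candidate with at most one neighbour on the target side can be opened as a second entrance
  to \<open>x\<close> without creating a bypass of \<open>x\<close>.\<close>

lemma cand_entrance:
  "wsum {(S, x, y). S \<subseteq> coords \<and> x \<in> V \<and> y \<in> V \<and> cand S x y \<and> Inl y \<notin> S \<and>
       y \<notin> Tgt \<and> card {w\<in>reach Tgt (S - {Inl x}). adj w y} \<le> 1}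
     \<le> C ^ 3 * ((1 - \<rho>) / \<rho>) * real 16 * wsum Good"
  (is "wsum ?A \<le> _")
proof -
  define PB where "PB S x y = {w\<in>reach Tgt (S - {Inl x}). adj w y}" for S x y
  define U where "U S x = the_elem (pot Src S x)" for S x
  \<comment> \<open>The bonds reset by \<open>N\<close>. As \<open>PB\<close> has at most one
    element they are at most three, whence the factor \<open>C ^ 3\<close> and, with two possible
    \<open>y\<close>, at most \<open>2 * 2 ^ 3 = 16\<close> preimages.\<close>
  define Q where "Q S x y = {{x, y}, {y, U S x}} \<union> (\<lambda>w. {w, y}) ` PB S x y" for S x y
  define N where "N S x y = insert (Inl y) ((S \<union> Inr ` {{x, y}, {y, U S x}}) - Inr ` (\<lambda>w. {w, y}) ` PB S x y)"
    for S x y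
  define \<phi> where "\<phi> = (\<lambda>(S, x, y). (N S x y, x))"
  have main: "(N S x y, x) \<in> Good \<and> finite (Q S x y) \<and> card (Q S x y) \<le> 3 \<and>
      y \<in> reach Src (N S x y - {Inl x}) \<and> adj y x \<and>
      {v \<in> reach Src (N S x y - {Inl x} - {Inl y}). adj v x} = {U S x} \<and>
      {w \<in> reach Tgt (N S x y - {Inl x} - {Inl y}). adj w y} = PB S x y \<and>
      (\<forall>k. k \<notin> Inr ` Q S x y \<longrightarrow> k \<in> S \<longleftrightarrow> k \<in> N S x y - {Inl y})"
    if z: "S \<subseteq> coords" "x \<in> V" "y \<in> V" "cand S x y" "Inl y \<notin> S" "y \<notin> Tgt" "card (PB S x y) \<le> 1"
    for S x y
  proof -
    obtain u u' where t: "thin S x u u'" "adj x y" "adj y u" "y \<noteq> u'"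
      using z(4) unfolding cand_def by blast
    note tf = thin_facts[OF t(1) z(2)]
    have Uu: "U S x = u" using t(1) by (simp add: U_def thin_def)
    have yx: "adj y x" "y \<noteq> x" "y \<noteq> u" using t(2,3) adj_sym adj_irrefl by auto
    define S0 where "S0 = S - {Inl x}"
    define S1 where "S1 = N S x y - {Inl x}"
    have xS: "Inl x \<in> S" and nc: "\<not> conn S0" using t(1) by (auto simp: thin_def S0_def)
    have far: "Inr {a, b} \<in> N S x y \<longleftrightarrow> Inr {a, b} \<in> S" if "a \<noteq> y" "b \<noteq> y" for a b
      using that by (auto simp: N_def doubleton_eq_iff)
    have site: "Inl a \<in> S1 \<longleftrightarrow> Inl a \<in> S0 \<or> a = y" for a
      using yx by (auto simp: S1_def S0_def N_def)
    have yS0: "Inl y \<notin> S0" using z by (auto simp: S0_def)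
    have ge: "reach Z S0 \<subseteq> reach Z S1" for Z
    proof (rule reach_least)
      fix a assume "a \<in> Z" "a \<in> V" "Inl a \<in> S0"
      then show "a \<in> reach Z S1" using site by (auto intro: reach.base)
    next
      fix a b assume a: "a \<in> reach Z S1" and ab: "stp S0 a b"
      have "a \<noteq> y" "b \<noteq> y" using ab yS0 by (auto simp: stp_def)
      then have "stp S1 a b" using ab far[of a b] site by (auto simp: stp_def S1_def S0_def)
      then show "b \<in> reach Z S1" using a by (rule reach.step[rotated])
    qed
    have same: "reach Z (S1 - {Inl y}) = reach Z S0" for Z
    proof (rule reach_cong)
      fix a assume "a \<in> V"
      show "Inl a \<in> S1 - {Inl y} \<longleftrightarrow> Inl a \<in> S0" using site yS0 by auto
    next
      fix a b assume "Inl a \<in> S1 - {Inl y}" "Inl b \<in> S1 - {Inl y}"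
      then have "a \<noteq> y" "b \<noteq> y" by auto
      then show "Inr {a, b} \<in> S1 - {Inl y} \<longleftrightarrow> Inr {a, b} \<in> S0"
        using far by (simp add: S1_def S0_def)
    qed
    \<comment> \<open>The open \<open>y\<close> must not extend the target side: it is no target,
      and all its bonds to that cluster were closed.\<close>
    have Tle: "reach Tgt S1 \<subseteq> reach Tgt S0"
    proof (rule reach_least)
      fix a assume "a \<in> Tgt" "a \<in> V" "Inl a \<in> S1"
      then show "a \<in> reach Tgt S0" using site z by (auto intro: reach.base)
    next
      fix a b assume a: "a \<in> reach Tgt S0" and ab: "stp S1 a b"
      have ay: "a \<noteq> y" using reach_open[OF a] yS0 by auto
      have "b \<noteq> y"
      proof
        assume eq: "b = y"
        then have "adj a y" using ab by (auto simp: stp_def)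
        then have "a \<in> PB S x y" using a by (auto simp: PB_def S0_def)
        then have "Inr {a, y} \<notin> N S x y" by (auto simp: N_def)
        then show False using ab eq by (auto simp: stp_def S1_def)
      qed
      then have "stp S0 a b" using ab ay far[of a b] site by (auto simp: stp_def S1_def S0_def)
      then show "b \<in> reach Tgt S0" using a by (rule reach.step[rotated])
    qed
    have nc1: "\<not> conn S1" using nc Tle by (auto simp: conn_iff_Tgt)
    have uA: "u \<in> reach Src S0" and u'B: "u' \<in> reach Tgt S0" using tf by (auto simp: S0_def)
    have u_nPB: "u \<notin> PB S x y" and x_nPB: "x \<notin> PB S x y"
      using tf(5,9) reach_open[of x Tgt "S - {Inl x}"] by (auto simp: PB_def)
    have yu: "Inr {y, u} \<in> N S x y" and xy: "Inr {y, x} \<in> N S x y"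
      using u_nPB x_nPB yx unfolding N_def Uu by (auto simp: doubleton_eq_iff insert_commute)
    have yA: "y \<in> reach Src S1"
    proof (rule reach.step)
      show "u \<in> reach Src S1" using uA ge by blast
      show "stp S1 u y" using tf z yu t(3) adj_sym[OF t(3)] reach_open[OF uA] site yx
        by (auto simp: stp_def S1_def insert_commute)
    qed
    have uy_nb: "u \<in> nb Src (N S x y) x" "y \<in> nb Src (N S x y) x"
    proof -
      have "Inr {u, x} \<in> S" using t(1) by (simp add: thin_def)
      then have "Inr {u, x} \<in> N S x y" using far[of u x] yx by auto
      then show "u \<in> nb Src (N S x y) x" "y \<in> nb Src (N S x y) x"
        using uA ge[of Src] yA xy tf(3) yx(1) by (auto simp: nb_def S1_def)
    qed
    have u'_nb: "u' \<in> nb Tgt (N S x y) x"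
    proof -
      have "Inr {u', x} \<in> S" using t(1) by (simp add: thin_def)
      then have "Inr {u', x} \<in> N S x y" using far[of u' x] yx t(4) by auto
      then show ?thesis using u'B ge[of Tgt] tf(4) by (auto simp: nb_def S1_def)
    qed
    have "card {u, y} \<le> card (nb Src (N S x y) x)"
      by (rule card_mono) (use uy_nb finite_nb in auto)
    then have c2: "card (nb Src (N S x y) x) \<noteq> 1" using yx by simp
    have "good (N S x y) x"
      by (rule goodI) (use z(2) xS nc1 uy_nb u'_nb c2 in \<open>auto simp: N_def S1_def\<close>)
    moreover have "N S x y \<subseteq> coords"
      using z(1) edge_in_coords[OF z(2,3) t(2)] edge_in_coords[OF z(3) tf(1) t(3)] z(3)
      unfolding N_def Uu by (auto simp: coords_def)
    moreover have fPB: "finite (PB S x y)" unfolding PB_def using finite_reach by auto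
    moreover have "card (Q S x y) \<le> 3"
    proof -
      have "card (Q S x y) \<le> card {{x, y}, {y, U S x}} + card ((\<lambda>w. {w, y}) ` PB S x y)"
        unfolding Q_def by (rule card_Un_le)
      also have "card ((\<lambda>w. {w, y}) ` PB S x y) \<le> 1"
        using card_image_le[OF fPB, of "\<lambda>w. {w, y}"] z(7) by linarith
      also have "card {{x, y}, {y, U S x}} \<le> 2" by (simp add: card_insert_if)
      finally show ?thesis by simp
    qed
    moreover have "{v \<in> reach Src (N S x y - {Inl x} - {Inl y}). adj v x} = {U S x}"
      using same[of Src] t(1) by (simp add: S1_def S0_def thin_def pot_def Uu)
    moreover have "{w \<in> reach Tgt (N S x y - {Inl x} - {Inl y}). adj w y} = PB S x y"
      using same[of Tgt] by (simp add: S1_def S0_def PB_def)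
    moreover have "k \<in> S \<longleftrightarrow> k \<in> N S x y - {Inl y}" if "k \<notin> Inr ` Q S x y" for k
      using that z(5) unfolding N_def Q_def by (cases k) auto
    ultimately show ?thesis using z(2) yA yx(1) fPB unfolding Good_def S1_def
      by (auto simp: Q_def)
  qed
  show ?thesis
  proof (rule weight_sum_le_by_map[where \<phi> = \<phi>])
    show "\<phi> ` ?A \<subseteq> Good" using main by (auto simp: \<phi>_def PB_def)
    show "finite ?A" by (rule finite_triples)
    fix z assume "z \<in> ?A"
    then obtain S x y where z: "z = (S, x, y)" "S \<subseteq> coords" "x \<in> V" "y \<in> V" "cand S x y" "Inl y \<notin> S"
      "y \<notin> Tgt" "card (PB S x y) \<le> 1" by (auto simp: PB_def)
    note mn = main[OF z(2-)]
    have "W S \<le> C ^ 3 * W (N S x y - {Inl y})"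
      by (rule W_edges[of "Q S x y"]) (use mn in \<open>auto\<close>)
    moreover have "\<rho> * W (N S x y - {Inl y}) = (1 - \<rho>) * W (N S x y)"
      using W_insert[of y "N S x y - {Inl y}"] z by (simp add: N_def insert_absorb)
    then have "W (N S x y - {Inl y}) = (1 - \<rho>) / \<rho> * W (N S x y)" using \<rho> by (simp add: field_simps)
    ultimately show "W (fst z) \<le> C ^ 3 * ((1 - \<rho>) / \<rho>) * W (fst (\<phi> z))"
      by (simp add: \<phi>_def z)
  next
    fix g assume "g \<in> Good"
    obtain S' x where g: "g = (S', x)" by (cases g)
    \<comment> \<open>Decoding: once \<open>x\<close> and \<open>y\<close> are removed, the clusters
      are the original ones, so \<open>U S x\<close> and \<open>PB S x y\<close> can be read off
      \<open>S'\<close>.\<close>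
    define Q' where "Q' y = {{x, y}, {y, the_elem {v \<in> reach Src (S' - {Inl x} - {Inl y}). adj v x}}} \<union>
        (\<lambda>w. {w, y}) ` {w \<in> reach Tgt (S' - {Inl x} - {Inl y}). adj w y}" for y
    define Y where "Y = {y \<in> reach Src (S' - {Inl x}). adj y x \<and>
       (\<exists>u. {v \<in> reach Src (S' - {Inl x} - {Inl y}). adj v x} = {u})}"
    define Y' where "Y' = {y\<in>Y. finite (Q' y) \<and> card (Q' y) \<le> 3}"
    have Y2: "card Y \<le> 2" unfolding Y_def by (rule card_cut_vertices_le)
    have finY: "finite Y" unfolding Y_def using finite_reach by auto
    have Y': "finite Y'" "card Y' \<le> 2"
      using finY card_mono[of Y Y'] Y2 by (auto simp: Y'_def)
    have sb: "{z\<in>?A. \<phi> z = g} \<subseteq> (\<Union>y\<in>Y'. (\<lambda>R. ((S' - {Inl y}) - Inr ` Q' y \<union> Inr ` R, x, y)) ` Pow (Q' y))"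
    proof
      fix z assume "z \<in> {z\<in>?A. \<phi> z = g}"
      then obtain S y where z: "z = (S, x, y)" "S \<subseteq> coords" "x \<in> V" "y \<in> V" "cand S x y" "Inl y \<notin> S"
        "y \<notin> Tgt" "card (PB S x y) \<le> 1" and S': "S' = N S x y"
        by (auto simp: PB_def \<phi>_def g)
      note mn = main[OF z(2-)]
      have QQ: "Q' y = Q S x y" unfolding Q'_def Q_def S' using mn by simp
      have "y \<in> Y" unfolding Y_def S' using mn by blast
      then have "y \<in> Y'" unfolding Y'_def using mn QQ by simp
      moreover have "S = (S' - {Inl y} - Inr ` Q' y) \<union> Inr ` {e\<in>Q' y. Inr e \<in> S}"
        by (rule reconstruct) (use mn in \<open>simp add: QQ S'\<close>)
      then have "z \<in> (\<lambda>R. ((S' - {Inl y}) - Inr ` Q' y \<union> Inr ` R, x, y)) ` Pow (Q' y)"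
        unfolding z(1) by (intro image_eqI[of _ _ "{e\<in>Q' y. Inr e \<in> S}"]) auto
      ultimately show "z \<in> (\<Union>y\<in>Y'. (\<lambda>R. ((S' - {Inl y}) - Inr ` Q' y \<union> Inr ` R, x, y)) ` Pow (Q' y))"
        by blast
    qed
    have fc: "finite (\<Union>y\<in>Y'. (\<lambda>R. ((S' - {Inl y}) - Inr ` Q' y \<union> Inr ` R, x, y)) ` Pow (Q' y))"
      "card (\<Union>y\<in>Y'. (\<lambda>R. ((S' - {Inl y}) - Inr ` Q' y \<union> Inr ` R, x, y)) ` Pow (Q' y)) \<le> 2 * 2 ^ 3"
      using card_UN_Pow_le[OF Y', of Q' 3 "\<lambda>y R. ((S' - {Inl y}) - Inr ` Q' y \<union> Inr ` R, x, y)"]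
      by (simp_all add: Y'_def)
    have "card {z\<in>?A. \<phi> z = g} \<le> 2 * 2 ^ 3"
      by (rule order_trans[OF card_mono[OF fc(1) sb] fc(2)])
    then show "card {z\<in>?A. \<phi> z = g} \<le> 16" by simp
  qed (use finite_Good W_nonneg \<rho> C in auto)
qed

text \<open>Otherwise the candidate itself is a good pivotal vertex once \<open>x\<close> is removed.\<close>

lemma cand_replacement:
  "wsum {(S, x, y). S \<subseteq> coords \<and> x \<in> V \<and> y \<in> V \<and> cand S x y \<and> Inl y \<notin> S \<and>
       (y \<in> Tgt \<or> 2 \<le> card {w\<in>reach Tgt (S - {Inl x}). adj w y})}
     \<le> C ^ 3 * real (D * 8) * wsum Good"
  (is "wsum ?A \<le> _")
proof -
  \<comment> \<open>Both choices depend only on the sets of neighbours in the two clusters. These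
    sets survive the modification, so the changed bonds can be recomputed from its result.\<close>
  define f where "f PA = (SOME u. u \<in> PA)" for PA :: "'a set"
  define h where "h PB = (SOME B. B \<subseteq> PB \<and> card B = 2)" for PB :: "'a set"
  \<comment> \<open>Two bonds towards the target make \<open>y\<close> good; a pivotal
    \<open>y\<close> in \<open>Tgt\<close> is never bad and needs none.\<close>
  define G where "G y PA PB = insert {f PA, y} (if y \<in> Tgt then {} else (\<lambda>w. {w, y}) ` h PB)"
    for y and PA PB :: "'a set"
  define Q where "Q S x y = G y {v\<in>reach Src (S - {Inl x}). adj v y} {w\<in>reach Tgt (S - {Inl x}). adj w y}"
    for S x y
  define N where "N S x y = insert (Inl y) (S - {Inl x}) \<union> Inr ` Q S x y" for S x y
  define \<phi> where "\<phi> = (\<lambda>(S, x, y). (N S x y, y))"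
  have main: "(N S x y, y) \<in> Good \<and> finite (Q S x y) \<and> card (Q S x y) \<le> 3 \<and> adj y x \<and> Inl x \<in> S \<and>
      G y {v \<in> reach Src (N S x y - {Inl y}). adj v y} {w \<in> reach Tgt (N S x y - {Inl y}). adj w y} = Q S x y"
    if z: "S \<subseteq> coords" "x \<in> V" "y \<in> V" "cand S x y" "Inl y \<notin> S"
      "y \<in> Tgt \<or> 2 \<le> card {w\<in>reach Tgt (S - {Inl x}). adj w y}"
    for S x y
  proof -
    obtain u u' where t: "thin S x u u'" "adj x y" "adj y u" "y \<noteq> u'"
      using z(4) unfolding cand_def by blast
    note tf = thin_facts[OF t(1) z(2)]
    define S0 where "S0 = S - {Inl x}"
    define PA where "PA = {v\<in>reach Src S0. adj v y}"
    define PB where "PB = {w\<in>reach Tgt S0. adj w y}"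
    have QG: "Q S x y = G y PA PB" by (simp add: Q_def PA_def PB_def S0_def)
    have "u \<in> PA" using tf(5) adj_sym[OF t(3)] by (simp add: PA_def S0_def)
    then have fPA: "f PA \<in> PA" unfolding f_def by (rule someI)
    have hPB: "h PB \<subseteq> PB \<and> card (h PB) = 2" if "y \<notin> Tgt"
    proof -
      have "2 \<le> card PB" using z(6) that by (simp add: PB_def S0_def)
      then obtain B where "B \<subseteq> PB" "card B = 2" by (meson obtain_subset_with_card_n)
      then show ?thesis unfolding h_def by (intro someI_ex[of "\<lambda>B. B \<subseteq> PB \<and> card B = 2"]) auto
    qed
    have y_in: "y \<in> e" if "e \<in> Q S x y" for e using that unfolding QG G_def by (auto split: if_splits)
    have same: "reach Z (N S x y - {Inl y}) = reach Z S0" for Z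
    proof (rule reach_cong)
      fix a assume "a \<in> V"
      show "Inl a \<in> N S x y - {Inl y} \<longleftrightarrow> Inl a \<in> S0" using z(5) by (auto simp: N_def S0_def)
    next
      fix a b assume "Inl a \<in> N S x y - {Inl y}" "Inl b \<in> N S x y - {Inl y}"
      then have "a \<noteq> y" "b \<noteq> y" by auto
      then have "{a, b} \<notin> Q S x y" using y_in by blast
      then show "Inr {a, b} \<in> N S x y - {Inl y} \<longleftrightarrow> Inr {a, b} \<in> S0"
        by (auto simp: N_def S0_def)
    qed
    have xS: "Inl x \<in> S" and nc: "\<not> conn S0" using t(1) by (auto simp: thin_def S0_def)
    have sub: "Inr e \<in> N S x y" if "e \<in> Q S x y" for e using that by (auto simp: N_def)
    have nA: "nb Src (N S x y) y \<noteq> {}"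
      using fPA sub[of "{f PA, y}"] by (auto simp: nb_def same PA_def QG G_def)
    have nB: "y \<in> Tgt \<or> 2 \<le> card (nb Tgt (N S x y) y)"
    proof (cases "y \<in> Tgt")
      case False
      have "h PB \<subseteq> nb Tgt (N S x y) y"
        using hPB[OF False] sub False by (auto simp: nb_def same PB_def QG G_def)
      from card_mono[OF finite_nb this] show ?thesis using hPB[OF False] by simp
    qed auto
    have nc': "\<not> conn (N S x y - {Inl y})" using nc conn_cong[OF same] by simp
    have "nb Tgt (N S x y) y \<noteq> {}" if "2 \<le> card (nb Tgt (N S x y) y)" using that by auto
    then have "good (N S x y) y"
      using goodI[of y "N S x y"] z(3) nA nB nc' by (auto simp: N_def)
    moreover have "N S x y \<subseteq> coords"
    proof -
      have "Inr e \<in> coords" if "e \<in> Q S x y" for e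
      proof -
        have fV: "f PA \<in> V" "adj (f PA) y" using fPA reach_open unfolding PA_def by blast+
        have hV: "w \<in> V \<and> adj w y" if "y \<notin> Tgt" "w \<in> h PB" for w
          using hPB[OF that(1)] that(2) reach_open unfolding PB_def by blast
        show ?thesis using that edge_in_coords[OF fV(1) z(3) fV(2)] hV edge_in_coords[OF _ z(3)]
          unfolding QG G_def by (auto split: if_splits)
      qed
      then show ?thesis using z(1,3) by (auto simp: N_def coords_def)
    qed
    moreover have "finite (Q S x y) \<and> card (Q S x y) \<le> 3"
    proof (cases "y \<in> Tgt")
      case False
      have fh: "finite (h PB)" using hPB[OF False] card.infinite by force
      have "card ((\<lambda>w. {w, y}) ` h PB) \<le> 2" using card_image_le[OF fh] hPB[OF False] by metis
      then show ?thesis using fh False unfolding QG G_def by (simp add: card_insert_if)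
    qed (simp add: QG G_def)
    moreover have "G y {v \<in> reach Src (N S x y - {Inl y}). adj v y}
        {w \<in> reach Tgt (N S x y - {Inl y}). adj w y} = Q S x y"
      by (simp add: same QG PA_def PB_def)
    ultimately show ?thesis using z(3) xS adj_sym[OF t(2)] unfolding Good_def by blast
  qed
  show ?thesis
  proof (rule weight_sum_le_by_map[where \<phi> = \<phi>])
    show "\<phi> ` ?A \<subseteq> Good" using main by (auto simp: \<phi>_def)
    show "finite ?A" by (rule finite_triples)
    fix z assume "z \<in> ?A"
    then obtain S x y where z: "z = (S, x, y)" "S \<subseteq> coords" "x \<in> V" "y \<in> V" "cand S x y" "Inl y \<notin> S"
      "y \<in> Tgt \<or> 2 \<le> card {w\<in>reach Tgt (S - {Inl x}). adj w y}" by auto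
    note mn = main[OF z(2-)]
    \<comment> \<open>The open site moves from \<open>x\<close> to \<open>y\<close>, so the site
      part of the weight is unchanged and no power of \<open>\<rho>\<close> appears.\<close>
    define S1 where "S1 = insert (Inl y) (S - {Inl x})"
    have "W S1 \<le> C ^ 3 * W (N S x y)"
      by (rule W_edges[of "Q S x y"]) (use mn in \<open>auto simp: S1_def N_def\<close>)
    moreover have "\<rho> * W (S - {Inl x}) = (1 - \<rho>) * W S"
      using W_insert[of x "S - {Inl x}"] z mn by (simp add: insert_absorb)
    moreover have "\<rho> * W (S - {Inl x}) = (1 - \<rho>) * W S1"
      using W_insert[of y "S - {Inl x}"] z by (simp add: S1_def)
    ultimately have "W S \<le> C ^ 3 * W (N S x y)" using \<rho> by simp
    then show "W (fst z) \<le> C ^ 3 * W (fst (\<phi> z))"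
      by (simp add: \<phi>_def z)
  next
    fix g assume g_in: "g \<in> Good"
    obtain S' y where g: "g = (S', y)" by (cases g)
    have yV: "y \<in> V" using g_in by (auto simp: Good_def g)
    define Q' where "Q' = G y {v \<in> reach Src (S' - {Inl y}). adj v y} {w \<in> reach Tgt (S' - {Inl y}). adj w y}"
    \<comment> \<open>Besides the bond states, the lost information is which of the at most
      \<open>D\<close> neighbours of \<open>y\<close> was \<open>x\<close>.\<close>
    define X where "X = {x\<in>V. adj y x \<and> finite Q' \<and> card Q' \<le> 3}"
    have X: "finite X" "card X \<le> D"
    proof -
      have sub: "X \<subseteq> {x\<in>V. adj y x}" by (auto simp: X_def)
      have fin: "finite {x\<in>V. adj y x}" using finV by simp
      show "finite X" by (rule finite_subset[OF sub fin])
      show "card X \<le> D" by (rule order_trans[OF card_mono[OF fin sub] degree[OF yV]])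
    qed
    define R where "R x r = (insert (Inl x) (S' - {Inl y}) - Inr ` Q' \<union> Inr ` r, x, y)" for x r
    have sb: "{z\<in>?A. \<phi> z = g} \<subseteq> (\<Union>x\<in>X. R x ` Pow Q')"
    proof
      fix z assume "z \<in> {z\<in>?A. \<phi> z = g}"
      then obtain S x where z: "z = (S, x, y)" "S \<subseteq> coords" "x \<in> V" "y \<in> V" "cand S x y" "Inl y \<notin> S"
        "y \<in> Tgt \<or> 2 \<le> card {w\<in>reach Tgt (S - {Inl x}). adj w y}" and S': "S' = N S x y"
        by (auto simp: \<phi>_def g)
      note mn = main[OF z(2-)]
      have QQ: "Q' = Q S x y" unfolding Q'_def S' using mn by simp
      have "x \<in> X" unfolding X_def using mn QQ z by simp
      moreover have "S = (insert (Inl x) (S' - {Inl y}) - Inr ` Q') \<union> Inr ` {e\<in>Q'. Inr e \<in> S}"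
      proof (rule reconstruct)
        fix k :: "'a + 'a set" assume "k \<notin> Inr ` Q'"
        then show "k \<in> S \<longleftrightarrow> k \<in> insert (Inl x) (S' - {Inl y})"
          using mn z(6) unfolding QQ S' N_def by auto
      qed
      then have "z \<in> R x ` Pow Q'"
        unfolding z(1) by (intro image_eqI[of _ _ "{e\<in>Q'. Inr e \<in> S}"]) (auto simp: R_def)
      ultimately show "z \<in> (\<Union>x\<in>X. R x ` Pow Q')" by blast
    qed
    have fc: "finite (\<Union>x\<in>X. R x ` Pow Q')" "card (\<Union>x\<in>X. R x ` Pow Q') \<le> D * 2 ^ 3"
      using card_UN_Pow_le[OF X, of "\<lambda>_. Q'" 3 R] by (simp_all add: X_def)
    have "card {z\<in>?A. \<phi> z = g} \<le> D * 2 ^ 3"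
      by (rule order_trans[OF card_mono[OF fc(1) sb] fc(2)])
    then show "card {z\<in>?A. \<phi> z = g} \<le> D * 8" by simp
  qed (use finite_Good W_nonneg C in auto)
qed

text \<open>\<open>1 / \<rho>\<close>, \<open>D\<close> and \<open>m\<close> are all of order
  \<open>N ^ 2\<close> in the application, which keeps this constant bounded.\<close>

definition gain_const :: real where
  "gain_const = 4 * C + (16 * C ^ 3 / \<rho> + 16 * real D * C ^ 3) / real (m - 1)"

lemma bad_le_good:
  "wsum {(S, x). S \<subseteq> coords \<and> x \<in> V \<and> bad S x} \<le> gain_const * wsum Good"
proof -
  let ?g = "wsum Good"
  define T1 where "T1 X = {(S, x). S \<subseteq> coords \<and> x \<in> V \<and> bad S x \<and> pot X S x \<noteq> nb X S x}" for X
  define T2 where "T2 = {(S, x). S \<subseteq> coords \<and> x \<in> V \<and> (\<exists>u u'. thin S x u u')}"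
  define Yo where "Yo = {(S, x, y). S \<subseteq> coords \<and> x \<in> V \<and> y \<in> V \<and> cand S x y \<and> Inl y \<in> S}"
  define Yc where "Yc = {(S, x, y). S \<subseteq> coords \<and> x \<in> V \<and> y \<in> V \<and> cand S x y \<and> Inl y \<notin> S}"
  define Y1 where "Y1 = {(S, x, y). S \<subseteq> coords \<and> x \<in> V \<and> y \<in> V \<and> cand S x y \<and> Inl y \<notin> S \<and>
       y \<notin> Tgt \<and> card {w\<in>reach Tgt (S - {Inl x}). adj w y} \<le> 1}"
  define Y2 where "Y2 = {(S, x, y). S \<subseteq> coords \<and> x \<in> V \<and> y \<in> V \<and> cand S x y \<and> Inl y \<notin> S \<and>
       (y \<in> Tgt \<or> 2 \<le> card {w\<in>reach Tgt (S - {Inl x}). adj w y})}"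
  have fin: "finite (T1 X)" "finite T2" "finite Yo" "finite Yc" "finite Y1" "finite Y2" for X
    unfolding T1_def T2_def Yo_def Yc_def Y1_def Y2_def
    by ((rule finite_pairs finite_triples)+)
  have "wsum {(S, x). S \<subseteq> coords \<and> x \<in> V \<and> bad S x} \<le> wsum (T1 Src \<union> T1 Tgt \<union> T2)"
  proof (rule sum_mono2)
    show "{(S, x). S \<subseteq> coords \<and> x \<in> V \<and> bad S x} \<subseteq> T1 Src \<union> T1 Tgt \<union> T2"
      using bad_cases by (auto simp: T1_def T2_def)
  qed (use fin W_nonneg in auto)
  also have "\<dots> \<le> wsum (T1 Src \<union> T1 Tgt) + wsum T2"
    using sum_Un[of "T1 Src \<union> T1 Tgt" T2 "\<lambda>z. W (fst z)"] fin
      sum_nonneg[of "(T1 Src \<union> T1 Tgt) \<inter> T2" "\<lambda>z. W (fst z)"] W_nonneg by simp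
  also have "wsum (T1 Src \<union> T1 Tgt) \<le> wsum (T1 Src) + wsum (T1 Tgt)"
    using sum_Un[of "T1 Src" "T1 Tgt" "\<lambda>z. W (fst z)"] fin
      sum_nonneg[of "T1 Src \<inter> T1 Tgt" "\<lambda>z. W (fst z)"] W_nonneg by simp
  also have "wsum (T1 Src) \<le> C * 2 * ?g" using many_potential[of Src] by (simp add: T1_def)
  also have "wsum (T1 Tgt) \<le> C * 2 * ?g" using many_potential[of Tgt] by (simp add: T1_def)
  finally have A: "wsum {(S, x). S \<subseteq> coords \<and> x \<in> V \<and> bad S x} \<le> 4 * C * ?g + wsum T2" by simp
  have "real (m - 1) * wsum T2 \<le> wsum (Yo \<union> Yc)"
  proof -
    have "{(S, x, y). S \<subseteq> coords \<and> x \<in> V \<and> y \<in> V \<and> cand S x y} = Yo \<union> Yc"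
      by (auto simp: Yo_def Yc_def)
    then show ?thesis using thin_bound by (simp add: T2_def)
  qed
  also have "\<dots> = wsum Yo + wsum Yc"
    by (rule sum.union_disjoint) (use fin in \<open>auto simp: Yo_def Yc_def\<close>)
  \<comment> \<open>Relative to the closed candidates the open ones weigh at most
    \<open>\<rho> / (1 - \<rho>)\<close>, so both together weigh at most
    \<open>1 / (1 - \<rho>)\<close>.\<close>
  also have "\<dots> \<le> wsum Yc / (1 - \<rho>)"
    using cand_open \<rho> by (simp add: Yo_def Yc_def field_simps)
  also have "wsum Yc \<le> wsum (Y1 \<union> Y2)"
    by (rule sum_mono2) (use fin W_nonneg in \<open>auto simp: Yc_def Y1_def Y2_def\<close>)
  also have "\<dots> \<le> wsum Y1 + wsum Y2"
    using sum_Un[of Y1 Y2 "\<lambda>z. W (fst z)"] fin sum_nonneg[of "Y1 \<inter> Y2" "\<lambda>z. W (fst z)"] W_nonneg by simp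
  also have "wsum Y1 \<le> C ^ 3 * ((1 - \<rho>) / \<rho>) * real 16 * ?g"
    unfolding Y1_def by (rule cand_entrance)
  also have "wsum Y2 \<le> C ^ 3 * real (D * 8) * ?g"
    unfolding Y2_def by (rule cand_replacement)
  finally have B: "real (m - 1) * wsum T2 \<le>
      (C ^ 3 * ((1 - \<rho>) / \<rho>) * real 16 * ?g + C ^ 3 * real (D * 8) * ?g) / (1 - \<rho>)"
    using \<rho> by (simp add: divide_right_mono)
  also have "\<dots> = 16 * C ^ 3 / \<rho> * ?g + C ^ 3 * real (D * 8) * ?g / (1 - \<rho>)"
    using \<rho> by (simp add: field_simps)
  also have "C ^ 3 * real (D * 8) * ?g / (1 - \<rho>) \<le> C ^ 3 * real (D * 8) * ?g / (1 / 2)"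
    using \<rho> C W_nonneg by (intro divide_left_mono mult_nonneg_nonneg sum_nonneg) auto
  finally have "real (m - 1) * wsum T2 \<le> (16 * C ^ 3 / \<rho> + 16 * real D * C ^ 3) * ?g"
    by (simp add: algebra_simps)
  then have "wsum T2 \<le> (16 * C ^ 3 / \<rho> + 16 * real D * C ^ 3) / real (m - 1) * ?g"
    using m by (simp add: field_simps)
  then show ?thesis using A unfolding gain_const_def by (simp add: algebra_simps)
qed

end

section \<open>Connection probabilities along curves of parameters\<close>

context finite_two_terminal
begin

definition site_bond_param :: "real \<Rightarrow> real \<Rightarrow> 'a + 'a set \<Rightarrow> real" where
  "site_bond_param \<rho> p = case_sum (\<lambda>_. \<rho>) (\<lambda>_. p)"

definition Theta :: "real \<Rightarrow> real \<Rightarrow> real" where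
  "Theta \<rho> p = bern_expect coords (site_bond_param \<rho> p) (\<lambda>S. of_bool (conn S))"

abbreviation exp_piv :: "real \<Rightarrow> real \<Rightarrow> real" where
  "exp_piv \<rho> p \<equiv> bern_expect coords (site_bond_param \<rho> p) (\<lambda>S. real (card {x\<in>V. piv S x}))"

abbreviation exp_epiv :: "real \<Rightarrow> real \<Rightarrow> real" where
  "exp_epiv \<rho> p \<equiv> bern_expect coords (site_bond_param \<rho> p) (\<lambda>S. real (card {e\<in>edges. epiv S e}))"

lemma param_range:
  assumes "0 \<le> \<rho>" "\<rho> \<le> 1" "0 \<le> p" "p \<le> 1"
  shows "0 \<le> site_bond_param \<rho> p k \<and> site_bond_param \<rho> p k \<le> 1"
  using assms by (cases k) (auto simp: site_bond_param_def)

lemma exp_piv_eq: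
  "\<rho> * (\<Sum>x\<in>V. bern_expect coords (site_bond_param \<rho> p)
      (\<lambda>S. of_bool (conn (insert (Inl x) S)) - of_bool (conn (S - {Inl x})))) = exp_piv \<rho> p"
proof -
  have "\<rho> * (\<Sum>x\<in>V. bern_expect coords (site_bond_param \<rho> p)
      (\<lambda>S. of_bool (conn (insert (Inl x) S)) - of_bool (conn (S - {Inl x})))) =
    (\<Sum>x\<in>V. bern_expect coords (site_bond_param \<rho> p)
      (\<lambda>S. if Inl x \<in> S then of_bool (conn S) - of_bool (conn (S - {Inl x})) else 0))"
    unfolding sum_distrib_left
  proof (rule sum.cong[OF refl])
    fix x assume "x \<in> V"
    then have x: "Inl x \<in> coords" by (simp add: coords_def)
    show "\<rho> * bern_expect coords (site_bond_param \<rho> p)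
        (\<lambda>S. of_bool (conn (insert (Inl x) S)) - of_bool (conn (S - {Inl x}))) =
      bern_expect coords (site_bond_param \<rho> p)
        (\<lambda>S. if Inl x \<in> S then of_bool (conn S) - of_bool (conn (S - {Inl x})) else 0)"
      using bern_expect_pivotal[OF finite_coords x, of "site_bond_param \<rho> p" "\<lambda>S. of_bool (conn S)"]
      by (simp add: site_bond_param_def)
  qed
  also have "\<dots> = bern_expect coords (site_bond_param \<rho> p) (\<lambda>S. \<Sum>x\<in>V. of_bool (piv S x))"
    unfolding bern_expect_sum
  proof (intro sum.cong refl arg_cong[of _ _ "bern_expect coords (site_bond_param \<rho> p)"] ext)
    fix x S
    show "(if Inl x \<in> S then of_bool (conn S) - of_bool (conn (S - {Inl x})) else 0) = (of_bool (piv S x) :: real)"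
      using conn_mono[of "S - {Inl x}" S] by (cases "Inl x \<in> S") (auto simp: piv_def)
  qed
  also have "\<dots> = exp_piv \<rho> p"
    using finV by (simp add: Int_def)
  finally show ?thesis .
qed

lemma exp_epiv_eq:
  "p * (\<Sum>e\<in>edges. bern_expect coords (site_bond_param \<rho> p)
      (\<lambda>S. of_bool (conn (insert (Inr e) S)) - of_bool (conn (S - {Inr e})))) = exp_epiv \<rho> p"
proof -
  have "p * (\<Sum>e\<in>edges. bern_expect coords (site_bond_param \<rho> p)
      (\<lambda>S. of_bool (conn (insert (Inr e) S)) - of_bool (conn (S - {Inr e})))) =
    (\<Sum>e\<in>edges. bern_expect coords (site_bond_param \<rho> p)
      (\<lambda>S. if Inr e \<in> S then of_bool (conn S) - of_bool (conn (S - {Inr e})) else 0))"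
    unfolding sum_distrib_left
  proof (rule sum.cong[OF refl])
    fix x assume "x \<in> edges"
    then have x: "Inr x \<in> coords" by (simp add: coords_def)
    show "p * bern_expect coords (site_bond_param \<rho> p)
        (\<lambda>S. of_bool (conn (insert (Inr x) S)) - of_bool (conn (S - {Inr x}))) =
      bern_expect coords (site_bond_param \<rho> p)
        (\<lambda>S. if Inr x \<in> S then of_bool (conn S) - of_bool (conn (S - {Inr x})) else 0)"
      using bern_expect_pivotal[OF finite_coords x, of "site_bond_param \<rho> p" "\<lambda>S. of_bool (conn S)"]
      by (simp add: site_bond_param_def)
  qed
  also have "\<dots> = bern_expect coords (site_bond_param \<rho> p) (\<lambda>S. \<Sum>e\<in>edges. of_bool (epiv S e))"
    unfolding bern_expect_sum
  proof (intro sum.cong refl arg_cong[of _ _ "bern_expect coords (site_bond_param \<rho> p)"] ext)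
    fix e S
    show "(if Inr e \<in> S then of_bool (conn S) - of_bool (conn (S - {Inr e})) else 0) = (of_bool (epiv S e) :: real)"
      using conn_mono[of "S - {Inr e}" S] by (cases "Inr e \<in> S") (auto simp: epiv_def)
  qed
  also have "\<dots> = exp_epiv \<rho> p"
    using finite_edges by (simp add: Int_def)
  finally show ?thesis .
qed

text \<open>In terms of open pivotal coordinates, Russo's formula carries the logarithmic
  derivatives of the two parameters.\<close>

lemma Theta_has_derivative:
  assumes r: "(r has_real_derivative r') (at t)" and s: "(s has_real_derivative s') (at t)"
    and nz: "r t \<noteq> 0" "s t \<noteq> 0"
  shows "((\<lambda>t. Theta (r t) (s t)) has_real_derivative
     (r' / r t * exp_piv (r t) (s t) + s' / s t * exp_epiv (r t) (s t))) (at t)"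
proof -
  define \<pi>' where "\<pi>' = case_sum (\<lambda>_::'a. r') (\<lambda>_::'a set. s')"
  let ?\<pi> = "\<lambda>t. site_bond_param (r t) (s t)"
  let ?F = "\<lambda>S. of_bool (conn S) :: real"
  let ?d = "\<lambda>k. bern_expect coords (?\<pi> t) (\<lambda>S. ?F (insert k S) - ?F (S - {k}))"
  have dk: "((\<lambda>t. ?\<pi> t k) has_real_derivative \<pi>' k) (at t)" for k
    using r s by (cases k) (simp_all add: site_bond_param_def \<pi>'_def)
  have "((\<lambda>t. Theta (r t) (s t)) has_real_derivative (\<Sum>k\<in>coords. \<pi>' k * ?d k)) (at t)"
    unfolding Theta_def
    by (rule bern_expect_has_derivative[where \<pi> = ?\<pi> and \<pi>' = \<pi>', OF finite_coords dk])
  moreover have sp: "(\<Sum>k\<in>coords. h k) = (\<Sum>x\<in>V. h (Inl x)) + (\<Sum>e\<in>edges. h (Inr e))"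
    for h :: "'a + 'a set \<Rightarrow> real"
    unfolding coords_def using finV finite_edges
    by (subst sum.union_disjoint) (auto simp: sum.reindex)
  have "(\<Sum>k\<in>coords. \<pi>' k * ?d k) = (\<Sum>x\<in>V. r' * ?d (Inl x)) + (\<Sum>e\<in>edges. s' * ?d (Inr e))"
    unfolding sp by (simp add: \<pi>'_def)
  moreover have "(\<Sum>x\<in>V. r' * ?d (Inl x)) = r' / r t * exp_piv (r t) (s t)"
    using exp_piv_eq[of "r t" "s t"] nz by (simp add: sum_distrib_left[symmetric] field_simps)
  moreover have "(\<Sum>e\<in>edges. s' * ?d (Inr e)) = s' / s t * exp_epiv (r t) (s t)"
    using exp_epiv_eq[of "s t" "r t"] nz by (simp add: sum_distrib_left[symmetric] field_simps)
  ultimately show ?thesis by simp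
qed

lemma exp_piv_nonneg:
  assumes "0 \<le> \<rho>" "\<rho> \<le> 1" "0 \<le> p" "p \<le> 1"
  shows "0 \<le> exp_piv \<rho> p"
  unfolding bern_expect_def
  by (intro sum_nonneg mult_nonneg_nonneg bern_weight_nonneg param_range assms) auto

lemma Theta_mono_site:
  assumes "0 < \<rho>" "\<rho> \<le> \<rho>'" "\<rho>' \<le> 1" "0 < p" "p \<le> 1"
  shows "Theta \<rho> p \<le> Theta \<rho>' p"
proof (rule DERIV_nonneg_imp_nondecreasing[OF assms(2)])
  fix x assume x: "\<rho> \<le> x" "x \<le> \<rho>'"
  have "((\<lambda>t. Theta t p) has_real_derivative (1 / x * exp_piv x p + 0 / p * exp_epiv x p)) (at x)"
    by (rule Theta_has_derivative) (use assms x in \<open>auto intro!: derivative_eq_intros\<close>)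
  moreover have "0 \<le> exp_piv x p" by (rule exp_piv_nonneg) (use assms x in auto)
  ultimately show "\<exists>y. ((\<lambda>t. Theta t p) has_real_derivative y) (at x) \<and> 0 \<le> y"
    using assms x by (intro exI[of _ "1 / x * exp_piv x p + 0 / p * exp_epiv x p"]) auto
qed

text \<open>On this curve the logarithmic derivatives of density and bond parameter are
  \<open>- \<alpha> / t\<close> and \<open>1 / t\<close>, so the hypothesis on pivotal counts is the
  sign of the derivative.\<close>

lemma Theta_curve:
  assumes ab: "0 < a" "a \<le> b" "b \<le> 1" and c: "0 < c"
    and le: "\<And>t. a \<le> t \<Longrightarrow> t \<le> b \<Longrightarrow>
      exp_epiv (c * t powr (- \<alpha>)) t \<le> \<alpha> * exp_piv (c * t powr (- \<alpha>)) t"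
  shows "Theta (c * b powr (- \<alpha>)) b \<le> Theta (c * a powr (- \<alpha>)) a"
proof (rule DERIV_nonpos_imp_nonincreasing[OF ab(2)])
  fix t assume t: "a \<le> t" "t \<le> b"
  have t0: "0 < t" using ab t by simp
  let ?r = "\<lambda>t. c * t powr (- \<alpha>)"
  have d: "(?r has_real_derivative c * (- \<alpha> * t powr (- \<alpha> - 1))) (at t)"
    using t0 by (auto intro!: derivative_eq_intros simp: has_real_derivative_powr)
  have D: "((\<lambda>t. Theta (?r t) t) has_real_derivative
     ((c * (- \<alpha> * t powr (- \<alpha> - 1))) / ?r t * exp_piv (?r t) t + 1 / t * exp_epiv (?r t) t)) (at t)"
    by (rule Theta_has_derivative[OF d]) (use t0 c in \<open>auto intro!: derivative_eq_intros\<close>)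
  have eq: "(c * (- \<alpha> * t powr (- \<alpha> - 1))) / ?r t = - \<alpha> / t"
    using t0 c by (simp add: powr_diff field_simps)
  have "- \<alpha> / t * exp_piv (?r t) t + 1 / t * exp_epiv (?r t) t \<le> 0"
    using le[OF t] t0 by (simp add: field_simps)
  then show "\<exists>y. ((\<lambda>t. Theta (?r t) t) has_real_derivative y) (at t) \<and> y \<le> 0"
    using D[unfolded eq] by blast
qed

lemma exp_epiv_le:
  assumes "0 \<le> \<rho>" "\<rho> \<le> 1" "0 \<le> p" "p \<le> 1"
  shows "exp_epiv \<rho> p \<le> exp_piv \<rho> p"
  by (rule bern_expect_mono) (use param_range[OF assms] card_epiv_le_piv in auto)

end

context percolation_gain
begin

text \<open>Let \<open>b\<close> and \<open>g\<close> be the expected numbers of bad and good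
  pivotal sites. From \<open>b \<le> K * g\<close>, the good ones are at least the fraction
  \<open>1 / (1 + K)\<close> of all. Twice the pivotal bonds are at most pivotal plus bad sites,
  that is, twice the pivotal sites minus \<open>g\<close>.\<close>

lemma exp_epiv_gain:
  assumes K: "gain_const \<le> K"
  shows "exp_epiv \<rho> p \<le> (1 - 1 / (2 * (1 + K))) * exp_piv \<rho> p"
proof -
  let ?E = "bern_expect coords (site_bond_param \<rho> p)"
  let ?b = "?E (\<lambda>S. real (card {x\<in>V. bad S x}))" and ?g = "?E (\<lambda>S. real (card {x\<in>V. good S x}))"
  have K0: "0 \<le> gain_const" using C \<rho> m unfolding gain_const_def by simp
  have pr: "0 \<le> site_bond_param \<rho> p k \<and> site_bond_param \<rho> p k \<le> 1" for k
    using param_range[of \<rho> p] \<rho> p by auto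
  have W: "W S = bern_weight coords (site_bond_param \<rho> p) S" for S
    by (simp add: W_def site_bond_param_def)
  have "?b \<le> gain_const * ?g"
    using bad_le_good unfolding bern_expect_card[OF finite_coords finV] Good_def W .
  moreover have "0 \<le> ?g" 
    unfolding bern_expect_def by (intro sum_nonneg mult_nonneg_nonneg bern_weight_nonneg pr) auto
  ultimately have b: "?b \<le> K * ?g" using K by (meson mult_right_mono order_trans)
  have split: "exp_piv \<rho> p = ?g + ?b"
    unfolding bern_expect_add[symmetric] by (simp add: card_piv_split)
  have "2 * exp_epiv \<rho> p = ?E (\<lambda>S. 2 * real (card {e\<in>edges. epiv S e}))"
    by (rule bern_expect_cmult[symmetric])
  also have "\<dots> \<le> ?E (\<lambda>S. real (card {x\<in>V. piv S x}) + real (card {x\<in>V. bad S x}))"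
  proof (rule bern_expect_mono)
    fix S show "2 * real (card {e\<in>edges. epiv S e}) \<le> real (card {x\<in>V. piv S x}) + real (card {x\<in>V. bad S x})"
      using card_epiv_bad[of S] by linarith
  qed (rule pr)
  also have "\<dots> = exp_piv \<rho> p + ?b" by (rule bern_expect_add)
  finally have e: "2 * exp_epiv \<rho> p \<le> exp_piv \<rho> p + ?b" .
  have K1: "0 < 1 + K" using K K0 by simp
  have "exp_piv \<rho> p \<le> (1 + K) * ?g" using split b by (simp add: algebra_simps)
  then have "exp_piv \<rho> p / (1 + K) \<le> ?g" using K1 by (simp add: field_simps)
  then have "2 * exp_epiv \<rho> p \<le> 2 * exp_piv \<rho> p - exp_piv \<rho> p / (1 + K)" using e split by simp
  then show ?thesis using K1 by (simp add: field_simps)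
qed

end

context finite_two_terminal
begin

text \<open>Three moves: to bond parameter \<open>p2\<close> with exponent 1, where only
  \<open>card_epiv_le_piv\<close> is available because the odds of a bond explode near 1; to
  \<open>q\<close> with exponent \<open>\<alpha>\<close>; up to \<open>\<rho>1\<close> by
  monotonicity. The density never falls below \<open>\<rho>0\<close> on the way, so one
  \<open>K\<close> dominates all the constants \<open>gain_const\<close>.\<close>

lemma Theta_site_to_bond:
  fixes C K q p2 \<rho>0 \<rho>1 :: real and D m :: nat
  defines "\<alpha> \<equiv> 1 - 1 / (2 * (1 + K))"
  assumes q: "0 < q" "q \<le> p2" "p2 < 1" and \<rho>0: "0 < \<rho>0" "\<rho>0 / p2 * (p2 / q) powr \<alpha> \<le> \<rho>1" "\<rho>1 \<le> 1 / 2"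
    and C: "1 \<le> C" "1 \<le> C * q" "1 \<le> C * (1 - p2)"
    and degree: "\<And>x. x \<in> V \<Longrightarrow> card {y\<in>V. adj x y} \<le> D"
    and lens: "\<And>x u. x \<in> V \<Longrightarrow> u \<in> V \<Longrightarrow> x \<notin> Tgt \<Longrightarrow> adj x u \<Longrightarrow>
        m \<le> card {y\<in>V. adj x y \<and> adj y u}"
    and m: "2 \<le> m"
    and K: "4 * C + (16 * C ^ 3 / \<rho>0 + 16 * real D * C ^ 3) / real (m - 1) \<le> K"
  shows "Theta \<rho>0 1 \<le> Theta \<rho>1 q"
proof -
  have K0: "0 \<le> K"
  proof -
    have "0 \<le> 4 * C + (16 * C ^ 3 / \<rho>0 + 16 * real D * C ^ 3) / real (m - 1)"
      using C \<rho>0 m by (intro add_nonneg_nonneg divide_nonneg_nonneg mult_nonneg_nonneg) auto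
    from order_trans[OF this K] show ?thesis .
  qed
  have \<alpha>: "0 \<le> \<alpha>" "\<alpha> \<le> 1" using K0 unfolding \<alpha>_def by (auto simp: field_simps)
  have p2: "0 < p2" using q by simp
  define \<rho>2 where "\<rho>2 = \<rho>0 / p2"
  have r12: "\<rho>2 \<le> \<rho>1"
  proof -
    have "1 \<le> (p2 / q) powr \<alpha>" using q \<alpha> by (intro ge_one_powr_ge_zero) auto
    then have "\<rho>2 * 1 \<le> \<rho>2 * (p2 / q) powr \<alpha>" using \<rho>0 p2 by (intro mult_left_mono) (auto simp: \<rho>2_def)
    then show ?thesis using \<rho>0 by (simp add: \<rho>2_def)
  qed
  have r02: "\<rho>0 \<le> \<rho>2" using \<rho>0 p2 q by (simp add: \<rho>2_def field_simps)
  have "Theta (\<rho>0 * 1 powr (- 1)) 1 \<le> Theta (\<rho>0 * p2 powr (- 1)) p2"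
  proof (rule Theta_curve)
    fix t assume t: "p2 \<le> t" "t \<le> 1"
    have "\<rho>0 * t powr (- 1) = \<rho>0 / t" using t p2 by (simp add: powr_minus divide_inverse)
    moreover have "\<rho>0 / t \<le> \<rho>2" unfolding \<rho>2_def using t p2 \<rho>0 by (intro divide_left_mono) auto
    moreover have "0 \<le> \<rho>0 / t" using \<rho>0 t p2 by simp
    ultimately have "0 \<le> \<rho>0 * t powr (- 1)" "\<rho>0 * t powr (- 1) \<le> 1"
      using r12 \<rho>0(3) by linarith+
    from exp_epiv_le[OF this] show "exp_epiv (\<rho>0 * t powr (- 1)) t \<le> 1 * exp_piv (\<rho>0 * t powr (- 1)) t"
      using t p2 by simp
  qed (use p2 q \<rho>0 in auto)
  then have 1: "Theta \<rho>0 1 \<le> Theta \<rho>2 p2" using p2 by (simp add: \<rho>2_def powr_minus divide_inverse)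
  define c where "c = \<rho>2 * p2 powr \<alpha>"
  have c: "0 < c" using \<rho>0 p2 by (simp add: c_def \<rho>2_def)
  have val: "c * t powr (- \<alpha>) = \<rho>2 * (p2 / t) powr \<alpha>" if "0 < t" for t
    using that p2 by (simp add: c_def powr_minus_divide powr_divide)
  have "Theta (c * p2 powr (- \<alpha>)) p2 \<le> Theta (c * q powr (- \<alpha>)) q"
  proof (rule Theta_curve)
    fix t assume t: "q \<le> t" "t \<le> p2"
    let ?\<rho> = "c * t powr (- \<alpha>)"
    have t0: "0 < t" using q t by simp
    have lo: "\<rho>0 \<le> ?\<rho>"
    proof -
      have "1 \<le> (p2 / t) powr \<alpha>" using t t0 \<alpha> by (intro ge_one_powr_ge_zero) auto
      then have "\<rho>2 * 1 \<le> \<rho>2 * (p2 / t) powr \<alpha>" using \<rho>0 p2 by (intro mult_left_mono) (auto simp: \<rho>2_def)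
      then show ?thesis using r02 val[OF t0] by simp
    qed
    have hi: "?\<rho> \<le> 1 / 2"
    proof -
      have "(p2 / t) powr \<alpha> \<le> (p2 / q) powr \<alpha>"
        using t t0 q p2 \<alpha> by (intro powr_mono2 divide_left_mono) auto
      then have "\<rho>2 * (p2 / t) powr \<alpha> \<le> \<rho>2 * (p2 / q) powr \<alpha>"
        using \<rho>0 p2 by (intro mult_left_mono) (auto simp: \<rho>2_def)
      then show ?thesis using \<rho>0(2,3) val[OF t0] unfolding \<rho>2_def by linarith
    qed
    have "percolation_gain V adj Tgt ?\<rho> t C D m"
    proof unfold_locales
      show "0 < ?\<rho>" using lo \<rho>0 by simp
      have "C * q \<le> C * t" using C t by (intro mult_left_mono) auto
      then show "1 - t \<le> C * t" using C t0 by linarith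
      have "C * (1 - p2) \<le> C * (1 - t)" using C t by (intro mult_left_mono) auto
      then show "t \<le> C * (1 - t)" using C t q by linarith
    qed (use hi t t0 q C degree lens m in auto)
    then interpret G: percolation_gain V adj Src Tgt ?\<rho> t C D m .
    have "16 * C ^ 3 / ?\<rho> \<le> 16 * C ^ 3 / \<rho>0" using lo \<rho>0 C by (intro divide_left_mono) auto
    then have le: "(16 * C ^ 3 / ?\<rho> + 16 * real D * C ^ 3) / real (m - 1) \<le>
       (16 * C ^ 3 / \<rho>0 + 16 * real D * C ^ 3) / real (m - 1)"
      by (intro divide_right_mono) auto
    have "G.gain_const \<le> K"
      unfolding G.gain_const_def by (rule order_trans[OF add_left_mono[OF le] K])
    from G.exp_epiv_gain[OF this]
    show "exp_epiv ?\<rho> t \<le> \<alpha> * exp_piv ?\<rho> t" unfolding \<alpha>_def .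
  qed (use q c in auto)
  then have 2: "Theta \<rho>2 p2 \<le> Theta (\<rho>2 * (p2 / q) powr \<alpha>) q"
    using val[of p2] val[of q] p2 q by simp
  have 3: "Theta (\<rho>2 * (p2 / q) powr \<alpha>) q \<le> Theta \<rho>1 q"
    by (rule Theta_mono_site) (use \<rho>0 p2 q in \<open>auto simp: \<rho>2_def\<close>)
  show ?thesis using 1 2 3 by linarith
qed

end

section \<open>Percolation on the lattice\<close>

type_synonym site = "int \<times> int"

text \<open>The radius \<open>4 * N\<close> is the unit distance measured in sides of cells.\<close>

definition ladj :: "nat \<Rightarrow> site \<Rightarrow> site \<Rightarrow> bool" where
  "ladj N u v \<longleftrightarrow> u \<noteq> v \<and> (fst u - fst v)\<^sup>2 + (snd u - snd v)\<^sup>2 \<le> (4 * int N)\<^sup>2"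

definition lbox :: "nat \<Rightarrow> site set" where
  "lbox n = {- int n..int n} \<times> {- int n..int n}"

lemma finite_box [simp]: "finite (lbox n)"
  by (simp add: lbox_def)

lemma lbox_mono: "m \<le> n \<Longrightarrow> lbox m \<subseteq> lbox n"
  by (auto simp: lbox_def)

lemma ex_box: "\<exists>n. z \<in> lbox n"
  by (rule exI[of _ "nat (max \<bar>fst z\<bar> \<bar>snd z\<bar>)"]) (cases z, auto simp: lbox_def)

lemma finite_subset_box:
  assumes "finite A" shows "\<exists>n. A \<subseteq> lbox n"
  using assms
proof (induction A)
  case (insert z A)
  then obtain n m where "A \<subseteq> lbox n" "z \<in> lbox m" using ex_box by blast
  then have "insert z A \<subseteq> lbox (max n m)"
    using lbox_mono[of n "max n m"] lbox_mono[of m "max n m"] by auto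
  then show ?case by blast
qed auto

lemma infinite_iff_box: "infinite A \<longleftrightarrow> (\<forall>n. \<exists>v\<in>A. v \<notin> lbox n)"
proof
  assume "infinite A"
  then show "\<forall>n. \<exists>v\<in>A. v \<notin> lbox n" using finite_subset[OF _ finite_box] by blast
next
  assume "\<forall>n. \<exists>v\<in>A. v \<notin> lbox n"
  then show "infinite A" using finite_subset_box by blast
qed

lemma ladj_bound:
  assumes "ladj N u v"
  shows "\<bar>fst u - fst v\<bar> \<le> 4 * int N" "\<bar>snd u - snd v\<bar> \<le> 4 * int N"
proof -
  have "(fst u - fst v)\<^sup>2 \<le> (4 * int N)\<^sup>2" "(snd u - snd v)\<^sup>2 \<le> (4 * int N)\<^sup>2"
    using assms zero_le_power2[of "fst u - fst v"] zero_le_power2[of "snd u - snd v"]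
    unfolding ladj_def by linarith+
  then show "\<bar>fst u - fst v\<bar> \<le> 4 * int N" "\<bar>snd u - snd v\<bar> \<le> 4 * int N"
    using abs_le_square_iff[of _ "4 * int N"] by fastforce+
qed

lemma ladj_box: "ladj N u v \<Longrightarrow> u \<in> lbox n \<Longrightarrow> v \<in> lbox (n + 4 * N)"
  using ladj_bound[of N u v] by (cases u, cases v) (auto simp: lbox_def)

lemma ladj_degree: "card {y\<in>A. ladj N x y} \<le> (8 * N + 1)\<^sup>2" "finite {y. ladj N x y}"
proof -
  let ?B = "{fst x - 4 * int N..fst x + 4 * int N} \<times> {snd x - 4 * int N..snd x + 4 * int N}"
  have sub: "y \<in> ?B" if "ladj N x y" for y
    using ladj_bound[OF that] by (cases y) auto
  have fin: "finite ?B" by simp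
  show "finite {y. ladj N x y}" by (rule finite_subset[OF _ fin]) (use sub in auto)
  have "card {y\<in>A. ladj N x y} \<le> card ?B" by (rule card_mono[OF fin]) (use sub in auto)
  also have "card ?B = (8 * N + 1)\<^sup>2" by (simp add: power2_eq_square nat_add_distrib nat_mult_distrib)
  finally show "card {y\<in>A. ladj N x y} \<le> (8 * N + 1)\<^sup>2" .
qed

text \<open>A square of \<open>N\<close> by \<open>N\<close> sites with its corner at the rounded
  midpoint of \<open>x\<close> and \<open>u\<close> lies within reach of both; the subtracted 2
  accounts for \<open>x\<close> and \<open>u\<close> themselves.\<close>

lemma ladj_lens:
  assumes N: "1 \<le> N" and xu: "ladj N x u" and V: "\<And>y. ladj N x y \<Longrightarrow> y \<in> V"
  shows "N\<^sup>2 - 2 \<le> card {y\<in>V. ladj N x y \<and> ladj N y u}"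
proof -
  define c where "c = ((fst x + fst u) div 2, (snd x + snd u) div 2)"
  define Q where "Q = (\<lambda>(i, j). (fst c + i, snd c + j)) ` ({0..<int N} \<times> {0..<int N})"
  have inj: "inj_on (\<lambda>(i, j). (fst c + i, snd c + j)) ({0..<int N} \<times> {0..<int N})"
    by (auto simp: inj_on_def)
  have cQ: "card Q = N\<^sup>2" unfolding Q_def using card_image[OF inj] by (simp add: power2_eq_square)
  have fQ: "finite Q" unfolding Q_def by simp
  have near: "(fst y - fst z)\<^sup>2 + (snd y - snd z)\<^sup>2 \<le> (4 * int N)\<^sup>2" if y: "y \<in> Q" and z: "z = x \<or> z = u" for y z
  proof -
    obtain i j where ij: "y = (fst c + i, snd c + j)" "0 \<le> i" "i < int N" "0 \<le> j" "j < int N"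
      using y by (auto simp: Q_def)
    define a where "a = fst u - fst x"
    define b where "b = snd u - snd x"
    define e where "e = 2 * fst y - fst x - fst u"
    define f where "f = 2 * snd y - snd x - snd u"
    have ef: "\<bar>e\<bar> \<le> \<bar>2 * int N\<bar>" "\<bar>f\<bar> \<le> \<bar>2 * int N\<bar>" using ij N by (auto simp: e_def f_def c_def)
    have ef2: "e\<^sup>2 \<le> 4 * (int N)\<^sup>2" "f\<^sup>2 \<le> 4 * (int N)\<^sup>2"
      using ef unfolding abs_le_square_iff by (simp_all add: power_mult_distrib)
    have ab: "a\<^sup>2 + b\<^sup>2 \<le> 16 * (int N)\<^sup>2"
      using xu by (simp add: ladj_def a_def b_def power2_commute power_mult_distrib)
    have par: "(s + t)\<^sup>2 \<le> 2 * s\<^sup>2 + 2 * t\<^sup>2" "(t - s)\<^sup>2 \<le> 2 * s\<^sup>2 + 2 * t\<^sup>2" for s t :: int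
    proof -
      have "2 * s\<^sup>2 + 2 * t\<^sup>2 - (s + t)\<^sup>2 = (s - t)\<^sup>2" "2 * s\<^sup>2 + 2 * t\<^sup>2 - (t - s)\<^sup>2 = (s + t)\<^sup>2"
        by (simp_all add: power2_eq_square algebra_simps)
      then show "(s + t)\<^sup>2 \<le> 2 * s\<^sup>2 + 2 * t\<^sup>2" "(t - s)\<^sup>2 \<le> 2 * s\<^sup>2 + 2 * t\<^sup>2"
        using zero_le_power2[of "s - t"] zero_le_power2[of "s + t"] by linarith+
    qed
    \<comment> \<open>Four times the squared distance is at most \<open>2 * 16 + 2 * 8 = 48\<close>
      times \<open>N ^ 2\<close>, below the admissible 64.\<close>
    have lin: "4 * X \<le> 2 * A + 2 * E \<Longrightarrow> 4 * Y \<le> 2 * B + 2 * F \<Longrightarrow> E \<le> 4 * n \<Longrightarrow> F \<le> 4 * n \<Longrightarrow>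
        A + B \<le> 16 * n \<Longrightarrow> 0 \<le> n \<Longrightarrow> X + Y \<le> 16 * n" for X Y A B E F n :: int
      by linarith
    have X: "(2 * (fst y - fst z))\<^sup>2 \<le> 2 * a\<^sup>2 + 2 * e\<^sup>2"
    proof (cases "z = x")
      case True
      then have "2 * (fst y - fst z) = a + e" by (simp add: a_def e_def)
      then show ?thesis using par(1)[of a e] by simp
    next
      case False
      then have "2 * (fst y - fst z) = e - a" using z by (simp add: a_def e_def)
      then show ?thesis using par(2)[of e a] by simp
    qed
    have Y: "(2 * (snd y - snd z))\<^sup>2 \<le> 2 * b\<^sup>2 + 2 * f\<^sup>2"
    proof (cases "z = x")
      case True
      then have "2 * (snd y - snd z) = b + f" by (simp add: b_def f_def)
      then show ?thesis using par(1)[of b f] by simp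
    next
      case False
      then have "2 * (snd y - snd z) = f - b" using z by (simp add: b_def f_def)
      then show ?thesis using par(2)[of f b] by simp
    qed
    have four: "(2::int)\<^sup>2 = 4" by simp
    have "(fst y - fst z)\<^sup>2 + (snd y - snd z)\<^sup>2 \<le> 16 * (int N)\<^sup>2"
      by (rule lin[OF X[unfolded power_mult_distrib four] Y[unfolded power_mult_distrib four] ef2 ab]) simp
    then show ?thesis by (simp add: power_mult_distrib)
  qed
  have "Q - {x, u} \<subseteq> {y\<in>V. ladj N x y \<and> ladj N y u}"
  proof
    fix y assume y: "y \<in> Q - {x, u}"
    then have "ladj N x y" "ladj N y u"
      using near[of y x] near[of y u] by (auto simp: ladj_def power2_commute)
    then show "y \<in> {y\<in>V. ladj N x y \<and> ladj N y u}" using V by auto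
  qed
  moreover have "finite {y\<in>V. ladj N x y \<and> ladj N y u}"
    by (rule finite_subset[OF _ ladj_degree(2)[of N x]]) auto
  ultimately have "card (Q - {x, u}) \<le> card {y\<in>V. ladj N x y \<and> ladj N y u}" by (rule card_mono[rotated])
  moreover have "card Q - card {x, u} \<le> card (Q - {x, u})" by (rule diff_card_le_card_Diff) simp
  moreover have "card {x, u} \<le> 2" by (simp add: card_insert_if)
  ultimately show ?thesis using cQ by linarith
qed

interpretation lat: site_bond UNIV "ladj N" for N
  by unfold_locales (auto simp: ladj_def power2_commute)

definition lreach :: "nat \<Rightarrow> site set \<Rightarrow> (site + site set) set \<Rightarrow> site set" where
  "lreach N = site_bond.reach UNIV (ladj N)"

definition exits :: "nat \<Rightarrow> nat \<Rightarrow> nat \<Rightarrow> (site + site set) set \<Rightarrow> bool" where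
  "exits N k n S \<longleftrightarrow> (\<exists>v\<in>lreach N (lbox k) S. v \<notin> lbox n)"

lemma fin_lat: "finite_two_terminal (lbox n) (ladj N)"
  by unfold_locales (auto simp: ladj_def power2_commute)

text \<open>No step exceeds \<open>4 * N\<close> in a coordinate, so a path from
  \<open>lbox k\<close> that leaves \<open>lbox n\<close> lands in the outer layer at its first
  exit. The finite window thus decides \<open>exits\<close>, see \<open>exits_iff\<close>.\<close>

definition LTheta :: "nat \<Rightarrow> nat \<Rightarrow> nat \<Rightarrow> real \<Rightarrow> real \<Rightarrow> real" where
  "LTheta N k n = finite_two_terminal.Theta (lbox (n + 4 * N)) (ladj N) (lbox k) (lbox (n + 4 * N) - lbox n)"

definition Lcoords :: "nat \<Rightarrow> nat \<Rightarrow> (site + site set) set" where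
  "Lcoords N n = finite_two_terminal.coords (lbox (n + 4 * N)) (ladj N)"

lemma exits_iff:
  assumes kn: "k \<le> n"
  shows "exits N k n S \<longleftrightarrow>
    two_terminal.conn (lbox (n + 4 * N)) (ladj N) (lbox k) (lbox (n + 4 * N) - lbox n) (S \<inter> Lcoords N n)"
proof -
  interpret F: finite_two_terminal "lbox (n + 4 * N)" "ladj N" "lbox k" "lbox (n + 4 * N) - lbox n"
    by (rule fin_lat)
  let ?S = "S \<inter> Lcoords N n"
  have sub: "F.reach (lbox k) ?S \<subseteq> lreach N (lbox k) S"
  proof (rule F.reach_least)
    fix u assume "u \<in> lbox k" "Inl u \<in> ?S"
    then show "u \<in> lreach N (lbox k) S" unfolding lreach_def by (auto intro: lat.reach.base)
  next
    fix u v assume u: "u \<in> lreach N (lbox k) S" "F.stp ?S u v"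
    then have "lat.stp N S u v" by (auto simp: F.stp_def lat.stp_def)
    then show "v \<in> lreach N (lbox k) S" using u unfolding lreach_def by (auto intro: lat.reach.step)
  qed
  have coordsI: "Inl u \<in> Lcoords N n" if "u \<in> lbox (n + 4 * N)" for u
    using that by (simp add: Lcoords_def F.coords_def)
  show ?thesis
  proof
    assume ex: "exits N k n S"
    show "F.conn ?S"
    proof (rule ccontr)
      assume nc: "\<not> F.conn ?S"
      have "lreach N (lbox k) S \<subseteq> F.reach (lbox k) ?S \<inter> lbox n"
        unfolding lreach_def
      proof (rule lat.reach_least)
        fix u assume u: "u \<in> lbox k" "Inl u \<in> S"
        have "u \<in> lbox n" "u \<in> lbox (n + 4 * N)" using u kn lbox_mono[of k n] lbox_mono[of n "n + 4 * N"] by auto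
        then show "u \<in> F.reach (lbox k) ?S \<inter> lbox n" using u coordsI[of u] by (auto intro!: F.reach.base)
      next
        fix u v assume u: "u \<in> F.reach (lbox k) ?S \<inter> lbox n" "lat.stp N S u v"
        have a: "ladj N u v" using u(2) by (simp add: lat.stp_def)
        have v: "v \<in> lbox (n + 4 * N)" using ladj_box[OF a] u by auto
        have u': "u \<in> lbox (n + 4 * N)" using u lbox_mono[of n "n + 4 * N"] by auto
        have "F.stp ?S u v"
          using u(2) v u' a coordsI F.edge_in_coords[OF u' v a]
          by (auto simp: lat.stp_def F.stp_def Lcoords_def)
        then have vr: "v \<in> F.reach (lbox k) ?S" using u by (auto intro: F.reach.step)
        then have "v \<in> lbox n" using nc v by (auto simp: F.conn_def)
        then show "v \<in> F.reach (lbox k) ?S \<inter> lbox n" using vr by simp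
      qed
      then show False using ex by (auto simp: exits_def)
    qed
  next
    assume "F.conn ?S"
    then show "exits N k n S" using sub by (auto simp: F.conn_def exits_def)
  qed
qed

text \<open>Uniformity in \<open>N\<close> is settled here:
  \<open>1 / \<rho>0 \<le> N ^ 2 / c0\<close>, degrees are at most \<open>81 * N ^ 2\<close>, and
  \<open>N ^ 2 - 3 \<ge> N ^ 2 / 4\<close> for \<open>N \<ge> 2\<close>. All powers of
  \<open>N\<close> cancel, and \<open>K\<close> depends on \<open>C\<close> and \<open>c0\<close>
  only.\<close>

lemma LTheta_site_to_bond:
  fixes C c0 q p2 \<rho>0 \<rho>1 :: real
  defines "K \<equiv> 4 * C + 4 * (16 * C ^ 3 / c0 + 16 * 81 * C ^ 3)"
  defines "\<alpha> \<equiv> 1 - 1 / (2 * (1 + K))"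
  assumes q: "0 < q" "q \<le> p2" "p2 < 1"
    and \<rho>0: "0 < c0" "c0 / real N ^ 2 \<le> \<rho>0" "\<rho>0 / p2 * (p2 / q) powr \<alpha> \<le> \<rho>1" "\<rho>1 \<le> 1 / 2"
    and C: "1 \<le> C" "1 \<le> C * q" "1 \<le> C * (1 - p2)"
    and N: "2 \<le> N"
  shows "LTheta N k n \<rho>0 1 \<le> LTheta N k n \<rho>1 q"
proof -
  interpret F: finite_two_terminal "lbox (n + 4 * N)" "ladj N" "lbox k" "lbox (n + 4 * N) - lbox n"
    by (rule fin_lat)
  have N0: "0 < real N" using N by simp
  have \<rho>0': "0 < \<rho>0"
  proof -
    have "0 < c0 / real N ^ 2" using \<rho>0(1) N0 by simp
    then show ?thesis using \<rho>0(2) by linarith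
  qed
  have N4: "4 \<le> N\<^sup>2" using power_mono[of 2 N 2] N by simp
  have m1: "real N ^ 2 / 4 \<le> real (N\<^sup>2 - 2 - 1)"
  proof -
    have "real (N\<^sup>2 - 2 - 1) = real (N\<^sup>2) - 3" using N4 by (simp add: of_nat_diff)
    moreover have "4 \<le> real (N\<^sup>2)" using N4 by (metis numeral_le_real_of_nat_iff)
    ultimately show ?thesis unfolding of_nat_power by linarith
  qed
  have m2: "0 < real N ^ 2 / 4" using N0 by simp
  have C0: "0 \<le> C ^ 3" using C by simp
  have "16 * C ^ 3 / \<rho>0 \<le> 16 * C ^ 3 / (c0 / real N ^ 2)"
    using \<rho>0 \<rho>0' C0 N0 by (intro divide_left_mono) auto
  moreover have "16 * real ((8 * N + 1)\<^sup>2) * C ^ 3 \<le> 16 * (81 * real N ^ 2) * C ^ 3"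
  proof (intro mult_right_mono mult_left_mono)
    have "(8 * N + 1)\<^sup>2 \<le> (9 * N)\<^sup>2" using N by (intro power_mono) auto
    then have "real ((8 * N + 1)\<^sup>2) \<le> real ((9 * N)\<^sup>2)" by (rule of_nat_mono)
    then show "real ((8 * N + 1)\<^sup>2) \<le> 81 * real N ^ 2" by (simp add: power_mult_distrib)
  qed (use C0 in auto)
  ultimately have s: "16 * C ^ 3 / \<rho>0 + 16 * real ((8 * N + 1)\<^sup>2) * C ^ 3 \<le>
     real N ^ 2 * (16 * C ^ 3 / c0 + 16 * 81 * C ^ 3)" (is "?a \<le> ?b")
    by (simp add: algebra_simps)
  have "?a / real (N\<^sup>2 - 2 - 1) \<le> ?b / (real N ^ 2 / 4)"
    by (rule frac_le) (use s m1 m2 C0 \<rho>0 in \<open>auto intro!: mult_nonneg_nonneg add_nonneg_nonneg\<close>)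
  also have "\<dots> = 4 * (16 * C ^ 3 / c0 + 16 * 81 * C ^ 3)" using N0 by simp
  finally have K: "4 * C + ?a / real (N\<^sup>2 - 2 - 1) \<le> K" unfolding K_def by simp
  have lens: "N\<^sup>2 - 2 \<le> card {y\<in>lbox (n + 4 * N). ladj N x y \<and> ladj N y u}"
    if "x \<in> lbox (n + 4 * N)" "x \<notin> lbox (n + 4 * N) - lbox n" "ladj N x u" for x u
    by (rule ladj_lens) (use that N ladj_box in auto)
  show ?thesis
    unfolding LTheta_def
    by (rule F.Theta_site_to_bond[where C = C and K = K and D = "(8 * N + 1)\<^sup>2" and m = "N\<^sup>2 - 2"
          and ?p2.0 = p2])
       (use q \<rho>0 \<rho>0' C K lens ladj_degree N4 in \<open>auto simp: \<alpha>_def\<close>)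
qed

section \<open>Bernoulli product measures on the infinite lattice\<close>

abbreviation Bern :: "real \<Rightarrow> ('i \<Rightarrow> bool) measure" where
  "Bern p \<equiv> PiM UNIV (\<lambda>_. measure_pmf (bernoulli_pmf p))"

lemma prob_space_Bern: "prob_space (Bern p)"
  by (intro prob_space_PiM prob_space_measure_pmf)

lemma space_Bern [simp]: "space (PiM UNIV (\<lambda>k. measure_pmf (P k))) = UNIV"
  by (auto simp: space_PiM PiE_UNIV_domain)

lemma cylinder_sets:
  fixes P :: "'k \<Rightarrow> 'b pmf"
  assumes "finite K"
  shows "{\<omega>\<in>space (PiM UNIV (\<lambda>k. measure_pmf (P k))). \<forall>k\<in>K. \<omega> k \<in> F k} \<in> sets (PiM UNIV (\<lambda>k. measure_pmf (P k)))"
proof (rule sets.sets_Collect_finite_All[OF _ assms])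
  fix k assume "k \<in> K"
  have "(\<lambda>\<omega>. \<omega> k) -` F k \<inter> space (PiM UNIV (\<lambda>k. measure_pmf (P k))) \<in> sets (PiM UNIV (\<lambda>k. measure_pmf (P k)))"
    by (rule measurable_sets[OF measurable_component_singleton]) auto
  then show "{\<omega>\<in>space (PiM UNIV (\<lambda>k. measure_pmf (P k))). \<omega> k \<in> F k} \<in> sets (PiM UNIV (\<lambda>k. measure_pmf (P k)))"
    by (simp add: vimage_def Int_def)
qed

lemma measure_bernoulli:
  assumes "0 \<le> p" "p \<le> 1"
  shows "measure (measure_pmf (bernoulli_pmf p)) {b} = (if b then p else 1 - p)"
  using assms by (simp add: measure_pmf_single)

text \<open>Passes from the infinite product measure to the finite sums for which Russo's formula
  was derived.\<close>

lemma measure_PiM_finite_event: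
  fixes \<pi> :: "'k \<Rightarrow> real"
  assumes K: "finite K" and \<pi>: "\<And>k. 0 \<le> \<pi> k \<and> \<pi> k \<le> 1"
  shows "measure (PiM UNIV (\<lambda>k. measure_pmf (bernoulli_pmf (\<pi> k)))) {\<omega>. P {k\<in>K. \<omega> k}} =
    bern_expect K \<pi> (\<lambda>S. of_bool (P S))"
proof -
  let ?M = "PiM UNIV (\<lambda>k. measure_pmf (bernoulli_pmf (\<pi> k)))"
  interpret product_prob_space "\<lambda>k. measure_pmf (bernoulli_pmf (\<pi> k))" UNIV
    by unfold_locales
  define A where "A S = {\<omega> \<in> space ?M. \<forall>k\<in>K. \<omega> k \<in> {k \<in> S}}" for S :: "'k set"
  have A_sets: "A S \<in> sets ?M" for S unfolding A_def by (rule cylinder_sets[OF K])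
  have A_meas: "measure ?M (A S) = bern_weight K \<pi> S" for S
  proof -
    have "emeasure ?M (A S) = (\<Prod>k\<in>K. emeasure (measure_pmf (bernoulli_pmf (\<pi> k))) {k \<in> S})"
      unfolding A_def by (rule emeasure_PiM_Collect) (use K in auto)
    also have "\<dots> = (\<Prod>k\<in>K. ennreal (if k \<in> S then \<pi> k else 1 - \<pi> k))"
      using \<pi> by (intro prod.cong refl) (simp add: measure_pmf.emeasure_eq_measure measure_bernoulli)
    also have "\<dots> = ennreal (bern_weight K \<pi> S)"
      unfolding bern_weight_def using \<pi> by (intro prod_ennreal) auto
    finally show ?thesis using bern_weight_nonneg[of K \<pi> S] \<pi> by (simp add: measure_def)
  qed
  have "{\<omega>. P {k\<in>K. \<omega> k}} = (\<Union>S\<in>{S\<in>Pow K. P S}. A S)"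
  proof (intro set_eqI iffI)
    fix \<omega> assume "\<omega> \<in> {\<omega>. P {k\<in>K. \<omega> k}}"
    then show "\<omega> \<in> (\<Union>S\<in>{S\<in>Pow K. P S}. A S)"
      by (intro UN_I[of "{k\<in>K. \<omega> k}"]) (auto simp: A_def)
  next
    fix \<omega> assume "\<omega> \<in> (\<Union>S\<in>{S\<in>Pow K. P S}. A S)"
    then obtain S where "S \<subseteq> K" "P S" "\<omega> \<in> A S" by auto
    moreover from this have "{k\<in>K. \<omega> k} = S" by (auto simp: A_def)
    ultimately show "\<omega> \<in> {\<omega>. P {k\<in>K. \<omega> k}}" by simp
  qed
  moreover have "measure ?M (\<Union>S\<in>{S\<in>Pow K. P S}. A S) = (\<Sum>S\<in>{S\<in>Pow K. P S}. measure ?M (A S))"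
  proof (rule P.finite_measure_finite_Union)
    show "disjoint_family_on A {S \<in> Pow K. P S}"
      by (auto simp: disjoint_family_on_def A_def)
  qed (use K A_sets in auto)
  ultimately show ?thesis
    unfolding bern_expect_def A_meas using K by (simp add: sum.inter_filter[symmetric] of_bool_def if_distrib cong: if_cong)
qed

definition cfg :: "(site \<Rightarrow> bool) \<Rightarrow> (site set \<Rightarrow> bool) \<Rightarrow> (site + site set) set" where
  "cfg \<sigma> \<eta> = {k. case_sum \<sigma> \<eta> k}"

lemma cfg_simps [simp]: "Inl v \<in> cfg \<sigma> \<eta> \<longleftrightarrow> \<sigma> v" "Inr e \<in> cfg \<sigma> \<eta> \<longleftrightarrow> \<eta> e"
  by (simp_all add: cfg_def)

text \<open>Independent site and bond fields form one product measure over the disjoint sum of the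
  indices, to which \<open>measure_PiM_finite_event\<close> applies; as separate factors they allow
  Fubini.\<close>

lemma distr_case_sum:
  "distr (Bern \<rho> \<Otimes>\<^sub>M Bern q) (PiM UNIV (\<lambda>k. measure_pmf (bernoulli_pmf (case_sum (\<lambda>_. \<rho>) (\<lambda>_. q) k))))
     (\<lambda>(\<sigma>, \<eta>). case_sum \<sigma> \<eta>) =
   PiM (UNIV :: ('a + 'b) set) (\<lambda>k. measure_pmf (bernoulli_pmf (case_sum (\<lambda>_. \<rho>) (\<lambda>_. q) k)))"
  (is "distr ?P ?Q ?h = ?Q")
proof -
  interpret S: prob_space "Bern \<rho> :: ('a \<Rightarrow> bool) measure" by (rule prob_space_Bern)
  interpret E: prob_space "Bern q :: ('b \<Rightarrow> bool) measure" by (rule prob_space_Bern)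
  interpret SP: product_prob_space "\<lambda>_::'a. measure_pmf (bernoulli_pmf \<rho>)" UNIV by unfold_locales
  interpret EP: product_prob_space "\<lambda>_::'b. measure_pmf (bernoulli_pmf q)" UNIV by unfold_locales
  interpret QP: product_prob_space "\<lambda>k::'a+'b. measure_pmf (bernoulli_pmf (case_sum (\<lambda>_. \<rho>) (\<lambda>_. q) k))" UNIV
    by unfold_locales
  have m: "?h \<in> measurable ?P ?Q"
  proof (rule measurable_PiM_single')
    fix k :: "'a + 'b"
    show "(\<lambda>\<omega>. ?h \<omega> k) \<in> measurable ?P (measure_pmf (bernoulli_pmf (case_sum (\<lambda>_. \<rho>) (\<lambda>_. q) k)))"
      by (cases k) (auto simp: case_prod_unfold)
  qed auto
  show ?thesis
  proof (rule QP.PiM_eq)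
    fix J :: "('a + 'b) set" and F
    assume J: "finite J"
    define J1 where "J1 = Inl -` J"
    define J2 where "J2 = Inr -` J"
    have fin: "finite J1" "finite J2" using J by (auto simp: J1_def J2_def intro!: finite_vimageI)
    have JJ: "J = Inl ` J1 \<union> Inr ` J2" unfolding J1_def J2_def
      by (auto simp: image_iff) (metis sumE)
    have emb: "prod_emb UNIV (\<lambda>k. measure_pmf (bernoulli_pmf (case_sum (\<lambda>_. \<rho>) (\<lambda>_. q) k))) J (Pi\<^sub>E J F) =
       {\<omega>. \<forall>k\<in>J. \<omega> k \<in> F k}"
      by (auto simp: prod_emb_def PiE_iff)
    have pre: "?h -` {\<omega>. \<forall>k\<in>J. \<omega> k \<in> F k} \<inter> space ?P =
        {\<sigma>\<in>space (Bern \<rho>). \<forall>k\<in>J1. \<sigma> k \<in> F (Inl k)} \<times> {\<eta>\<in>space (Bern q). \<forall>k\<in>J2. \<eta> k \<in> F (Inr k)}"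
      unfolding JJ by (auto simp: space_pair_measure ball_Un)
    have "emeasure (distr ?P ?Q ?h) {\<omega>. \<forall>k\<in>J. \<omega> k \<in> F k} =
        emeasure ?P (?h -` {\<omega>. \<forall>k\<in>J. \<omega> k \<in> F k} \<inter> space ?P)"
    proof (rule emeasure_distr[OF m])
      have "{\<omega>. \<forall>k\<in>J. \<omega> k \<in> F k} = {\<omega>\<in>space ?Q. \<forall>k\<in>J. \<omega> k \<in> F k}" by simp
      also have "\<dots> \<in> sets ?Q" by (rule cylinder_sets[OF J])
      finally show "{\<omega>. \<forall>k\<in>J. \<omega> k \<in> F k} \<in> sets ?Q" .
    qed
    also have "\<dots> = emeasure (Bern \<rho>) {\<sigma>\<in>space (Bern \<rho>). \<forall>k\<in>J1. \<sigma> k \<in> F (Inl k)} *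
        emeasure (Bern q) {\<eta>\<in>space (Bern q). \<forall>k\<in>J2. \<eta> k \<in> F (Inr k)}"
      unfolding pre by (rule E.emeasure_pair_measure_Times) (rule cylinder_sets, rule fin)+
    also have "\<dots> = (\<Prod>k\<in>J1. emeasure (measure_pmf (bernoulli_pmf \<rho>)) (F (Inl k))) *
       (\<Prod>k\<in>J2. emeasure (measure_pmf (bernoulli_pmf q)) (F (Inr k)))"
      by (intro arg_cong2[where f = times] SP.emeasure_PiM_Collect EP.emeasure_PiM_Collect) (use fin in auto)
    also have "\<dots> = (\<Prod>k\<in>J. emeasure (measure_pmf (bernoulli_pmf (case_sum (\<lambda>_. \<rho>) (\<lambda>_. q) k))) (F k))"
      unfolding JJ using fin by (subst prod.union_disjoint) (auto simp: prod.reindex)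
    finally show "emeasure (distr ?P ?Q ?h)
        (prod_emb UNIV (\<lambda>k. measure_pmf (bernoulli_pmf (case_sum (\<lambda>_. \<rho>) (\<lambda>_. q) k))) J (Pi\<^sub>E J F)) =
       (\<Prod>k\<in>J. emeasure (measure_pmf (bernoulli_pmf (case_sum (\<lambda>_. \<rho>) (\<lambda>_. q) k))) (F k))"
      unfolding emb .
  qed simp
qed

lemma measure_exits:
  assumes kn: "k \<le> n" and \<rho>: "0 \<le> \<rho>" "\<rho> \<le> 1" and q: "0 \<le> q" "q \<le> 1"
  shows "measure (Bern \<rho> \<Otimes>\<^sub>M Bern q) {(\<sigma>, \<eta>). exits N k n (cfg \<sigma> \<eta>)} = LTheta N k n \<rho> q"
proof -
  let ?P = "Bern \<rho> \<Otimes>\<^sub>M Bern q :: ((site \<Rightarrow> bool) \<times> (site set \<Rightarrow> bool)) measure"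
  let ?Q = "PiM UNIV (\<lambda>k. measure_pmf (bernoulli_pmf (case_sum (\<lambda>_::site. \<rho>) (\<lambda>_::site set. q) k)))"
  interpret F: finite_two_terminal "lbox (n + 4 * N)" "ladj N" "lbox k" "lbox (n + 4 * N) - lbox n"
    by (rule fin_lat)
  have K: "finite (Lcoords N n)" unfolding Lcoords_def by (rule F.finite_coords)
  define P where "P S = F.conn S" for S
  have Pc: "{\<omega>. P {k\<in>Lcoords N n. \<omega> k}} \<in> sets ?Q"
  proof -
    have "{\<omega>. P {k\<in>Lcoords N n. \<omega> k}} = (\<Union>S\<in>{S\<in>Pow (Lcoords N n). P S}. {\<omega>\<in>space ?Q. \<forall>k\<in>Lcoords N n. \<omega> k \<in> {k \<in> S}})"
      (is "?L = ?R")
    proof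
      show "?L \<subseteq> ?R"
      proof
        fix \<omega> assume "\<omega> \<in> ?L"
        then show "\<omega> \<in> ?R" by (intro UN_I[of "{k\<in>Lcoords N n. \<omega> k}"]) auto
      qed
      show "?R \<subseteq> ?L"
      proof
        fix \<omega> assume "\<omega> \<in> ?R"
        then obtain S where "S \<subseteq> Lcoords N n" "P S" "\<forall>k\<in>Lcoords N n. \<omega> k = (k \<in> S)" by auto
        moreover from this have "{k\<in>Lcoords N n. \<omega> k} = S" by auto
        ultimately show "\<omega> \<in> ?L" by simp
      qed
    qed
    also have "\<dots> \<in> sets ?Q" by (intro sets.finite_UN cylinder_sets K) (use K in auto)
    finally show ?thesis .
  qed
  have h: "(\<lambda>(\<sigma>, \<eta>). case_sum \<sigma> \<eta>) \<in> measurable ?P ?Q"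
  proof (rule measurable_PiM_single')
    fix k :: "site + site set"
    show "(\<lambda>\<omega>. (\<lambda>(\<sigma>, \<eta>). case_sum \<sigma> \<eta>) \<omega> k) \<in> measurable ?P (measure_pmf (bernoulli_pmf (case_sum (\<lambda>_. \<rho>) (\<lambda>_. q) k)))"
      by (cases k) (auto simp: case_prod_unfold)
  qed auto
  have ev: "{(\<sigma>, \<eta>). exits N k n (cfg \<sigma> \<eta>)} =
      (\<lambda>(\<sigma>, \<eta>). case_sum \<sigma> \<eta>) -` {\<omega>. P {k\<in>Lcoords N n. \<omega> k}} \<inter> space ?P"
  proof -
    have "cfg \<sigma> \<eta> \<inter> Lcoords N n = {k\<in>Lcoords N n. case_sum \<sigma> \<eta> k}" for \<sigma> \<eta>
      by (auto simp: cfg_def)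
    then show ?thesis by (auto simp: exits_iff[OF kn] P_def space_pair_measure)
  qed
  have "measure ?P {(\<sigma>, \<eta>). exits N k n (cfg \<sigma> \<eta>)} =
     measure (distr ?P ?Q (\<lambda>(\<sigma>, \<eta>). case_sum \<sigma> \<eta>)) {\<omega>. P {k\<in>Lcoords N n. \<omega> k}}"
    unfolding ev by (rule measure_distr[OF h Pc, symmetric])
  also have "\<dots> = measure ?Q {\<omega>. P {k\<in>Lcoords N n. \<omega> k}}" by (simp only: distr_case_sum)
  also have "\<dots> = bern_expect (Lcoords N n) (case_sum (\<lambda>_. \<rho>) (\<lambda>_. q)) (\<lambda>S. of_bool (P S))"
    by (rule measure_PiM_finite_event[OF K]) (use \<rho> q in \<open>auto split: sum.split\<close>)
  also have "\<dots> = LTheta N k n \<rho> q"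
    unfolding LTheta_def F.Theta_def F.site_bond_param_def P_def Lcoords_def ..
  finally show ?thesis .
qed

text \<open>Paths of fixed length turn reachability into a countable union, which is what its
  measurability needs; the least length is the graph distance used in \<open>llevel\<close>.\<close>

fun lpath :: "nat \<Rightarrow> site set \<Rightarrow> (site + site set) set \<Rightarrow> nat \<Rightarrow> site \<Rightarrow> bool" where
  "lpath N X S 0 v \<longleftrightarrow> v \<in> X \<and> Inl v \<in> S"
| "lpath N X S (Suc n) v \<longleftrightarrow> (\<exists>u. lpath N X S n u \<and> lat.stp N S u v)"

lemma lreach_iff_lpath: "v \<in> lreach N X S \<longleftrightarrow> (\<exists>n. lpath N X S n v)"
proof
  assume "v \<in> lreach N X S"
  then show "\<exists>n. lpath N X S n v" unfolding lreach_def
  proof (induction rule: lat.reach.induct)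
    case (base u)
    then have "lpath N X S 0 u" by simp
    then show ?case ..
  next
    case (step u v)
    then obtain n where "lpath N X S n u" by auto
    then have "lpath N X S (Suc n) v" using step(2) unfolding lpath.simps by blast
    then show ?case ..
  qed
next
  have "lpath N X S n v \<Longrightarrow> v \<in> lreach N X S" for n v
    unfolding lreach_def
    by (induction n arbitrary: v) (auto intro: lat.reach.base lat.reach.step)
  then show "\<exists>n. lpath N X S n v \<Longrightarrow> v \<in> lreach N X S" by blast
qed

lemma measurable_lreach [measurable (raw)]:
  assumes [measurable]: "\<And>v. Measurable.pred M (\<lambda>w. \<sigma> w v)" "\<And>e. Measurable.pred M (\<lambda>w. \<eta> w e)"
  shows "Measurable.pred M (\<lambda>w. v \<in> lreach N X (cfg (\<sigma> w) (\<eta> w)))"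
proof -
  have "Measurable.pred M (\<lambda>w. lpath N X (cfg (\<sigma> w) (\<eta> w)) n v)" for n v
  proof (induction n arbitrary: v)
    case (Suc n)
    note [measurable] = Suc.IH
    show ?case by (simp add: lat.stp_def)
  qed simp
  then show ?thesis unfolding lreach_iff_lpath by measurable
qed

definition infc :: "nat \<Rightarrow> (site \<Rightarrow> bool) \<Rightarrow> (site set \<Rightarrow> bool) \<Rightarrow> site \<Rightarrow> bool" where
  "infc N \<sigma> \<eta> z \<longleftrightarrow> infinite (lreach N {z} (cfg \<sigma> \<eta>))"

lemma measurable_infc [measurable (raw)]:
  assumes [measurable]: "\<And>v. Measurable.pred M (\<lambda>w. \<sigma> w v)" "\<And>e. Measurable.pred M (\<lambda>w. \<eta> w e)"
  shows "Measurable.pred M (\<lambda>w. infc N (\<sigma> w) (\<eta> w) z)"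
  unfolding infc_def infinite_iff_box Bex_def by measurable

lemma exits_mono: "n \<le> n' \<Longrightarrow> exits N k n' S \<Longrightarrow> exits N k n S"
  unfolding exits_def using lbox_mono by blast

lemma lreach_mono: "X \<subseteq> X' \<Longrightarrow> S \<subseteq> S' \<Longrightarrow> lreach N X S \<subseteq> lreach N X' S'"
  unfolding lreach_def
  by (rule lat.reach_least) (auto intro: lat.reach.base lat.reach.step simp: lat.stp_def subset_iff)

lemma lreach_UN: "lreach N X S = (\<Union>z\<in>X. lreach N {z} S)"
proof
  show "lreach N X S \<subseteq> (\<Union>z\<in>X. lreach N {z} S)" unfolding lreach_def
  proof (rule lat.reach_least)
    fix u v assume "u \<in> (\<Union>z\<in>X. lat.reach N {z} S)" "lat.stp N S u v"
    then show "v \<in> (\<Union>z\<in>X. lat.reach N {z} S)" using lat.reach.step by blast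
  qed (auto intro: lat.reach.base)
qed (use lreach_mono in blast)

lemma exits_infc: "(\<forall>n. exits N k n (cfg \<sigma> \<eta>)) \<longleftrightarrow> (\<exists>z\<in>lbox k. infc N \<sigma> \<eta> z)"
  unfolding exits_def infc_def infinite_iff_box[symmetric] lreach_UN[of N "lbox k"]
  by (simp add: infinite_iff_box[symmetric])

text \<open>Every site has finitely many neighbours, so deleting \<open>v\<close> leaves an infinite
  cluster in finitely many pieces, one of them infinite. Changing a single site thus cannot create
  or destroy percolation, as the zero-one law requires.\<close>

lemma infc_remove:
  "(\<exists>z. infc N \<sigma> \<eta> z) \<longleftrightarrow> (\<exists>z. infc N (\<sigma>(v := False)) \<eta> z)"
proof
  assume "\<exists>z. infc N (\<sigma>(v := False)) \<eta> z"
  then obtain z where z: "infinite (lreach N {z} (cfg (\<sigma>(v := False)) \<eta>))" by (auto simp: infc_def)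
  have "cfg (\<sigma>(v := False)) \<eta> \<subseteq> cfg \<sigma> \<eta>"
    by (auto simp: cfg_def split: sum.splits if_splits)
  from infinite_super[OF lreach_mono[OF subset_refl this] z]
  show "\<exists>z. infc N \<sigma> \<eta> z" unfolding infc_def by blast
next
  assume "\<exists>z. infc N \<sigma> \<eta> z"
  then obtain z where z: "infinite (lreach N {z} (cfg \<sigma> \<eta>))" by (auto simp: infc_def)
  let ?S = "cfg \<sigma> \<eta>" and ?S' = "cfg (\<sigma>(v := False)) \<eta>"
  let ?X = "insert z {y. ladj N v y}"
  have "lreach N {z} ?S \<subseteq> insert v (lreach N ?X ?S')"
    unfolding lreach_def
  proof (rule lat.reach_least)
    fix u assume "u \<in> {z}" "Inl u \<in> ?S"
    then show "u \<in> insert v (lat.reach N ?X ?S')" by (auto intro!: lat.reach.base)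
  next
    fix u w assume u: "u \<in> insert v (lat.reach N ?X ?S')" and st: "lat.stp N ?S u w"
    show "w \<in> insert v (lat.reach N ?X ?S')"
    proof (cases "w = v")
      case False
      show ?thesis
      proof (cases "u = v")
        case True
        then show ?thesis using st False by (auto intro!: lat.reach.base simp: lat.stp_def)
      next
        case u': False
        then have "u \<in> lat.reach N ?X ?S'" using u by simp
        moreover have "lat.stp N ?S' u w" using st False u' by (simp add: lat.stp_def)
        ultimately show ?thesis by (auto intro: lat.reach.step)
      qed
    qed simp
  qed
  from infinite_super[OF this z] have "infinite (lreach N ?X ?S')" by simp
  moreover have "finite ?X" using ladj_degree(2) by simp
  ultimately show "\<exists>z. infc N (\<sigma>(v := False)) \<eta> z"
    unfolding lreach_UN[of N ?X] infc_def using finite_UN_I[of ?X] by blast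
qed

text \<open>Quenched in the sites: the critical probabilities of a component refer to a fixed point
  set, with only the bonds random.\<close>

definition ltheta :: "nat \<Rightarrow> real \<Rightarrow> (site \<Rightarrow> bool) \<Rightarrow> site \<Rightarrow> ennreal" where
  "ltheta N q \<sigma> z = emeasure (Bern q) {\<eta>. infc N \<sigma> \<eta> z}"

definition lperc :: "nat \<Rightarrow> real \<Rightarrow> (site \<Rightarrow> bool) \<Rightarrow> bool" where
  "lperc N q \<sigma> \<longleftrightarrow> (\<exists>z. 0 < ltheta N q \<sigma> z)"

lemma infc_sets: "{\<eta>. infc N \<sigma> \<eta> z} \<in> sets (Bern q)"
proof -
  have "Measurable.pred (Bern q) (\<lambda>\<eta>. infc N \<sigma> \<eta> z)" by measurable
  then show ?thesis by (simp add: pred_def)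
qed

lemma measurable_ltheta [measurable (raw)]:
  assumes \<sigma>: "\<And>v. Measurable.pred M (\<lambda>w. \<sigma> w v)"
  shows "(\<lambda>w. ltheta N q (\<sigma> w) z) \<in> borel_measurable M"
proof -
  interpret E: prob_space "Bern q :: (site set \<Rightarrow> bool) measure" by (rule prob_space_Bern)
  have "Measurable.pred (M \<Otimes>\<^sub>M Bern q) (\<lambda>x. infc N (\<sigma> (fst x)) (snd x) z)"
  proof (rule measurable_infc)
    fix v note [measurable] = \<sigma>[of v]
    show "Measurable.pred (M \<Otimes>\<^sub>M Bern q) (\<lambda>x. \<sigma> (fst x) v)" by measurable
  qed measurable
  then have "{x\<in>space (M \<Otimes>\<^sub>M Bern q). infc N (\<sigma> (fst x)) (snd x) z} \<in> sets (M \<Otimes>\<^sub>M Bern q)"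
    by (simp add: pred_def)
  from E.measurable_emeasure_Pair[OF this]
  show ?thesis
    by (rule measurable_cong[THEN iffD1, rotated])
      (auto simp: ltheta_def space_pair_measure intro!: arg_cong[where f = "emeasure _"])
qed

lemma measurable_lperc [measurable (raw)]:
  assumes [measurable]: "\<And>v. Measurable.pred M (\<lambda>w. \<sigma> w v)"
  shows "Measurable.pred M (\<lambda>w. lperc N q (\<sigma> w))"
  unfolding lperc_def by measurable

lemma lperc_iff: "lperc N q \<sigma> \<longleftrightarrow> \<not> (AE \<eta> in Bern q. \<not> (\<exists>z. infc N \<sigma> \<eta> z))"
proof -
  have "(AE \<eta> in Bern q. \<not> (\<exists>z. infc N \<sigma> \<eta> z)) \<longleftrightarrow> (\<forall>z. AE \<eta> in Bern q. \<not> infc N \<sigma> \<eta> z)"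
    by (simp add: AE_all_countable)
  also have "\<dots> \<longleftrightarrow> (\<forall>z. ltheta N q \<sigma> z = 0)"
  proof (intro all_cong1)
    fix z
    have "(AE \<eta> in Bern q. \<not> infc N \<sigma> \<eta> z) \<longleftrightarrow> emeasure (Bern q) {\<eta>\<in>space (Bern q). \<not> \<not> infc N \<sigma> \<eta> z} = 0"
      by (rule AE_iff_measurable) (use infc_sets in auto)
    then show "(AE \<eta> in Bern q. \<not> infc N \<sigma> \<eta> z) \<longleftrightarrow> ltheta N q \<sigma> z = 0" by (simp add: ltheta_def)
  qed
  finally show ?thesis by (auto simp: lperc_def zero_less_iff_neq_zero)
qed

lemma lperc_upd: "lperc N q (\<sigma>(v := b)) \<longleftrightarrow> lperc N q \<sigma>"
  unfolding lperc_iff using infc_remove[of N \<sigma> _ v] infc_remove[of N "\<sigma>(v := b)" _ v] by simp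

text \<open>Kolmogorov's law. Resetting the first \<open>n\<close> coordinates to \<open>d\<close>
  does not affect membership in \<open>A\<close>, so \<open>A\<close> is its own preimage under a
  map that sees only the later coordinates, hence a tail event.\<close>

lemma zero_one_law_PiM:
  fixes B :: "'b measure"
  assumes inf: "countable (UNIV :: 'i set)" "infinite (UNIV :: 'i set)"
    and B: "prob_space B" and d: "d \<in> space B"
    and A: "A \<in> sets (PiM (UNIV :: 'i set) (\<lambda>_. B))"
    and upd: "\<And>\<omega> i. \<omega> \<in> space (PiM (UNIV :: 'i set) (\<lambda>_. B)) \<Longrightarrow> \<omega> \<in> A \<longleftrightarrow> fun_upd \<omega> i d \<in> A"
  shows "measure (PiM UNIV (\<lambda>_. B)) A = 0 \<or> measure (PiM UNIV (\<lambda>_. B)) A = 1"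
proof -
  let ?P = "PiM (UNIV :: 'i set) (\<lambda>_. B)"
  interpret B: prob_space B by fact
  interpret P: prob_space ?P by (intro prob_space_PiM B)
  define e where "e = (from_nat_into UNIV :: nat \<Rightarrow> 'i)"
  have bij: "bij e" unfolding e_def using bij_betw_from_nat_into[OF inf] .
  define F where "F n = {(\<lambda>\<omega>. \<omega> (e n)) -` X \<inter> space ?P |X. X \<in> sets B}" for n
  have comp: "(\<lambda>\<omega>. \<omega> i) \<in> measurable ?P B" for i by measurable
  show ?thesis
  proof (rule P.kolmogorov_0_1_law[of F])
    show "sigma_algebra (space ?P) (F i)" for i
    proof -
      have "F i = sets (vimage_algebra (space ?P) (\<lambda>\<omega>. \<omega> (e i)) B)"
        unfolding F_def by (rule sets_vimage_algebra2[symmetric]) (use measurable_space[OF comp] in auto)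
      then show ?thesis
        using sets.sigma_algebra_axioms[of "vimage_algebra (space ?P) (\<lambda>\<omega>. \<omega> (e i)) B"] by simp
    qed
    have "P.indep_vars (\<lambda>_. B) (\<lambda>i \<omega>. \<omega> i) UNIV"
    proof (subst P.indep_vars_iff_distr_eq_PiM)
      have "distr ?P (PiM UNIV (\<lambda>_. B)) (\<lambda>x. \<lambda>i\<in>UNIV. x i) = distr ?P ?P (\<lambda>x. x)"
        by (simp only: restrict_UNIV)
      also have "\<dots> = ?P" by simp
      finally show "distr ?P (PiM UNIV (\<lambda>_. B)) (\<lambda>x. \<lambda>i\<in>UNIV. x i) = (\<Pi>\<^sub>M i\<in>UNIV. distr ?P B (\<lambda>\<omega>. \<omega> i))"
        by (simp only: distr_PiM_component[OF B UNIV_I])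
    qed (use comp in auto)
    then have ind: "P.indep_sets (\<lambda>i. {(\<lambda>\<omega>. \<omega> i) -` X \<inter> space ?P |X. X \<in> sets B}) UNIV"
      unfolding P.indep_vars_def2 by simp
    show "P.indep_sets F UNIV"
    proof (rule P.indep_setsI)
      show "F i \<subseteq> P.events" for i unfolding F_def using measurable_sets[OF comp] by auto
      fix X J assume J: "J \<noteq> {}" "J \<subseteq> UNIV" "finite J" and X: "\<forall>j\<in>J. X j \<in> F j"
      have inj: "inj_on e J" using bij by (meson bij_is_inj inj_on_subset subset_UNIV)
      define Y where "Y i = X (the_inv_into UNIV e i)" for i
      have Y: "Y (e j) = X j" for j using bij by (simp add: Y_def the_inv_into_f_f bij_is_inj)
      have "P.prob (\<Inter>i\<in>e ` J. Y i) = (\<Prod>i\<in>e ` J. P.prob (Y i))"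
        by (rule P.indep_setsD[OF ind]) (use J X Y in \<open>auto simp: F_def\<close>)
      then show "P.prob (\<Inter>j\<in>J. X j) = (\<Prod>j\<in>J. P.prob (X j))"
        by (simp add: prod.reindex[OF inj] Y)
    qed
    have "A \<in> sigma_sets (space ?P) (\<Union> (F ` {n..}))" for n
    proof -
      let ?T = "sigma (space ?P) (\<Union> (F ` {n..}))"
      have sub: "\<Union> (F ` {n..}) \<subseteq> Pow (space ?P)" by (auto simp: F_def)
      define g where "g \<omega> = (\<lambda>i. if i \<in> e ` {..<n} then d else \<omega> i)" for \<omega> :: "'i \<Rightarrow> 'b"
      have g_A: "g \<omega> \<in> A \<longleftrightarrow> \<omega> \<in> A" if "\<omega> \<in> space ?P" for \<omega>
      proof -
        have "(\<lambda>i. if i \<in> e ` {..<m} then d else \<omega> i) \<in> space ?P \<and>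
            ((\<lambda>i. if i \<in> e ` {..<m} then d else \<omega> i) \<in> A \<longleftrightarrow> \<omega> \<in> A)" for m
        proof (induction m)
          case 0
          then show ?case using that by simp
        next
          case (Suc m)
          let ?f = "\<lambda>m i. if i \<in> e ` {..<m} then d else \<omega> i"
          have eq: "?f (Suc m) = fun_upd (?f m) (e m) d" by (auto simp: lessThan_Suc fun_eq_iff)
          have "fun_upd (?f m) (e m) d \<in> space ?P" using Suc d by (auto simp: space_PiM PiE_iff)
          then show ?case using upd[of "?f m" "e m"] Suc unfolding eq by simp
        qed
        then show ?thesis unfolding g_def by blast
      qed
      have "g \<in> measurable ?T ?P"
      proof (rule measurable_PiM_single')
        show "g \<in> space ?T \<rightarrow> (\<Pi>\<^sub>E i\<in>UNIV. space B)"
          using d by (auto simp: g_def space_measure_of_conv space_PiM PiE_iff)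
        fix i
        show "(\<lambda>\<omega>. g \<omega> i) \<in> measurable ?T B"
        proof (cases "i \<in> e ` {..<n}")
          case True
          then show ?thesis using d by (simp add: g_def)
        next
          case False
          obtain m where m: "i = e m" using bij by (metis bij_pointE)
          then have "n \<le> m" using False by (auto simp: not_less[symmetric])
          have "(\<lambda>\<omega>. \<omega> i) \<in> measurable ?T B"
          proof (rule measurableI)
            fix \<omega> assume "\<omega> \<in> space ?T"
            then show "\<omega> i \<in> space B" by (auto simp: space_measure_of_conv space_PiM PiE_iff)
          next
            fix X assume "X \<in> sets B"
            then have "(\<lambda>\<omega>. \<omega> i) -` X \<inter> space ?P \<in> F m" by (auto simp: F_def m)
            then show "(\<lambda>\<omega>. \<omega> i) -` X \<inter> space ?T \<in> sets ?T"
              using \<open>n \<le> m\<close> by (auto simp: sets_measure_of[OF sub] space_measure_of_conv intro!: sigma_sets.Basic)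
          qed
          then show ?thesis using False by (simp add: g_def)
        qed
      qed
      from measurable_sets[OF this A] have "g -` A \<inter> space ?P \<in> sigma_sets (space ?P) (\<Union> (F ` {n..}))"
        by (simp add: sets_measure_of[OF sub] space_measure_of_conv)
      moreover have "g -` A \<inter> space ?P = A" using g_A sets.sets_into_space[OF A] by auto
      ultimately show ?thesis by simp
    qed
    then show "A \<in> P.tail_events F" by (auto simp: P.tail_events_def)
  qed
qed

lemma infinite_sites: "infinite (UNIV :: site set)"
  by (simp add: finite_prod)

lemma lperc_zero_one:
  assumes "\<not> (AE \<sigma> in Bern \<rho>. \<not> lperc N q \<sigma>)"
  shows "AE \<sigma> in Bern \<rho>. lperc N q \<sigma>"
proof -
  interpret P: prob_space "Bern \<rho> :: (site \<Rightarrow> bool) measure" by (rule prob_space_Bern)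
  let ?A = "{\<sigma>. lperc N q \<sigma>}"
  have "Measurable.pred (Bern \<rho>) (lperc N q)" by measurable
  then have A: "?A \<in> sets (Bern \<rho>)" by (simp add: pred_def)
  have "P.prob ?A = 0 \<or> P.prob ?A = 1"
    by (rule zero_one_law_PiM[where d = False])
      (use infinite_sites A in \<open>auto simp: lperc_upd prob_space_measure_pmf\<close>)
  then show ?thesis
  proof
    assume "P.prob ?A = 0"
    then have "AE \<sigma> in Bern \<rho>. \<not> lperc N q \<sigma>"
      using A by (intro AE_I[of _ _ ?A]) (auto simp: P.emeasure_eq_measure)
    then show ?thesis using assms by simp
  next
    assume "P.prob ?A = 1"
    then show ?thesis using P.AE_prob_1[of ?A] A by simp
  qed
qed

text \<open>A bound uniform in \<open>n\<close> survives the decreasing intersection, so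
  \<open>lbox k\<close> meets an infinite cluster with probability at least \<open>c\<close>. Fubini
  turns this into \<open>lperc\<close> on a set of site configurations that is not null, and the
  zero-one law makes it almost sure.\<close>

lemma lperc_of_LTheta:
  assumes c: "0 < c" "\<And>n. k \<le> n \<Longrightarrow> c \<le> LTheta N k n \<rho> q"
    and \<rho>: "0 \<le> \<rho>" "\<rho> \<le> 1" and q: "0 \<le> q" "q \<le> 1"
  shows "AE \<sigma> in Bern \<rho>. lperc N q \<sigma>"
proof (rule lperc_zero_one)
  let ?S = "Bern \<rho> :: (site \<Rightarrow> bool) measure" and ?E = "Bern q :: (site set \<Rightarrow> bool) measure"
  let ?P = "?S \<Otimes>\<^sub>M ?E"
  interpret S: prob_space ?S by (rule prob_space_Bern)
  interpret E: prob_space ?E by (rule prob_space_Bern)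
  interpret P: pair_prob_space ?S ?E ..
  define A where "A n = {x\<in>space ?P. exits N k (k + n) (cfg (fst x) (snd x))}" for n
  have A_sets: "A n \<in> sets ?P" for n
    unfolding A_def exits_def Bex_def by measurable
  have A_eq: "A n = {(\<sigma>, \<eta>). exits N k (k + n) (cfg \<sigma> \<eta>)}" for n
    by (auto simp: A_def space_pair_measure)
  have dec: "decseq A"
  proof (rule decseq_SucI)
    show "A (Suc n) \<subseteq> A n" for n using exits_mono[of "k + n" "k + Suc n"] by (auto simp: A_def)
  qed
  have "(\<lambda>n. measure ?P (A n)) \<longlonglongrightarrow> measure ?P (\<Inter>n. A n)"
    by (rule P.finite_Lim_measure_decseq[OF _ dec]) (use A_sets in auto)
  moreover have "c \<le> measure ?P (A n)" for n
    unfolding A_eq using measure_exits[of k "k + n" \<rho> q N] \<rho> q c by simp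
  ultimately have lim: "c \<le> measure ?P (\<Inter>n. A n)" by (intro LIMSEQ_le_const) auto
  show "\<not> (AE \<sigma> in ?S. \<not> lperc N q \<sigma>)"
  proof
    assume "AE \<sigma> in ?S. \<not> lperc N q \<sigma>"
    then have "AE \<sigma> in ?S. AE \<eta> in ?E. \<not> (\<exists>z. infc N \<sigma> \<eta> z)" by (simp add: lperc_iff)
    then have "AE x in ?P. \<not> (\<exists>z. infc N (fst x) (snd x) z)"
      by (intro P.AE_pair_measure) (auto intro!: measurable_infc measurable_compose[OF measurable_fst] measurable_compose[OF measurable_snd])
    then have "AE x in ?P. x \<notin> (\<Inter>n. A n)"
    proof eventually_elim
      case (elim x)
      show ?case
      proof
        assume x: "x \<in> (\<Inter>n. A n)"
        have "exits N k n (cfg (fst x) (snd x))" for n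
          using x exits_mono[of n "k + n"] by (auto simp: A_def)
        then show False using elim exits_infc by blast
      qed
    qed
    then have "measure ?P (\<Inter>n. A n) = 0"
      using A_sets by (subst P.prob_eq_0) auto
    then show False using lim c by simp
  qed
qed

lemma LTheta_of_site_percolation:
  assumes perc: "\<not> (AE \<sigma> in Bern \<rho>. \<not> (\<exists>z. infc N \<sigma> (\<lambda>_. True) z))"
    and \<rho>: "0 \<le> \<rho>" "\<rho> \<le> 1"
  shows "\<exists>k c. 0 < c \<and> (\<forall>n\<ge>k. c \<le> LTheta N k n \<rho> 1)"
proof -
  let ?S = "Bern \<rho> :: (site \<Rightarrow> bool) measure" and ?E = "Bern 1 :: (site set \<Rightarrow> bool) measure"
  let ?P = "?S \<Otimes>\<^sub>M ?E"
  interpret S: prob_space ?S by (rule prob_space_Bern)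
  interpret E: prob_space ?E by (rule prob_space_Bern)
  interpret P: pair_prob_space ?S ?E ..
  define A where "A k = {\<sigma>. \<forall>n. exits N k n (cfg \<sigma> (\<lambda>_. True))}" for k
  have A_sets: "A k \<in> sets ?S" for k
  proof -
    have "Measurable.pred ?S (\<lambda>\<sigma>. \<forall>n. exits N k n (cfg \<sigma> (\<lambda>_. True)))"
      unfolding exits_def Bex_def by measurable
    then show ?thesis by (simp add: A_def pred_def)
  qed
  have "\<exists>k. S.prob (A k) \<noteq> 0"
  proof (rule ccontr)
    assume "\<not> ?thesis"
    then have "AE \<sigma> in ?S. \<sigma> \<notin> A k" for k using A_sets[of k] by (subst S.prob_eq_0[symmetric]) auto
    then have "AE \<sigma> in ?S. \<forall>k. \<sigma> \<notin> A k" by (simp add: AE_all_countable)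
    then have "AE \<sigma> in ?S. \<not> (\<exists>z. infc N \<sigma> (\<lambda>_. True) z)"
    proof eventually_elim
      case (elim \<sigma>)
      then show ?case unfolding A_def exits_infc using ex_box by blast
    qed
    then show False using perc by simp
  qed
  then obtain k where k: "0 < S.prob (A k)" using measure_nonneg by (metis less_eq_real_def)
  have "S.prob (A k) \<le> LTheta N k n \<rho> 1" if n: "k \<le> n" for n
  proof -
    interpret F: finite_two_terminal "lbox (n + 4 * N)" "ladj N" "lbox k" "lbox (n + 4 * N) - lbox n"
      by (rule fin_lat)
    \<comment> \<open>At bond parameter 1 the finitely many bonds of the window are almost surely
      open, so site percolation may be read as site-bond percolation.\<close>
    let ?B = "{\<eta>\<in>space ?E. \<forall>e\<in>F.edges. \<eta> e \<in> {True}}"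
    have B: "?B \<in> sets ?E" by (rule cylinder_sets[OF F.finite_edges])
    interpret EP: product_prob_space "\<lambda>_::site set. measure_pmf (bernoulli_pmf 1)" UNIV by unfold_locales
    have "emeasure ?E ?B = (\<Prod>e\<in>F.edges. emeasure (measure_pmf (bernoulli_pmf 1)) {True})"
      by (rule EP.emeasure_PiM_Collect) (use F.finite_edges in auto)
    also have "\<dots> = 1" by (simp add: measure_pmf.emeasure_eq_measure measure_bernoulli)
    finally have B1: "emeasure ?E ?B = 1" .
    have sub: "A k \<times> ?B \<subseteq> {(\<sigma>, \<eta>). exits N k n (cfg \<sigma> \<eta>)}"
    proof (clarsimp simp: A_def)
      fix \<sigma> :: "site \<Rightarrow> bool" and \<eta> :: "site set \<Rightarrow> bool"
      assume a: "\<forall>n. exits N k n (cfg \<sigma> (\<lambda>_. True))" and b: "\<forall>e\<in>F.edges. \<eta> e"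
      have "cfg \<sigma> (\<lambda>_. True) \<inter> Lcoords N n = cfg \<sigma> \<eta> \<inter> Lcoords N n"
        using b by (auto simp: Lcoords_def F.coords_def)
      then show "exits N k n (cfg \<sigma> \<eta>)" using a exits_iff[OF n] by metis
    qed
    have ms: "{(\<sigma>, \<eta>). exits N k n (cfg \<sigma> \<eta>)} \<in> sets ?P"
    proof -
      have "{x\<in>space ?P. exits N k n (cfg (fst x) (snd x))} \<in> sets ?P"
        unfolding exits_def Bex_def by measurable
      moreover have "{x\<in>space ?P. exits N k n (cfg (fst x) (snd x))} = {(\<sigma>, \<eta>). exits N k n (cfg \<sigma> \<eta>)}"
        by (auto simp: space_pair_measure)
      ultimately show ?thesis by simp
    qed
    have "emeasure ?S (A k) = emeasure ?P (A k \<times> ?B)"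
      using E.emeasure_pair_measure_Times[OF A_sets B] B1 by simp
    also have "\<dots> \<le> emeasure ?P {(\<sigma>, \<eta>). exits N k n (cfg \<sigma> \<eta>)}"
      by (rule emeasure_mono[OF sub ms])
    finally have "S.prob (A k) \<le> measure ?P {(\<sigma>, \<eta>). exits N k n (cfg \<sigma> \<eta>)}"
      by (simp add: S.emeasure_eq_measure P.emeasure_eq_measure)
    then show ?thesis using measure_exits[OF n \<rho>, of 1 N] by simp
  qed
  then show ?thesis using k by blast
qed

section \<open>Path counting at small site density\<close>

fun walks :: "nat \<Rightarrow> site \<Rightarrow> nat \<Rightarrow> site list set" where
  "walks N z 0 = {[z]}"
| "walks N z (Suc n) = (\<Union>xs\<in>walks N z n. (\<lambda>v. v # xs) ` {v. ladj N (hd xs) v \<and> v \<notin> set xs})"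

lemma walks_distinct: "xs \<in> walks N z n \<Longrightarrow> distinct xs \<and> length xs = Suc n"
  by (induction n arbitrary: xs) auto

lemma finite_walks: "finite (walks N z n) \<and> card (walks N z n) \<le> ((8 * N + 1)\<^sup>2) ^ n"
proof (induction n)
  case (Suc n)
  let ?D = "(8 * N + 1)\<^sup>2"
  let ?f = "\<lambda>xs. (\<lambda>v. v # xs) ` {v. ladj N (hd xs) v \<and> v \<notin> set xs}"
  have fin: "finite {v. ladj N (hd xs) v \<and> v \<notin> set xs}" for xs
    by (rule finite_subset[OF _ ladj_degree(2)[of N "hd xs"]]) auto
  have c: "card (?f xs) \<le> ?D" for xs
  proof -
    have "card (?f xs) \<le> card {v. ladj N (hd xs) v \<and> v \<notin> set xs}" by (rule card_image_le[OF fin])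
    also have "\<dots> \<le> card {v\<in>UNIV. ladj N (hd xs) v}"
      by (rule card_mono) (use ladj_degree(2)[of N "hd xs"] in auto)
    also have "\<dots> \<le> ?D" by (rule ladj_degree(1))
    finally show ?thesis .
  qed
  have "card (walks N z (Suc n)) \<le> (\<Sum>xs\<in>walks N z n. card (?f xs))"
    unfolding walks.simps by (rule card_UN_le) (use Suc in auto)
  also have "\<dots> \<le> (\<Sum>xs\<in>walks N z n. ?D)" by (rule sum_mono) (rule c)
  also have "\<dots> \<le> ?D ^ n * ?D" using Suc by simp
  finally show ?case using Suc fin by (auto simp: mult.commute)
qed simp

definition llevel :: "nat \<Rightarrow> site \<Rightarrow> (site + site set) set \<Rightarrow> site \<Rightarrow> nat" where
  "llevel N z S v = (LEAST n. lpath N {z} S n v)"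

text \<open>Along a shortest path from \<open>z\<close> the level rises strictly, so the path avoids
  itself.\<close>

lemma walk_of_level:
  assumes "v \<in> lreach N {z} S" "llevel N z S v = n"
  shows "\<exists>xs\<in>walks N z n. hd xs = v \<and> (\<forall>u\<in>set xs. Inl u \<in> S \<and> llevel N z S u \<le> n)"
  using assms
proof (induction n arbitrary: v)
  case 0
  have "lpath N {z} S (llevel N z S v) v"
    unfolding llevel_def by (rule LeastI_ex) (use 0 lreach_iff_lpath in blast)
  then have "lpath N {z} S 0 v" unfolding 0(2) .
  then have "v = z" "Inl z \<in> S" by auto
  then show ?case using 0(2) by (intro bexI[of _ "[z]"]) auto
next
  case (Suc n)
  have "lpath N {z} S (llevel N z S v) v"
    unfolding llevel_def by (rule LeastI_ex) (use Suc.prems lreach_iff_lpath in blast)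
  then have "lpath N {z} S (Suc n) v" using Suc.prems(2) by simp
  then obtain u where u: "lpath N {z} S n u" "lat.stp N S u v" by (auto simp del: split_paired_Ex)
  have le: "llevel N z S u \<le> n" unfolding llevel_def by (rule Least_le) (rule u)
  have ur: "u \<in> lreach N {z} S" using u lreach_iff_lpath by blast
  have "lpath N {z} S (llevel N z S u) u" unfolding llevel_def by (rule LeastI) (rule u)
  then have "lpath N {z} S (Suc (llevel N z S u)) v" using u(2) by (auto simp del: split_paired_Ex)
  then have "llevel N z S v \<le> Suc (llevel N z S u)" unfolding llevel_def by (rule Least_le)
  then have "llevel N z S u = n" using le Suc.prems by simp
  from Suc.IH[OF ur this] obtain xs where xs: "xs \<in> walks N z n" "hd xs = u"
    "\<forall>u\<in>set xs. Inl u \<in> S \<and> llevel N z S u \<le> n" by blast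
  have "v \<notin> set xs" using xs(3) Suc.prems(2) by force
  then have "v # xs \<in> walks N z (Suc n)" using xs u(2) by (auto simp: lat.stp_def)
  moreover have "\<forall>w\<in>set (v # xs). Inl w \<in> S \<and> llevel N z S w \<le> Suc n"
    using xs(3) u(2) Suc.prems(2) by (auto simp: lat.stp_def le_SucI)
  ultimately show ?case by (metis list.sel(1))
qed

lemma walk_of_infc:
  assumes "infc N \<sigma> \<eta> z"
  shows "\<exists>xs\<in>walks N z n. \<forall>u\<in>set xs. \<sigma> u"
proof -
  let ?S = "cfg \<sigma> \<eta>"
  have fin: "finite {v. lpath N {z} ?S m v}" for m
  proof (induction m)
    case 0
    show ?case by (rule finite_subset[of _ "{z}"]) auto
  next
    case (Suc m)
    have "{v. lpath N {z} ?S (Suc m) v} \<subseteq> (\<Union>u\<in>{v. lpath N {z} ?S m v}. {v. ladj N u v})"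
      by (auto simp: lat.stp_def)
    moreover have "finite (\<Union>u\<in>{v. lpath N {z} ?S m v}. {v. ladj N u v})"
      using Suc ladj_degree(2) by (rule finite_UN_I)
    ultimately show ?case by (rule finite_subset)
  qed
  have "\<exists>v\<in>lreach N {z} ?S. n \<le> llevel N z ?S v"
  proof (rule ccontr)
    assume n: "\<not> ?thesis"
    have "lreach N {z} ?S \<subseteq> (\<Union>m\<in>{..<n}. {v. lpath N {z} ?S m v})"
    proof
      fix v assume v: "v \<in> lreach N {z} ?S"
      then have "lpath N {z} ?S (llevel N z ?S v) v"
        unfolding llevel_def lreach_iff_lpath by (rule LeastI_ex)
      then show "v \<in> (\<Union>m\<in>{..<n}. {v. lpath N {z} ?S m v})" using n v by (auto simp: not_le)
    qed
    moreover have "finite (\<Union>m\<in>{..<n}. {v. lpath N {z} ?S m v})" using fin by auto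
    ultimately show False using assms finite_subset unfolding infc_def by blast
  qed
  then obtain v where v: "v \<in> lreach N {z} ?S" "n \<le> llevel N z ?S v" by auto
  from walk_of_level[OF v(1) refl] obtain xs where
    xs: "xs \<in> walks N z (llevel N z ?S v)" "\<forall>u\<in>set xs. \<sigma> u" by auto
  have "\<exists>ys\<in>walks N z n. set ys \<subseteq> set xs" if "xs \<in> walks N z m" "n \<le> m" for m xs
    using that
  proof (induction m arbitrary: xs)
    case (Suc m)
    show ?case
    proof (cases "n = Suc m")
      case True
      then show ?thesis using Suc.prems by blast
    next
      case False
      obtain v ys where "xs = v # ys" "ys \<in> walks N z m" using Suc.prems by auto
      then show ?thesis using Suc.IH[of ys] False Suc.prems by auto
    qed
  qed auto
  from this[OF xs(1) v(2)] show ?thesis using xs(2) by blast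
qed

text \<open>An infinite cluster contains open self-avoiding walks of every length \<open>n\<close>.
  With \<open>D = (8 * N + 1) ^ 2\<close> there are at most \<open>D ^ n\<close> of them, and each
  is open with probability at most \<open>\<rho> ^ n\<close> since its sites are distinct. This
  yields the positivity of \<open>gilbert_lambda_c\<close>.\<close>

lemma subcritical_site:
  assumes \<rho>: "0 \<le> \<rho>" "\<rho> \<le> 1" and small: "\<rho> * real ((8 * N + 1)\<^sup>2) < 1"
  shows "AE \<sigma> in Bern \<rho>. \<not> (\<exists>z. infc N \<sigma> \<eta> z)"
proof -
  let ?S = "Bern \<rho> :: (site \<Rightarrow> bool) measure" and ?D = "real ((8 * N + 1)\<^sup>2)"
  interpret S: prob_space ?S by (rule prob_space_Bern)
  interpret SP: product_prob_space "\<lambda>_::site. measure_pmf (bernoulli_pmf \<rho>)" UNIV by unfold_locales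
  have "AE \<sigma> in ?S. \<not> infc N \<sigma> \<eta> z" for z
  proof -
    have "Measurable.pred ?S (\<lambda>\<sigma>. infc N \<sigma> \<eta> z)" by measurable
    then have ms: "{\<sigma>. infc N \<sigma> \<eta> z} \<in> sets ?S" by (simp add: pred_def)
    have "S.prob {\<sigma>. infc N \<sigma> \<eta> z} \<le> (\<rho> * ?D) ^ n" for n
    proof -
      let ?A = "\<lambda>xs. {\<sigma>\<in>space ?S. \<forall>u\<in>set xs. \<sigma> u \<in> {True}}"
      have A: "?A xs \<in> sets ?S" for xs by (rule cylinder_sets) simp
      have pA: "S.prob (?A xs) \<le> \<rho> ^ n" if xs: "xs \<in> walks N z n" for xs
      proof -
        have "emeasure ?S (?A xs) = (\<Prod>u\<in>set xs. emeasure (measure_pmf (bernoulli_pmf \<rho>)) {True})"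
          by (rule SP.emeasure_PiM_Collect) auto
        also have "\<dots> = ennreal \<rho> ^ card (set xs)"
          using \<rho> by (simp add: measure_pmf.emeasure_eq_measure measure_bernoulli)
        also have "\<dots> = ennreal (\<rho> ^ Suc n)"
          using walks_distinct[OF xs] \<rho> by (simp only: distinct_card ennreal_power)
        finally have "S.prob (?A xs) = \<rho> ^ Suc n" using \<rho> by (simp add: measure_def)
        then show ?thesis using \<rho> by (simp add: mult_left_le_one_le)
      qed
      have "{\<sigma>. infc N \<sigma> \<eta> z} \<subseteq> (\<Union>xs\<in>walks N z n. ?A xs)"
        using walk_of_infc[of N _ \<eta> z n] by fastforce
      then have "S.prob {\<sigma>. infc N \<sigma> \<eta> z} \<le> S.prob (\<Union>xs\<in>walks N z n. ?A xs)"
        using A finite_walks by (intro S.finite_measure_mono sets.finite_UN) auto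
      also have "\<dots> \<le> (\<Sum>xs\<in>walks N z n. S.prob (?A xs))"
        using A finite_walks by (intro S.finite_measure_subadditive_finite) auto
      also have "\<dots> \<le> (\<Sum>xs\<in>walks N z n. \<rho> ^ n)" by (rule sum_mono) (rule pA)
      also have "\<dots> = real (card (walks N z n)) * \<rho> ^ n" by simp
      also have "\<dots> \<le> real (((8 * N + 1)\<^sup>2) ^ n) * \<rho> ^ n"
        using finite_walks[of N z n] \<rho> by (intro mult_right_mono of_nat_mono) auto
      finally show ?thesis by (simp add: power_mult_distrib mult.commute)
    qed
    moreover have "(\<lambda>n. (\<rho> * ?D) ^ n) \<longlonglongrightarrow> 0"
      using small \<rho> by (intro LIMSEQ_power_zero) auto
    ultimately have "S.prob {\<sigma>. infc N \<sigma> \<eta> z} \<le> 0" by (intro LIMSEQ_le_const) auto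
    then have "S.prob {\<sigma>. infc N \<sigma> \<eta> z} = 0" using measure_nonneg[of ?S "{\<sigma>. infc N \<sigma> \<eta> z}"] by simp
    then show ?thesis using ms by (subst (asm) S.prob_eq_0) auto
  qed
  then show ?thesis by (simp add: AE_all_countable)
qed

section \<open>Thinning of Poisson processes\<close>

definition cellidx :: "real \<Rightarrow> pt \<Rightarrow> site" where
  "cellidx s x = (\<lfloor>x $ 1 / s\<rfloor>, \<lfloor>x $ 2 / s\<rfloor>)"

definition cell :: "real \<Rightarrow> site \<Rightarrow> pt set" where
  "cell s z = {x. cellidx s x = z}"

lemma measurable_cellidx [measurable]: "cellidx s \<in> measurable borel (count_space UNIV)"
proof -
  have [measurable]: "(\<lambda>x::pt. x $ i) \<in> borel_measurable borel" for i
    by (intro borel_measurable_continuous_onI continuous_intros)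
  show ?thesis unfolding cellidx_def by measurable
qed

lemma cell_borel [measurable]: "cell s z \<in> sets borel"
proof -
  have "cellidx s -` {z} \<inter> space borel \<in> sets borel" by (rule measurable_sets[OF measurable_cellidx]) simp
  then show ?thesis by (simp add: cell_def vimage_def)
qed

lemma cell_iff:
  assumes "0 < s"
  shows "x \<in> cell s z \<longleftrightarrow> s * of_int (fst z) \<le> x $ 1 \<and> x $ 1 < s * (of_int (fst z) + 1) \<and>
     s * of_int (snd z) \<le> x $ 2 \<and> x $ 2 < s * (of_int (snd z) + 1)"
  using assms by (cases z) (auto simp: cell_def cellidx_def floor_eq_iff field_simps)

lemma forall_2: "(\<forall>i::2. P i) \<longleftrightarrow> P 1 \<and> P 2"
  by (metis exhaust_2)

lemma cell_between:
  assumes s: "0 < s"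
  shows "box (vector [s * of_int (fst z), s * of_int (snd z)]) (vector [s * (of_int (fst z) + 1), s * (of_int (snd z) + 1)]) \<subseteq> cell s z"
    "cell s z \<subseteq> cbox (vector [s * of_int (fst z), s * of_int (snd z)]) (vector [s * (of_int (fst z) + 1), s * (of_int (snd z) + 1)] :: pt)"
  by (auto simp: cell_iff[OF s] mem_box_cart forall_2 vector_2)

lemma measure_cell:
  assumes s: "0 < s"
  shows "measure lborel (cell s z) = s\<^sup>2" "emeasure lborel (cell s z) = ennreal (s\<^sup>2)"
proof -
  let ?a = "vector [s * of_int (fst z), s * of_int (snd z)] :: pt" and ?b = "vector [s * (of_int (fst z) + 1), s * (of_int (snd z) + 1)] :: pt"
  have ne: "cbox ?a ?b \<noteq> {}"
    using s by (auto simp: interval_ne_empty_cart forall_2 vector_2)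
  have c: "measure lborel (cbox ?a ?b) = s\<^sup>2"
    unfolding content_cbox_cart[OF ne] by (simp add: UNIV_2 vector_2 algebra_simps power2_eq_square)
  have e: "emeasure lborel (cbox ?a ?b) = ennreal (s\<^sup>2)"
  proof -
    have "emeasure lborel (cbox ?a ?b) \<noteq> \<infinity>" using emeasure_lborel_cbox_finite[of ?a ?b] by auto
    from emeasure_eq_ennreal_measure[OF this[unfolded infinity_ennreal_def]] show ?thesis unfolding c .
  qed
  have eb: "emeasure lborel (box ?a ?b) = ennreal (s\<^sup>2)"
    unfolding e[symmetric] emeasure_lborel_box_eq emeasure_lborel_cbox_eq by simp
  have "emeasure lborel (box ?a ?b) \<le> emeasure lborel (cell s z)"
    "emeasure lborel (cell s z) \<le> emeasure lborel (cbox ?a ?b)"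
    by (intro emeasure_mono cell_between[OF s]; simp)+
  then show em: "emeasure lborel (cell s z) = ennreal (s\<^sup>2)" unfolding e eb by (rule antisym[rotated])
  then show "measure lborel (cell s z) = s\<^sup>2" by (simp add: measure_def)
qed

lemma bounded_cell: "0 < s \<Longrightarrow> bounded (cell s z)"
  by (rule bounded_subset[OF bounded_cbox cell_between(2)])

lemma finite_cellidx:
  assumes "bounded A" "0 < s" shows "finite (cellidx s ` A)"
proof -
  obtain B where B: "\<And>x. x \<in> A \<Longrightarrow> norm x \<le> B" using assms by (auto simp: bounded_iff)
  have "cellidx s ` A \<subseteq> {\<lfloor>- B / s\<rfloor>..\<lfloor>B / s\<rfloor>} \<times> {\<lfloor>- B / s\<rfloor>..\<lfloor>B / s\<rfloor>}"
  proof
    fix z assume "z \<in> cellidx s ` A"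
    then obtain x where x: "x \<in> A" "z = cellidx s x" by auto
    have "\<bar>x $ i\<bar> \<le> B" for i using component_le_norm_cart[of x i] B[OF x(1)] by linarith
    then have "- B / s \<le> x $ i / s \<and> x $ i / s \<le> B / s" for i
      using assms(2) by (intro conjI divide_right_mono) (auto simp: abs_le_iff minus_le_iff)
    then show "z \<in> {\<lfloor>- B / s\<rfloor>..\<lfloor>B / s\<rfloor>} \<times> {\<lfloor>- B / s\<rfloor>..\<lfloor>B / s\<rfloor>}"
      unfolding x(2) cellidx_def by (auto intro!: floor_mono)
  qed
  then show ?thesis by (rule finite_subset) simp
qed

lemma cell_separate:
  assumes "x \<noteq> y"
  shows "\<exists>m0. \<forall>m\<ge>m0. cellidx (1 / 2 ^ m) x \<noteq> cellidx (1 / 2 ^ m) y"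
proof -
  obtain i where i: "x $ i \<noteq> y $ i" using assms by (auto simp: vec_eq_iff)
  obtain m0 where m0: "(1 / 2) ^ m0 < \<bar>x $ i - y $ i\<bar>"
    using real_arch_pow_inv[of "\<bar>x $ i - y $ i\<bar>" "1 / 2"] i by auto
  have "cellidx (1 / 2 ^ m) x \<noteq> cellidx (1 / 2 ^ m) y" if "m0 \<le> m" for m
  proof
    assume eq: "cellidx (1 / 2 ^ m) x = cellidx (1 / 2 ^ m) y"
    have "\<lfloor>x $ i * 2 ^ m\<rfloor> = \<lfloor>y $ i * 2 ^ m\<rfloor>" using eq exhaust_2[of i] by (auto simp: cellidx_def)
    then have "\<bar>x $ i * 2 ^ m - y $ i * 2 ^ m\<bar> < 1" by linarith
    then have "\<bar>x $ i - y $ i\<bar> * 2 ^ m < 1" by (simp add: abs_mult left_diff_distrib[symmetric])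
    then have "\<bar>x $ i - y $ i\<bar> < (1 / 2) ^ m" by (simp add: field_simps power_divide)
    also have "\<dots> \<le> (1 / 2) ^ m0" using that by (intro power_decreasing) auto
    finally show False using m0 by simp
  qed
  then show ?thesis by blast
qed

definition loc_finite :: "pt set \<Rightarrow> bool" where
  "loc_finite S \<longleftrightarrow> (\<forall>A. bounded A \<longrightarrow> finite (S \<inter> A))"

definition separated :: "pt set \<Rightarrow> site \<Rightarrow> nat \<Rightarrow> bool" where
  "separated S z m \<longleftrightarrow> (\<forall>w. card (S \<inter> (cell 1 z \<inter> cell (1 / 2 ^ m) w)) \<le> 1)"

definition sep_level :: "pt set \<Rightarrow> site \<Rightarrow> nat" where
  "sep_level S z = (LEAST m. separated S z m)"

text \<open>A point is labelled by its dyadic subcell at the first level separating the points of its unit cell.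
  Marks indexed by these countably many labels thin every configuration through one fixed product measure.\<close>

definition label :: "pt set \<Rightarrow> pt \<Rightarrow> site \<times> nat \<times> site" where
  "label S x = (let z = cellidx 1 x; m = sep_level S z in (z, m, cellidx (1 / 2 ^ m) x))"

lemma separated_sep_level:
  assumes "loc_finite S"
  shows "separated S z (sep_level S z)"
proof -
  let ?F = "S \<inter> cell 1 z"
  have fin: "finite ?F" using assms bounded_cell[of 1 z] by (auto simp: loc_finite_def)
  have "\<exists>m0. \<forall>m\<ge>m0. x \<noteq> y \<longrightarrow> cellidx (1 / 2 ^ m) x \<noteq> cellidx (1 / 2 ^ m) y" for x y
    using cell_separate[of x y] by blast
  then obtain f where f: "\<And>x y m. f x y \<le> m \<Longrightarrow> x \<noteq> y \<Longrightarrow> cellidx (1 / 2 ^ m) x \<noteq> cellidx (1 / 2 ^ m) y"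
    by metis
  define m where "m = Max (insert 0 ((\<lambda>(x, y). f x y) ` (?F \<times> ?F)))"
  have "f x y \<le> m" if "x \<in> ?F" "y \<in> ?F" for x y
    unfolding m_def using fin that by (intro Max_ge) (auto intro!: rev_image_eqI[of "(x, y)"])
  then have "x = y" if "x \<in> ?F" "y \<in> ?F" "cellidx (1 / 2 ^ m) x = cellidx (1 / 2 ^ m) y" for x y
    using f that by metis
  then have inj: "x = y" if "x \<in> S \<inter> (cell 1 z \<inter> cell (1 / 2 ^ m) w)" "y \<in> S \<inter> (cell 1 z \<inter> cell (1 / 2 ^ m) w)" for x y w
    using that unfolding cell_def by blast
  have "finite (S \<inter> (cell 1 z \<inter> cell (1 / 2 ^ m) w))" for w by (rule finite_subset[OF _ fin]) auto
  then have "separated S z m"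
    unfolding separated_def One_nat_def using inj by (auto simp: card_le_Suc0_iff_eq)
  then show ?thesis unfolding sep_level_def by (rule LeastI)
qed

lemma inj_on_label:
  assumes S: "loc_finite S" shows "inj_on (label S) S"
proof (rule inj_onI)
  fix x y assume x: "x \<in> S" and y: "y \<in> S" and eq: "label S x = label S y"
  define z where "z = cellidx 1 x"
  define m where "m = sep_level S z"
  have z: "cellidx 1 y = z" using eq by (simp add: label_def Let_def z_def)
  let ?A = "S \<inter> (cell 1 z \<inter> cell (1 / 2 ^ m) (cellidx (1 / 2 ^ m) x))"
  have "finite ?A" using S bounded_cell[of 1 z] by (auto simp: loc_finite_def intro: bounded_subset)
  moreover have "card ?A \<le> 1" using separated_sep_level[OF S, of z] unfolding separated_def m_def by blast
  moreover have "x \<in> ?A" "y \<in> ?A"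
    using x y z eq by (auto simp: cell_def z_def[symmetric] label_def Let_def m_def)
  ultimately show "x = y" by (auto simp: card_le_Suc0_iff_eq)
qed

definition thinned :: "pt set \<Rightarrow> (site \<times> nat \<times> site \<Rightarrow> bool) \<Rightarrow> pt set" where
  "thinned S u = {x\<in>S. u (label S x)}"

section \<open>Thinning identities for Poisson and binomial weights\<close>

definition pois :: "real \<Rightarrow> nat \<Rightarrow> real" where
  "pois a k = exp (- a) * a ^ k / fact k"

text \<open>The algebra of thinning: a Poisson total that is split binomially gives a product of two
  Poisson weights.\<close>

lemma pois_split:
  assumes "0 \<le> p" "p \<le> 1"
  shows "pois a (k + l) * (real ((k + l) choose k) * p ^ k * (1 - p) ^ l) = pois (a * p) k * pois (a * (1 - p)) l"
proof -
  have "real ((k + l) choose k) = fact (k + l) / (fact k * fact l)"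
    by (simp add: binomial_fact)
  moreover have "exp (- a) = exp (- (a * p)) * exp (- (a * (1 - p)))"
    by (simp add: exp_add[symmetric] algebra_simps)
  ultimately show ?thesis
    unfolding pois_def power_add power_mult_distrib by simp
qed

lemma bern_expect_Un:
  assumes "finite K1" "finite K2" "K1 \<inter> K2 = {}"
  shows "bern_expect (K1 \<union> K2) \<pi> (\<lambda>S. f (S \<inter> K1) * g (S \<inter> K2)) = bern_expect K1 \<pi> f * bern_expect K2 \<pi> g"
proof -
  have w: "bern_weight (K1 \<union> K2) \<pi> (A \<union> B) = bern_weight K1 \<pi> A * bern_weight K2 \<pi> B"
    if "A \<subseteq> K1" "B \<subseteq> K2" for A B
  proof -
    have "bern_weight (K1 \<union> K2) \<pi> (A \<union> B) = bern_weight K1 \<pi> (A \<union> B) * bern_weight K2 \<pi> (A \<union> B)"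
      unfolding bern_weight_def by (rule prod.union_disjoint[OF assms])
    also have "bern_weight K1 \<pi> (A \<union> B) = bern_weight K1 \<pi> A" by (rule bern_weight_cong) (use that assms in auto)
    also have "bern_weight K2 \<pi> (A \<union> B) = bern_weight K2 \<pi> B" by (rule bern_weight_cong) (use that assms in auto)
    finally show ?thesis .
  qed
  have "bij_betw (\<lambda>(A, B). A \<union> B) (Pow K1 \<times> Pow K2) (Pow (K1 \<union> K2))"
    by (rule bij_betwI[where g = "\<lambda>S. (S \<inter> K1, S \<inter> K2)"]) (use assms in auto)
  then have "bern_expect (K1 \<union> K2) \<pi> (\<lambda>S. f (S \<inter> K1) * g (S \<inter> K2)) =
     (\<Sum>(A, B)\<in>Pow K1 \<times> Pow K2. bern_weight (K1 \<union> K2) \<pi> (A \<union> B) * (f ((A \<union> B) \<inter> K1) * g ((A \<union> B) \<inter> K2)))"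
    unfolding bern_expect_def by (subst sum.reindex_bij_betw[symmetric]) (auto simp: case_prod_unfold)
  also have "\<dots> = (\<Sum>(A, B)\<in>Pow K1 \<times> Pow K2. (bern_weight K1 \<pi> A * f A) * (bern_weight K2 \<pi> B * g B))"
  proof (intro sum.cong refl, clarsimp)
    fix A B assume AB: "A \<subseteq> K1" "B \<subseteq> K2"
    have "(A \<union> B) \<inter> K1 = A" "(A \<union> B) \<inter> K2 = B" using AB assms by auto
    then show "bern_weight (K1 \<union> K2) \<pi> (A \<union> B) * (f ((A \<union> B) \<inter> K1) * g ((A \<union> B) \<inter> K2)) =
       bern_weight K1 \<pi> A * f A * (bern_weight K2 \<pi> B * g B)" by (simp add: w[OF AB])
  qed
  also have "\<dots> = bern_expect K1 \<pi> f * bern_expect K2 \<pi> g"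
    unfolding bern_expect_def sum_product by (subst sum.cartesian_product) simp
  finally show ?thesis .
qed

lemma bern_expect_prod:
  assumes "finite J" "\<And>j. j \<in> J \<Longrightarrow> finite (L j)" "disjoint_family_on L J"
  shows "bern_expect (\<Union>j\<in>J. L j) \<pi> (\<lambda>S. \<Prod>j\<in>J. f j (S \<inter> L j)) = (\<Prod>j\<in>J. bern_expect (L j) \<pi> (f j))"
  using assms
proof (induction J)
  case empty
  show ?case by (simp add: bern_expect_def bern_weight_def)
next
  case (insert i J)
  let ?K = "\<Union>j\<in>J. L j"
  have dj: "L i \<inter> ?K = {}" using insert.hyps(2) insert.prems(2)
    by (fastforce simp: disjoint_family_on_def)
  have "bern_expect (\<Union>j\<in>insert i J. L j) \<pi> (\<lambda>S. \<Prod>j\<in>insert i J. f j (S \<inter> L j)) =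
      bern_expect (L i \<union> ?K) \<pi> (\<lambda>S. f i (S \<inter> L i) * (\<lambda>S. \<Prod>j\<in>J. f j (S \<inter> L j)) (S \<inter> ?K))"
  proof -
    have "(\<Prod>j\<in>J. f j (S \<inter> L j)) = (\<Prod>j\<in>J. f j (S \<inter> ?K \<inter> L j))" for S
      by (intro prod.cong refl arg_cong[where f = "f _"]) auto
    then show ?thesis using insert.hyps by simp
  qed
  also have "\<dots> = bern_expect (L i) \<pi> (f i) * bern_expect ?K \<pi> (\<lambda>S. \<Prod>j\<in>J. f j (S \<inter> L j))"
    by (rule bern_expect_Un[OF _ _ dj]) (use insert in auto)
  also have "bern_expect ?K \<pi> (\<lambda>S. \<Prod>j\<in>J. f j (S \<inter> L j)) = (\<Prod>j\<in>J. bern_expect (L j) \<pi> (f j))"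
    by (rule insert.IH) (use insert.prems in \<open>auto simp: disjoint_family_on_def\<close>)
  finally show ?case using insert.hyps by simp
qed

lemma bern_expect_binomial:
  assumes "finite L"
  shows "bern_expect L (\<lambda>_. p) (\<lambda>S. of_bool (card S = k)) = real (card L choose k) * p ^ k * (1 - p) ^ (card L - k)"
proof -
  have w: "bern_weight L (\<lambda>_. p) S = p ^ card S * (1 - p) ^ (card L - card S)" if "S \<subseteq> L" for S
  proof -
    have "bern_weight L (\<lambda>_. p) S = (\<Prod>k\<in>S. p) * (\<Prod>k\<in>L - S. 1 - p)"
      unfolding bern_weight_def using that assms
      by (subst prod.If_cases) (auto simp: Int_absorb1 Int_absorb2 Diff_eq)
    then show ?thesis using that assms by (simp add: card_Diff_subset finite_subset)
  qed
  have "bern_expect L (\<lambda>_. p) (\<lambda>S. of_bool (card S = k)) =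
      (\<Sum>S\<in>Pow L. if card S = k then p ^ k * (1 - p) ^ (card L - k) else 0)"
    unfolding bern_expect_def using w by (intro sum.cong) auto
  also have "\<dots> = (\<Sum>S\<in>{S\<in>Pow L. card S = k}. p ^ k * (1 - p) ^ (card L - k))"
    using assms by (intro sum.inter_filter[symmetric]) auto
  also have "\<dots> = real (card {S. S \<subseteq> L \<and> card S = k}) * (p ^ k * (1 - p) ^ (card L - k))" by simp
  finally show ?thesis using n_subsets[OF assms, of k] by simp
qed

lemma card_UN_disjoint_fun:
  assumes "finite I" "\<And>i. i \<in> I \<Longrightarrow> finite (B \<inter> f -` {i})" "f ` B \<subseteq> I"
  shows "card B = (\<Sum>i\<in>I. card (B \<inter> f -` {i}))"
proof -
  have "B = (\<Union>i\<in>I. B \<inter> f -` {i})" using assms(3) by auto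
  then have "card B = card (\<Union>i\<in>I. B \<inter> f -` {i})" by simp
  also have "\<dots> = (\<Sum>i\<in>I. card (B \<inter> f -` {i}))"
    by (rule card_UN_disjoint) (use assms in auto)
  finally show ?thesis .
qed

text \<open>Applying a function of \<open>m\<close> to \<open>sep_level S z\<close> separates the
  random level from a finite sum over fixed subcells; there are countably many levels, and for each
  of them the sum is measurable.\<close>

lemma card_thinned:
  assumes S: "loc_finite S" and A: "bounded A"
  shows "card (thinned S u \<inter> A) = (\<Sum>z\<in>cellidx 1 ` A. (\<lambda>m. \<Sum>w\<in>cellidx (1 / 2 ^ m) ` cell 1 z.
     of_bool (u (z, m, w)) * card (S \<inter> (A \<inter> cell 1 z \<inter> cell (1 / 2 ^ m) w))) (sep_level S z))"
proof -
  have fin: "finite (S \<inter> B)" if "B \<subseteq> A" for B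
    using S A bounded_subset[OF A that] by (auto simp: loc_finite_def)
  let ?B = "thinned S u \<inter> A"
  have finB: "finite ?B" by (rule finite_subset[OF _ fin[of A]]) (auto simp: thinned_def)
  have "card ?B = (\<Sum>z\<in>cellidx 1 ` A. card (?B \<inter> cellidx 1 -` {z}))"
    by (rule card_UN_disjoint_fun) (use A finite_cellidx[of A 1] finB in auto)
  also have "\<dots> = (\<Sum>z\<in>cellidx 1 ` A. (\<lambda>m. \<Sum>w\<in>cellidx (1 / 2 ^ m) ` cell 1 z.
     of_bool (u (z, m, w)) * card (S \<inter> (A \<inter> cell 1 z \<inter> cell (1 / 2 ^ m) w))) (sep_level S z))"
  proof (rule sum.cong[OF refl])
    fix z
    define m where "m = sep_level S z"
    let ?C = "?B \<inter> cellidx 1 -` {z}"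
    have "card ?C = (\<Sum>w\<in>cellidx (1 / 2 ^ m) ` cell 1 z. card (?C \<inter> cellidx (1 / 2 ^ m) -` {w}))"
      by (rule card_UN_disjoint_fun)
        (use finB finite_cellidx[OF bounded_cell, of 1 "1 / 2 ^ m" z] in \<open>auto simp: cell_def\<close>)
    also have "\<dots> = (\<Sum>w\<in>cellidx (1 / 2 ^ m) ` cell 1 z.
      of_bool (u (z, m, w)) * card (S \<inter> (A \<inter> cell 1 z \<inter> cell (1 / 2 ^ m) w)))"
    proof (rule sum.cong[OF refl])
      fix w
      have "?C \<inter> cellidx (1 / 2 ^ m) -` {w} = (if u (z, m, w) then S \<inter> (A \<inter> cell 1 z \<inter> cell (1 / 2 ^ m) w) else {})"
        by (auto simp: thinned_def label_def Let_def cell_def m_def)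
      then show "card (?C \<inter> cellidx (1 / 2 ^ m) -` {w}) =
          of_bool (u (z, m, w)) * card (S \<inter> (A \<inter> cell 1 z \<inter> cell (1 / 2 ^ m) w))" by simp
    qed
    finally show "card ?C = (\<lambda>m. \<Sum>w\<in>cellidx (1 / 2 ^ m) ` cell 1 z.
       of_bool (u (z, m, w)) * card (S \<inter> (A \<inter> cell 1 z \<inter> cell (1 / 2 ^ m) w))) (sep_level S z)"
      by (simp add: m_def)
  qed
  finally show ?thesis .
qed

lemma pois_sums: "pois a sums 1"
proof -
  have "(\<lambda>k. a ^ k /\<^sub>R fact k) sums exp a" by (rule exp_converges)
  from sums_mult[OF this, of "exp (- a)"] show ?thesis
    by (simp add: pois_def[abs_def] exp_minus field_simps scaleR_conv_of_real)
qed

lemma (in prob_space) indep_vars_discreteI: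
  fixes X :: "'i \<Rightarrow> 'a \<Rightarrow> 'b :: countable"
  assumes X: "\<And>i. i \<in> I \<Longrightarrow> X i \<in> measurable M (count_space UNIV)"
    and eq: "\<And>J k. finite J \<Longrightarrow> J \<subseteq> I \<Longrightarrow> J \<noteq> {} \<Longrightarrow>
      prob {\<omega>\<in>space M. \<forall>j\<in>J. X j \<omega> = k j} = (\<Prod>j\<in>J. prob {\<omega>\<in>space M. X j \<omega> = k j})"
  shows "indep_vars (\<lambda>_. count_space UNIV) X I"
proof -
  \<comment> \<open>The empty set is adjoined so that the generator is closed under
    intersection.\<close>
  define G where "G i = insert {} ((\<lambda>k. {\<omega>\<in>space M. X i \<omega> = k}) ` UNIV)" for i
  have ev: "{\<omega>\<in>space M. X i \<omega> = k} \<in> events" if "i \<in> I" for i k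
    using measurable_sets[OF X[OF that], of "{k}"] by (simp add: vimage_def Int_def conj_commute)
  have "indep_sets G I"
  proof (rule indep_setsI)
    show "G i \<subseteq> events" if "i \<in> I" for i using ev[OF that] by (auto simp: G_def)
    fix A J assume J: "J \<noteq> {}" "J \<subseteq> I" "finite J" and A: "\<forall>j\<in>J. A j \<in> G j"
    show "prob (\<Inter>j\<in>J. A j) = (\<Prod>j\<in>J. prob (A j))"
    proof (cases "\<exists>j\<in>J. A j = {}")
      case True
      then have "(\<Inter>j\<in>J. A j) = {}" by auto
      moreover obtain j where j: "j \<in> J" "A j = {}" using True by blast
      have "\<exists>j\<in>J. prob (A j) = 0" by (rule bexI[OF _ j(1)]) (simp add: j(2))
      then have "(\<Prod>j\<in>J. prob (A j)) = 0" by (rule prod_zero[OF J(3)])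
      ultimately show ?thesis by simp
    next
      case False
      have "\<exists>k. A j = {\<omega>\<in>space M. X j \<omega> = k}" if "j \<in> J" for j
        using A False that unfolding G_def by (fastforce simp del: split_paired_Ex)
      then obtain k where k: "\<And>j. j \<in> J \<Longrightarrow> A j = {\<omega>\<in>space M. X j \<omega> = k j}" by metis
      have "(\<Inter>j\<in>J. A j) = (\<Inter>j\<in>J. {\<omega>\<in>space M. X j \<omega> = k j})" by (rule INF_cong[OF refl k])
      also have "\<dots> = {\<omega>\<in>space M. \<forall>j\<in>J. X j \<omega> = k j}" using J(1) by auto
      finally show ?thesis using eq[OF J(3,2,1), of k] k by simp
    qed
  qed
  moreover have "Int_stable (G i)" for i
    unfolding Int_stable_def G_def by auto
  ultimately have "indep_sets (\<lambda>i. sigma_sets (space M) (G i)) I" by (rule indep_sets_sigma)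
  then show ?thesis
    unfolding indep_vars_def2
  proof (intro conjI ballI)
    show "random_variable (count_space UNIV) (X i)" if "i \<in> I" for i using X[OF that] .
    assume "indep_sets (\<lambda>i. sigma_sets (space M) (G i)) I"
    then show "indep_sets (\<lambda>i. {X i -` A \<inter> space M |A. A \<in> sets (count_space UNIV)}) I"
    proof (rule indep_sets_mono_sets)
      fix i assume "i \<in> I"
      show "{X i -` A \<inter> space M |A. A \<in> sets (count_space UNIV)} \<subseteq> sigma_sets (space M) (G i)"
      proof safe
        fix A
        have "(\<Union>k\<in>A. {\<omega>\<in>space M. X i \<omega> = k}) \<in> sigma_sets (space M) (G i)"
          by (rule sigma_sets_UNION) (auto simp: G_def intro: sigma_sets.Basic)
        moreover have "X i -` A \<inter> space M = (\<Union>k\<in>A. {\<omega>\<in>space M. X i \<omega> = k})" by auto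
        ultimately show "X i -` A \<inter> space M \<in> sigma_sets (space M) (G i)" by simp
      qed
    qed
  qed
qed

text \<open>Local finiteness holds almost surely in \<open>poisson_pp\<close>; here it holds
  everywhere. This makes labels injective and cells finite for every outcome, and keeps
  \<open>card\<close>, which is 0 on infinite sets, from mistaking a crowded cell for an empty
  one.\<close>

locale lf_poisson = prob_space M for M :: "'a measure" +
  fixes lam :: real and P :: "'a \<Rightarrow> pt set"
  assumes pp: "poisson_pp M lam P" and lf: "\<And>\<omega>. loc_finite (P \<omega>)"
begin

lemma lam_pos: "0 < lam"
  using pp by (simp add: poisson_pp_def)

lemma count_measurable:
  assumes "A \<in> sets borel" "bounded A"
  shows "(\<lambda>\<omega>. card (P \<omega> \<inter> A)) \<in> measurable M (count_space UNIV)"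
  using pp assms unfolding poisson_pp_def by auto

lemma count_prob:
  assumes "A \<in> sets borel" "bounded A"
  shows "prob {\<omega>\<in>space M. card (P \<omega> \<inter> A) = k} = pois (lam * measure lborel A) k"
  using pp assms unfolding poisson_pp_def pois_def by auto

lemma count_joint:
  assumes J: "finite J" and A: "\<And>j. j \<in> J \<Longrightarrow> A j \<in> sets borel \<and> bounded (A j)"
    and dj: "disjoint_family_on A J"
  shows "prob {\<omega>\<in>space M. \<forall>j\<in>J. card (P \<omega> \<inter> A j) = k j} = (\<Prod>j\<in>J. pois (lam * measure lborel (A j)) (k j))"
proof (cases "J = {}")
  case True
  then show ?thesis by (simp add: prob_space)
next
  case False
  obtain f where f: "bij_betw f {..<card J} J" using ex_bij_betw_nat_finite[OF J] by (auto simp: atLeast0LessThan)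
  let ?n = "card J"
  have fJ: "f i \<in> J" if "i < ?n" for i using bij_betwE[OF f] that by auto
  have inj: "inj_on f {..<?n}" using f by (simp add: bij_betw_def)
  have "disjoint_family_on (\<lambda>i. A (f i)) {..<?n}"
    unfolding disjoint_family_on_def
  proof (intro ballI impI)
    fix i i' assume "i \<in> {..<?n}" "i' \<in> {..<?n}" "i \<noteq> i'"
    then have "f i \<noteq> f i'" "f i \<in> J" "f i' \<in> J" using inj fJ by (auto simp: inj_on_def)
    then show "A (f i) \<inter> A (f i') = {}" using dj by (auto simp: disjoint_family_on_def)
  qed
  moreover have "\<forall>i<?n. A (f i) \<in> sets lborel \<and> bounded (A (f i))" using A fJ by auto
  ultimately have ind: "indep_vars (\<lambda>_. count_space UNIV) (\<lambda>i \<omega>. card (P \<omega> \<inter> A (f i))) {..<?n}"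
    using pp[unfolded poisson_pp_def, THEN conjunct2, THEN conjunct2, THEN conjunct2, THEN conjunct2,
        THEN spec, THEN spec, of ?n "\<lambda>i. A (f i)"] by simp
  have "prob (\<Inter>i\<in>{..<?n}. (\<lambda>\<omega>. card (P \<omega> \<inter> A (f i))) -` {k (f i)} \<inter> space M) =
     (\<Prod>i\<in>{..<?n}. prob ((\<lambda>\<omega>. card (P \<omega> \<inter> A (f i))) -` {k (f i)} \<inter> space M))"
    by (rule indep_varsD_finite[OF ind]) (use False J in \<open>auto simp: card_gt_0_iff lessThan_empty_iff\<close>)
  also have "\<dots> = (\<Prod>i\<in>{..<?n}. pois (lam * measure lborel (A (f i))) (k (f i)))"
  proof (rule prod.cong[OF refl])
    fix i assume "i \<in> {..<?n}"
    then show "prob ((\<lambda>\<omega>. card (P \<omega> \<inter> A (f i))) -` {k (f i)} \<inter> space M) = pois (lam * measure lborel (A (f i))) (k (f i))"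
      using count_prob[of "A (f i)" "k (f i)"] A fJ by (auto simp: vimage_def Int_def conj_commute)
  qed
  also have "\<dots> = (\<Prod>j\<in>J. pois (lam * measure lborel (A j)) (k j))"
    by (rule prod.reindex_bij_betw[OF f])
  also have "(\<Inter>i\<in>{..<?n}. (\<lambda>\<omega>. card (P \<omega> \<inter> A (f i))) -` {k (f i)} \<inter> space M) =
      {\<omega>\<in>space M. \<forall>j\<in>J. card (P \<omega> \<inter> A j) = k j}"
  proof -
    have Jf: "f ` {..<?n} = J" using f by (simp add: bij_betw_def)
    have "(\<forall>j\<in>f ` {..<?n}. Q j) \<longleftrightarrow> (\<forall>i\<in>{..<?n}. Q (f i))" for Q by simp
    then have "(\<forall>j\<in>J. Q j) \<longleftrightarrow> (\<forall>i\<in>{..<?n}. Q (f i))" for Q unfolding Jf .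
    moreover have "?n > 0" using False J by (simp add: card_gt_0_iff)
    ultimately show ?thesis by auto
  qed
  finally show ?thesis .
qed

lemma measurable_sep_level:
  "(\<lambda>\<omega>. sep_level (P \<omega>) z) \<in> measurable M (count_space UNIV)"
  unfolding sep_level_def
proof (rule measurable_Least)
  fix m
  have [measurable]: "(\<lambda>\<omega>. card (P \<omega> \<inter> (cell 1 z \<inter> cell (1 / 2 ^ m) w))) \<in> measurable M (count_space UNIV)" for w
    by (rule count_measurable) (auto intro: bounded_subset[OF bounded_cell[of 1 z]])
  show "Measurable.pred M (\<lambda>\<omega>. separated (P \<omega>) z m)" unfolding separated_def by measurable
qed

definition marked :: "real \<Rightarrow> ('a \<times> (site \<times> nat \<times> site \<Rightarrow> bool)) measure" where
  "marked p = M \<Otimes>\<^sub>M Bern p"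

lemma measurable_card_thinned:
  assumes A: "A \<in> sets borel" "bounded A" and h: "\<And>l. Measurable.pred (marked p) (\<lambda>x. h x l)"
  shows "(\<lambda>x. card (thinned (P (fst x)) (h x) \<inter> A)) \<in> measurable (marked p) (count_space UNIV)"
proof -
  note [measurable] = h
  have "(\<lambda>x. (\<lambda>m. \<Sum>w\<in>cellidx (1 / 2 ^ m) ` cell 1 z. of_bool (h x (z, m, w)) *
     card (P (fst x) \<inter> (A \<inter> cell 1 z \<inter> cell (1 / 2 ^ m) w))) (sep_level (P (fst x)) z))
     \<in> measurable (marked p) (count_space UNIV)" for z
  proof (rule measurable_compose_countable[where g = "\<lambda>x. sep_level (P (fst x)) z"])
    show "(\<lambda>x. sep_level (P (fst x)) z) \<in> measurable (marked p) (count_space UNIV)"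
      unfolding marked_def by (rule measurable_compose[OF measurable_fst measurable_sep_level])
    fix m
    have [measurable]: "(\<lambda>x. card (P (fst x) \<inter> (A \<inter> cell 1 z \<inter> cell (1 / 2 ^ m) w))) \<in>
        measurable (marked p) (count_space UNIV)" for w
      unfolding marked_def
      by (rule measurable_compose[OF measurable_fst count_measurable])
        (use A in \<open>auto intro: bounded_subset\<close>)
    show "(\<lambda>x. \<Sum>w\<in>cellidx (1 / 2 ^ m) ` cell 1 z. of_bool (h x (z, m, w)) *
       card (P (fst x) \<inter> (A \<inter> cell 1 z \<inter> cell (1 / 2 ^ m) w))) \<in> measurable (marked p) (count_space UNIV)"
      by measurable
  qed
  then show ?thesis
    unfolding card_thinned[OF lf A(2)] by (intro measurable_sum_nat) 
qed

text \<open>On a fixed set \<open>S\<close> labels are injective, so the marks of its points are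
  independent coins, and disjoint regions read disjoint sets of labels.\<close>

lemma thinned_prob:
  assumes S: "loc_finite S" and J: "finite J" and A: "\<And>j. j \<in> J \<Longrightarrow> bounded (A j)"
    and dj: "disjoint_family_on A J" and p: "0 \<le> p" "p \<le> 1"
  shows "measure (Bern p) {u. \<forall>j\<in>J. card (thinned S u \<inter> A j) = k j} =
    (\<Prod>j\<in>J. real (card (S \<inter> A j) choose k j) * p ^ k j * (1 - p) ^ (card (S \<inter> A j) - k j))"
proof -
  define L where "L j = label S ` (S \<inter> A j)" for j
  have fin: "finite (S \<inter> A j)" if "j \<in> J" for j using S A[OF that] by (auto simp: loc_finite_def)
  have inj: "inj_on (label S) (S \<inter> A j)" for j
    using inj_on_label[OF S] by (rule inj_on_subset) auto
  have finL: "finite (L j)" if "j \<in> J" for j using fin[OF that] by (simp add: L_def)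
  have cL: "card (L j) = card (S \<inter> A j)" for j unfolding L_def by (rule card_image[OF inj])
  have djL: "disjoint_family_on L J"
    unfolding disjoint_family_on_def
  proof (intro ballI impI)
    fix i j assume ij: "i \<in> J" "j \<in> J" "i \<noteq> j"
    have "A i \<inter> A j = {}" using dj ij by (auto simp: disjoint_family_on_def)
    then have "(S \<inter> A i) \<inter> (S \<inter> A j) = {}" by blast
    then show "L i \<inter> L j = {}"
      unfolding L_def using inj_on_image_Int[OF inj_on_label[OF S], of "S \<inter> A i" "S \<inter> A j"] by simp
  qed
  let ?K = "\<Union>j\<in>J. L j"
  have cT: "card (thinned S u \<inter> A j) = card ({l\<in>?K. u l} \<inter> L j)" if "j \<in> J" for u j
  proof -
    have "{l\<in>?K. u l} \<inter> L j = label S ` (thinned S u \<inter> A j)"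
      using that unfolding L_def by (auto simp: thinned_def)
    moreover have "inj_on (label S) (thinned S u \<inter> A j)"
      using inj_on_label[OF S] by (rule inj_on_subset) (auto simp: thinned_def)
    ultimately show ?thesis by (simp add: card_image)
  qed
  have "{u. \<forall>j\<in>J. card (thinned S u \<inter> A j) = k j} = {u. (\<lambda>Y. \<forall>j\<in>J. card (Y \<inter> L j) = k j) {l\<in>?K. u l}}"
    using cT by auto
  then have "measure (Bern p) {u. \<forall>j\<in>J. card (thinned S u \<inter> A j) = k j} =
     bern_expect ?K (\<lambda>_. p) (\<lambda>Y. of_bool (\<forall>j\<in>J. card (Y \<inter> L j) = k j))"
    using measure_PiM_finite_event[of ?K "\<lambda>_. p" "\<lambda>Y. \<forall>j\<in>J. card (Y \<inter> L j) = k j"] J finL p by simp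
  also have "\<dots> = bern_expect ?K (\<lambda>_. p) (\<lambda>Y. \<Prod>j\<in>J. (\<lambda>j Y. of_bool (card Y = k j)) j (Y \<inter> L j))"
  proof -
    have "of_bool (\<forall>j\<in>J. card (Y \<inter> L j) = k j) = (\<Prod>j\<in>J. of_bool (card (Y \<inter> L j) = k j) :: real)" for Y
      using J by (induction J) auto
    then show ?thesis by simp
  qed
  also have "\<dots> = (\<Prod>j\<in>J. bern_expect (L j) (\<lambda>_. p) (\<lambda>Y. of_bool (card Y = k j)))"
    by (rule bern_expect_prod[OF J finL djL])
  also have "\<dots> = (\<Prod>j\<in>J. real (card (S \<inter> A j) choose k j) * p ^ k j * (1 - p) ^ (card (S \<inter> A j) - k j))"
    by (intro prod.cong refl) (simp add: bern_expect_binomial finL cL)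
  finally show ?thesis .
qed

abbreviation Tin :: "'a \<times> (site \<times> nat \<times> site \<Rightarrow> bool) \<Rightarrow> pt set" where
  "Tin x \<equiv> thinned (P (fst x)) (snd x)"

abbreviation Tout :: "'a \<times> (site \<times> nat \<times> site \<Rightarrow> bool) \<Rightarrow> pt set" where
  "Tout x \<equiv> thinned (P (fst x)) (\<lambda>l. \<not> snd x l)"

lemma measurable_Tin:
  assumes A: "A \<in> sets borel" "bounded A"
  shows "(\<lambda>x. card (Tin x \<inter> A)) \<in> measurable (marked p) (count_space UNIV)"
    "(\<lambda>x. card (Tout x \<inter> A)) \<in> measurable (marked p) (count_space UNIV)"
proof -
  have [measurable]: "Measurable.pred (marked p) (\<lambda>x. snd x l)" for l
    unfolding marked_def by measurable
  show "(\<lambda>x. card (Tin x \<inter> A)) \<in> measurable (marked p) (count_space UNIV)"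
    by (rule measurable_card_thinned[OF A]) measurable
  show "(\<lambda>x. card (Tout x \<inter> A)) \<in> measurable (marked p) (count_space UNIV)"
    by (rule measurable_card_thinned[OF A]) measurable
qed

lemma prob_space_marked: "prob_space (marked p)"
  unfolding marked_def
  by (intro prob_space_pair prob_space_axioms prob_space_Bern)

text \<open>Once the total counts are right, the conditional probability is the same product
  \<open>c\<close> of binomial weights for every configuration, because \<open>thinned_prob\<close>
  sees nothing else of it. \<open>pois_split\<close> then factors the result.\<close>

lemma marking:
  assumes J: "finite J" and A: "\<And>j. j \<in> J \<Longrightarrow> A j \<in> sets borel \<and> bounded (A j)"
    and dj: "disjoint_family_on A J" and p: "0 \<le> p" "p \<le> 1"
  shows "measure (marked p) {x\<in>space (marked p). \<forall>j\<in>J. card (Tin x \<inter> A j) = k j \<and> card (Tout x \<inter> A j) = l j} =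
    (\<Prod>j\<in>J. pois (lam * measure lborel (A j) * p) (k j) * pois (lam * measure lborel (A j) * (1 - p)) (l j))"
proof -
  let ?E = "{x\<in>space (marked p). \<forall>j\<in>J. card (Tin x \<inter> A j) = k j \<and> card (Tout x \<inter> A j) = l j}"
  let ?U = "Bern p :: (site \<times> nat \<times> site \<Rightarrow> bool) measure"
  interpret U: prob_space ?U by (rule prob_space_Bern)
  have E: "?E \<in> sets (marked p)"
  proof (rule sets.sets_Collect_finite_All[OF _ J])
    fix j assume "j \<in> J"
    note [measurable] = measurable_Tin[of "A j" p, OF A[OF this, THEN conjunct1] A[OF this, THEN conjunct2]]
    show "{x\<in>space (marked p). card (Tin x \<inter> A j) = k j \<and> card (Tout x \<inter> A j) = l j} \<in> sets (marked p)"
      by measurable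
  qed
  define c where "c = (\<Prod>j\<in>J. real ((k j + l j) choose k j) * p ^ k j * (1 - p) ^ l j)"
  have c0: "0 \<le> c" unfolding c_def using p by (intro prod_nonneg) auto
  let ?B = "{\<omega>\<in>space M. \<forall>j\<in>J. card (P \<omega> \<inter> A j) = k j + l j}"
  have B: "?B \<in> sets M"
  proof (rule sets.sets_Collect_finite_All[OF _ J])
    fix j assume "j \<in> J"
    note [measurable] = count_measurable[of "A j", OF A[OF this, THEN conjunct1] A[OF this, THEN conjunct2]]
    show "{\<omega>\<in>space M. card (P \<omega> \<inter> A j) = k j + l j} \<in> sets M" by measurable
  qed
  have slice: "emeasure ?U (Pair \<omega> -` ?E) = ennreal c * indicator ?B \<omega>" if "\<omega> \<in> space M" for \<omega>
  proof -
    let ?S = "P \<omega>"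
    have tin: "card (thinned ?S u \<inter> A j) + card (thinned ?S (\<lambda>l. \<not> u l) \<inter> A j) = card (?S \<inter> A j)"
      if "j \<in> J" for u j
    proof -
      have f: "finite (?S \<inter> A j)" using lf A[OF that] by (auto simp: loc_finite_def)
      have "?S \<inter> A j = (thinned ?S u \<inter> A j) \<union> (thinned ?S (\<lambda>l. \<not> u l) \<inter> A j)" by (auto simp: thinned_def)
      moreover have "card ((thinned ?S u \<inter> A j) \<union> (thinned ?S (\<lambda>l. \<not> u l) \<inter> A j)) =
         card (thinned ?S u \<inter> A j) + card (thinned ?S (\<lambda>l. \<not> u l) \<inter> A j)"
        by (rule card_Un_disjoint) (auto intro: finite_subset[OF _ f] simp: thinned_def)
      ultimately show ?thesis by simp
    qed
    show ?thesis
    proof (cases "\<forall>j\<in>J. card (?S \<inter> A j) = k j + l j")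
      case True
      have "Pair \<omega> -` ?E = {u. \<forall>j\<in>J. card (thinned ?S u \<inter> A j) = k j}"
      proof (intro set_eqI iffI)
        fix u assume "u \<in> Pair \<omega> -` ?E"
        then show "u \<in> {u. \<forall>j\<in>J. card (thinned ?S u \<inter> A j) = k j}" by simp
      next
        fix u assume u: "u \<in> {u. \<forall>j\<in>J. card (thinned ?S u \<inter> A j) = k j}"
        have "card (thinned ?S (\<lambda>l. \<not> u l) \<inter> A j) = l j" if "j \<in> J" for j
          using tin[OF that, of u] u True that by simp
        then show "u \<in> Pair \<omega> -` ?E" using u \<open>\<omega> \<in> space M\<close> by (simp add: marked_def space_pair_measure)
      qed
      then have "emeasure ?U (Pair \<omega> -` ?E) = ennreal (measure ?U {u. \<forall>j\<in>J. card (thinned ?S u \<inter> A j) = k j})"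
        by (simp add: U.emeasure_eq_measure)
      also have "\<dots> = ennreal c"
        using thinned_prob[OF lf J _ dj p, of \<omega> k] A True by (simp add: c_def)
      finally show ?thesis using True \<open>\<omega> \<in> space M\<close> by simp
    next
      case False
      have e: "Pair \<omega> -` ?E = {}"
      proof (rule equals0I)
        fix u assume "u \<in> Pair \<omega> -` ?E"
        then show False using False tin[of _ u] by fastforce
      qed
      show ?thesis unfolding e using False by simp
    qed
  qed
  have "emeasure (marked p) ?E = (\<integral>\<^sup>+\<omega>. emeasure ?U (Pair \<omega> -` ?E) \<partial>M)"
    unfolding marked_def by (rule U.emeasure_pair_measure_alt) (use E in \<open>simp add: marked_def\<close>)
  also have "\<dots> = (\<integral>\<^sup>+\<omega>. ennreal c * indicator ?B \<omega> \<partial>M)"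
    by (rule nn_integral_cong) (rule slice)
  also have "\<dots> = ennreal c * emeasure M ?B" using B by (rule nn_integral_cmult_indicator)
  also have "\<dots> = ennreal (c * prob ?B)" using c0 by (simp add: emeasure_eq_measure ennreal_mult)
  finally have "measure (marked p) ?E = c * prob ?B"
    using c0 by (simp add: measure_def)
  also have "prob ?B = (\<Prod>j\<in>J. pois (lam * measure lborel (A j)) (k j + l j))"
    by (rule count_joint[OF J A dj])
  also have "c * \<dots> = (\<Prod>j\<in>J. pois (lam * measure lborel (A j)) (k j + l j) *
      (real ((k j + l j) choose k j) * p ^ k j * (1 - p) ^ l j))"
    unfolding c_def prod.distrib[symmetric] by (simp add: mult.commute)
  also have "\<dots> = (\<Prod>j\<in>J. pois (lam * measure lborel (A j) * p) (k j) * pois (lam * measure lborel (A j) * (1 - p)) (l j))"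
    by (intro prod.cong refl pois_split p)
  finally show ?thesis .
qed

end

lemma (in lf_poisson) counts_indep:
  assumes A: "\<And>j. j \<in> I \<Longrightarrow> A j \<in> sets borel \<and> bounded (A j)" and dj: "disjoint_family_on A I"
  shows "indep_vars (\<lambda>_. count_space UNIV) (\<lambda>j \<omega>. card (P \<omega> \<inter> A j)) I"
proof (rule indep_vars_discreteI)
  show "(\<lambda>\<omega>. card (P \<omega> \<inter> A i)) \<in> measurable M (count_space UNIV)" if "i \<in> I" for i
    using count_measurable A[OF that] by blast
  fix J and k :: "_ \<Rightarrow> nat" assume J: "finite J" "J \<subseteq> I"
  have "prob {\<omega>\<in>space M. \<forall>j\<in>J. card (P \<omega> \<inter> A j) = k j} = (\<Prod>j\<in>J. pois (lam * measure lborel (A j)) (k j))"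
    by (rule count_joint[OF J(1) _ disjoint_family_on_mono[OF J(2) dj]]) (use J(2) A in blast)
  also have "\<dots> = (\<Prod>j\<in>J. prob {\<omega>\<in>space M. card (P \<omega> \<inter> A j) = k j})"
    by (intro prod.cong refl count_prob[symmetric]) (use J(2) A in blast)+
  finally show "prob {\<omega>\<in>space M. \<forall>j\<in>J. card (P \<omega> \<inter> A j) = k j} =
    (\<Prod>j\<in>J. prob {\<omega>\<in>space M. card (P \<omega> \<inter> A j) = k j})" .
qed

lemma poisson_ppI:
  assumes M: "prob_space M" and lam: "lam > 0"
    and lf: "\<And>\<omega>. loc_finite (P \<omega>)"
    and ms: "\<And>A. A \<in> sets borel \<Longrightarrow> bounded A \<Longrightarrow> (\<lambda>\<omega>. card (P \<omega> \<inter> A)) \<in> measurable M (count_space UNIV)"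
    and joint: "\<And>(J :: nat set) A k. finite J \<Longrightarrow> (\<And>j. j \<in> J \<Longrightarrow> A j \<in> sets borel \<and> bounded (A j)) \<Longrightarrow>
       disjoint_family_on A J \<Longrightarrow>
       measure M {\<omega>\<in>space M. \<forall>j\<in>J. card (P \<omega> \<inter> A j) = k j} = (\<Prod>j\<in>J. pois (lam * measure lborel (A j)) (k j))"
  shows "lf_poisson M lam P"
proof -
  interpret prob_space M by fact
  have one: "prob {\<omega>\<in>space M. card (P \<omega> \<inter> A) = k} = pois (lam * measure lborel A) k"
    if "A \<in> sets borel" "bounded A" for A k
    using joint[of "{0}" "\<lambda>_. A" "\<lambda>_. k"] that by (simp add: disjoint_family_on_def)
  have "indep_vars (\<lambda>_. count_space UNIV) (\<lambda>i \<omega>. card (P \<omega> \<inter> A i)) {..<n}"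
    if A: "\<forall>i<n. A i \<in> sets lborel \<and> bounded (A i)" and dj: "disjoint_family_on A {..<n}" for n :: nat and A
  proof (rule indep_vars_discreteI)
    show "(\<lambda>\<omega>. card (P \<omega> \<inter> A i)) \<in> measurable M (count_space UNIV)" if "i \<in> {..<n}" for i
      using ms[of "A i"] A that by simp
    fix J and k :: "nat \<Rightarrow> nat" assume J: "finite J" "J \<subseteq> {..<n}"
    have "prob {\<omega>\<in>space M. \<forall>j\<in>J. card (P \<omega> \<inter> A j) = k j} = (\<Prod>j\<in>J. pois (lam * measure lborel (A j)) (k j))"
      by (rule joint[OF J(1) _ disjoint_family_on_mono[OF J(2) dj]]) (use J(2) A in auto)
    also have "\<dots> = (\<Prod>j\<in>J. prob {\<omega>\<in>space M. card (P \<omega> \<inter> A j) = k j})"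
      by (intro prod.cong refl one[symmetric]) (use J A in auto)
    finally show "prob {\<omega>\<in>space M. \<forall>j\<in>J. card (P \<omega> \<inter> A j) = k j} =
      (\<Prod>j\<in>J. prob {\<omega>\<in>space M. card (P \<omega> \<inter> A j) = k j})" .
  qed
  then have "poisson_pp M lam P"
    unfolding poisson_pp_def using M lam lf ms one by (auto simp: loc_finite_def pois_def)
  then show ?thesis using lf by unfold_locales
qed

lemma loc_finite_subset: "loc_finite S \<Longrightarrow> T \<subseteq> S \<Longrightarrow> loc_finite T"
  unfolding loc_finite_def by (meson Int_mono finite_subset order_refl)

lemma loc_finite_thinned: "loc_finite S \<Longrightarrow> loc_finite (thinned S u)"
  by (rule loc_finite_subset) (auto simp: thinned_def)

lemma Collect_ball_INT: "L \<noteq> {} \<Longrightarrow> {x\<in>A. \<forall>j\<in>L. R j x} = (\<Inter>j\<in>L. {x. R j x} \<inter> A)"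
  by auto

definition pr :: "real \<Rightarrow> bool \<Rightarrow> real" where
  "pr p b = (if b then p else 1 - p)"

context lf_poisson
begin

text \<open>Retained and removed points as one family, so that their joint independence is a
  statement about a single index set.\<close>

definition Tb :: "bool \<Rightarrow> 'a \<times> (site \<times> nat \<times> site \<Rightarrow> bool) \<Rightarrow> pt set" where
  "Tb b x = thinned (P (fst x)) (\<lambda>l. snd x l = b)"

lemma Tb_simps [simp]: "Tb True x = Tin x" "Tb False x = Tout x"
  by (simp_all add: Tb_def)

lemma measurable_Tb:
  assumes A: "A \<in> sets borel" "bounded A"
  shows "(\<lambda>x. card (Tb b x \<inter> A)) \<in> measurable (marked p) (count_space UNIV)"
  using measurable_Tin[OF A] by (cases b) auto

lemma Tb_marking:
  assumes J: "finite J" and A: "\<And>j. j \<in> J \<Longrightarrow> A j \<in> sets borel \<and> bounded (A j)"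
    and dj: "disjoint_family_on A J" and p: "0 \<le> p" "p \<le> 1"
  shows "measure (marked p) {x\<in>space (marked p). \<forall>j\<in>J. \<forall>b. card (Tb b x \<inter> A j) = k b j} =
    (\<Prod>j\<in>J. \<Prod>b\<in>UNIV. pois (lam * measure lborel (A j) * pr p b) (k b j))"
  using marking[OF J A dj p, of "k True" "k False"] by (simp add: all_bool_eq pr_def UNIV_bool mult.commute conj_commute)

text \<open>Sum the joint law over the count of the complementary family, whose Poisson weights add
  up to 1.\<close>

lemma Tb_count:
  assumes A: "A \<in> sets borel" "bounded A" and p: "0 \<le> p" "p \<le> 1"
  shows "measure (marked p) {x\<in>space (marked p). card (Tb b x \<inter> A) = k} = pois (lam * measure lborel A * pr p b) k"
proof -
  interpret Q: prob_space "marked p" by (rule prob_space_marked)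
  let ?E = "\<lambda>l. {x\<in>space (marked p). card (Tb b x \<inter> A) = k \<and> card (Tb (\<not> b) x \<inter> A) = l}"
  note [measurable] = measurable_Tb[OF A]
  have "(\<lambda>l. Q.prob (?E l)) sums Q.prob (\<Union>l. ?E l)"
    by (rule Q.finite_measure_UNION) (auto simp: disjoint_family_on_def)
  moreover have "(\<Union>l. ?E l) = {x\<in>space (marked p). card (Tb b x \<inter> A) = k}" by auto
  moreover have "Q.prob (?E l) = pois (lam * measure lborel A * pr p b) k * pois (lam * measure lborel A * pr p (\<not> b)) l" for l
    using Tb_marking[of "{()}" "\<lambda>_. A" p "\<lambda>b' _. if b' = b then k else l"] A p
    by (cases b) (simp_all add: disjoint_family_on_def all_bool_eq UNIV_bool conj_commute mult.commute)
  moreover have "(\<lambda>l. pois (lam * measure lborel A * pr p b) k * pois (lam * measure lborel A * pr p (\<not> b)) l) sums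
      (pois (lam * measure lborel A * pr p b) k * 1)" by (intro sums_mult pois_sums)
  ultimately show ?thesis using sums_unique2 by fastforce
qed

text \<open>Two layers: pairs of counts are independent across the sets \<open>A j\<close>, and for
  each \<open>j\<close> the two counts are independent of each other. An event about finitely many
  indices is regrouped accordingly by \<open>L\<close> and \<open>B\<close>.\<close>

lemma Tb_indep:
  assumes A: "\<And>j. j \<in> I \<Longrightarrow> A j \<in> sets borel \<and> bounded (A j)"
    and dj: "disjoint_family_on A I" and p: "0 \<le> p" "p \<le> 1"
  shows "prob_space.indep_vars (marked p) (\<lambda>_. count_space UNIV) (\<lambda>i x. card (Tb (fst i) x \<inter> A (snd i))) (UNIV \<times> I)"
proof -
  interpret Q: prob_space "marked p" by (rule prob_space_marked)
  let ?pi = "\<lambda>b j. pois (lam * measure lborel (A j) * pr p b)"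
  have one: "Q.prob {x\<in>space (marked p). card (Tb b x \<inter> A j) = k} = ?pi b j k" if "j \<in> I" for b j k
    using Tb_count A[OF that] p by blast
  have ms: "(\<lambda>x. card (Tb b x \<inter> A j)) \<in> measurable (marked p) (count_space UNIV)" if "j \<in> I" for b j
    using measurable_Tb A[OF that] by blast
  define Y where "Y j x b = card (Tb b x \<inter> A j)" for j x b
  let ?Yp = "\<lambda>j x. (Y j x True, Y j x False)"
  have cell: "Q.indep_vars (\<lambda>_. count_space UNIV) (\<lambda>b x. Y j x b) UNIV" if j: "j \<in> I" for j
  proof (rule Q.indep_vars_discreteI)
    show "(\<lambda>x. Y j x b) \<in> measurable (marked p) (count_space UNIV)" for b using ms[OF j] by (simp add: Y_def)
    fix B :: "bool set" and k :: "bool \<Rightarrow> nat" assume B: "B \<noteq> {}"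
    show "Q.prob {x\<in>space (marked p). \<forall>b\<in>B. Y j x b = k b} = (\<Prod>b\<in>B. Q.prob {x\<in>space (marked p). Y j x b = k b})"
    proof (cases "B = UNIV")
      case True
      then show ?thesis using Tb_marking[of "{j}" A p "\<lambda>b _. k b"] A[OF j] p one[OF j]
        by (simp add: disjoint_family_on_def Y_def)
    next
      case False
      then obtain b where "B = {b}" using B by (metis (full_types) UNIV_bool empty_iff insert_iff subset_singletonD subsetI equalityI)
      then show ?thesis by simp
    qed
  qed
  have Yp: "?Yp j \<in> measurable (marked p) (count_space UNIV)" if "j \<in> I" for j
  proof -
    note [measurable] = ms[OF that]
    have "?Yp j \<in> measurable (marked p) (count_space UNIV \<Otimes>\<^sub>M count_space UNIV)" unfolding Y_def by measurable
    then show ?thesis by (simp add: pair_measure_countable)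
  qed
  have cells: "Q.indep_vars (\<lambda>_. count_space UNIV) ?Yp I"
  proof (rule Q.indep_vars_discreteI)
    fix J and k :: "_ \<Rightarrow> nat \<times> nat" assume J: "finite J" "J \<subseteq> I"
    have e: "Q.prob {x\<in>space (marked p). \<forall>j\<in>J'. ?Yp j x = k j} = (\<Prod>j\<in>J'. ?pi True j (fst (k j)) * ?pi False j (snd (k j)))"
      if "J' \<subseteq> J" for J'
    proof -
      have "{x\<in>space (marked p). \<forall>j\<in>J'. ?Yp j x = k j} =
        {x\<in>space (marked p). \<forall>j\<in>J'. \<forall>b. card (Tb b x \<inter> A j) = (if b then fst (k j) else snd (k j))}"
        by (auto simp: Y_def prod_eq_iff all_bool_eq)
      moreover have "finite J'" using finite_subset[OF that J(1)] .
      moreover have "disjoint_family_on A J'" by (rule disjoint_family_on_mono[OF _ dj]) (use that J in blast)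
      moreover have "\<And>j. j \<in> J' \<Longrightarrow> A j \<in> sets borel \<and> bounded (A j)" using that J A by blast
      ultimately show ?thesis
        using Tb_marking[of J' A p "\<lambda>b j. if b then fst (k j) else snd (k j)"] p by (simp add: UNIV_bool mult.commute)
    qed
    show "Q.prob {x\<in>space (marked p). \<forall>j\<in>J. ?Yp j x = k j} = (\<Prod>j\<in>J. Q.prob {x\<in>space (marked p). ?Yp j x = k j})"
      unfolding e[OF subset_refl]
    proof (rule prod.cong[OF refl])
      fix j assume "j \<in> J"
      then show "?pi True j (fst (k j)) * ?pi False j (snd (k j)) = Q.prob {x\<in>space (marked p). ?Yp j x = k j}"
        using e[of "{j}"] by simp
    qed
  qed (rule Yp)
  show ?thesis
  proof (rule Q.indep_vars_discreteI)
    show "(\<lambda>x. card (Tb (fst i) x \<inter> A (snd i))) \<in> measurable (marked p) (count_space UNIV)" if "i \<in> UNIV \<times> I" for i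
      using ms that by auto
    fix J :: "(bool \<times> _) set" and k :: "bool \<times> _ \<Rightarrow> nat" assume J: "finite J" "J \<subseteq> UNIV \<times> I" "J \<noteq> {}"
    define L where "L = snd ` J"
    define B where "B j = {b. (b, j) \<in> J}" for j
    have L: "finite L" "L \<subseteq> I" "L \<noteq> {}" using J by (auto simp: L_def)
    have JS: "J = (\<lambda>(j, b). (b, j)) ` Sigma L B" by (force simp: L_def B_def)
    have sel: "(if b then Y j x True else Y j x False) = Y j x b" for j x b by simp
    have vim: "?Yp j -` {y. \<forall>b\<in>B j. (if b then fst y else snd y) = k (b, j)} = {x. \<forall>b\<in>B j. Y j x b = k (b, j)}" for j
      by (simp only: vimage_def mem_Collect_eq fst_conv snd_conv sel)
    have "{x\<in>space (marked p). \<forall>i\<in>J. card (Tb (fst i) x \<inter> A (snd i)) = k i} =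
        (\<Inter>j\<in>L. ?Yp j -` {y. \<forall>b\<in>B j. (if b then fst y else snd y) = k (b, j)} \<inter> space (marked p))"
    proof -
      have all: "(\<forall>i\<in>J. R (fst i) (snd i)) \<longleftrightarrow> (\<forall>j\<in>L. \<forall>b\<in>B j. R b j)" for R
      proof (intro iffI ballI)
        fix j b assume "\<forall>i\<in>J. R (fst i) (snd i)" "b \<in> B j"
        from bspec[OF this(1), of "(b, j)"] this(2) show "R b j" by (simp add: B_def)
      next
        fix i assume a: "\<forall>j\<in>L. \<forall>b\<in>B j. R b j" "i \<in> J"
        have "snd i \<in> L" "fst i \<in> B (snd i)" using a(2) by (simp_all add: L_def B_def)
        then show "R (fst i) (snd i)" using a(1) by simp
      qed
      have "(\<forall>i\<in>J. card (Tb (fst i) x \<inter> A (snd i)) = k i) \<longleftrightarrow> (\<forall>j\<in>L. \<forall>b\<in>B j. Y j x b = k (b, j))" for x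
        using all[of "\<lambda>b j. Y j x b = k (b, j)"] by (simp add: Y_def)
      then show ?thesis unfolding vim using Collect_ball_INT[OF L(3), of "space (marked p)" "\<lambda>j x. \<forall>b\<in>B j. Y j x b = k (b, j)"] by simp
    qed
    also have "Q.prob \<dots> = (\<Prod>j\<in>L. Q.prob (?Yp j -` {y. \<forall>b\<in>B j. (if b then fst y else snd y) = k (b, j)} \<inter> space (marked p)))"
      by (rule Q.indep_varsD_finite[OF Q.indep_vars_subset[OF cells L(2)] L(3,1)]) auto
    also have "\<dots> = (\<Prod>j\<in>L. \<Prod>b\<in>B j. Q.prob {x\<in>space (marked p). Y j x b = k (b, j)})"
    proof (rule prod.cong[OF refl])
      fix j assume j: "j \<in> L"
      have Bj: "B j \<noteq> {}" using j by (auto simp: L_def B_def)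
      have "?Yp j -` {y. \<forall>b\<in>B j. (if b then fst y else snd y) = k (b, j)} \<inter> space (marked p) =
         (\<Inter>b\<in>B j. (\<lambda>x. Y j x b) -` {k (b, j)} \<inter> space (marked p))"
        unfolding vim using Collect_ball_INT[OF Bj, of "space (marked p)" "\<lambda>b x. Y j x b = k (b, j)"]
        by (simp add: vimage_def Int_def conj_commute)
      also have "Q.prob \<dots> = (\<Prod>b\<in>B j. Q.prob ((\<lambda>x. Y j x b) -` {k (b, j)} \<inter> space (marked p)))"
        by (rule Q.indep_varsD_finite[OF Q.indep_vars_subset[OF cell]]) (use j L Bj in auto)
      finally show "Q.prob (?Yp j -` {y. \<forall>b\<in>B j. (if b then fst y else snd y) = k (b, j)} \<inter> space (marked p)) =
         (\<Prod>b\<in>B j. Q.prob {x\<in>space (marked p). Y j x b = k (b, j)})"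
        by (simp add: vimage_def Int_def conj_commute)
    qed
    also have "\<dots> = (\<Prod>(j, b)\<in>Sigma L B. Q.prob {x\<in>space (marked p). Y j x b = k (b, j)})"
      by (rule prod.Sigma) (use L in auto)
    also have "\<dots> = (\<Prod>i\<in>J. Q.prob {x\<in>space (marked p). card (Tb (fst i) x \<inter> A (snd i)) = k i})"
      unfolding JS by (subst prod.reindex) (auto simp: inj_on_def Y_def intro!: prod.cong)
    finally show "Q.prob {x\<in>space (marked p). \<forall>i\<in>J. card (Tb (fst i) x \<inter> A (snd i)) = k i} =
       (\<Prod>i\<in>J. Q.prob {x\<in>space (marked p). card (Tb (fst i) x \<inter> A (snd i)) = k i})" .
  qed
qed

lemma lf_poisson_Tb:
  assumes p: "0 < p" "p < 1"
  shows "lf_poisson (marked p) (lam * pr p b) (Tb b)"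
proof (rule poisson_ppI)
  interpret Q: prob_space "marked p" by (rule prob_space_marked)
  show "prob_space (marked p)" by (rule prob_space_marked)
  show "0 < lam * pr p b" using p lam_pos by (simp add: pr_def)
  show "loc_finite (Tb b x)" for x unfolding Tb_def by (rule loc_finite_thinned[OF lf])
  show "(\<lambda>x. card (Tb b x \<inter> A)) \<in> measurable (marked p) (count_space UNIV)" if "A \<in> sets borel" "bounded A" for A
    by (rule measurable_Tb[OF that])
  fix J :: "nat set" and A :: "nat \<Rightarrow> pt set" and k :: "nat \<Rightarrow> nat"
  assume J: "finite J" and A: "\<And>j. j \<in> J \<Longrightarrow> A j \<in> sets borel \<and> bounded (A j)" and dj: "disjoint_family_on A J"
  show "measure (marked p) {x\<in>space (marked p). \<forall>j\<in>J. card (Tb b x \<inter> A j) = k j} =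
    (\<Prod>j\<in>J. pois (lam * pr p b * measure lborel (A j)) (k j))"
  proof (cases "J = {}")
    case True
    then show ?thesis by (simp add: Q.prob_space)
  next
    case False
    have ind: "Q.indep_vars (\<lambda>_. count_space UNIV) (\<lambda>i x. card (Tb (fst i) x \<inter> A (snd i))) (UNIV \<times> J)"
      by (rule Tb_indep[OF A dj]) (use p in auto)
    have "{x\<in>space (marked p). \<forall>j\<in>J. card (Tb b x \<inter> A j) = k j} =
        (\<Inter>i\<in>{b} \<times> J. (\<lambda>x. card (Tb (fst i) x \<inter> A (snd i))) -` {k (snd i)} \<inter> space (marked p))"
      using False by auto
    also have "Q.prob \<dots> = (\<Prod>i\<in>{b} \<times> J. Q.prob ((\<lambda>x. card (Tb (fst i) x \<inter> A (snd i))) -` {k (snd i)} \<inter> space (marked p)))"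
      by (rule Q.indep_varsD_finite[OF Q.indep_vars_subset[OF ind]]) (use J False in auto)
    also have "\<dots> = (\<Prod>i\<in>{b} \<times> J. pois (lam * pr p b * measure lborel (A (snd i))) (k (snd i)))"
    proof (rule prod.cong[OF refl])
      fix i assume i: "i \<in> {b} \<times> J"
      then show "Q.prob ((\<lambda>x. card (Tb (fst i) x \<inter> A (snd i))) -` {k (snd i)} \<inter> space (marked p)) =
          pois (lam * pr p b * measure lborel (A (snd i))) (k (snd i))"
        using Tb_count[of "A (snd i)" p b "k (snd i)"] A p
        by (auto simp: vimage_def Int_def conj_commute ac_simps)
    qed
    also have "\<dots> = (\<Prod>j\<in>J. pois (lam * pr p b * measure lborel (A j)) (k j))"
      by (simp add: prod.cartesian_product' flip: prod.cartesian_product)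
    finally show ?thesis .
  qed
qed

lemma lf_poisson_thinned: "0 < p \<Longrightarrow> p < 1 \<Longrightarrow> lf_poisson (marked p) (lam * p) Tin"
  using lf_poisson_Tb[of p True] by (simp add: pr_def Tb_def[abs_def])

text \<open>\<open>gilbert_lambda_c\<close> speaks of measures on the point sets themselves. The law
  of \<open>P\<close> is put on the largest sigma-algebra that makes \<open>P\<close> measurable, so
  every measurable property of \<open>P\<close> carries over.\<close>

lemma canonical_poisson:
  obtains M' :: "pt set measure" where "poisson_pp M' lam (\<lambda>S. S)"
    "\<And>L. Measurable.pred M (\<lambda>\<omega>. L (P \<omega>)) \<Longrightarrow> AE \<omega> in M. L (P \<omega>) \<Longrightarrow> AE S in M'. L S"
proof -
  define F where "F = {A :: pt set set. P -` A \<inter> space M \<in> sets M}"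
  define M' where "M' = distr M (sigma UNIV F) P"
  have P: "P \<in> measurable M (sigma UNIV F)"
    by (rule measurable_measure_of) (auto simp: F_def)
  have pred: "{S. L S} \<in> sets (sigma UNIV F)" if "Measurable.pred M (\<lambda>\<omega>. L (P \<omega>))" for L
  proof -
    have "P -` {S. L S} \<inter> space M = {\<omega>\<in>space M. L (P \<omega>)}" by auto
    then have "{S. L S} \<in> F" using that by (simp add: F_def pred_def)
    then show ?thesis by (simp add: sets_measure_of_conv)
  qed
  have space': "space M' = UNIV" by (simp add: M'_def space_measure_of_conv)
  interpret M': prob_space M' unfolding M'_def by (rule prob_space_distr[OF P])
  have AE': "AE S in M'. L S" if L: "Measurable.pred M (\<lambda>\<omega>. L (P \<omega>))" "AE \<omega> in M. L (P \<omega>)" for L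
    unfolding M'_def using pred[OF L(1)] L(2)
    by (subst AE_distr_iff[OF P]) (simp_all add: space_measure_of_conv)
  have meas': "measure M' {S. L S} = prob {\<omega>\<in>space M. L (P \<omega>)}" if "Measurable.pred M (\<lambda>\<omega>. L (P \<omega>))" for L
    unfolding M'_def using measure_distr[OF P pred[OF that]] by (simp add: vimage_def Int_def conj_commute)
  have cnt: "Measurable.pred M (\<lambda>\<omega>. card (P \<omega> \<inter> A) = k)" if "A \<in> sets borel" "bounded A" for A k
  proof -
    note [measurable] = count_measurable[OF that]
    show ?thesis by measurable
  qed
  have ms: "(\<lambda>S. card (S \<inter> A)) \<in> measurable M' (count_space UNIV)" if A: "A \<in> sets borel" "bounded A" for A
  proof (subst measurable_count_space_eq2_countable, intro conjI ballI)
    show "(\<lambda>S. card (S \<inter> A)) -` {k} \<inter> space M' \<in> sets M'" for k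
      using pred[OF cnt[OF A]] by (simp add: space' M'_def vimage_def)
  qed auto
  have one: "M'.prob {S\<in>space M'. card (S \<inter> A) = k} = pois (lam * measure lborel A) k"
    if A: "A \<in> sets borel" "bounded A" for A k
    using meas'[OF cnt[OF A]] count_prob[OF A] by (simp add: space')
  have "M'.indep_vars (\<lambda>_. count_space UNIV) (\<lambda>i S. card (S \<inter> A i)) {..<n}"
    if A: "\<forall>i<n. A i \<in> sets lborel \<and> bounded (A i)" and dj: "disjoint_family_on A {..<n}" for n :: nat and A
  proof (rule M'.indep_vars_discreteI)
    show "(\<lambda>S. card (S \<inter> A i)) \<in> measurable M' (count_space UNIV)" if "i \<in> {..<n}" for i
      using ms[of "A i"] A that by simp
    fix J and k :: "nat \<Rightarrow> nat" assume J: "finite J" "J \<subseteq> {..<n}"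
    have "Measurable.pred M (\<lambda>\<omega>. \<forall>j\<in>J. card (P \<omega> \<inter> A j) = k j)"
      by (rule pred_intros_finite(3)[OF J(1)]) (use cnt J A in auto)
    from meas'[OF this] have "M'.prob {S\<in>space M'. \<forall>j\<in>J. card (S \<inter> A j) = k j} =
       prob {\<omega>\<in>space M. \<forall>j\<in>J. card (P \<omega> \<inter> A j) = k j}" by (simp add: space')
    also have "\<dots> = (\<Prod>j\<in>J. pois (lam * measure lborel (A j)) (k j))"
      by (rule count_joint[OF J(1) _ disjoint_family_on_mono[OF J(2) dj]]) (use J(2) A in auto)
    also have "\<dots> = (\<Prod>j\<in>J. M'.prob {S\<in>space M'. card (S \<inter> A j) = k j})"
      by (intro prod.cong refl one[symmetric]) (use J A in auto)
    finally show "M'.prob {S\<in>space M'. \<forall>j\<in>J. card (S \<inter> A j) = k j} =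
      (\<Prod>j\<in>J. M'.prob {S\<in>space M'. card (S \<inter> A j) = k j})" .
  qed
  moreover have "AE S in M'. loc_finite S" by (rule AE') (use lf in auto)
  ultimately have "poisson_pp M' lam (\<lambda>S. S)"
    unfolding poisson_pp_def using M'.prob_space_axioms lam_pos ms one by (auto simp: loc_finite_def pois_def)
  then show ?thesis using AE' that by blast
qed

section \<open>Occupied cells of a Poisson process\<close>

definition rate :: "real \<Rightarrow> real" where
  "rate s = 1 - exp (- (lam * s\<^sup>2))"

end

definition occ :: "real \<Rightarrow> pt set \<Rightarrow> site \<Rightarrow> bool" where
  "occ s S z \<longleftrightarrow> S \<inter> cell s z \<noteq> {}"

context lf_poisson
begin

lemma occ_iff: "0 < s \<Longrightarrow> occ s (P \<omega>) z \<longleftrightarrow> card (P \<omega> \<inter> cell s z) \<noteq> 0"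
  using lf bounded_cell[of s z] by (auto simp: occ_def loc_finite_def)

lemma measurable_occ: "0 < s \<Longrightarrow> Measurable.pred M (\<lambda>\<omega>. occ s (P \<omega>) z)"
proof -
  assume s: "0 < s"
  have [measurable]: "(\<lambda>\<omega>. card (P \<omega> \<inter> cell s z)) \<in> measurable M (count_space UNIV)"
    by (rule count_measurable) (use s bounded_cell in auto)
  show ?thesis unfolding occ_iff[OF s] by measurable
qed

text \<open>Counts in disjoint cells are independent and of equal law. This is the bridge from the
  point process to Bernoulli sites.\<close>

lemma distr_occ:
  assumes s: "0 < s"
  shows "distr M (Bern (rate s)) (\<lambda>\<omega>. occ s (P \<omega>)) = Bern (rate s)"
proof -
  let ?X = "\<lambda>z \<omega>. occ s (P \<omega>) z"
  have r: "0 \<le> rate s" "rate s \<le> 1" using lam_pos by (auto simp: rate_def)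
  have "indep_vars (\<lambda>_. count_space UNIV) (\<lambda>z \<omega>. card (P \<omega> \<inter> cell s z)) UNIV"
    by (rule counts_indep) (use s bounded_cell in \<open>auto simp: disjoint_family_on_def cell_def\<close>)
  then have "indep_vars (\<lambda>_. count_space UNIV) (\<lambda>z \<omega>. (\<lambda>n. n \<noteq> 0) (card (P \<omega> \<inter> cell s z))) UNIV"
    by (rule indep_vars_compose2) auto
  then have ind: "indep_vars (\<lambda>_. count_space UNIV) ?X UNIV" by (simp add: occ_iff[OF s])
  have marg: "distr M (count_space UNIV) (?X z) = measure_pmf (bernoulli_pmf (rate s))" for z
  proof (rule measure_eqI_countable[of _ "UNIV :: bool set"])
    have ms: "?X z \<in> measurable M (count_space UNIV)" by (rule measurable_occ[OF s])
    interpret D: prob_space "distr M (count_space UNIV) (?X z)" by (rule prob_space_distr[OF ms])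
    have F: "measure (distr M (count_space UNIV) (?X z)) {False} = 1 - rate s"
    proof -
      have "measure (distr M (count_space UNIV) (?X z)) {False} = prob (?X z -` {False} \<inter> space M)"
        by (rule measure_distr[OF ms]) simp
      also have "?X z -` {False} \<inter> space M = {\<omega>\<in>space M. card (P \<omega> \<inter> cell s z) = 0}"
        using occ_iff[OF s, of _ z] by blast
      also have "prob \<dots> = 1 - rate s"
        using count_prob[of "cell s z" 0] s bounded_cell by (simp add: pois_def rate_def measure_cell)
      finally show ?thesis .
    qed
    have "UNIV - {False} = {True}" by auto
    then have T: "measure (distr M (count_space UNIV) (?X z)) {True} = rate s"
      using D.prob_compl[of "{False}"] F by simp
    fix b :: bool
    show "emeasure (distr M (count_space UNIV) (?X z)) {b} = emeasure (measure_pmf (bernoulli_pmf (rate s))) {b}"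
      unfolding D.emeasure_eq_measure measure_pmf.emeasure_eq_measure measure_bernoulli[OF r]
      using F T by (cases b) auto
  qed auto
  have "distr M (PiM UNIV (\<lambda>_. count_space UNIV)) (\<lambda>x. \<lambda>i\<in>UNIV. ?X i x) = (\<Pi>\<^sub>M i\<in>UNIV. distr M (count_space UNIV) (?X i))"
    using ind by (subst (asm) indep_vars_iff_distr_eq_PiM) (auto simp: measurable_occ[OF s])
  then have "distr M (PiM UNIV (\<lambda>_. count_space UNIV)) (\<lambda>\<omega>. occ s (P \<omega>)) = Bern (rate s)"
    by (simp only: marg restrict_UNIV)
  moreover have "distr M (PiM UNIV (\<lambda>_. count_space UNIV)) (\<lambda>\<omega>. occ s (P \<omega>)) = distr M (Bern (rate s)) (\<lambda>\<omega>. occ s (P \<omega>))"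
    by (rule distr_cong) (auto intro!: sets_PiM_cong)
  ultimately show ?thesis by simp
qed

lemma measurable_occ_Bern: "0 < s \<Longrightarrow> (\<lambda>\<omega>. occ s (P \<omega>)) \<in> measurable M (Bern \<rho>)"
  by (rule measurable_PiM_single') (auto simp: measurable_occ)

lemma AE_occ_iff:
  assumes s: "0 < s" and Q: "Measurable.pred (Bern (rate s)) Q"
  shows "(AE \<omega> in M. Q (occ s (P \<omega>))) \<longleftrightarrow> (AE \<sigma> in Bern (rate s). Q \<sigma>)"
proof -
  have "(AE \<sigma> in distr M (Bern (rate s)) (\<lambda>\<omega>. occ s (P \<omega>)). Q \<sigma>) \<longleftrightarrow> (AE \<omega> in M. Q (occ s (P \<omega>)))"
    by (rule AE_distr_iff[OF measurable_occ_Bern[OF s]]) (use Q in \<open>simp add: pred_def\<close>)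
  then show ?thesis unfolding distr_occ[OF s] by simp
qed

end

section \<open>Distances between points and between cell indices\<close>

lemma dist_sq: "dist x y = sqrt ((x $ 1 - y $ 1)\<^sup>2 + (x $ 2 - y $ 2)\<^sup>2)" for x y :: pt
  by (simp add: dist_norm norm_vec_def L2_set_def UNIV_2)

lemma cell_offset:
  assumes "x \<in> cell s z" "0 < s"
  shows "0 \<le> x $ 1 / s - fst z" "x $ 1 / s - fst z < 1" "0 \<le> x $ 2 / s - snd z" "x $ 2 / s - snd z < 1"
  using assms unfolding cell_iff[OF assms(2)] by (auto simp: field_simps)

lemma sqrt_le_sqrt2:
  fixes a b :: real assumes "\<bar>a\<bar> \<le> 1" "\<bar>b\<bar> \<le> 1" shows "sqrt (a\<^sup>2 + b\<^sup>2) \<le> sqrt 2"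
proof -
  have "a\<^sup>2 \<le> 1" "b\<^sup>2 \<le> 1" using assms by (simp_all add: abs_square_le_1)
  then show ?thesis by (intro real_sqrt_le_mono) linarith
qed

text \<open>Replacing points by cell indices moves each coordinate of the rescaled difference by at
  most 1, hence its length by at most \<open>sqrt 2\<close>.\<close>

lemma cell_dist:
  assumes x: "x \<in> cell s z" and y: "y \<in> cell s w" and s: "0 < s"
  defines "d \<equiv> sqrt ((real_of_int (fst z - fst w))\<^sup>2 + (real_of_int (snd z - snd w))\<^sup>2)"
  shows "d \<le> dist x y / s + sqrt 2" "dist x y \<le> s * (d + sqrt 2)"
proof -
  define a where "a = x $ 1 / s - y $ 1 / s"
  define b where "b = x $ 2 / s - y $ 2 / s"
  define e where "e = real_of_int (fst z - fst w) - a"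
  define f where "f = real_of_int (snd z - snd w) - b"
  have ef: "\<bar>e\<bar> \<le> 1" "\<bar>f\<bar> \<le> 1"
    using cell_offset[OF x s] cell_offset[OF y s] by (auto simp: e_def f_def a_def b_def)
  have ds: "dist x y / s = sqrt (a\<^sup>2 + b\<^sup>2)"
  proof -
    have "a\<^sup>2 + b\<^sup>2 = ((x $ 1 - y $ 1)\<^sup>2 + (x $ 2 - y $ 2)\<^sup>2) / s\<^sup>2"
      by (simp add: a_def b_def diff_divide_distrib[symmetric] power_divide add_divide_distrib)
    then show ?thesis using s by (simp add: dist_sq real_sqrt_divide)
  qed
  have "d = sqrt ((a + e)\<^sup>2 + (b + f)\<^sup>2)" by (simp add: d_def e_def f_def)
  also have "\<dots> \<le> sqrt (a\<^sup>2 + b\<^sup>2) + sqrt (e\<^sup>2 + f\<^sup>2)" by (rule real_sqrt_sum_squares_triangle_ineq)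
  also have "\<dots> \<le> dist x y / s + sqrt 2" using sqrt_le_sqrt2[OF ef] ds by simp
  finally show "d \<le> dist x y / s + sqrt 2" .
  have "sqrt (a\<^sup>2 + b\<^sup>2) = sqrt ((real_of_int (fst z - fst w) + - e)\<^sup>2 + (real_of_int (snd z - snd w) + - f)\<^sup>2)"
    by (simp add: e_def f_def)
  also have "\<dots> \<le> d + sqrt ((- e)\<^sup>2 + (- f)\<^sup>2)" unfolding d_def by (rule real_sqrt_sum_squares_triangle_ineq)
  also have "\<dots> \<le> d + sqrt 2" using sqrt_le_sqrt2[OF ef] by simp
  finally have "s * (dist x y / s) \<le> s * (d + sqrt 2)" unfolding ds using s by (intro mult_left_mono) auto
  then show "dist x y \<le> s * (d + sqrt 2)" using s by simp
qed

lemma ladj_sqrt: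
  "sqrt ((real_of_int (fst z - fst w))\<^sup>2 + (real_of_int (snd z - snd w))\<^sup>2) \<le> 4 * real N \<longleftrightarrow> z = w \<or> ladj N z w"
proof -
  have "sqrt ((real_of_int (fst z - fst w))\<^sup>2 + (real_of_int (snd z - snd w))\<^sup>2) \<le> 4 * real N \<longleftrightarrow>
     (real_of_int (fst z - fst w))\<^sup>2 + (real_of_int (snd z - snd w))\<^sup>2 \<le> (4 * real N)\<^sup>2"
    using real_sqrt_le_iff[of "(real_of_int (fst z - fst w))\<^sup>2 + (real_of_int (snd z - snd w))\<^sup>2" "(4 * real N)\<^sup>2"]
    by (simp only: real_sqrt_abs abs_of_nonneg[of "4 * real N"] mult_nonneg_nonneg zero_le_numeral of_nat_0_le_iff)
  also have "\<dots> \<longleftrightarrow> real_of_int ((fst z - fst w)\<^sup>2 + (snd z - snd w)\<^sup>2) \<le> real_of_int ((4 * int N)\<^sup>2)" by simp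
  also have "\<dots> \<longleftrightarrow> (fst z - fst w)\<^sup>2 + (snd z - snd w)\<^sup>2 \<le> (4 * int N)\<^sup>2" by (rule of_int_le_iff)
  also have "\<dots> \<longleftrightarrow> z = w \<or> ladj N z w" by (auto simp: ladj_def)
  finally show ?thesis .
qed

lemma gadj_ladj:
  assumes "gadj S x y" "x \<in> cell s z" "y \<in> cell s w" "0 < s" "1 / s + sqrt 2 \<le> 4 * real N"
  shows "z = w \<or> ladj N z w"
proof -
  have "dist x y / s \<le> 1 / s" using assms by (intro divide_right_mono) (auto simp: gadj_def)
  then show ?thesis
    using cell_dist(1)[OF assms(2,3,4)] assms(5) unfolding ladj_sqrt[symmetric] by linarith
qed

lemma ladj_dist:
  assumes "z = w \<or> ladj N z w" "x \<in> cell s z" "y \<in> cell s w" "0 < s" "s * (4 * real N + sqrt 2) \<le> 1"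
  shows "dist x y \<le> 1"
proof -
  have "sqrt ((real_of_int (fst z - fst w))\<^sup>2 + (real_of_int (snd z - snd w))\<^sup>2) + sqrt 2 \<le> 4 * real N + sqrt 2"
    using assms(1) unfolding ladj_sqrt[symmetric] by simp
  then have "s * (sqrt ((real_of_int (fst z - fst w))\<^sup>2 + (real_of_int (snd z - snd w))\<^sup>2) + sqrt 2) \<le> s * (4 * real N + sqrt 2)"
    using assms(4) by (intro mult_left_mono) auto
  then show ?thesis using cell_dist(2)[OF assms(2,3,4)] assms(5) by linarith
qed

text \<open>Adjacent points lie in equal or adjacent cells, and a cell holds finitely many points,
  so an infinite component occupies infinitely many cells.\<close>

lemma inf_comp_infc:
  assumes S: "loc_finite S" and inf: "has_inf_comp S" and s: "0 < s" "1 / s + sqrt 2 \<le> 4 * real N"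
  shows "\<exists>z. infc N (occ s S) (\<lambda>_. True) z"
proof -
  obtain x where x: "x \<in> S" "infinite {y. (gadj S)\<^sup>*\<^sup>* x y}" using inf by (auto simp: has_inf_comp_def)
  let ?R = "lreach N {cellidx s x} (cfg (occ s S) (\<lambda>_. True))"
  have oc: "occ s S (cellidx s y)" if "y \<in> S" for y using that by (auto simp: occ_def cell_def)
  have reach: "y \<in> S \<and> cellidx s y \<in> ?R" if "(gadj S)\<^sup>*\<^sup>* x y" for y
    using that
  proof (induction rule: rtranclp_induct)
    case base
    show ?case using x oc[OF x(1)] unfolding lreach_def by (auto intro!: lat.reach.base)
  next
    case (step y w)
    have w: "w \<in> S" using step by (auto simp: gadj_def)
    have "cellidx s y = cellidx s w \<or> ladj N (cellidx s y) (cellidx s w)"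
      by (rule gadj_ladj[OF step(2)]) (use s in \<open>auto simp: cell_def\<close>)
    then show ?case
    proof
      assume a: "ladj N (cellidx s y) (cellidx s w)"
      have "lat.stp N (cfg (occ s S) (\<lambda>_. True)) (cellidx s y) (cellidx s w)"
        using a oc[OF w] oc[of y] step by (auto simp: lat.stp_def)
      then show ?thesis using step w unfolding lreach_def by (auto intro: lat.reach.step)
    qed (use step w in auto)
  qed
  have "infinite ?R"
  proof
    assume fin: "finite ?R"
    have "{y. (gadj S)\<^sup>*\<^sup>* x y} \<subseteq> (\<Union>z\<in>?R. S \<inter> cell s z)"
      using reach by (fastforce simp: cell_def)
    moreover have "finite (\<Union>z\<in>?R. S \<inter> cell s z)"
      by (rule finite_UN_I[OF fin]) (use S bounded_cell[OF s(1)] in \<open>simp add: loc_finite_def\<close>)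
    ultimately show False using x(2) by (meson finite_subset)
  qed
  then show ?thesis unfolding infc_def by blast
qed

section \<open>Comparison of the Gilbert graph with the lattice\<close>

text \<open>The process is made empty on a null set of outcomes that covers all failures of local
  finiteness; finite-dimensional laws are kept.\<close>

lemma poisson_pp_lf:
  assumes "poisson_pp M lam P"
  obtains P' where "lf_poisson M lam P'" "AE \<omega> in M. P' \<omega> = P \<omega>"
proof -
  interpret prob_space M using assms by (simp add: poisson_pp_def)
  have "AE \<omega> in M. loc_finite (P \<omega>)" using assms by (simp add: poisson_pp_def loc_finite_def)
  then obtain N where N: "{\<omega>\<in>space M. \<not> loc_finite (P \<omega>)} \<subseteq> N" "emeasure M N = 0" "N \<in> sets M"
    by (rule AE_E)
  define P' where "P' \<omega> = (if \<omega> \<in> N \<or> \<omega> \<notin> space M then {} else P \<omega>)" for \<omega>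
  have ae: "AE \<omega> in M. P' \<omega> = P \<omega>"
  proof (rule AE_I[OF _ N(2,3)])
    show "{\<omega>\<in>space M. P' \<omega> \<noteq> P \<omega>} \<subseteq> N" by (auto simp: P'_def)
  qed
  have lf: "loc_finite (P' \<omega>)" for \<omega>
    using N(1) by (auto simp: P'_def loc_finite_def)
  have ms: "(\<lambda>\<omega>. card (P' \<omega> \<inter> A)) \<in> measurable M (count_space UNIV)" if A: "A \<in> sets borel" "bounded A" for A
  proof -
    have [measurable]: "(\<lambda>\<omega>. card (P \<omega> \<inter> A)) \<in> measurable M (count_space UNIV)"
      using assms A by (simp add: poisson_pp_def)
    have [measurable]: "N \<in> sets M" by fact
    have "(\<lambda>\<omega>. if \<omega> \<in> N then 0 else card (P \<omega> \<inter> A)) \<in> measurable M (count_space UNIV)" by measurable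
    then show ?thesis by (rule measurable_cong[THEN iffD1, rotated]) (auto simp: P'_def)
  qed
  have ind: "indep_vars (\<lambda>_. count_space UNIV) (\<lambda>i \<omega>. card (P \<omega> \<inter> A i)) {..<n}"
    if "\<forall>i<n. A i \<in> sets lborel \<and> bounded (A i)" "disjoint_family_on A {..<n}" for n :: nat and A
    using assms[unfolded poisson_pp_def, THEN conjunct2, THEN conjunct2, THEN conjunct2, THEN conjunct2,
        THEN spec, THEN spec, of n A] that by simp
  have eqp: "prob {\<omega>\<in>space M. Q (P' \<omega>)} = prob {\<omega>\<in>space M. Q (P \<omega>)}"
    if "{\<omega>\<in>space M. Q (P' \<omega>)} \<in> events" "{\<omega>\<in>space M. Q (P \<omega>)} \<in> events" for Q
    by (rule measure_eq_AE) (use ae that in auto)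
  have one: "prob {\<omega>\<in>space M. card (P \<omega> \<inter> A) = k} = pois (lam * measure lborel A) k"
    if "A \<in> sets borel" "bounded A" for A k
    using assms that unfolding poisson_pp_def pois_def by auto
  have one': "prob {\<omega>\<in>space M. card (P' \<omega> \<inter> A) = k} = pois (lam * measure lborel A) k"
    if A: "A \<in> sets borel" "bounded A" for A k
  proof -
    have [measurable]: "(\<lambda>\<omega>. card (P \<omega> \<inter> A)) \<in> measurable M (count_space UNIV)"
      using assms A by (simp add: poisson_pp_def)
    note [measurable] = ms[OF A]
    have "prob {\<omega>\<in>space M. card (P' \<omega> \<inter> A) = k} = prob {\<omega>\<in>space M. card (P \<omega> \<inter> A) = k}"
      by (rule eqp[of "\<lambda>S. card (S \<inter> A) = k"]) measurable
    then show ?thesis using one[OF A] by simp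
  qed
  have "indep_vars (\<lambda>_. count_space UNIV) (\<lambda>i \<omega>. card (P' \<omega> \<inter> A i)) {..<n}"
    if A: "\<forall>i<n. A i \<in> sets lborel \<and> bounded (A i)" and dj: "disjoint_family_on A {..<n}" for n :: nat and A
  proof (rule indep_vars_discreteI)
    show "(\<lambda>\<omega>. card (P' \<omega> \<inter> A i)) \<in> measurable M (count_space UNIV)" if "i \<in> {..<n}" for i
      using ms A that by simp
    fix J and k :: "nat \<Rightarrow> nat" assume J: "finite J" "J \<subseteq> {..<n}" "J \<noteq> {}"
    have JA: "A j \<in> sets borel" "bounded (A j)" if "j \<in> J" for j using J(2) A that by auto
    have ev: "{\<omega>\<in>space M. \<forall>j\<in>J. card (P' \<omega> \<inter> A j) = k j} \<in> events"
      "{\<omega>\<in>space M. \<forall>j\<in>J. card (P \<omega> \<inter> A j) = k j} \<in> events"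
    proof -
      have "{\<omega>\<in>space M. card (P' \<omega> \<inter> A j) = k j} \<in> events" "{\<omega>\<in>space M. card (P \<omega> \<inter> A j) = k j} \<in> events"
        if j: "j \<in> J" for j
      proof -
        note [measurable] = ms[OF JA[OF j]]
        have [measurable]: "(\<lambda>\<omega>. card (P \<omega> \<inter> A j)) \<in> measurable M (count_space UNIV)"
          using assms JA[OF j] by (simp add: poisson_pp_def)
        show "{\<omega>\<in>space M. card (P' \<omega> \<inter> A j) = k j} \<in> events" "{\<omega>\<in>space M. card (P \<omega> \<inter> A j) = k j} \<in> events"
          by measurable
      qed
      then show "{\<omega>\<in>space M. \<forall>j\<in>J. card (P' \<omega> \<inter> A j) = k j} \<in> events"
        "{\<omega>\<in>space M. \<forall>j\<in>J. card (P \<omega> \<inter> A j) = k j} \<in> events"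
        using J(1) by (auto intro: sets.sets_Collect_finite_All)
    qed
    have "prob {\<omega>\<in>space M. \<forall>j\<in>J. card (P' \<omega> \<inter> A j) = k j} = prob {\<omega>\<in>space M. \<forall>j\<in>J. card (P \<omega> \<inter> A j) = k j}"
      by (rule eqp[of "\<lambda>S. \<forall>j\<in>J. card (S \<inter> A j) = k j", OF ev])
    also have "{\<omega>\<in>space M. \<forall>j\<in>J. card (P \<omega> \<inter> A j) = k j} = (\<Inter>j\<in>J. (\<lambda>\<omega>. card (P \<omega> \<inter> A j)) -` {k j} \<inter> space M)"
      using J(3) by auto
    also have "prob \<dots> = (\<Prod>j\<in>J. prob ((\<lambda>\<omega>. card (P \<omega> \<inter> A j)) -` {k j} \<inter> space M))"
      by (rule indep_varsD_finite[OF indep_vars_subset[OF ind[OF A dj] J(2)] J(3,1)]) auto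
    also have "\<dots> = (\<Prod>j\<in>J. prob {\<omega>\<in>space M. card (P' \<omega> \<inter> A j) = k j})"
    proof (rule prod.cong[OF refl])
      fix j assume j: "j \<in> J"
      have "(\<lambda>\<omega>. card (P \<omega> \<inter> A j)) -` {k j} \<inter> space M = {\<omega>\<in>space M. card (P \<omega> \<inter> A j) = k j}" by auto
      then show "prob ((\<lambda>\<omega>. card (P \<omega> \<inter> A j)) -` {k j} \<inter> space M) = prob {\<omega>\<in>space M. card (P' \<omega> \<inter> A j) = k j}"
        using one[OF JA[OF j]] one'[OF JA[OF j]] by simp
    qed
    finally show "prob {\<omega>\<in>space M. \<forall>j\<in>J. card (P' \<omega> \<inter> A j) = k j} =
      (\<Prod>j\<in>J. prob {\<omega>\<in>space M. card (P' \<omega> \<inter> A j) = k j})" .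
  qed
  then have "poisson_pp M lam P'"
    unfolding poisson_pp_def using prob_space_axioms lf ms one' assms by (auto simp: loc_finite_def pois_def poisson_pp_def)
  then have "lf_poisson M lam P'" using lf by unfold_locales
  then show ?thesis using that ae by blast
qed

definition rep :: "real \<Rightarrow> pt set \<Rightarrow> site \<Rightarrow> pt" where
  "rep s S z = (SOME x. x \<in> S \<inter> cell s z)"

lemma rep_in: "occ s S z \<Longrightarrow> rep s S z \<in> S \<and> rep s S z \<in> cell s z"
  unfolding occ_def rep_def using someI_ex[of "\<lambda>x. x \<in> S \<inter> cell s z"] by blast

lemma rep_inj: "occ s S z \<Longrightarrow> occ s S w \<Longrightarrow> rep s S z = rep s S w \<Longrightarrow> z = w"
  using rep_in[of s S z] rep_in[of s S w] by (auto simp: cell_def)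

text \<open>One representative point per occupied cell embeds the lattice cluster injectively into
  the Gilbert graph. Distinct bonds become distinct edges between representatives, and
  \<open>C\<close> cannot be left because it is closed under adjacency.\<close>

lemma bond_embed:
  assumes s: "0 < s" "s * (4 * real N + sqrt 2) \<le> 1" and TS: "T \<subseteq> S"
    and C: "\<And>x y. x \<in> C \<Longrightarrow> gadj S x y \<Longrightarrow> y \<in> C" and z: "rep s T z \<in> C"
    and \<eta>: "\<And>a b. occ s T a \<Longrightarrow> occ s T b \<Longrightarrow> ladj N a b \<Longrightarrow> rep s T a \<in> C \<Longrightarrow> rep s T b \<in> C \<Longrightarrow>
        \<eta> {a, b} \<Longrightarrow> \<eta>' {rep s T a, rep s T b}"
    and inf: "infc N (occ s T) \<eta> z"
  shows "bond_perc C \<eta>'"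
proof -
  let ?R = "lreach N {z} (cfg (occ s T) \<eta>)"
  let ?g = "\<lambda>a b. gadj C a b \<and> \<eta>' {a, b}"
  have oc: "occ s T v" if "v \<in> ?R" for v using that lat.reach_open unfolding lreach_def by fastforce
  have main: "rep s T v \<in> C \<and> ?g\<^sup>*\<^sup>* (rep s T z) (rep s T v)" if "v \<in> ?R" for v
    using that unfolding lreach_def
  proof (induction rule: lat.reach.induct)
    case (base u)
    then show ?case using z by auto
  next
    case (step u v)
    have a: "ladj N u v" "occ s T u" "occ s T v" "\<eta> {u, v}" using step(2) by (auto simp: lat.stp_def)
    have d: "dist (rep s T u) (rep s T v) \<le> 1"
      by (rule ladj_dist[of u v N _ s]) (use a rep_in s in auto)
    have ne: "rep s T u \<noteq> rep s T v" using rep_inj[OF a(2,3)] a(1) by (auto simp: ladj_def)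
    have in_S: "rep s T u \<in> S" "rep s T v \<in> S" using rep_in[OF a(2)] rep_in[OF a(3)] TS by auto
    have vC: "rep s T v \<in> C" using C[of "rep s T u" "rep s T v"] step.IH in_S d ne by (auto simp: gadj_def)
    have g: "?g (rep s T u) (rep s T v)"
      using step.IH vC d ne \<eta>[OF a(2,3,1) _ vC a(4)] by (auto simp: gadj_def)
    have "?g\<^sup>*\<^sup>* (rep s T z) (rep s T v)"
      by (rule rtranclp.rtrancl_into_rtrancl[where r = ?g, OF conjunct2[OF step.IH] g])
    then show ?case using vC by simp
  qed
  have "inj_on (rep s T) ?R" using rep_inj oc by (metis inj_onI)
  then have "infinite (rep s T ` ?R)" using inf finite_imageD unfolding infc_def by blast
  moreover have "rep s T ` ?R \<subseteq> {y. ?g\<^sup>*\<^sup>* (rep s T z) y}" using main by auto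
  ultimately have "infinite {y. ?g\<^sup>*\<^sup>* (rep s T z) y}" using finite_subset by blast
  then show ?thesis unfolding bond_perc_def using z by blast
qed

lemma infc_mono: "infc N \<sigma> \<eta> z \<Longrightarrow> (\<And>e. \<eta> e \<Longrightarrow> \<eta>' e) \<Longrightarrow> infc N \<sigma> \<eta>' z"
proof -
  assume a: "infc N \<sigma> \<eta> z" "\<And>e. \<eta> e \<Longrightarrow> \<eta>' e"
  have "cfg \<sigma> \<eta> \<subseteq> cfg \<sigma> \<eta>'" using a(2) by (auto simp: cfg_def split: sum.splits)
  from infinite_super[OF lreach_mono[OF subset_refl this]] a(1) show "infc N \<sigma> \<eta>' z" by (simp add: infc_def)
qed

lemma infc_open:
  assumes "infc N \<sigma> \<eta> z" shows "\<sigma> z"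
proof (rule ccontr)
  assume n: "\<not> \<sigma> z"
  have "lreach N {z} (cfg \<sigma> \<eta>) \<subseteq> {}"
    unfolding lreach_def by (rule lat.reach_least) (use n in auto)
  then show False using assms by (simp add: infc_def)
qed

lemma infc_inf_comp:
  assumes s: "0 < s" "s * (4 * real N + sqrt 2) \<le> 1" and inf: "infc N (occ s S) \<eta> z"
  shows "has_inf_comp S"
proof -
  let ?x = "rep s S z"
  define C where "C = {y. (gadj S)\<^sup>*\<^sup>* ?x y}"
  have "occ s S z" by (rule infc_open[OF inf])
  then have x: "?x \<in> S" using rep_in by blast
  have "bond_perc C (\<lambda>_. True)"
  proof (rule bond_embed[OF s subset_refl])
    show "y \<in> C" if "x \<in> C" "gadj S x y" for x y
      using that unfolding C_def by (auto intro: rtranclp.rtrancl_into_rtrancl)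
    show "rep s S z \<in> C" by (simp add: C_def)
    show "infc N (occ s S) \<eta> z" by (rule inf)
  qed simp
  then obtain y where y: "y \<in> C" "infinite {w. (gadj C)\<^sup>*\<^sup>* y w}" by (auto simp: bond_perc_def)
  have CS: "C \<subseteq> S"
  proof
    fix w assume "w \<in> C"
    then have "(gadj S)\<^sup>*\<^sup>* ?x w" by (simp add: C_def)
    then show "w \<in> S" by (cases rule: rtranclp.cases) (use x in \<open>auto simp: gadj_def\<close>)
  qed
  have "gadj C \<le> gadj S" using CS by (auto simp: gadj_def)
  from rtranclp_mono[OF this] have "{w. (gadj C)\<^sup>*\<^sup>* y w} \<subseteq> {w. (gadj S)\<^sup>*\<^sup>* y w}" by blast
  from infinite_super[OF this y(2)] have "infinite {w. (gadj S)\<^sup>*\<^sup>* y w}" .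
  then show ?thesis using y CS by (auto simp: has_inf_comp_def)
qed

text \<open>With side \<open>s_up N\<close>, adjacent points lie in equal or adjacent cells; with side \<open>s_dn N\<close>, any two
  points of adjacent cells are adjacent.\<close>

definition s_up :: "nat \<Rightarrow> real" where "s_up N = 1 / (4 * real N - sqrt 2)"
definition s_dn :: "nat \<Rightarrow> real" where "s_dn N = 1 / (4 * real N + sqrt 2)"

lemma s_pos: "1 \<le> N \<Longrightarrow> 0 < s_up N" "0 < s_dn N"
proof -
  have "sqrt 2 < 2" using real_sqrt_less_mono[of 2 4] by simp
  then show "1 \<le> N \<Longrightarrow> 0 < s_up N" by (simp add: s_up_def)
  show "0 < s_dn N" by (simp add: s_dn_def add_nonneg_pos)
qed

lemma s_up_eq: "1 \<le> N \<Longrightarrow> 1 / s_up N + sqrt 2 \<le> 4 * real N"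
  by (simp add: s_up_def)

lemma s_dn_eq: "s_dn N * (4 * real N + sqrt 2) \<le> 1"
  using s_pos(2)[of N] by (simp add: s_dn_def)

lemma lperc_site_True: "lperc N q \<sigma> \<Longrightarrow> \<exists>z. infc N \<sigma> (\<lambda>_. True) z"
proof -
  assume "lperc N q \<sigma>"
  then obtain z where z: "0 < ltheta N q \<sigma> z" by (auto simp: lperc_def)
  then have "{\<eta>. infc N \<sigma> \<eta> z} \<noteq> {}" unfolding ltheta_def by (metis emeasure_empty less_irrefl)
  then obtain \<eta> where "infc N \<sigma> \<eta> z" by auto
  then show "\<exists>z. infc N \<sigma> (\<lambda>_. True) z" using infc_mono[of N \<sigma> \<eta> z "\<lambda>_. True"] by blast
qed

section \<open>Percolating intensities and the critical intensity\<close>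

definition perc_intensities :: "real set" where
  "perc_intensities = {lam. lam > 0 \<and>
     (\<exists>M :: pt set measure. poisson_pp M lam (\<lambda>S. S) \<and> (AE S in M. has_inf_comp S))}"

lemma gilbert_le: "\<mu> \<in> perc_intensities \<Longrightarrow> gilbert_lambda_c \<le> \<mu>"
  unfolding gilbert_lambda_c_def perc_intensities_def
  by (rule cInf_lower) (auto intro!: bdd_belowI[of _ 0])

lemma inf_comp_LTheta:
  assumes "lf_poisson M lam P" and N: "1 \<le> N" and perc: "\<not> (AE \<omega> in M. \<not> has_inf_comp (P \<omega>))"
  shows "\<exists>k c. 0 < c \<and> (\<forall>n\<ge>k. c \<le> LTheta N k n (1 - exp (- (lam * (s_up N)\<^sup>2))) 1)"
proof -
  interpret lf_poisson M lam P by fact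
  let ?s = "s_up N"
  have Q: "Measurable.pred (Bern (rate ?s)) (\<lambda>\<sigma>. \<not> (\<exists>z. infc N \<sigma> (\<lambda>_. True) z))" by measurable
  have "\<not> (AE \<omega> in M. \<not> (\<exists>z. infc N (occ ?s (P \<omega>)) (\<lambda>_. True) z))"
  proof
    assume "AE \<omega> in M. \<not> (\<exists>z. infc N (occ ?s (P \<omega>)) (\<lambda>_. True) z)"
    then have "AE \<omega> in M. \<not> has_inf_comp (P \<omega>)"
    proof eventually_elim
      case (elim \<omega>)
      then show ?case using inf_comp_infc[OF lf _ s_pos(1)[OF N] s_up_eq[OF N]] by blast
    qed
    then show False using perc by simp
  qed
  then have "\<not> (AE \<sigma> in Bern (rate ?s). \<not> (\<exists>z. infc N \<sigma> (\<lambda>_. True) z))"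
    using AE_occ_iff[OF s_pos(1)[OF N] Q] by blast
  from LTheta_of_site_percolation[OF this] show ?thesis
    using lam_pos by (simp add: rate_def)
qed

lemma (in lf_poisson) lperc_occ:
  assumes c: "0 < c" "\<And>n. k \<le> n \<Longrightarrow> c \<le> LTheta N k n (rate s) q" and s: "0 < s" and q: "0 \<le> q" "q \<le> 1"
  shows "AE \<omega> in M. lperc N q (occ s (P \<omega>))"
proof (subst AE_occ_iff[OF s])
  show "AE \<sigma> in Bern (rate s). lperc N q \<sigma>"
    by (rule lperc_of_LTheta[OF c]) (use lam_pos q in \<open>auto simp: rate_def\<close>)
qed measurable

lemma LTheta_mono:
  assumes "0 < \<rho>" "\<rho> \<le> \<rho>'" "\<rho>' \<le> 1" "0 < p" "p \<le> 1"
  shows "LTheta N k n \<rho> p \<le> LTheta N k n \<rho>' p"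
proof -
  interpret F: finite_two_terminal "lbox (n + 4 * N)" "ladj N" "lbox k" "lbox (n + 4 * N) - lbox n"
    by (rule fin_lat)
  show ?thesis unfolding LTheta_def by (rule F.Theta_mono_site[OF assms])
qed

text \<open>The error of discretisation: the ratio of the areas of the two kinds of cells, and the
  factor \<open>1 + x\<close> lost in the estimate \<open>x / (1 + x) \<le> 1 - exp (- x)\<close> of
  an occupation probability.\<close>

lemma scale_limit:
  "(\<lambda>N. (s_up N / s_dn N)\<^sup>2 * (1 + a * (s_dn N)\<^sup>2)) \<longlonglongrightarrow> 1"
  "(\<lambda>N. a * (s_dn N)\<^sup>2) \<longlonglongrightarrow> 0"
  unfolding s_up_def s_dn_def by real_asymp+

text \<open>Monotonicity in the intensity through the lattice: for large \<open>N\<close> the gap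
  between \<open>\<mu>\<close> and \<open>\<mu>'\<close> outweighs the ratio of the sides
  \<open>s_up N\<close> and \<open>s_dn N\<close>. The zero-one law behind \<open>lperc_occ\<close>
  upgrades positive to full probability.\<close>

lemma inf_comp_perc_intensity:
  assumes "lf_poisson M \<mu> T" "lf_poisson M' \<mu>' T'" and lt: "\<mu> < \<mu>'"
    and perc: "\<not> (AE \<omega> in M. \<not> has_inf_comp (T \<omega>))"
  shows "\<mu>' \<in> perc_intensities"
proof -
  interpret A: lf_poisson M \<mu> T by fact
  interpret B: lf_poisson M' \<mu>' T' by fact
  have "1 < \<mu>' / \<mu>" using lt A.lam_pos by simp
  with order_tendstoD(2)[OF scale_limit(1)[of 0]]
  have "eventually (\<lambda>N. (s_up N / s_dn N)\<^sup>2 * (1 + 0 * (s_dn N)\<^sup>2) < \<mu>' / \<mu>) sequentially" by blast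
  then obtain N where N: "1 \<le> N" "(s_up N / s_dn N)\<^sup>2 < \<mu>' / \<mu>"
    by (auto simp: eventually_sequentially) (metis max.cobounded1 max.cobounded2)
  have le: "\<mu> * (s_up N)\<^sup>2 \<le> \<mu>' * (s_dn N)\<^sup>2"
    using N(2) A.lam_pos s_pos(2)[of N] by (simp add: power_divide field_simps)
  obtain k c where c: "0 < c" "\<forall>n\<ge>k. c \<le> LTheta N k n (1 - exp (- (\<mu> * (s_up N)\<^sup>2))) 1"
    using inf_comp_LTheta[OF assms(1) N(1) perc] by blast
  have "AE \<omega> in M'. lperc N 1 (occ (s_dn N) (T' \<omega>))"
  proof (rule B.lperc_occ[OF c(1)])
    fix n assume "k \<le> n"
    then have "c \<le> LTheta N k n (1 - exp (- (\<mu> * (s_up N)\<^sup>2))) 1" using c by blast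
    also have "\<dots> \<le> LTheta N k n (B.rate (s_dn N)) 1"
      by (rule LTheta_mono) (use le A.lam_pos s_pos(1)[OF N(1)] in \<open>auto simp: B.rate_def\<close>)
    finally show "c \<le> LTheta N k n (B.rate (s_dn N)) 1" .
  qed (use s_pos in auto)
  then have ae: "AE \<omega> in M'. lperc N 1 (occ (s_dn N) (T' \<omega>))" .
  obtain M2 :: "pt set measure" where M2: "poisson_pp M2 \<mu>' (\<lambda>S. S)"
    "\<And>L. Measurable.pred M' (\<lambda>\<omega>. L (T' \<omega>)) \<Longrightarrow> AE \<omega> in M'. L (T' \<omega>) \<Longrightarrow> AE S in M2. L S"
    by (rule B.canonical_poisson) (rule that; blast)
  have "AE S in M2. lperc N 1 (occ (s_dn N) S)"
    by (rule M2(2)[OF _ ae]) (intro measurable_lperc B.measurable_occ s_pos)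
  then have "AE S in M2. has_inf_comp S"
  proof eventually_elim
    case (elim S)
    then show ?case using lperc_site_True infc_inf_comp[OF s_pos(2) s_dn_eq] by blast
  qed
  then show ?thesis using M2(1) B.lam_pos unfolding perc_intensities_def by blast
qed

text \<open>Path counting for \<open>N = 2\<close>: the degree bound is
  \<open>(8 * 2 + 1) ^ 2 = 289\<close>, and a cell is occupied with probability at most
  \<open>\<mu> * (s_up 2) ^ 2\<close>.\<close>

lemma perc_intensity_lower:
  assumes "\<mu> \<in> perc_intensities"
  shows "1 / (289 * (s_up 2)\<^sup>2) \<le> \<mu>"
proof (rule ccontr)
  assume n: "\<not> ?thesis"
  obtain M :: "pt set measure" where M: "poisson_pp M \<mu> (\<lambda>S. S)" "AE S in M. has_inf_comp S"
    using assms by (auto simp: perc_intensities_def)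
  obtain P where P: "lf_poisson M \<mu> P" "AE S in M. P S = S" using poisson_pp_lf[OF M(1)] .
  interpret lf_poisson M \<mu> P by fact
  let ?s = "s_up 2"
  have s: "0 < ?s" by (rule s_pos) simp
  have "rate ?s \<le> \<mu> * ?s\<^sup>2" unfolding rate_def using exp_ge_add_one_self[of "- (\<mu> * ?s\<^sup>2)"] by linarith
  moreover have "\<mu> * ?s\<^sup>2 * 289 < 1" using n s by (simp add: field_simps)
  ultimately have "rate ?s * 289 < 1" by linarith
  then have "AE \<sigma> in Bern (rate ?s). \<not> (\<exists>z. infc 2 \<sigma> (\<lambda>_. True) z)"
    using lam_pos by (intro subcritical_site) (auto simp: rate_def)
  then have "AE \<omega> in M. \<not> (\<exists>z. infc 2 (occ ?s (P \<omega>)) (\<lambda>_. True) z)"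
    by (subst AE_occ_iff[OF s]) measurable
  with M(2) P(2) have "AE \<omega> in M. False"
  proof eventually_elim
    case (elim \<omega>)
    then show ?case using inf_comp_infc[OF lf _ s s_up_eq[of 2], of \<omega>] by auto
  qed
  then show False by simp
qed

lemma gilbert_pos:
  assumes "perc_intensities \<noteq> {}" shows "0 < gilbert_lambda_c"
proof -
  have "1 / (289 * (s_up 2)\<^sup>2) \<le> gilbert_lambda_c"
    unfolding gilbert_lambda_c_def perc_intensities_def[symmetric]
    by (rule cInf_greatest[OF assms perc_intensity_lower])
  moreover have "0 < 1 / (289 * (s_up 2)\<^sup>2)" using s_pos(1)[of 2] by simp
  ultimately show ?thesis by linarith
qed

lemma one_minus_exp_bounds:
  fixes x :: real assumes "0 \<le> x"
  shows "1 - exp (- x) \<le> x" "x / (1 + x) \<le> 1 - exp (- x)"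
proof -
  show "1 - exp (- x) \<le> x" using exp_ge_add_one_self[of "- x"] by linarith
  have "exp (- x) \<le> 1 / (1 + x)"
    using exp_ge_add_one_self[of x] assms by (simp add: exp_minus field_simps)
  then show "x / (1 + x) \<le> 1 - exp (- x)" using assms by (simp add: field_simps)
qed

text \<open>Site percolation at an intensity near \<open>gilbert_lambda_c\<close> is traded for bond
  percolation with \<open>q\<close> below \<open>ps\<close> at a larger intensity
  \<open>lam'\<close>. That \<open>lam'\<close> is still below \<open>lam\<close> leaves points in
  reserve for sprinkling.\<close>

lemma (in lf_poisson) supercritical_bond:
  assumes L: "0 < gilbert_lambda_c" "gilbert_lambda_c < lam" and ne: "perc_intensities \<noteq> {}"
  obtains q p N where "0 < q" "q < gilbert_lambda_c / lam" "0 < p" "p < 1" "2 \<le> N"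
    "AE x in marked p. lperc N q (occ (s_dn N) (Tin x))"
proof -
  define lc where "lc = gilbert_lambda_c"
  define ps where "ps = lc / lam"
  have lc: "0 < lc" "lc < lam" using L by (auto simp: lc_def)
  have ps: "0 < ps" "ps < 1" using lc by (auto simp: ps_def)
  define p2 where "p2 = (1 + ps) / 2"
  have p2: "ps < p2" "p2 < 1" using ps by (auto simp: p2_def)
  \<comment> \<open>\<open>C\<close> must precede the choice of \<open>q\<close>, because
    \<open>\<alpha>\<close> depends on \<open>C\<close> and \<open>q\<close> on
    \<open>\<alpha>\<close>. The term \<open>2 / ps\<close> serves every \<open>q\<close> above
    \<open>ps / 2\<close>, the term \<open>1 / (1 - p2)\<close> the upper end of the bond
    parameters.\<close>
  define C where "C = 1 + 2 / ps + 1 / (1 - p2)"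
  \<comment> \<open>From \<open>s_up N \<ge> 1 / (4 * N)\<close> one has
    \<open>lam0 * (s_up N) ^ 2 \<ge> lc / (16 * N ^ 2)\<close>; passing to \<open>1 - exp\<close>
    costs at most another factor 2.\<close>
  define c0 where "c0 = lc / 32"
  define K where "K = 4 * C + 4 * (16 * C ^ 3 / c0 + 16 * 81 * C ^ 3)"
  define \<alpha> where "\<alpha> = 1 - 1 / (2 * (1 + K))"
  have C1: "1 \<le> C" using ps p2 by (simp add: C_def)
  have c0: "0 < c0" using lc by (simp add: c0_def)
  have K0: "0 \<le> K" unfolding K_def using C1 c0 by simp
  have \<alpha>: "0 \<le> \<alpha>" "\<alpha> < 1" unfolding \<alpha>_def using K0 by (auto simp: field_simps)
  have lim: "((\<lambda>q. p2 * (q / p2) powr \<alpha>) \<longlongrightarrow> p2 * (ps / p2) powr \<alpha>) (at_left ps)"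
    using ps p2 by (intro tendsto_intros) auto
  \<comment> \<open>Here \<open>\<alpha> < 1\<close> enters: with \<open>\<alpha> = 1\<close> both
    sides would agree. By continuity the inequality persists for \<open>q\<close> slightly below
    \<open>ps\<close>.\<close>
  have gt: "ps < p2 * (ps / p2) powr \<alpha>"
  proof -
    have "(ps / p2) powr 1 < (ps / p2) powr \<alpha>"
      using ps p2 \<alpha> by (intro powr_less_mono') auto
    then show ?thesis using ps p2 by (simp add: field_simps)
  qed
  have "eventually (\<lambda>q. ps < p2 * (q / p2) powr \<alpha>) (at_left ps)"
    by (rule order_tendstoD(1)[OF lim gt])
  moreover have "eventually (\<lambda>q. q \<in> {ps / 2<..<ps}) (at_left ps)"
    using ps by (intro eventually_at_left_real) auto
  ultimately have "eventually (\<lambda>q. ps < p2 * (q / p2) powr \<alpha> \<and> q \<in> {ps / 2<..<ps}) (at_left ps)"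
    by eventually_elim auto
  then obtain q where q: "ps < p2 * (q / p2) powr \<alpha>" "ps / 2 < q" "q < ps"
    using eventually_happens[of _ "at_left ps"] by (auto simp: trivial_limit_at_left_real)
  have q0: "0 < q" using q ps by linarith
  \<comment> \<open>\<open>1 / \<tau>\<close> is the factor by which the density must grow to reach
    bond parameter \<open>q\<close>. The gap from \<open>ps\<close> to \<open>\<tau>\<close> is cut
    in three: below \<open>m1\<close> to have \<open>lam' < lam\<close>, between \<open>m1\<close>
    and \<open>m2\<close> to find a percolating \<open>lam0\<close> near the infimum, above
    \<open>m2\<close> for the error of discretisation.\<close>
  define \<tau> where "\<tau> = p2 * (q / p2) powr \<alpha>"
  define m1 where "m1 = (2 * ps + \<tau>) / 3"
  define m2 where "m2 = (ps + 2 * \<tau>) / 3"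
  have m: "ps < m1" "m1 < m2" "m2 < \<tau>" "0 < m1" using q ps by (auto simp: m1_def m2_def \<tau>_def)
  define lam' where "lam' = lc / m1"
  have lam': "0 < lam'" "lam' < lam"
    using lc m ps by (auto simp: lam'_def ps_def field_simps)
  have "lc < m2 * lam'" using m lc by (simp add: lam'_def field_simps)
  then obtain lam0 where lam0: "lam0 \<in> perc_intensities" "lam0 < m2 * lam'"
    using cInf_lessD[OF ne, of "m2 * lam'"]
    unfolding lc_def gilbert_lambda_c_def perc_intensities_def[symmetric] by blast
  have lam0_ge: "lc \<le> lam0" unfolding lc_def by (rule gilbert_le[OF lam0(1)])
  obtain M0 :: "pt set measure" where M0: "poisson_pp M0 lam0 (\<lambda>S. S)" "AE S in M0. has_inf_comp S"
    using lam0 by (auto simp: perc_intensities_def)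
  obtain P0 where P0: "lf_poisson M0 lam0 P0" "AE S in M0. P0 S = S" using poisson_pp_lf[OF M0(1)] .
  interpret A: lf_poisson M0 lam0 P0 by fact
  have perc0: "\<not> (AE S in M0. \<not> has_inf_comp (P0 S))"
  proof
    assume "AE S in M0. \<not> has_inf_comp (P0 S)"
    with M0(2) P0(2) have "AE S in M0. False" by eventually_elim simp
    then show False by simp
  qed
  have "1 < \<tau> / m2" using m by simp
  with order_tendstoD(2)[OF scale_limit(1)[of lam']]
  have e1: "eventually (\<lambda>N. (s_up N / s_dn N)\<^sup>2 * (1 + lam' * (s_dn N)\<^sup>2) < \<tau> / m2) sequentially" by blast
  have e2: "eventually (\<lambda>N. lam' * (s_dn N)\<^sup>2 < 1 / 2) sequentially"
    by (rule order_tendstoD(2)[OF scale_limit(2)]) simp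
  have e3: "eventually (\<lambda>N. lc \<le> 16 * (real N)\<^sup>2) sequentially" by real_asymp
  have e4: "eventually (\<lambda>N. 2 \<le> N) sequentially" by (rule eventually_ge_at_top)
  have "eventually (\<lambda>N. (s_up N / s_dn N)\<^sup>2 * (1 + lam' * (s_dn N)\<^sup>2) < \<tau> / m2 \<and> lam' * (s_dn N)\<^sup>2 < 1 / 2 \<and>
      lc \<le> 16 * (real N)\<^sup>2 \<and> 2 \<le> N) sequentially"
    using e1 e2 e3 e4 by eventually_elim auto
  then obtain N where N: "(s_up N / s_dn N)\<^sup>2 * (1 + lam' * (s_dn N)\<^sup>2) < \<tau> / m2"
    "lam' * (s_dn N)\<^sup>2 < 1 / 2" "lc \<le> 16 * (real N)\<^sup>2" "2 \<le> N"
    using eventually_happens'[OF sequentially_bot] by blast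
  have N1: "1 \<le> N" using N by simp
  note sp = s_pos(1)[OF N1] s_pos(2)[of N]
  define \<rho>0 where "\<rho>0 = 1 - exp (- (lam0 * (s_up N)\<^sup>2))"
  define \<rho>1 where "\<rho>1 = 1 - exp (- (lam' * (s_dn N)\<^sup>2))"
  have \<rho>0_hi: "\<rho>0 \<le> lam0 * (s_up N)\<^sup>2"
    unfolding \<rho>0_def by (rule one_minus_exp_bounds) (use A.lam_pos in simp)
  have \<rho>1_lo: "lam' * (s_dn N)\<^sup>2 / (1 + lam' * (s_dn N)\<^sup>2) \<le> \<rho>1"
    unfolding \<rho>1_def by (rule one_minus_exp_bounds) (use lam' in simp)
  have \<rho>1_hi: "\<rho>1 \<le> 1 / 2"
    using one_minus_exp_bounds(1)[of "lam' * (s_dn N)\<^sup>2"] N(2) lam' by (simp add: \<rho>1_def)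
  have \<rho>0_lo: "c0 / real N ^ 2 \<le> \<rho>0"
  proof -
    define y where "y = lc / (16 * (real N)\<^sup>2)"
    have y: "0 < y" "y \<le> 1" using lc N by (auto simp: y_def field_simps)
    have "0 < 4 * real N - sqrt 2" using sp(1) by (simp add: s_up_def)
    then have "1 / (4 * real N) \<le> s_up N"
      unfolding s_up_def using N1 by (intro divide_left_mono mult_pos_pos) auto
    then have "(1 / (4 * real N))\<^sup>2 \<le> (s_up N)\<^sup>2" by (intro power_mono) auto
    then have "lc * (1 / (4 * real N))\<^sup>2 \<le> lam0 * (s_up N)\<^sup>2"
      using lam0_ge lc by (intro mult_mono) auto
    then have yle: "y \<le> lam0 * (s_up N)\<^sup>2" by (simp add: y_def power_divide power_mult_distrib)
    have "c0 / real N ^ 2 = y / 2" by (simp add: c0_def y_def)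
    also have "\<dots> \<le> y / (1 + y)" using y by (intro divide_left_mono) auto
    also have "\<dots> \<le> 1 - exp (- y)" by (rule one_minus_exp_bounds) (use y in simp)
    also have "\<dots> \<le> \<rho>0" unfolding \<rho>0_def using yle by simp
    finally show ?thesis .
  qed
  have ratio: "\<rho>0 / p2 * (p2 / q) powr \<alpha> \<le> \<rho>1"
  proof -
    define x where "x = lam' * (s_dn N)\<^sup>2"
    have x: "0 < x" using lam' sp by (simp add: x_def)
    have \<tau>0: "0 < \<tau>" using m ps by linarith
    have m20: "0 < m2" using m by linarith
    have sq: "(s_up N)\<^sup>2 = (s_up N / s_dn N)\<^sup>2 * (s_dn N)\<^sup>2" using sp by (simp add: power_divide)
    have "\<rho>0 \<le> m2 * lam' * (s_up N)\<^sup>2"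
      using \<rho>0_hi lam0(2) sp by (meson less_imp_le mult_right_mono order_trans zero_le_power2)
    also have "\<dots> = m2 * x * (s_up N / s_dn N)\<^sup>2" unfolding sq x_def by (simp add: ac_simps)
    also have "\<dots> \<le> m2 * x * (\<tau> / m2 / (1 + x))"
    proof (rule mult_left_mono)
      have "(s_up N / s_dn N)\<^sup>2 * (1 + x) \<le> \<tau> / m2" using N(1) by (simp only: x_def less_imp_le)
      then show "(s_up N / s_dn N)\<^sup>2 \<le> \<tau> / m2 / (1 + x)" by (subst pos_le_divide_eq) (use x in simp_all)
    qed (use x m20 in simp)
    also have "\<dots> = \<tau> * (x / (1 + x))" using m20 by simp
    also have "\<dots> \<le> \<tau> * \<rho>1" using \<rho>1_lo \<tau>0 unfolding x_def[symmetric] by (intro mult_left_mono) auto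
    finally have le: "\<rho>0 \<le> \<tau> * \<rho>1" .
    have inv: "(p2 / q) powr \<alpha> / p2 = 1 / \<tau>"
      using q0 ps p2 by (simp add: \<tau>_def powr_divide)
    have "\<rho>0 / p2 * (p2 / q) powr \<alpha> = \<rho>0 * ((p2 / q) powr \<alpha> / p2)" by simp
    also have "\<dots> = \<rho>0 / \<tau>" unfolding inv by simp
    also have "\<dots> \<le> \<rho>1" using le \<tau>0 by (simp add: field_simps)
    finally show ?thesis .
  qed
  have Cq: "1 \<le> C * q" "1 \<le> C * (1 - p2)"
  proof -
    have "2 / ps * q \<le> C * q" using q0 p2 by (intro mult_right_mono) (auto simp: C_def)
    moreover have "1 \<le> 2 / ps * q" using q ps by (simp add: field_simps)
    ultimately show "1 \<le> C * q" by linarith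
    have "1 / (1 - p2) * (1 - p2) \<le> C * (1 - p2)" using ps p2 by (intro mult_right_mono) (auto simp: C_def)
    then show "1 \<le> C * (1 - p2)" using p2 by simp
  qed
  obtain k c where c: "0 < c" "\<forall>n\<ge>k. c \<le> LTheta N k n \<rho>0 1"
    using inf_comp_LTheta[OF P0(1) N1 perc0] unfolding \<rho>0_def by blast
  define p where "p = lam' / lam"
  have p: "0 < p" "p < 1" using lam' lam_pos by (auto simp: p_def)
  interpret T: lf_poisson "marked p" "lam * p" Tin by (rule lf_poisson_thinned) (use p in auto)
  have lp: "lam * p = lam'" using lam_pos by (simp add: p_def)
  have rate: "T.rate (s_dn N) = \<rho>1" unfolding T.rate_def \<rho>1_def unfolding lp ..
  have "AE x in marked p. lperc N q (occ (s_dn N) (Tin x))"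
  proof (rule T.lperc_occ[OF c(1)])
    fix n assume "k \<le> n"
    then have "c \<le> LTheta N k n \<rho>0 1" using c by blast
    also have "\<dots> \<le> LTheta N k n \<rho>1 q"
      by (rule LTheta_site_to_bond[where C = C and ?c0.0 = c0 and ?p2.0 = p2])
        (use q0 q p2 c0 \<rho>0_lo ratio \<rho>1_hi C1 Cq N in \<open>auto simp: \<alpha>_def K_def\<close>)
    finally show "c \<le> LTheta N k n (T.rate (s_dn N)) q" unfolding rate .
  qed (use q0 q ps sp in auto)
  then show ?thesis using that[of q p N] q0 q(3) p N(4) unfolding ps_def lc_def by blast
qed

section \<open>Sprinkling and mass transport\<close>

declare split_paired_All [simp del] split_paired_Ex [simp del]

lemma measurable_rtranclp [measurable (raw)]:
  fixes R :: "'x \<Rightarrow> 'b :: countable \<Rightarrow> 'b \<Rightarrow> bool"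
  assumes R: "\<And>a b. Measurable.pred M (\<lambda>x. R x a b)"
  shows "Measurable.pred M (\<lambda>x. (R x)\<^sup>*\<^sup>* a b)"
proof -
  note [measurable] = R
  have "Measurable.pred M (\<lambda>x. (R x ^^ n) a b)" for n a b
  proof (induction n arbitrary: b)
    case (Suc n)
    note [measurable] = Suc.IH
    show ?case by (simp add: relcompp_apply)
  qed simp
  then show ?thesis unfolding rtranclp_power by measurable
qed

lemma suminf_indicator_card:
  "(\<Sum>n. indicator A n :: ennreal) = emeasure (count_space UNIV) A"
  by (simp add: nn_integral_count_space_nat[symmetric])

section \<open>Sup distance and fully open balls\<close>

definition supd :: "site \<Rightarrow> site \<Rightarrow> nat" where
  "supd u v = nat (max \<bar>fst u - fst v\<bar> \<bar>snd u - snd v\<bar>)"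

lemma supd_commute: "supd u v = supd v u"
  by (simp add: supd_def abs_minus_commute)

lemma supd_0 [simp]: "supd u v = 0 \<longleftrightarrow> u = v"
  by (auto simp: supd_def prod_eq_iff)

lemma supd_le_iff: "supd u v \<le> r \<longleftrightarrow> \<bar>fst u - fst v\<bar> \<le> int r \<and> \<bar>snd u - snd v\<bar> \<le> int r"
  by (simp add: supd_def nat_le_iff)

lemma supd_triangle: "supd u w \<le> supd u v + supd v w"
proof -
  have "\<bar>fst u - fst v\<bar> \<le> int (supd u v)" "\<bar>snd u - snd v\<bar> \<le> int (supd u v)"
    "\<bar>fst v - fst w\<bar> \<le> int (supd v w)" "\<bar>snd v - snd w\<bar> \<le> int (supd v w)"
    using supd_le_iff[of u v "supd u v"] supd_le_iff[of v w "supd v w"] by auto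
  then show ?thesis unfolding supd_le_iff of_nat_add by (intro conjI; linarith)
qed

lemma supd_shift [simp]: "supd (u + t) (v + t) = supd u v"
  by (simp add: supd_def)

lemma finite_supd_ball: "finite {u. supd w u \<le> r}"
proof -
  have "{u. supd w u \<le> r} \<subseteq> {fst w - int r..fst w + int r} \<times> {snd w - int r..snd w + int r}"
    by (auto simp: supd_def)
  then show ?thesis by (rule finite_subset) simp
qed

lemma supd_path:
  assumes "supd w v = Suc r"
  obtains u where "supd w u = 1" "supd u v = r"
proof -
  define u where "u = (fst w + sgn (fst v - fst w), snd w + sgn (snd v - snd w))"
  have "\<bar>fst w - fst v\<bar> \<le> int (Suc r)" "\<bar>snd w - snd v\<bar> \<le> int (Suc r)"
    using assms supd_le_iff[of w v "Suc r"] by auto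
  moreover have "\<bar>a + sgn (b - a) - b\<bar> \<le> int r" if "\<bar>a - b\<bar> \<le> int (Suc r)" for a b :: int
    using that by (auto simp: sgn_if abs_if split: if_splits)
  ultimately have "supd u v \<le> r" unfolding supd_le_iff u_def by simp
  moreover have "supd w u \<le> 1" unfolding supd_le_iff u_def by (simp add: sgn_if)
  moreover have "Suc r \<le> supd w u + supd u v" using supd_triangle[of w v u] assms by simp
  ultimately have "supd w u = 1" "supd u v = r" by linarith+
  then show ?thesis using that by blast
qed

text \<open>Infinitely many centres in \<open>A\<close> can be chosen greedily with pairwise
  disjoint balls. These are full independently, each with probability at least \<open>b ^ D\<close>,
  so almost surely one of them is.\<close>

lemma AE_full_ball:
  assumes A: "infinite A" and b: "0 < b" "b \<le> 1"
  shows "AE \<sigma> in Bern b. \<exists>w\<in>A. \<forall>u. supd w u \<le> R \<longrightarrow> \<sigma> u"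
proof -
  let ?B = "\<lambda>w. {u. supd w u \<le> R}"
  let ?P = "Bern b :: (site \<Rightarrow> bool) measure"
  interpret P: prob_space ?P by (rule prob_space_Bern)
  have ex: "\<exists>w\<in>A. \<forall>i<n. 2 * R < supd (g i) w" for g :: "nat \<Rightarrow> site" and n
  proof (rule ccontr)
    assume "\<not> ?thesis"
    then have "A \<subseteq> (\<Union>i<n. {u. supd (g i) u \<le> 2 * R})" by (auto simp: not_less)
    moreover have "finite (\<Union>i<n. {u. supd (g i) u \<le> 2 * R})" 
      by (intro finite_UN_I finite_supd_ball) simp
    ultimately show False using A by (meson finite_subset)
  qed
  have "\<exists>g. \<forall>n::nat. (\<lambda>g n r. r \<in> A \<and> (\<forall>i<n. 2 * R < supd (g i) r)) g n (g n)"
  proof (rule dependent_wellorder_choice)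
    fix n :: nat and g
    show "\<exists>r. r \<in> A \<and> (\<forall>i<n. 2 * R < supd (g i) r)" using ex[of n g] by blast
  qed simp
  then obtain g where gg: "\<forall>n::nat. g n \<in> A \<and> (\<forall>i<n. 2 * R < supd (g i) (g n))" by (rule exE)
  have g: "g n \<in> A" "i < n \<Longrightarrow> 2 * R < supd (g i) (g n)" for n i
    using gg[rule_format, of n] by simp_all
  have dj: "disjoint_family_on (\<lambda>n. ?B (g n)) I" for I
    unfolding disjoint_family_on_def
  proof (intro ballI impI)
    fix m n :: nat assume "m \<noteq> n"
    then have far: "2 * R < supd (g m) (g n)"
      using g(2)[of m n] g(2)[of n m] supd_commute[of "g m" "g n"] by (cases "m < n") auto
    show "?B (g m) \<inter> ?B (g n) = {}"
    proof (rule equals0I)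
      fix u assume "u \<in> ?B (g m) \<inter> ?B (g n)"
      then show False using supd_triangle[of "g m" "g n" u] supd_commute[of u "g n"] far by simp
    qed
  qed
  define D where "D = (2 * R + 1)\<^sup>2"
  have cB: "card (?B w) \<le> D" for w
  proof -
    have "?B w \<subseteq> {fst w - int R..fst w + int R} \<times> {snd w - int R..snd w + int R}"
      by (auto simp: supd_def)
    from card_mono[OF _ this] show ?thesis
      by (simp add: D_def power2_eq_square nat_add_distrib nat_mult_distrib)
  qed
  define F where "F n = {\<sigma>. \<forall>j<n. \<not> (\<forall>u\<in>?B (g j). \<sigma> u)}" for n :: nat
  have pF: "P.prob (F n) \<le> (1 - b ^ D) ^ n" for n
  proof -
    let ?K = "\<Union>j<n. ?B (g j)"
    let ?Q = "\<lambda>S. \<forall>j<n. \<not> (?B (g j) \<subseteq> S)"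
    have fK: "finite ?K" by (intro finite_UN_I finite_supd_ball) simp
    have "F n = {\<sigma>. ?Q {k\<in>?K. \<sigma> k}}" unfolding F_def by (auto simp: subset_iff)
    then have "P.prob (F n) = bern_expect ?K (\<lambda>_. b) (\<lambda>S. of_bool (?Q S))"
      using measure_PiM_finite_event[OF fK, of "\<lambda>_. b" ?Q] b by simp
    also have "\<dots> = bern_expect ?K (\<lambda>_. b) (\<lambda>S. \<Prod>j\<in>{..<n}. (\<lambda>j S. of_bool (\<not> ?B (g j) \<subseteq> S)) j (S \<inter> ?B (g j)))"
    proof -
      have "of_bool (\<forall>j<n. \<not> (?B (g j) \<subseteq> S)) = (\<Prod>j\<in>{..<n}. of_bool (\<not> ?B (g j) \<subseteq> S) :: real)" for S
        by (induction n) (auto simp: less_Suc_eq)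
      then show ?thesis by simp
    qed
    also have "\<dots> = (\<Prod>j\<in>{..<n}. bern_expect (?B (g j)) (\<lambda>_. b) (\<lambda>S. of_bool (\<not> ?B (g j) \<subseteq> S)))"
      by (rule bern_expect_prod) (use finite_supd_ball dj in auto)
    also have "\<dots> \<le> (\<Prod>j\<in>{..<n}. 1 - b ^ D)"
    proof (rule prod_mono, intro conjI)
      fix j
      let ?L = "?B (g j)"
      have fL: "finite ?L" by (rule finite_supd_ball)
      show "0 \<le> bern_expect ?L (\<lambda>_. b) (\<lambda>S. of_bool (\<not> ?L \<subseteq> S))"
        unfolding bern_expect_def using b by (intro sum_nonneg mult_nonneg_nonneg bern_weight_nonneg) auto
      have "bern_expect ?L (\<lambda>_. b) (\<lambda>S. of_bool (\<not> ?L \<subseteq> S)) + bern_expect ?L (\<lambda>_. b) (\<lambda>S. of_bool (card S = card ?L)) =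
          bern_expect ?L (\<lambda>_. b) (\<lambda>S. 1)"
        unfolding bern_expect_add[symmetric] unfolding bern_expect_def
      proof (rule sum.cong[OF refl])
        fix S assume S: "S \<in> Pow ?L"
        have "card S = card ?L \<longleftrightarrow> ?L \<subseteq> S"
        proof
          assume c: "card S = card ?L"
          have "S = ?L" by (rule card_subset_eq[OF fL _ c]) (use S in simp)
          then show "?L \<subseteq> S" by (rule equalityD2)
        next
          assume "?L \<subseteq> S"
          with S have "S = ?L" by (intro equalityI) simp_all
          then show "card S = card ?L" by (rule arg_cong)
        qed
        then show "bern_weight ?L (\<lambda>_. b) S * (of_bool (\<not> ?L \<subseteq> S) + of_bool (card S = card ?L)) = bern_weight ?L (\<lambda>_. b) S * 1"
          by simp
      qed
      moreover have "bern_expect ?L (\<lambda>_. b) (\<lambda>S. 1) = 1"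
        using measure_PiM_finite_event[OF fL, of "\<lambda>_. b" "\<lambda>_. True"] b P.prob_space by simp
      moreover have "b ^ D \<le> b ^ card ?L" using b cB by (intro power_decreasing) auto
      ultimately show "bern_expect ?L (\<lambda>_. b) (\<lambda>S. of_bool (\<not> ?L \<subseteq> S)) \<le> 1 - b ^ D"
        using bern_expect_binomial[OF fL, of b "card ?L"] by simp
    qed
    finally show ?thesis by simp
  qed
  have "(\<lambda>n. (1 - b ^ D) ^ n) \<longlonglongrightarrow> 0"
    using b power_le_one[of b D] by (intro LIMSEQ_power_zero) auto
  let ?Z = "{\<sigma>. \<forall>j. \<not> (\<forall>u\<in>?B (g j). \<sigma> u)}"
  have Zs: "?Z \<in> sets ?P"
  proof -
    have [measurable]: "Measurable.pred ?P (\<lambda>\<sigma>. \<sigma> u)" for u by measurable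
    have "Measurable.pred ?P (\<lambda>\<sigma>. \<forall>j. \<not> (\<forall>u\<in>?B (g j). \<sigma> u))" unfolding Ball_def by measurable
    then show ?thesis by (simp add: pred_def)
  qed
  have Fs: "F n \<in> sets ?P" for n
  proof -
    have "Measurable.pred ?P (\<lambda>\<sigma>. \<forall>j. j < n \<longrightarrow> \<not> (\<forall>u\<in>?B (g j). \<sigma> u))" unfolding Ball_def by measurable
    then show ?thesis by (simp add: pred_def F_def)
  qed
  have "P.prob ?Z \<le> (1 - b ^ D) ^ n" for n
    by (rule order_trans[OF P.finite_measure_mono[OF _ Fs] pF]) (auto simp: F_def)
  with \<open>(\<lambda>n. (1 - b ^ D) ^ n) \<longlonglongrightarrow> 0\<close> have "P.prob ?Z \<le> 0" by (intro LIMSEQ_le_const) auto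
  then have "P.prob ?Z = 0" by (rule antisym[OF _ measure_nonneg])
  then have "AE \<sigma> in ?P. \<sigma> \<notin> ?Z" using Zs by (subst (asm) P.prob_eq_0) auto
  then show ?thesis
  proof eventually_elim
    case (elim \<sigma>)
    then show ?case using g(1) by blast
  qed
qed

section \<open>Product measures with coordinates mapped, shifted or resampled\<close>

lemma distr_PiM_map:
  assumes M: "prob_space M" and f: "f \<in> measurable M N" and N: "distr M N f = N"
  shows "distr (PiM UNIV (\<lambda>_::'i. M)) (PiM UNIV (\<lambda>_. N)) (\<lambda>\<omega> i. f (\<omega> i)) = PiM UNIV (\<lambda>_. N)"
proof -
  interpret M: prob_space M by fact
  interpret N: prob_space N using M.prob_space_distr[OF f] N by simp
  interpret PM: product_prob_space "\<lambda>_::'i. M" UNIV by unfold_locales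
  interpret PN: product_prob_space "\<lambda>_::'i. N" UNIV by unfold_locales
  have m: "(\<lambda>\<omega> i. f (\<omega> i)) \<in> measurable (PiM UNIV (\<lambda>_::'i. M)) (PiM UNIV (\<lambda>_. N))"
    using f measurable_space[OF f]
    by (intro measurable_PiM_single') (auto simp: space_PiM PiE_iff intro!: measurable_compose[OF _ f])
  show ?thesis
  proof (rule PN.PiM_eq)
    fix J :: "'i set" and F assume J: "finite J" "\<And>j. j \<in> J \<Longrightarrow> F j \<in> sets N"
    have e: "prod_emb UNIV (\<lambda>_. N) J (Pi\<^sub>E J F) = {\<omega>\<in>space (PiM UNIV (\<lambda>_. N)). \<forall>j\<in>J. \<omega> j \<in> F j}"
      using J(2)[THEN sets.sets_into_space] by (auto simp: prod_emb_def space_PiM PiE_iff)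
    have sN: "prod_emb UNIV (\<lambda>_. N) J (Pi\<^sub>E J F) \<in> sets (PiM UNIV (\<lambda>_. N))"
      by (rule sets_PiM_I) (use J in auto)
    have "emeasure (distr (PiM UNIV (\<lambda>_::'i. M)) (PiM UNIV (\<lambda>_. N)) (\<lambda>\<omega> i. f (\<omega> i))) (prod_emb UNIV (\<lambda>_. N) J (Pi\<^sub>E J F)) =
       emeasure (PiM UNIV (\<lambda>_::'i. M)) {\<omega>\<in>space (PiM UNIV (\<lambda>_. M)). \<forall>j\<in>J. \<omega> j \<in> f -` F j \<inter> space M}"
      unfolding emeasure_distr[OF m sN]
      by (rule arg_cong[where f = "emeasure _"])
        (use measurable_space[OF f] in \<open>auto simp: e space_PiM PiE_iff\<close>)
    also have "\<dots> = (\<Prod>j\<in>J. emeasure M (f -` F j \<inter> space M))"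
      by (rule PM.emeasure_PiM_Collect) (use J measurable_sets[OF f] in auto)
    also have "\<dots> = (\<Prod>j\<in>J. emeasure N (F j))"
    proof (rule prod.cong[OF refl])
      fix j assume "j \<in> J"
      then show "emeasure M (f -` F j \<inter> space M) = emeasure N (F j)"
        using emeasure_distr[OF f J(2)[of j]] N by simp
    qed
    finally show "emeasure (distr (PiM UNIV (\<lambda>_::'i. M)) (PiM UNIV (\<lambda>_. N)) (\<lambda>\<omega> i. f (\<omega> i))) (prod_emb UNIV (\<lambda>_. N) J (Pi\<^sub>E J F)) =
       (\<Prod>j\<in>J. emeasure N (F j))" .
  qed simp
qed

lemma distr_PiM_shift:
  assumes M: "prob_space M" and b: "bij (g :: 'i \<Rightarrow> 'i)"
  shows "distr (PiM UNIV (\<lambda>_. M)) (PiM UNIV (\<lambda>_. M)) (\<lambda>\<omega> i. \<omega> (g i)) = PiM UNIV (\<lambda>_. M)"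
  using distr_PiM_reindex[of UNIV "\<lambda>_. M" g UNIV] M b by (simp add: bij_is_inj restrict_UNIV)

text \<open>Resampling the coordinates in a fixed set \<open>A\<close> from an independent copy
  preserves the law. In \<open>AE_not_many''\<close> that set depends on the first field only, which
  is held fixed.\<close>

lemma distr_PiM_merge:
  assumes M: "prob_space M"
  shows "distr (PiM UNIV (\<lambda>_. M) \<Otimes>\<^sub>M PiM UNIV (\<lambda>_. M)) (PiM UNIV (\<lambda>_. M)) (\<lambda>x i. if i \<in> A then snd x i else fst x i)
    = PiM (UNIV :: 'i set) (\<lambda>_. M)" (is "distr ?P ?Q ?h = ?Q")
proof -
  interpret M: prob_space M by fact
  interpret Q: prob_space ?Q by (intro prob_space_PiM M)
  interpret PM: product_prob_space "\<lambda>_::'i. M" UNIV by unfold_locales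
  have m: "?h \<in> measurable ?P ?Q"
  proof (rule measurable_PiM_single')
    fix i show "(\<lambda>x. if i \<in> A then snd x i else fst x i) \<in> measurable ?P M" by (cases "i \<in> A") auto
  qed (auto simp: space_pair_measure space_PiM PiE_iff)
  show ?thesis
  proof (rule PM.PiM_eq)
    fix J :: "'i set" and F assume J: "finite J" "\<And>j. j \<in> J \<Longrightarrow> F j \<in> sets M"
    have sQ: "prod_emb UNIV (\<lambda>_. M) J (Pi\<^sub>E J F) \<in> sets ?Q" by (rule sets_PiM_I) (use J in auto)
    let ?C = "\<lambda>I. {\<omega>\<in>space ?Q. \<forall>j\<in>I. \<omega> j \<in> F j}"
    have C: "?C I \<in> sets ?Q" if "I \<subseteq> J" for I
    proof (rule sets.sets_Collect_finite_All)
      fix j assume "j \<in> I"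
      then have "(\<lambda>\<omega>. \<omega> j) -` F j \<inter> space ?Q \<in> sets ?Q"
        using J that by (intro measurable_sets[OF measurable_component_singleton]) auto
      then show "{\<omega>\<in>space ?Q. \<omega> j \<in> F j} \<in> sets ?Q" by (simp add: vimage_def Int_def conj_commute)
    qed (use J that finite_subset in auto)
    have "?h -` prod_emb UNIV (\<lambda>_. M) J (Pi\<^sub>E J F) \<inter> space ?P = ?C (J - A) \<times> ?C (J \<inter> A)"
      using J(2)[THEN sets.sets_into_space]
      by (auto simp: prod_emb_def space_PiM PiE_iff space_pair_measure split: if_splits)
    then have "emeasure (distr ?P ?Q ?h) (prod_emb UNIV (\<lambda>_. M) J (Pi\<^sub>E J F)) = emeasure ?P (?C (J - A) \<times> ?C (J \<inter> A))"
      by (simp add: emeasure_distr[OF m sQ])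
    also have "\<dots> = emeasure ?Q (?C (J - A)) * emeasure ?Q (?C (J \<inter> A))"
      by (rule Q.emeasure_pair_measure_Times) (intro C; auto)+
    also have "\<dots> = (\<Prod>j\<in>J - A. emeasure M (F j)) * (\<Prod>j\<in>J \<inter> A. emeasure M (F j))"
      by (intro arg_cong2[where f = times] PM.emeasure_PiM_Collect) (use J in auto)
    also have "\<dots> = (\<Prod>j\<in>J. emeasure M (F j))"
      using prod.Int_Diff[OF J(1), of "\<lambda>j. emeasure M (F j)" A] by (simp add: mult.commute)
    finally show "emeasure (distr ?P ?Q ?h) (prod_emb UNIV (\<lambda>_. M) J (Pi\<^sub>E J F)) = (\<Prod>j\<in>J. emeasure M (F j))" .
  qed simp
qed

text \<open>Abstract setting for the last step. A site carries the contents of its cell: a first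
  component, of law \<open>\<nu>'\<close>, for the retained points and a second, of law
  \<open>\<nu>''\<close>, for the removed ones. \<open>I\<close> reads the first field alone, so the
  second can be resampled near \<open>I\<close> without moving it.\<close>

locale sprinkling =
  fixes \<nu>' \<nu>'' :: "'c measure"
    and D :: "site \<Rightarrow> site \<Rightarrow> 'c \<times> 'c \<Rightarrow> 'c \<times> 'c \<Rightarrow> bool"
    and o' o'' :: "'c \<Rightarrow> bool"
    and I :: "(site \<Rightarrow> bool) \<Rightarrow> site \<Rightarrow> bool"
  assumes \<nu>': "prob_space \<nu>'" and \<nu>'': "prob_space \<nu>''"
    and D_measurable: "\<And>z w. Measurable.pred ((\<nu>' \<Otimes>\<^sub>M \<nu>'') \<Otimes>\<^sub>M (\<nu>' \<Otimes>\<^sub>M \<nu>'')) (\<lambda>x. D z w (fst x) (snd x))"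
    and D_sym: "\<And>z w c d. D z w c d \<Longrightarrow> D w z d c"
    and D_shift: "\<And>z w v c d. D (z + v) (w + v) c d \<longleftrightarrow> D z w c d"
    and D_occ: "\<And>z w c d. D z w c d \<Longrightarrow> o' (fst c) \<or> o'' (snd c)"
    and D_near: "\<And>z w c d. supd z w = 1 \<Longrightarrow> o' (fst c) \<or> o'' (snd c) \<Longrightarrow> o' (fst d) \<or> o'' (snd d) \<Longrightarrow> D z w c d"
    and o'_measurable: "Measurable.pred \<nu>' o'" and o''_measurable: "Measurable.pred \<nu>'' o''"
    and o''_pos: "0 < measure \<nu>'' {c\<in>space \<nu>''. o'' c}"
    and I_measurable: "\<And>z. Measurable.pred (PiM UNIV (\<lambda>_. count_space UNIV)) (\<lambda>\<sigma>. I \<sigma> z)"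
    and I_shift: "\<And>\<sigma> z v. I (\<lambda>u. \<sigma> (u - v)) (z + v) \<longleftrightarrow> I \<sigma> z"
    and I_ne: "AE f in PiM UNIV (\<lambda>_. \<nu>'). \<exists>z. I (\<lambda>u. o' (f u)) z"
begin

abbreviation "F' \<equiv> PiM (UNIV :: site set) (\<lambda>_. \<nu>')"
abbreviation "F'' \<equiv> PiM (UNIV :: site set) (\<lambda>_. \<nu>'')"

definition G :: "(site \<Rightarrow> 'c) \<Rightarrow> (site \<Rightarrow> 'c) \<Rightarrow> site \<Rightarrow> site \<Rightarrow> bool" where
  "G f h z w \<longleftrightarrow> D z w (f z, h z) (f w, h w)"

definition near :: "nat \<Rightarrow> (site \<Rightarrow> 'c) \<Rightarrow> site \<Rightarrow> bool" where
  "near r f w \<longleftrightarrow> (\<exists>v. I (\<lambda>u. o' (f u)) v \<and> supd w v \<le> r)"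

definition lev :: "nat \<Rightarrow> (site \<Rightarrow> 'c) \<Rightarrow> (site \<Rightarrow> 'c) \<Rightarrow> site \<Rightarrow> bool" where
  "lev r f h z \<longleftrightarrow> (\<forall>w. (G f h)\<^sup>*\<^sup>* z w \<longrightarrow> \<not> near r f w)"

text \<open>Under \<open>lev r\<close> such a \<open>w\<close> is at distance exactly
  \<open>Suc r\<close> from \<open>I\<close>, the minimum over the component.\<close>

definition mini :: "nat \<Rightarrow> (site \<Rightarrow> 'c) \<Rightarrow> (site \<Rightarrow> 'c) \<Rightarrow> site \<Rightarrow> site \<Rightarrow> bool" where
  "mini r f h z w \<longleftrightarrow> (G f h)\<^sup>*\<^sup>* z w \<and> near (Suc r) f w"

lemma G_measurable [measurable (raw)]:
  assumes [measurable]: "f \<in> measurable M F'" "h \<in> measurable M F''"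
  shows "Measurable.pred M (\<lambda>x. G (f x) (h x) z w)"
proof -
  have [measurable]: "(\<lambda>x. f x z) \<in> measurable M \<nu>'" "(\<lambda>x. h x z) \<in> measurable M \<nu>''" for z
    by measurable
  have "(\<lambda>x. ((f x z, h x z), (f x w, h x w))) \<in> measurable M ((\<nu>' \<Otimes>\<^sub>M \<nu>'') \<Otimes>\<^sub>M (\<nu>' \<Otimes>\<^sub>M \<nu>''))" by measurable
  from measurable_compose[OF this D_measurable[of z w]] show ?thesis by (simp add: G_def)
qed

lemma I_measurable' [measurable (raw)]:
  assumes [measurable]: "f \<in> measurable M F'"
  shows "Measurable.pred M (\<lambda>x. I (\<lambda>u. o' (f x u)) z)"
proof -
  note [measurable] = o'_measurable
  have "(\<lambda>x u. o' (f x u)) \<in> measurable M (PiM UNIV (\<lambda>_. count_space UNIV))"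
    by (rule measurable_PiM_single') auto
  from measurable_compose[OF this I_measurable] show ?thesis .
qed

lemma near_measurable [measurable (raw)]:
  assumes [measurable]: "f \<in> measurable M F'"
  shows "Measurable.pred M (\<lambda>x. near r (f x) w)"
  unfolding near_def by measurable

lemma lev_measurable [measurable (raw)]:
  assumes [measurable]: "f \<in> measurable M F'" "h \<in> measurable M F''"
  shows "Measurable.pred M (\<lambda>x. lev r (f x) (h x) z)"
  unfolding lev_def by measurable

lemma mini_measurable [measurable (raw)]:
  assumes [measurable]: "f \<in> measurable M F'" "h \<in> measurable M F''"
  shows "Measurable.pred M (\<lambda>x. mini r (f x) (h x) z w)"
  unfolding mini_def by measurable

lemma G_sym: "G f h z w \<Longrightarrow> G f h w z"
  unfolding G_def by (rule D_sym)

lemma conn_sym: "(G f h)\<^sup>*\<^sup>* z w \<Longrightarrow> (G f h)\<^sup>*\<^sup>* w z"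
  using G_sym by (metis sympD sympI symp_rtranclp)

lemma lev_conn: "lev r f h z \<Longrightarrow> (G f h)\<^sup>*\<^sup>* z w \<Longrightarrow> lev r f h w"
  unfolding lev_def by (meson rtranclp_trans)

lemma conn_iff: "(G f h)\<^sup>*\<^sup>* z w \<Longrightarrow> (G f h)\<^sup>*\<^sup>* z v \<longleftrightarrow> (G f h)\<^sup>*\<^sup>* w v"
  by (meson conn_sym rtranclp_trans)

text \<open>A list instead of a cardinality keeps the bound a countable existential, so that the
  event is measurable.\<close>

definition few :: "nat \<Rightarrow> nat \<Rightarrow> (site \<Rightarrow> 'c) \<Rightarrow> (site \<Rightarrow> 'c) \<Rightarrow> site \<Rightarrow> bool" where
  "few r k f h z \<longleftrightarrow> infinite {w. (G f h)\<^sup>*\<^sup>* z w} \<and> lev r f h z \<and>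
     (\<exists>xs. length xs \<le> k \<and> (\<forall>w. mini r f h z w \<longrightarrow> w \<in> set xs))"

lemma few_measurable [measurable (raw)]:
  assumes [measurable]: "f \<in> measurable M F'" "h \<in> measurable M F''"
  shows "Measurable.pred M (\<lambda>x. few r k (f x) (h x) z)"
  unfolding few_def infinite_iff_box Bex_def mem_Collect_eq by measurable

lemma few_conn:
  assumes "few r k f h z" "(G f h)\<^sup>*\<^sup>* z w"
  shows "few r k f h w"
proof -
  have "{v. (G f h)\<^sup>*\<^sup>* z v} = {v. (G f h)\<^sup>*\<^sup>* w v}" using conn_iff[OF assms(2)] by blast
  moreover have "mini r f h z v \<longleftrightarrow> mini r f h w v" for v using conn_iff[OF assms(2)] by (simp add: mini_def)
  ultimately show ?thesis using assms(1) lev_conn[OF _ assms(2)] unfolding few_def by simp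
qed

definition shift :: "site \<Rightarrow> (site \<Rightarrow> 'c) \<Rightarrow> site \<Rightarrow> 'c" where
  "shift v f = (\<lambda>u. f (u - v))"

lemma G_shift: "G (shift v f) (shift v h) (z + v) (w + v) \<longleftrightarrow> G f h z w"
  by (simp add: G_def shift_def D_shift)

lemma conn_shift_le: "(G f h)\<^sup>*\<^sup>* z w \<Longrightarrow> (G (shift v f) (shift v h))\<^sup>*\<^sup>* (z + v) (w + v)"
proof (induction rule: rtranclp_induct)
  case (step y u)
  then show ?case using G_shift by (meson rtranclp.rtrancl_into_rtrancl)
qed simp

lemma shift_shift: "shift (- v) (shift v f) = f"
  by (simp add: shift_def)

lemma conn_shift: "(G (shift v f) (shift v h))\<^sup>*\<^sup>* (z + v) (w + v) \<longleftrightarrow> (G f h)\<^sup>*\<^sup>* z w"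
  using conn_shift_le[of f h z w v] conn_shift_le[of "shift v f" "shift v h" "z + v" "w + v" "- v"]
  by (auto simp: shift_shift)

lemma near_shift: "near r (shift v f) (w + v) \<longleftrightarrow> near r f w"
proof -
  have "near r (shift v f) (w + v) \<longleftrightarrow> (\<exists>u. I (\<lambda>x. o' (shift v f x)) (u + v) \<and> supd (w + v) (u + v) \<le> r)"
    unfolding near_def by (metis diff_add_cancel)
  also have "\<dots> \<longleftrightarrow> near r f w"
    using I_shift[of "\<lambda>x. o' (f x)" v] by (simp add: near_def shift_def)
  finally show ?thesis .
qed

lemma all_shift: "(\<forall>w::site. Q w) \<longleftrightarrow> (\<forall>w. Q (w + v))"
  by (metis diff_add_cancel)

lemma mini_shift: "mini r (shift v f) (shift v h) (z + v) (w + v) \<longleftrightarrow> mini r f h z w"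
  by (simp add: mini_def conn_shift near_shift)

lemma lev_shift: "lev r (shift v f) (shift v h) (z + v) \<longleftrightarrow> lev r f h z"
  unfolding lev_def by (subst all_shift[of _ v]) (simp add: conn_shift near_shift)

lemma few_shift_le: "few r k f h z \<Longrightarrow> few r k (shift v f) (shift v h) (z + v)"
proof -
  assume a: "few r k f h z"
  then obtain xs where xs: "length xs \<le> k" "\<forall>w. mini r f h z w \<longrightarrow> w \<in> set xs" by (auto simp: few_def)
  have sub: "(\<lambda>w. w + v) ` {w. (G f h)\<^sup>*\<^sup>* z w} \<subseteq> {w. (G (shift v f) (shift v h))\<^sup>*\<^sup>* (z + v) w}"
    by (intro image_subsetI) (simp add: conn_shift)
  have inj: "inj_on (\<lambda>w. w + v) {w. (G f h)\<^sup>*\<^sup>* z w}" by (simp add: inj_on_def)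
  have "infinite ((\<lambda>w. w + v) ` {w. (G f h)\<^sup>*\<^sup>* z w})"
    unfolding finite_image_iff[OF inj] using a by (simp add: few_def)
  from infinite_super[OF sub this] have "infinite {w. (G (shift v f) (shift v h))\<^sup>*\<^sup>* (z + v) w}" .
  moreover have "\<forall>w. mini r (shift v f) (shift v h) (z + v) w \<longrightarrow> w \<in> set (map (\<lambda>w. w + v) xs)"
    by (subst all_shift[of _ v]) (use xs(2) in \<open>auto simp: mini_shift\<close>)
  ultimately show ?thesis using a xs(1) lev_shift unfolding few_def
    by (intro conjI exI[of _ "map (\<lambda>w. w + v) xs"]) auto
qed

lemma few_shift: "few r k (shift v f) (shift v h) (z + v) \<longleftrightarrow> few r k f h z"
  using few_shift_le[of r k f h z v] few_shift_le[of r k "shift v f" "shift v h" "z + v" "- v"]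
  by (auto simp: shift_shift)

sublocale F': prob_space F' by (intro prob_space_PiM \<nu>')
sublocale F'': prob_space F'' by (intro prob_space_PiM \<nu>'')
sublocale F: pair_prob_space F' F'' ..

lemma distr_shift:
  "distr (F' \<Otimes>\<^sub>M F'') (F' \<Otimes>\<^sub>M F'') (\<lambda>(f, h). (shift v f, shift v h)) = F' \<Otimes>\<^sub>M F''"
proof -
  have b: "bij (\<lambda>u::site. u - v)" by (rule bij_betw_byWitness[where f' = "\<lambda>u. u + v"]) auto
  have d: "distr F' F' (shift v) = F'" "distr F'' F'' (shift v) = F''"
    unfolding shift_def by (intro distr_PiM_shift \<nu>' \<nu>'' b)+
  have m: "shift v \<in> measurable F' F'" "shift v \<in> measurable F'' F''"
    unfolding shift_def by (rule measurable_PiM_single'; auto simp: space_PiM PiE_iff)+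
  have "sigma_finite_measure (distr F'' F'' (shift v))" unfolding d by unfold_locales
  from pair_measure_distr[OF m this] show ?thesis unfolding d by simp
qed

lemma emeasure_shift:
  assumes Q: "Measurable.pred (F' \<Otimes>\<^sub>M F'') (\<lambda>x. Q (fst x) (snd x))"
  shows "emeasure (F' \<Otimes>\<^sub>M F'') {x\<in>space (F' \<Otimes>\<^sub>M F''). Q (shift v (fst x)) (shift v (snd x))} =
    emeasure (F' \<Otimes>\<^sub>M F'') {x\<in>space (F' \<Otimes>\<^sub>M F''). Q (fst x) (snd x)}"
proof -
  let ?P = "F' \<Otimes>\<^sub>M F''" and ?h = "\<lambda>(f, h). (shift v f, shift v h)"
  have m: "shift v \<in> measurable F' F'" "shift v \<in> measurable F'' F''"
    unfolding shift_def by (rule measurable_PiM_single'; auto simp: space_PiM PiE_iff)+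
  have hm: "?h \<in> measurable ?P ?P" using m by measurable
  have "emeasure ?P {x\<in>space ?P. Q (fst x) (snd x)} = emeasure (distr ?P ?P ?h) {x\<in>space ?P. Q (fst x) (snd x)}"
    by (simp only: distr_shift)
  also have "\<dots> = emeasure ?P (?h -` {x\<in>space ?P. Q (fst x) (snd x)} \<inter> space ?P)"
    by (rule emeasure_distr[OF hm]) (use Q in \<open>simp add: pred_def\<close>)
  also have "?h -` {x\<in>space ?P. Q (fst x) (snd x)} \<inter> space ?P =
      {x\<in>space ?P. Q (shift v (fst x)) (shift v (snd x))}"
    using measurable_space[OF hm] by auto
  finally show ?thesis by simp
qed

text \<open>Mass transport: every site of a component with at most \<open>k\<close> sites closest to \<open>I\<close> sends unit mass to
  each of these; a closest site would then receive infinite mass while every site sends at most \<open>k\<close>.\<close>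

lemma AE_not_few: "AE x in F' \<Otimes>\<^sub>M F''. \<forall>z w. \<not> (few r k (fst x) (snd x) z \<and> mini r (fst x) (snd x) z w)"
proof -
  let ?P = "F' \<Otimes>\<^sub>M F''"
  define m where "m z w x \<longleftrightarrow> few r k (fst x) (snd x) z \<and> mini r (fst x) (snd x) z w" for z w x
  have [measurable]: "Measurable.pred ?P (m z w)" for z w unfolding m_def by measurable
  define p where "p z w = emeasure ?P {x\<in>space ?P. m z w x}" for z w
  have p_shift: "p (z + v) (w + v) = p z w" for z w v
  proof -
    have ms: "Measurable.pred ?P (\<lambda>x. few r k (fst x) (snd x) (z + v) \<and> mini r (fst x) (snd x) (z + v) (w + v))"
      by measurable
    from emeasure_shift[OF ms, of v] show ?thesis
      by (simp add: p_def m_def few_shift mini_shift)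
  qed
  define e where "e = (from_nat_into UNIV :: nat \<Rightarrow> site)"
  have bij: "bij e" unfolding e_def using bij_betw_from_nat_into[OF _ infinite_sites] by simp
  have int: "(\<integral>\<^sup>+x. (\<Sum>n. indicator {n. Q n x} n) \<partial>?P) = (\<Sum>n. emeasure ?P {x\<in>space ?P. Q n x})"
    if [measurable]: "\<And>n. Measurable.pred ?P (Q n)" for Q
  proof -
    have "(\<integral>\<^sup>+x. (\<Sum>n. indicator {n. Q n x} n) \<partial>?P) = (\<integral>\<^sup>+x. (\<Sum>n. indicator {x\<in>space ?P. Q n x} x) \<partial>?P)"
      by (intro nn_integral_cong suminf_cong) (auto split: split_indicator)
    also have "\<dots> = (\<Sum>n. \<integral>\<^sup>+x. indicator {x\<in>space ?P. Q n x} x \<partial>?P)"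
      by (rule nn_integral_suminf) measurable
    also have "\<dots> = (\<Sum>n. emeasure ?P {x\<in>space ?P. Q n x})"
      by (intro suminf_cong nn_integral_indicator) measurable
    finally show ?thesis .
  qed
  have out: "(\<Sum>n. indicator {n. m 0 (- e n) x} n) \<le> ennreal (real k)" for x
  proof (cases "few r k (fst x) (snd x) 0")
    case True
    then obtain xs where xs: "length xs \<le> k" "\<forall>w. mini r (fst x) (snd x) 0 w \<longrightarrow> w \<in> set xs" by (auto simp: few_def)
    let ?A = "{n. m 0 (- e n) x}"
    have inj: "inj_on (\<lambda>n. - e n) ?A" using bij by (auto simp: inj_on_def bij_def)
    have sub: "(\<lambda>n. - e n) ` ?A \<subseteq> set xs" using xs(2) by (auto simp: m_def)
    have fin: "finite ?A" using finite_imageD[OF finite_subset[OF sub] inj] by simp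
    have "card ?A = card ((\<lambda>n. - e n) ` ?A)" using card_image[OF inj] by simp
    also have "\<dots> \<le> card (set xs)" by (rule card_mono[OF _ sub]) simp
    also have "\<dots> \<le> k" using card_length[of xs] xs(1) by linarith
    finally show ?thesis unfolding suminf_indicator_card using fin by (simp add: ennreal_of_nat_eq_real_of_nat)
  next
    case False
    then show ?thesis by (simp add: m_def)
  qed
  have inn: "m 0 0 x \<Longrightarrow> (\<Sum>n. indicator {n. m (e n) 0 x} n) = (\<infinity> :: ennreal)" for x
  proof -
    assume m0: "m 0 0 x"
    let ?C = "{w. (G (fst x) (snd x))\<^sup>*\<^sup>* 0 w}"
    have "m w 0 x" if "w \<in> ?C" for w
      using m0 that few_conn[of r k "fst x" "snd x" 0 w] conn_sym[of "fst x" "snd x" 0 w] unfolding m_def mini_def by blast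
    then have sub: "e -` ?C \<subseteq> {n. m (e n) 0 x}" by blast
    have "infinite (e -` ?C)"
    proof
      assume "finite (e -` ?C)"
      then have "finite (e ` (e -` ?C))" by simp
      then have "finite ?C" unfolding surj_image_vimage_eq[OF bij_is_surj[OF bij]] .
      then show False using m0 by (simp add: m_def few_def)
    qed
    from infinite_super[OF sub this] have "infinite {n. m (e n) 0 x}" .
    then show ?thesis unfolding suminf_indicator_card by simp
  qed
  \<comment> \<open>Shift invariance equates the expected mass received by 0 with the expected mass
    sent by 0, which is at most \<open>k\<close>. As reception is infinite wherever
    \<open>m 0 0\<close> holds, that event is null.\<close>
  have "\<infinity> * p 0 0 = (\<integral>\<^sup>+x. \<infinity> * indicator {x\<in>space ?P. m 0 0 x} x \<partial>?P)"
    unfolding p_def by (rule nn_integral_cmult_indicator[symmetric]) measurable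
  also have "\<dots> \<le> (\<integral>\<^sup>+x. (\<Sum>n. indicator {n. m (e n) 0 x} n) \<partial>?P)"
    by (rule nn_integral_mono) (auto simp: inn split: split_indicator)
  also have "\<dots> = (\<Sum>n. p (e n) 0)" unfolding p_def by (rule int) measurable
  also have "\<dots> = (\<Sum>n. p 0 (- e n))"
    using p_shift[of 0 "e n" "- e n" for n] by (intro suminf_cong) simp
  also have "\<dots> = (\<integral>\<^sup>+x. (\<Sum>n. indicator {n. m 0 (- e n) x} n) \<partial>?P)" unfolding p_def by (rule int[symmetric]) measurable
  also have "\<dots> \<le> (\<integral>\<^sup>+x. ennreal (real k) \<partial>?P)" by (rule nn_integral_mono) (rule out)
  also have "\<dots> < \<infinity>" by (simp add: F.emeasure_space_1 ennreal_mult_less_top)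
  finally have "p 0 0 = 0" by (cases "p 0 0 = 0") (auto simp: ennreal_top_mult)
  then have "p w w = 0" for w using p_shift[of 0 w 0] by simp
  then have "AE x in ?P. \<not> m w w x" for w
    unfolding p_def by (subst AE_iff_measurable[OF _ refl]) (auto simp: pred_def)
  then have "AE x in ?P. \<forall>w. \<not> m w w x" by (simp add: AE_all_countable)
  then show ?thesis
  proof eventually_elim
    case (elim x)
    show ?case
    proof (intro allI notI)
      fix z w assume a: "few r k (fst x) (snd x) z \<and> mini r (fst x) (snd x) z w"
      then have "(G (fst x) (snd x))\<^sup>*\<^sup>* z w" by (simp add: mini_def)
      then have "m w w x" using a few_conn unfolding m_def mini_def by blast
      then show False using elim by blast
    qed
  qed
qed

lemma AE_full_ball'':
  assumes A: "infinite A"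
  shows "AE h in F''. \<exists>w\<in>A. \<forall>u. supd w u \<le> R \<longrightarrow> o'' (h u)"
proof -
  interpret N: prob_space \<nu>'' by (rule \<nu>'')
  define b where "b = measure \<nu>'' {c\<in>space \<nu>''. o'' c}"
  have b: "0 < b" "b \<le> 1" using o''_pos by (auto simp: b_def)
  let ?B = "measure_pmf (bernoulli_pmf b)"
  have om: "o'' \<in> measurable \<nu>'' ?B" using o''_measurable by simp
  have d: "distr \<nu>'' ?B o'' = ?B"
  proof (rule measure_eqI_countable[of _ "UNIV :: bool set"])
    interpret Q: prob_space "distr \<nu>'' ?B o''" by (rule N.prob_space_distr[OF om])
    have "measure (distr \<nu>'' ?B o'') {True} = measure \<nu>'' (o'' -` {True} \<inter> space \<nu>'')" by (rule measure_distr[OF om]) simp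
    also have "o'' -` {True} \<inter> space \<nu>'' = {c\<in>space \<nu>''. o'' c}" by auto
    finally have T: "measure (distr \<nu>'' ?B o'') {True} = b" by (simp add: b_def)
    have "UNIV - {True} = {False}" by auto
    then have F: "measure (distr \<nu>'' ?B o'') {False} = 1 - b" using Q.prob_compl[of "{True}"] T by simp
    fix c show "emeasure (distr \<nu>'' ?B o'') {c} = emeasure ?B {c}"
      unfolding Q.emeasure_eq_measure measure_pmf.emeasure_eq_measure using T F b
      by (cases c) (simp_all add: measure_bernoulli)
  qed auto
  have m: "(\<lambda>h i. o'' (h i)) \<in> measurable F'' (Bern b)"
    using o''_measurable by (intro measurable_PiM_single') (auto intro!: measurable_compose[OF _ o''_measurable])
  have "AE \<sigma> in distr F'' (Bern b) (\<lambda>h i. o'' (h i)). \<exists>w\<in>A. \<forall>u. supd w u \<le> R \<longrightarrow> \<sigma> u"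
    unfolding distr_PiM_map[OF \<nu>'' om d] by (rule AE_full_ball[OF A b])
  from AE_distrD[OF m this] show ?thesis .
qed

text \<open>From \<open>w\<close> take a shortest path in the sup distance to a closest site of
  \<open>I\<close>. After the start it runs within distance \<open>r\<close> of \<open>I\<close>,
  where \<open>h\<close> takes the values \<open>h2\<close>, all occupied; consecutive occupied
  neighbours are linked by \<open>D_near\<close>.\<close>

lemma sprinkle_connect:
  fixes f h1 h2 r
  defines "h \<equiv> \<lambda>i. if near r f i then h2 i else h1 i"
  assumes w: "near (Suc r) f w" "\<not> near r f w" and full: "\<And>u. supd w u \<le> Suc r \<Longrightarrow> o'' (h2 u)"
    and occ: "o' (f w) \<or> o'' (h w)"
  shows "\<exists>v. (G f h)\<^sup>*\<^sup>* w v \<and> near r f v"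
proof -
  obtain v where v: "I (\<lambda>u. o' (f u)) v" "supd w v \<le> Suc r" using w(1) by (auto simp: near_def)
  have "\<not> supd w v \<le> r" using w(2) v(1) by (auto simp: near_def)
  then have wv: "supd w v = Suc r" using v(2) by simp
  have "\<exists>u. supd u v = Suc r - j \<and> supd w u \<le> j \<and> (G f h)\<^sup>*\<^sup>* w u \<and> (o' (f u) \<or> o'' (h u))" if "j \<le> Suc r" for j
    using that
  proof (induction j)
    case 0
    show ?case using wv occ by (intro exI[of _ w]) auto
  next
    case (Suc j)
    then obtain u where u: "supd u v = Suc (r - j)" "supd w u \<le> j" "(G f h)\<^sup>*\<^sup>* w u" "o' (f u) \<or> o'' (h u)"
      by (auto simp: Suc_diff_le)
    obtain u' where u': "supd u u' = 1" "supd u' v = r - j" using supd_path[OF u(1)] .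
    have le: "supd w u' \<le> Suc j" using supd_triangle[of w u' u] u(2) u'(1) by simp
    have "near r f u'" unfolding near_def by (rule exI[of _ v]) (use v(1) u'(2) in simp)
    then have o: "o'' (h u')" using full[of u'] le Suc.prems by (simp add: h_def)
    have "G f h u u'" unfolding G_def by (rule D_near[OF u'(1)]) (use u(4) o in simp_all)
    then have "(G f h)\<^sup>*\<^sup>* w u'" using u(3) by (rule rtranclp.rtrancl_into_rtrancl[rotated])
    then show ?case using u' le o by (intro exI[of _ u']) simp
  qed
  from this[of "Suc r"] obtain u where "supd u v = 0" "(G f h)\<^sup>*\<^sup>* w u" by auto
  moreover have "near r f v" unfolding near_def by (rule exI[of _ v]) (use v(1) in \<open>simp add: supd_0[THEN iffD2, OF refl]\<close>)
  ultimately show ?thesis by auto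
qed

definition many :: "nat \<Rightarrow> (site \<Rightarrow> 'c) \<Rightarrow> (site \<Rightarrow> 'c) \<Rightarrow> site \<Rightarrow> bool" where
  "many r f h z \<longleftrightarrow> lev r f h z \<and> infinite {w. mini r f h z w}"

lemma many_measurable [measurable (raw)]:
  assumes [measurable]: "f \<in> measurable M F'" "h \<in> measurable M F''"
  shows "Measurable.pred M (\<lambda>x. many r (f x) (h x) z)"
  unfolding many_def infinite_iff_box Bex_def mem_Collect_eq by measurable

text \<open>The second field is resampled within distance \<open>r\<close> of \<open>I\<close>. A
  component with \<open>lev r\<close> never enters this region, so its closest sites are fixed
  before the new values \<open>h2\<close> are drawn; if they are infinitely many, some have a full
  ball of new values, and \<open>sprinkle_connect\<close> contradicts \<open>lev r\<close>.\<close>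

lemma AE_not_many'':
  assumes f: "f \<in> space F'"
  shows "AE h in F''. \<forall>z. \<not> many r f h z"
proof -
  let ?merge = "\<lambda>x i. if i \<in> {w. near r f w} then snd x i else fst x i"
  let ?P = "F'' \<Otimes>\<^sub>M F''"
  interpret P: pair_prob_space F'' F'' ..
  \<comment> \<open>The graph outside the region to be resampled: it is the same for
    \<open>h1\<close> and for the merged field.\<close>
  define GN where "GN h z w \<longleftrightarrow> G f h z w \<and> \<not> near r f z \<and> \<not> near r f w" for h z w
  define A where "A z h = {w. (GN h)\<^sup>*\<^sup>* z w \<and> near (Suc r) f w}" for z h
  have [measurable]: "Measurable.pred M (\<lambda>x. G f (g x) z w)" if "g \<in> measurable M F''" for M g z w
    using G_measurable[of "\<lambda>_. f" M g z w] f that by simp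
  have GNm[measurable]: "Measurable.pred M (\<lambda>x. GN (g x) z w)" if [measurable]: "g \<in> measurable M F''" for M g z w
    unfolding GN_def by measurable
  have Am[measurable]: "Measurable.pred M (\<lambda>x. w \<in> A z (g x))" if [measurable]: "g \<in> measurable M F''" for M g z w
    unfolding A_def mem_Collect_eq by measurable
  have "AE h1 in F''. AE h2 in F''. \<forall>z. infinite (A z h1) \<longrightarrow> (\<exists>w\<in>A z h1. \<forall>u. supd w u \<le> Suc r \<longrightarrow> o'' (h2 u))"
  proof (rule AE_I2)
    fix h1
    have "AE h2 in F''. infinite (A z h1) \<longrightarrow> (\<exists>w\<in>A z h1. \<forall>u. supd w u \<le> Suc r \<longrightarrow> o'' (h2 u))" for z
      using AE_full_ball''[of "A z h1" "Suc r"] by (cases "infinite (A z h1)") auto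
    then show "AE h2 in F''. \<forall>z. infinite (A z h1) \<longrightarrow> (\<exists>w\<in>A z h1. \<forall>u. supd w u \<le> Suc r \<longrightarrow> o'' (h2 u))"
      by (simp add: AE_all_countable)
  qed
  then have "AE x in ?P. \<forall>z. infinite (A z (fst x)) \<longrightarrow> (\<exists>w\<in>A z (fst x). \<forall>u. supd w u \<le> Suc r \<longrightarrow> o'' (snd x u))"
  proof (intro P.AE_pair_measure)
    note [measurable] = o''_measurable
    have [measurable]: "Measurable.pred ?P (\<lambda>x. w \<in> A z (fst x))" for w z by (rule Am) measurable
    have [measurable]: "Measurable.pred ?P (\<lambda>x. o'' (snd x u))" for u by measurable
    show "{x\<in>space ?P. \<forall>z. infinite (A z (fst x)) \<longrightarrow> (\<exists>w\<in>A z (fst x). \<forall>u. supd w u \<le> Suc r \<longrightarrow> o'' (snd x u))} \<in> sets ?P"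
      unfolding infinite_iff_box Bex_def by measurable
  qed auto
  then have "AE x in ?P. \<forall>z. \<not> many r f (?merge x) z"
  proof eventually_elim
    case (elim x)
    obtain h1 h2 where x: "x = (h1, h2)" by (cases x)
    define h where "h = (\<lambda>i. if near r f i then h2 i else h1 i)"
    have mh: "?merge x = h" by (rule ext) (simp add: x h_def)
    have GNh: "GN h = GN h1" by (intro ext) (simp add: GN_def G_def h_def)
    show ?case unfolding mh
    proof (intro allI notI)
      fix z assume mz: "many r f h z"
      then have lv: "lev r f h z" and inf: "infinite {w. mini r f h z w}" by (auto simp: many_def)
      have cN: "(GN h)\<^sup>*\<^sup>* z w" if "(G f h)\<^sup>*\<^sup>* z w" for w
        using that
      proof (induction rule: rtranclp_induct)
        case (step y w)
        have "\<not> near r f y" "\<not> near r f w"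
          using lv step(1,2) unfolding lev_def by (meson rtranclp.rtrancl_into_rtrancl)+
        then have "GN h y w" using step(2) by (simp add: GN_def)
        then show ?case using step.IH by (rule rtranclp.rtrancl_into_rtrancl[rotated])
      qed simp
      have "{w. mini r f h z w} \<subseteq> A z h1" using cN by (auto simp: mini_def A_def GNh)
      from infinite_super[OF this inf] elim obtain w where
        w: "w \<in> A z h1" "\<And>u. supd w u \<le> Suc r \<Longrightarrow> o'' (h2 u)" by (auto simp: x)
      have "GN h \<le> G f h" by (auto simp: GN_def)
      from rtranclp_mono[OF this] have cw: "(G f h)\<^sup>*\<^sup>* z w" using w(1) by (auto simp: A_def GNh)
      have nw: "near (Suc r) f w" "\<not> near r f w" using w(1) lv cw by (auto simp: A_def lev_def)
      \<comment> \<open>An unoccupied site has no neighbour in \<open>G\<close>, so its component is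
        just itself. Infinitely many closest sites force \<open>w\<close> to have a neighbour and
        hence, by \<open>D_occ\<close>, to be occupied.\<close>
      have "\<exists>v. (G f h)\<^sup>*\<^sup>* w v \<and> v \<noteq> w"
      proof (rule ccontr)
        assume n: "\<not> ?thesis"
        have "{v. mini r f h z v} \<subseteq> {w}"
          using n conn_iff[OF cw] by (auto simp: mini_def)
        then show False using inf finite_subset by blast
      qed
      then obtain v where v: "(G f h)\<^sup>*\<^sup>* w v" "v \<noteq> w" by blast
      from v(1) v(2) obtain y where "G f h w y" by (auto elim: converse_rtranclpE)
      then have occ: "o' (f w) \<or> o'' (h w)" using D_occ[of w y "(f w, h w)" "(f y, h y)"] by (simp add: G_def)
      obtain v where "(G f h)\<^sup>*\<^sup>* w v" "near r f v"
        using sprinkle_connect[OF nw w(2), of "\<lambda>u. u" h1] occ unfolding h_def by auto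
      then show False using lv cw unfolding lev_def by (meson rtranclp_trans)
    qed
  qed
  moreover have mm: "?merge \<in> measurable ?P F''"
  proof (rule measurable_PiM_single')
    fix i show "(\<lambda>x. ?merge x i) \<in> measurable ?P \<nu>''" by (cases "near r f i") auto
  qed (auto simp: space_pair_measure space_PiM PiE_iff)
  moreover have "{h\<in>space F''. \<forall>z. \<not> many r f h z} \<in> sets F''"
  proof -
    have [measurable]: "Measurable.pred F'' (\<lambda>h. many r f h z)" for z
      using many_measurable[of "\<lambda>_. f" F'' "\<lambda>h. h" r z] f by simp
    show ?thesis by measurable
  qed
  ultimately have "AE h in distr ?P F'' ?merge. \<forall>z. \<not> many r f h z" by (subst AE_distr_iff) auto
  then show ?thesis unfolding distr_PiM_merge[OF \<nu>''] .
qed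

lemma AE_not_many: "AE x in F' \<Otimes>\<^sub>M F''. \<forall>z. \<not> many r (fst x) (snd x) z"
proof (rule F.AE_pair_measure)
  show "AE f in F'. AE h in F''. \<forall>z. \<not> many r (fst (f, h)) (snd (f, h)) z"
    using AE_not_many'' by (auto intro!: AE_I2)
qed measurable

theorem AE_infinite_component_meets_I:
  "AE x in F' \<Otimes>\<^sub>M F''. \<forall>z. infinite {w. (G (fst x) (snd x))\<^sup>*\<^sup>* z w} \<longrightarrow>
     (\<exists>w. (G (fst x) (snd x))\<^sup>*\<^sup>* z w \<and> I (\<lambda>u. o' (fst x u)) w)"
proof -
  let ?P = "F' \<Otimes>\<^sub>M F''"
  have "AE x in ?P. \<exists>z. I (\<lambda>u. o' (fst x u)) z"
  proof (rule F.AE_pair_measure)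
    show "AE f in F'. AE h in F''. \<exists>z. I (\<lambda>u. o' (fst (f, h) u)) z" using I_ne by simp
  qed measurable
  moreover have "AE x in ?P. \<forall>r k z w. \<not> (few r k (fst x) (snd x) z \<and> mini r (fst x) (snd x) z w)"
    by (intro AE_all_countable[THEN iffD2] allI AE_not_few[unfolded AE_all_countable, THEN spec, THEN spec])
  moreover have "AE x in ?P. \<forall>r z. \<not> many r (fst x) (snd x) z"
    unfolding AE_all_countable[where P = "\<lambda>r x. \<forall>z. \<not> many r (fst x) (snd x) z"] using AE_not_many by blast
  ultimately show ?thesis
  proof eventually_elim
    case (elim x)
    obtain f h where x: "x = (f, h)" by (cases x)
    show ?case unfolding x fst_conv snd_conv
    proof (intro allI impI)
      fix z assume inf: "infinite {w. (G f h)\<^sup>*\<^sup>* z w}"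
      show "\<exists>w. (G f h)\<^sup>*\<^sup>* z w \<and> I (\<lambda>u. o' (f u)) w"
      proof (rule ccontr)
        assume n: "\<not> ?thesis"
        obtain v where v: "I (\<lambda>u. o' (f u)) v" using elim(1) by (auto simp: x)
        \<comment> \<open>The distance of the component from \<open>I\<close> is
          \<open>Suc r\<close>: it is finite because \<open>I\<close> is nonempty, and not 0 by
          assumption.\<close>
        define Q where "Q r \<longleftrightarrow> (\<exists>w. (G f h)\<^sup>*\<^sup>* z w \<and> near r f w)" for r
        have "Q (supd z v)" unfolding Q_def near_def using v by blast
        then have QL: "Q (LEAST r. Q r)" by (rule LeastI)
        have "\<not> Q 0" using n by (auto simp: Q_def near_def)
        then obtain r where r: "(LEAST r. Q r) = Suc r" using QL by (cases "LEAST r. Q r") auto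
        have "\<not> Q r" by (rule not_less_Least) (simp add: r)
        then have lv: "lev r f h z" by (auto simp: lev_def Q_def)
        obtain w where w: "mini r f h z w" using QL unfolding r by (auto simp: Q_def mini_def)
        have "\<not> many r f h z" using elim(3) by (auto simp: x)
        then have fin: "finite {w. mini r f h z w}" using lv by (auto simp: many_def)
        obtain xs where xs: "set xs = {w. mini r f h z w}" using finite_list[OF fin] by blast
        have "few r (length xs) f h z" unfolding few_def using inf lv xs by (intro conjI exI[of _ xs]) auto
        then show False using elim(2) w by (auto simp: x)
      qed
    qed
  qed
qed

end

section \<open>Independent cell configurations\<close>

definition Wn :: "nat \<Rightarrow> site set" where "Wn m = {0..<2 ^ m} \<times> {0..<2 ^ m}"
definition scl :: "nat \<Rightarrow> site \<Rightarrow> site" where "scl m z = (2 ^ m * fst z, 2 ^ m * snd z)"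
text \<open>The index of the dyadic square \<open>k\<close> levels up; \<open>div\<close> rounds
  down, as the floor in \<open>cellidx\<close> does, so negative indices are treated
  correctly.\<close>

definition par :: "nat \<Rightarrow> site \<Rightarrow> site" where "par k a = (fst a div 2 ^ k, snd a div 2 ^ k)"

text \<open>The dyadic occupation pattern of \<open>T\<close> in the cell \<open>z\<close>, in coordinates relative to \<open>z\<close>: its law for a
  Poisson process does not depend on \<open>z\<close>.\<close>

definition enc :: "real \<Rightarrow> pt set \<Rightarrow> site \<Rightarrow> nat \<times> site \<Rightarrow> bool" where
  "enc s T z = (\<lambda>(m, a). a \<in> Wn m \<and> occ (s / 2 ^ m) T (a + scl m z))"

lemma finite_Wn [simp]: "finite (Wn m)"
  by (simp add: Wn_def)

lemma cellidx_par: "cellidx (s / 2 ^ m) x = par k (cellidx (s / 2 ^ (m + k)) x)"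
proof -
  have "\<lfloor>y / (s / 2 ^ m)\<rfloor> = \<lfloor>y / (s / 2 ^ (m + k))\<rfloor> div 2 ^ k" for y
  proof -
    have "y / (s / 2 ^ m) = (y / (s / 2 ^ (m + k))) / real_of_int (2 ^ k)" by (simp add: power_add)
    then show ?thesis using floor_divide_real_eq_div[of "2 ^ k" "y / (s / 2 ^ (m + k))"] by simp
  qed
  then show ?thesis by (simp add: cellidx_def par_def)
qed

lemma par_shift: "par k (a + scl (m + k) z) = par k a + scl m z"
proof -
  have "(y + 2 ^ (m + k) * t) div 2 ^ k = y div 2 ^ k + 2 ^ m * t" for y t :: int
  proof -
    have "y + 2 ^ (m + k) * t = y + 2 ^ k * (2 ^ m * t)" by (simp add: power_add)
    then show ?thesis unfolding \<open>_ = y + 2 ^ k * (2 ^ m * t)\<close> by (subst div_mult_self2) auto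
  qed
  then show ?thesis by (simp add: par_def scl_def prod_eq_iff)
qed

lemma par_Wn: "par k a \<in> Wn m \<longleftrightarrow> a \<in> Wn (m + k)"
proof -
  have "0 \<le> y div 2 ^ k \<and> y div 2 ^ k < 2 ^ m \<longleftrightarrow> 0 \<le> y \<and> y < 2 ^ (m + k)" for y :: int
  proof -
    have "y div 2 ^ k < 2 ^ m \<longleftrightarrow> y < 2 ^ m * 2 ^ k"
    proof
      assume "y div 2 ^ k < 2 ^ m"
      then have "(y div 2 ^ k + 1) * 2 ^ k \<le> 2 ^ m * 2 ^ k" by (intro mult_right_mono) auto
      moreover have "y = y div 2 ^ k * 2 ^ k + y mod 2 ^ k" "y mod 2 ^ k < 2 ^ k" by (simp_all only: div_mult_mod_eq pos_mod_bound zero_less_power zero_less_numeral)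
      ultimately show "y < 2 ^ m * 2 ^ k" unfolding distrib_right mult_1 by linarith
    next
      assume a: "y < 2 ^ m * 2 ^ k"
      show "y div 2 ^ k < 2 ^ m"
      proof (rule ccontr)
        assume "\<not> y div 2 ^ k < 2 ^ m"
        then have "2 ^ m * 2 ^ k \<le> y div 2 ^ k * 2 ^ k" by (intro mult_right_mono) auto
        moreover have "y = y div 2 ^ k * 2 ^ k + y mod 2 ^ k" "0 \<le> y mod 2 ^ k" by (simp_all only: div_mult_mod_eq pos_mod_sign zero_less_power zero_less_numeral)
        ultimately show False using a by linarith
      qed
    qed
    then show ?thesis by (simp add: pos_imp_zdiv_nonneg_iff power_add)
  qed
  then show ?thesis by (cases a) (auto simp: par_def Wn_def)
qed

lemma Wn_par: "a \<in> Wn m \<longleftrightarrow> par m a = 0"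
  using par_Wn[of m a 0] by (auto simp: Wn_def zero_prod_def)

lemma scl_par: "a \<in> Wn m \<Longrightarrow> par m (a + scl m z) = z"
  using par_shift[of m a 0 z] by (simp add: scl_def Wn_par)

text \<open>A square is occupied iff one of its descendants is. Thus the finest of finitely many
  levels determines the others.\<close>

lemma enc_coarse: "enc s T z (m, a) \<longleftrightarrow> a \<in> Wn m \<and> (\<exists>a'\<in>Wn (m + k). par k a' = a \<and> enc s T z (m + k, a'))"
proof
  assume "enc s T z (m, a)"
  then obtain x where a: "a \<in> Wn m" and x: "x \<in> T" "cellidx (s / 2 ^ m) x = a + scl m z"
    by (auto simp: enc_def occ_def cell_def)
  define a' where "a' = cellidx (s / 2 ^ (m + k)) x - scl (m + k) z"
  have "par k a' + scl m z = par k (a' + scl (m + k) z)" by (rule par_shift[symmetric])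
  also have "\<dots> = a + scl m z" using x(2) cellidx_par[of s m x k] by (simp add: a'_def)
  finally have pa: "par k a' = a" by simp
  then have "a' \<in> Wn (m + k)" using par_Wn[of k a' m] a by simp
  moreover have "occ (s / 2 ^ (m + k)) T (a' + scl (m + k) z)" using x(1) by (auto simp: occ_def cell_def a'_def)
  ultimately show "a \<in> Wn m \<and> (\<exists>a'\<in>Wn (m + k). par k a' = a \<and> enc s T z (m + k, a'))"
    using a pa by (auto simp: enc_def)
next
  assume "a \<in> Wn m \<and> (\<exists>a'\<in>Wn (m + k). par k a' = a \<and> enc s T z (m + k, a'))"
  then obtain a' x where a: "a \<in> Wn m" "par k a' = a" and x: "x \<in> T" "cellidx (s / 2 ^ (m + k)) x = a' + scl (m + k) z"
    by (auto simp: enc_def occ_def cell_def)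
  have "cellidx (s / 2 ^ m) x = a + scl m z" using cellidx_par[of s m x k] x(2) a(2) par_shift by simp
  then show "enc s T z (m, a)" using a(1) x(1) by (auto simp: enc_def occ_def cell_def)
qed

abbreviation encM :: "(nat \<times> site \<Rightarrow> bool) measure" where
  "encM \<equiv> PiM UNIV (\<lambda>_. count_space UNIV)"

context lf_poisson
begin

lemma Tb_occ_iff: "0 < t \<Longrightarrow> occ t (Tb b x) c \<longleftrightarrow> card (Tb b x \<inter> cell t c) \<noteq> 0"
  using loc_finite_thinned[OF lf, of "fst x" "\<lambda>l. snd x l = b"] bounded_cell[of t c]
  by (auto simp: occ_def loc_finite_def Tb_def)

lemma measurable_occ_Tb: "0 < t \<Longrightarrow> Measurable.pred (marked p) (\<lambda>x. occ t (Tb b x) c)"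
proof -
  assume t: "0 < t"
  note [measurable] = measurable_Tb[OF cell_borel bounded_cell[OF t]]
  show ?thesis unfolding Tb_occ_iff[OF t] by measurable
qed

lemma measurable_enc_coord: "0 < s \<Longrightarrow> Measurable.pred (marked p) (\<lambda>x. enc s (Tb b x) z i)"
proof -
  assume s: "0 < s"
  have [measurable]: "Measurable.pred (marked p) (\<lambda>x. occ (s / 2 ^ m) (Tb b x) c)" for m c
    by (rule measurable_occ_Tb) (use s in simp)
  show ?thesis unfolding enc_def case_prod_unfold by measurable
qed

lemma measurable_enc: "0 < s \<Longrightarrow> (\<lambda>x. enc s (Tb b x) z) \<in> measurable (marked p) encM"
  by (rule measurable_PiM_single') (auto simp: measurable_enc_coord)

text \<open>At a fixed level the patterns of different cells, and of retained and removed points,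
  involve distinct independent occupations. By \<open>enc_coarse\<close> the sigma-algebras
  \<open>A m i\<close> increase with \<open>m\<close>, so their union over \<open>m\<close> is an
  intersection-stable generator and independence passes to the whole patterns.\<close>

lemma enc_indep:
  assumes s: "0 < s" and p: "0 \<le> p" "p \<le> 1"
  shows "prob_space.indep_vars (marked p) (\<lambda>_. encM) (\<lambda>i x. enc s (Tb (fst i) x) (snd i)) UNIV"
proof -
  interpret Q: prob_space "marked p" by (rule prob_space_marked)
  let ?\<Omega> = "space (marked p)"
  define E where "E m i = {{x\<in>?\<Omega>. occ (s / 2 ^ m) (Tb (fst i) x) (snd i)}}" for m i
  define B where "B m i = {fst i} \<times> ((\<lambda>a. a + scl m (snd i)) ` Wn m)" for m and i :: "bool \<times> site"
  define A where "A m i = sigma_sets ?\<Omega> (\<Union>j\<in>B m i. E m j)" for m i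
  have sm: "0 < s / 2 ^ m" for m :: nat using s by simp
  have indE: "Q.indep_sets (E m) UNIV" for m
  proof -
    have "Q.indep_vars (\<lambda>_. count_space UNIV) (\<lambda>i x. card (Tb (fst i) x \<inter> cell (s / 2 ^ m) (snd i))) (UNIV \<times> UNIV)"
      by (rule Tb_indep) (use p sm bounded_cell in \<open>auto simp: disjoint_family_on_def cell_def\<close>)
    then have "Q.indep_sets (\<lambda>i. {(\<lambda>x. card (Tb (fst i) x \<inter> cell (s / 2 ^ m) (snd i))) -` A \<inter> ?\<Omega> |A. A \<in> sets (count_space UNIV)}) UNIV"
      unfolding Q.indep_vars_def2 by simp
    then show ?thesis
    proof (rule Q.indep_sets_mono_sets)
      fix i :: "bool \<times> site"
      have "{x\<in>?\<Omega>. occ (s / 2 ^ m) (Tb (fst i) x) (snd i)} = (\<lambda>x. card (Tb (fst i) x \<inter> cell (s / 2 ^ m) (snd i))) -` {0<..} \<inter> ?\<Omega>"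
        by (auto simp: Tb_occ_iff[OF sm])
      then show "E m i \<subseteq> {(\<lambda>x. card (Tb (fst i) x \<inter> cell (s / 2 ^ m) (snd i))) -` A \<inter> ?\<Omega> |A. A \<in> sets (count_space UNIV)}"
        unfolding E_def by auto
    qed
  qed
  have indA: "Q.indep_sets (A m) UNIV" for m
    unfolding A_def
  proof (rule Q.indep_sets_collect_sigma)
    show "Q.indep_sets (E m) (\<Union>j\<in>UNIV. B m j)" by (rule Q.indep_sets_mono_index[OF _ indE]) simp
    show "Int_stable (E m i)" for i by (auto simp: E_def Int_stable_def)
    show "disjoint_family_on (B m) UNIV"
      unfolding disjoint_family_on_def
    proof (intro ballI impI, rule equals0I)
      fix i j x assume "i \<noteq> j" "x \<in> B m i \<inter> B m j"
      then obtain a a' where "fst x = fst i" "fst x = fst j" "a \<in> Wn m" "a' \<in> Wn m"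
        "snd x = a + scl m (snd i)" "snd x = a' + scl m (snd j)" by (auto simp: B_def)
      then have "fst i = fst j" "par m (snd x) = snd i" "par m (snd x) = snd j"
        using scl_par[of a m "snd i"] scl_par[of a' m "snd j"] by auto
      then show False using \<open>i \<noteq> j\<close> prod_eqI[of i j] by simp
    qed
  qed
  have A_enc: "{x\<in>?\<Omega>. enc s (Tb (fst i) x) (snd i) (m, a)} \<in> A m i" for m a i
  proof (cases "a \<in> Wn m")
    case True
    then have "{x\<in>?\<Omega>. enc s (Tb (fst i) x) (snd i) (m, a)} \<in> E m (fst i, a + scl m (snd i))"
      by (simp add: E_def enc_def)
    moreover have "(fst i, a + scl m (snd i)) \<in> B m i" using True by (auto simp: B_def)
    ultimately show ?thesis unfolding A_def by (intro sigma_sets.Basic UN_I)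
  qed (simp add: enc_def A_def sigma_sets.Empty)
  have sub\<Omega>: "(\<Union>j\<in>B m i. E m j) \<subseteq> Pow ?\<Omega>" for m i by (auto simp: E_def)
  have sa: "sigma_algebra ?\<Omega> (A m i)" for m i unfolding A_def by (rule sigma_algebra_sigma_sets[OF sub\<Omega>])
  have mono: "A m i \<subseteq> A (m + k) i" for m k i
    unfolding A_def[of m]
  proof (rule sigma_algebra.sigma_sets_subset[OF sa], rule subsetI)
    fix X assume "X \<in> (\<Union>j\<in>B m i. E m j)"
    then obtain a where a: "a \<in> Wn m" and X: "X = {x\<in>?\<Omega>. enc s (Tb (fst i) x) (snd i) (m, a)}"
      by (auto simp: E_def B_def enc_def)
    interpret S: sigma_algebra ?\<Omega> "A (m + k) i" by (rule sa)
    have "X = (\<Union>a'\<in>{a'\<in>Wn (m + k). par k a' = a}. {x\<in>?\<Omega>. enc s (Tb (fst i) x) (snd i) (m + k, a')})"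
      unfolding X using enc_coarse[of s _ "snd i" m a k] a by auto
    also have "\<dots> \<in> A (m + k) i" by (rule S.finite_UN) (use A_enc in auto)
    finally show "X \<in> A (m + k) i" .
  qed
  define G where "G i = (\<Union>m. A m i)" for i
  have "Q.indep_sets G UNIV"
  proof (rule Q.indep_setsI)
    show "G i \<subseteq> Q.events" for i using indA by (auto simp: G_def Q.indep_sets_def)
    fix X :: "bool \<times> site \<Rightarrow> _" and J assume J: "J \<noteq> {}" "finite J" and X: "\<forall>j\<in>J. X j \<in> G j"
    have "\<forall>j\<in>J. \<exists>m. X j \<in> A m j" using X by (simp add: G_def)
    from bchoice[OF this] obtain m where m: "\<And>j. j \<in> J \<Longrightarrow> X j \<in> A (m j) j" by blast
    have "X j \<in> A (Max (m ` J)) j" if "j \<in> J" for j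
    proof -
      have "m j \<le> Max (m ` J)" using J that by simp
      then obtain k where "Max (m ` J) = m j + k" using le_Suc_ex by blast
      then show ?thesis using m[OF that] mono[of "m j" j k] by auto
    qed
    then show "Q.prob (\<Inter>j\<in>J. X j) = (\<Prod>j\<in>J. Q.prob (X j))"
      using Q.indep_setsD[OF indA[of "Max (m ` J)"], of J X] J by simp
  qed
  moreover have "Int_stable (G i)" for i
    unfolding Int_stable_def
  proof (intro ballI)
    fix X Y assume "X \<in> G i" "Y \<in> G i"
    then obtain m n where mn: "X \<in> A m i" "Y \<in> A n i" by (auto simp: G_def)
    have "X \<in> A (m + n) i" "Y \<in> A (n + m) i" using mn mono[of m i n] mono[of n i m] by auto
    interpret S: sigma_algebra ?\<Omega> "A (m + n) i" by (rule sa)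
    have "X \<inter> Y \<in> A (m + n) i"
      by (rule S.Int) (use \<open>X \<in> A (m + n) i\<close> \<open>Y \<in> A (n + m) i\<close> in \<open>simp_all add: add.commute\<close>)
    then show "X \<inter> Y \<in> G i" by (auto simp: G_def)
  qed
  ultimately have "Q.indep_sets (\<lambda>i. sigma_sets ?\<Omega> (G i)) UNIV" by (rule Q.indep_sets_sigma)
  then have "Q.indep_sets (\<lambda>i. {(\<lambda>x. enc s (Tb (fst i) x) (snd i)) -` A \<inter> ?\<Omega> |A. A \<in> sets encM}) UNIV"
  proof (rule Q.indep_sets_mono_sets)
    fix i :: "bool \<times> site"
    let ?S = "sigma ?\<Omega> (G i)"
    have G: "G i \<subseteq> Pow ?\<Omega>" unfolding G_def A_def using sigma_sets_into_sp[OF sub\<Omega>] by blast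
    have "(\<lambda>x. enc s (Tb (fst i) x) (snd i)) \<in> measurable ?S encM"
    proof (rule measurable_PiM_single')
      fix j :: "nat \<times> site"
      have "{x\<in>?\<Omega>. enc s (Tb (fst i) x) (snd i) j} \<in> G i" using A_enc[of i "fst j" "snd j"] by (auto simp: G_def)
      then have "{x\<in>space ?S. enc s (Tb (fst i) x) (snd i) j} \<in> sets ?S"
        using G by (simp add: space_measure_of_conv sets_measure_of sigma_sets.Basic)
      then show "(\<lambda>x. enc s (Tb (fst i) x) (snd i) j) \<in> measurable ?S (count_space UNIV)" by (simp add: pred_def)
    qed auto
    from measurable_sets[OF this]
    show "{(\<lambda>x. enc s (Tb (fst i) x) (snd i)) -` A \<inter> ?\<Omega> |A. A \<in> sets encM} \<subseteq> sigma_sets ?\<Omega> (G i)"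
      using G by (auto simp: space_measure_of_conv sets_measure_of)
  qed
  then show ?thesis unfolding Q.indep_vars_def2 using measurable_enc[OF s] by simp
qed

definition encL :: "real \<Rightarrow> real \<Rightarrow> bool \<Rightarrow> (nat \<times> site \<Rightarrow> bool) measure" where
  "encL s p b = distr (marked p) encM (\<lambda>x. enc s (Tb b x) 0)"

text \<open>An event on finitely many coordinates is an event on one level, where the occupations
  are independent Bernoulli variables of equal parameter; translation by \<open>scl M' z\<close>
  does not change their law.\<close>

lemma distr_enc:
  assumes s: "0 < s" and p: "0 < p" "p < 1"
  shows "distr (marked p) encM (\<lambda>x. enc s (Tb b x) z) = encL s p b"
proof -
  interpret Q: prob_space "marked p" by (rule prob_space_marked)
  interpret B: lf_poisson "marked p" "lam * pr p b" "Tb b" by (rule lf_poisson_Tb[OF p])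
  have ms: "(\<lambda>x. enc s (Tb b x) z) \<in> measurable (marked p) encM" for z by (rule measurable_enc[OF s])
  show ?thesis unfolding encL_def
  proof (rule measure_eqI_PiM_infinite)
    show "finite_measure (distr (marked p) encM (\<lambda>x. enc s (Tb b x) z))"
      by (rule Q.finite_measure_distr[OF ms])
    fix F and J :: "(nat \<times> site) set" assume J: "finite J"
    let ?C = "prod_emb UNIV (\<lambda>_. count_space UNIV) J (Pi\<^sub>E J F) :: (nat \<times> site \<Rightarrow> bool) set"
    have C: "?C = {c. \<forall>j\<in>J. c j \<in> F j}" by (auto simp: prod_emb_def PiE_iff)
    have Cs: "?C \<in> sets encM" by (rule sets_PiM_I) (use J in auto)
    define M' where "M' = Max (insert 0 (fst ` J))"
    define R where "R \<sigma> \<longleftrightarrow> (\<forall>j\<in>J. (snd j \<in> Wn (fst j) \<and> (\<exists>a'\<in>Wn M'. par (M' - fst j) a' = snd j \<and> \<sigma> a')) \<in> F j)" for \<sigma>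
    have eR: "enc s T z \<in> ?C \<longleftrightarrow> R (\<lambda>a. occ (s / 2 ^ M') T (a + scl M' z))" for T z
      unfolding C R_def mem_Collect_eq
    proof (rule ball_cong[OF refl])
      fix j assume "j \<in> J"
      then have "fst j \<le> M'" using J by (simp add: M'_def)
      then have "enc s T z (fst j, snd j) \<longleftrightarrow> snd j \<in> Wn (fst j) \<and> (\<exists>a'\<in>Wn M'. par (M' - fst j) a' = snd j \<and> enc s T z (M', a'))"
        using enc_coarse[of s T z "fst j" "snd j" "M' - fst j"] by simp
      then show "enc s T z j \<in> F j \<longleftrightarrow> (snd j \<in> Wn (fst j) \<and> (\<exists>a'\<in>Wn M'. par (M' - fst j) a' = snd j \<and>
          occ (s / 2 ^ M') T (a' + scl M' z))) \<in> F j" by (simp add: enc_def cong: bex_cong)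
    qed
    have t: "0 < s / 2 ^ M'" using s by simp
    let ?\<rho> = "B.rate (s / 2 ^ M')"
    define sh where "sh z \<sigma> = (\<lambda>a. \<sigma> (a + scl M' z))" for z and \<sigma> :: "site \<Rightarrow> bool"
    have Rm: "Measurable.pred (Bern ?\<rho>) R"
    proof -
      have F: "Measurable.pred (Bern ?\<rho>) (\<lambda>\<sigma>. f \<sigma> \<in> F j)" if "Measurable.pred (Bern ?\<rho>) f" for f j
        by (rule measurable_compose[OF that]) simp
      have "Measurable.pred (Bern ?\<rho>) (\<lambda>\<sigma>. snd j \<in> Wn (fst j) \<and> (\<exists>a'\<in>Wn M'. par (M' - fst j) a' = snd j \<and> \<sigma> a'))" for j
        by (intro pred_intros_logic pred_intros_finite(4)) auto
      from F[OF this] show ?thesis unfolding R_def by (intro pred_intros_finite(3)[OF J])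
    qed
    have law: "emeasure (distr (marked p) encM (\<lambda>x. enc s (Tb b x) z)) ?C = emeasure (Bern ?\<rho>) {\<sigma>. R \<sigma>}" for z
    proof -
      have "bij (\<lambda>a. a + scl M' z)" by (rule bij_betwI[where g = "\<lambda>a. a - scl M' z"]) auto
      from distr_PiM_shift[OF _ this, of "measure_pmf (bernoulli_pmf ?\<rho>)"]
      have sh: "distr (Bern ?\<rho>) (Bern ?\<rho>) (sh z) = Bern ?\<rho>" by (simp add: measure_pmf.prob_space_axioms sh_def[abs_def])
      have shm: "sh z \<in> measurable (Bern ?\<rho>) (Bern ?\<rho>)" unfolding sh_def by (rule measurable_PiM_single') auto
      have om: "(\<lambda>x. occ (s / 2 ^ M') (Tb b x)) \<in> measurable (marked p) (Bern ?\<rho>)" by (rule B.measurable_occ_Bern[OF t])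
      have Rs: "{\<sigma>. R \<sigma>} \<in> sets (Bern ?\<rho>)" using Rm by (simp add: pred_def)
      have Rs': "sh z -` {\<sigma>. R \<sigma>} \<in> sets (Bern ?\<rho>)" using measurable_sets[OF shm Rs] by simp
      have "emeasure (distr (marked p) encM (\<lambda>x. enc s (Tb b x) z)) ?C =
         emeasure (marked p) ((\<lambda>x. enc s (Tb b x) z) -` ?C \<inter> space (marked p))" by (rule emeasure_distr[OF ms Cs])
      also have "(\<lambda>x. enc s (Tb b x) z) -` ?C \<inter> space (marked p) =
          (\<lambda>x. occ (s / 2 ^ M') (Tb b x)) -` (sh z -` {\<sigma>. R \<sigma>}) \<inter> space (marked p)" by (auto simp: eR sh_def)
      also have "emeasure (marked p) \<dots> = emeasure (distr (marked p) (Bern ?\<rho>) (\<lambda>x. occ (s / 2 ^ M') (Tb b x))) (sh z -` {\<sigma>. R \<sigma>})"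
        by (rule emeasure_distr[OF om Rs', symmetric])
      also have "\<dots> = emeasure (distr (Bern ?\<rho>) (Bern ?\<rho>) (sh z)) {\<sigma>. R \<sigma>}"
        unfolding B.distr_occ[OF t] emeasure_distr[OF shm Rs] by simp
      finally show ?thesis unfolding sh .
    qed
    show "emeasure (distr (marked p) encM (\<lambda>x. enc s (Tb b x) z)) ?C = emeasure (distr (marked p) encM (\<lambda>x. enc s (Tb b x) 0)) ?C"
      unfolding law ..
  qed simp_all
qed

lemma measurable_enc_family: "0 < s \<Longrightarrow> (\<lambda>x. enc s (Tb b x)) \<in> measurable (marked p) (PiM UNIV (\<lambda>_. encM))"
  by (rule measurable_PiM_single') (use measurable_enc in \<open>auto simp: space_PiM\<close>)

lemma distr_enc_family:
  assumes s: "0 < s" and p: "0 < p" "p < 1"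
  shows "distr (marked p) (PiM UNIV (\<lambda>_. encM)) (\<lambda>x. enc s (Tb b x)) = PiM UNIV (\<lambda>_. encL s p b)"
proof -
  interpret Q: prob_space "marked p" by (rule prob_space_marked)
  have ind: "Q.indep_vars (\<lambda>_. encM) (\<lambda>i x. enc s (Tb (fst i) x) (snd i)) UNIV"
    by (rule enc_indep) (use s p in auto)
  have "Q.indep_sets (\<lambda>z. {(\<lambda>x. enc s (Tb b x) z) -` A \<inter> space (marked p) |A. A \<in> sets encM}) UNIV"
  proof (rule Q.indep_setsI)
    show "{(\<lambda>x. enc s (Tb b x) z) -` A \<inter> space (marked p) |A. A \<in> sets encM} \<subseteq> Q.events" for z
      by (auto intro: measurable_sets[OF measurable_enc[OF s]])
    fix A and J :: "site set" assume J: "J \<noteq> {}" "finite J"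
      and A: "\<forall>j\<in>J. A j \<in> {(\<lambda>x. enc s (Tb b x) j) -` A \<inter> space (marked p) |A. A \<in> sets encM}"
    have "Q.prob (\<Inter>j\<in>{b} \<times> J. A (snd j)) = (\<Prod>j\<in>{b} \<times> J. Q.prob (A (snd j)))"
      by (rule Q.indep_setsD[OF ind[unfolded Q.indep_vars_def2, THEN conjunct2]]) (use J A in auto)
    moreover have "(\<Inter>j\<in>{b} \<times> J. A (snd j)) = (\<Inter>j\<in>J. A j)" by auto
    moreover have "(\<Prod>j\<in>{b} \<times> J. Q.prob (A (snd j))) = (\<Prod>j\<in>J. Q.prob (A j))"
      by (rule prod.reindex_bij_witness[where i = "Pair b" and j = snd]) auto
    ultimately show "Q.prob (\<Inter>j\<in>J. A j) = (\<Prod>j\<in>J. Q.prob (A j))" by simp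
  qed
  then have "Q.indep_vars (\<lambda>_. encM) (\<lambda>z x. enc s (Tb b x) z) UNIV"
    unfolding Q.indep_vars_def2 using measurable_enc[OF s] by simp
  then have "distr (marked p) (PiM UNIV (\<lambda>_. encM)) (\<lambda>x. \<lambda>z\<in>UNIV. enc s (Tb b x) z) =
      (\<Pi>\<^sub>M z\<in>UNIV. distr (marked p) encM (\<lambda>x. enc s (Tb b x) z))"
    by (subst (asm) Q.indep_vars_iff_distr_eq_PiM) (auto simp: measurable_enc[OF s])
  then show ?thesis by (simp add: restrict_UNIV distr_enc[OF s p])
qed

lemma distr_enc_pair:
  assumes s: "0 < s" and p: "0 < p" "p < 1"
  shows "distr (marked p) (PiM UNIV (\<lambda>_. encM) \<Otimes>\<^sub>M PiM UNIV (\<lambda>_. encM)) (\<lambda>x. (enc s (Tb True x), enc s (Tb False x))) =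
     PiM UNIV (\<lambda>_. encL s p True) \<Otimes>\<^sub>M PiM UNIV (\<lambda>_. encL s p False)"
proof -
  interpret Q: prob_space "marked p" by (rule prob_space_marked)
  have ind: "Q.indep_vars (\<lambda>_. encM) (\<lambda>i x. enc s (Tb (fst i) x) (snd i)) UNIV"
    by (rule enc_indep) (use s p in auto)
  let ?A = "{True} \<times> UNIV :: (bool \<times> site) set" and ?B = "{False} \<times> UNIV :: (bool \<times> site) set"
  have "Q.indep_var (PiM ?A (\<lambda>_. encM)) (\<lambda>x. restrict (\<lambda>i. enc s (Tb (fst i) x) (snd i)) ?A)
      (PiM ?B (\<lambda>_. encM)) (\<lambda>x. restrict (\<lambda>i. enc s (Tb (fst i) x) (snd i)) ?B)"
    by (rule Q.indep_var_restrict[OF ind]) auto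
  then have "Q.indep_var (PiM UNIV (\<lambda>_. encM)) ((\<lambda>r z. r (True, z)) \<circ> (\<lambda>x. restrict (\<lambda>i. enc s (Tb (fst i) x) (snd i)) ?A))
      (PiM UNIV (\<lambda>_. encM)) ((\<lambda>r z. r (False, z)) \<circ> (\<lambda>x. restrict (\<lambda>i. enc s (Tb (fst i) x) (snd i)) ?B))"
  proof (rule Q.indep_var_compose)
    show "(\<lambda>r z. r (True, z)) \<in> measurable (PiM ?A (\<lambda>_. encM)) (PiM UNIV (\<lambda>_. encM))"
      by (rule measurable_PiM_single') (auto simp: space_PiM)
    show "(\<lambda>r z. r (False, z)) \<in> measurable (PiM ?B (\<lambda>_. encM)) (PiM UNIV (\<lambda>_. encM))"
      by (rule measurable_PiM_single') (auto simp: space_PiM)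
  qed
  then have "Q.indep_var (PiM UNIV (\<lambda>_. encM)) (\<lambda>x. enc s (Tb True x)) (PiM UNIV (\<lambda>_. encM)) (\<lambda>x. enc s (Tb False x))"
    by (simp add: comp_def)
  then show ?thesis unfolding Q.indep_var_distribution_eq distr_enc_family[OF s p] by simp
qed

end

section \<open>Translation invariance and linked cells\<close>

lemma infc_shift_le:
  assumes "infc N \<sigma> (\<lambda>e. \<eta> ((\<lambda>u. u + v) ` e)) z"
  shows "infc N (\<lambda>u. \<sigma> (u - v)) \<eta> (z + v)"
proof -
  let ?S = "cfg \<sigma> (\<lambda>e. \<eta> ((\<lambda>u. u + v) ` e))" and ?S' = "cfg (\<lambda>u. \<sigma> (u - v)) \<eta>"
  have "a + v \<in> lreach N {z + v} ?S'" if "a \<in> lreach N {z} ?S" for a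
    using that unfolding lreach_def
  proof (induction rule: lat.reach.induct)
    case (base u)
    then show ?case by (intro lat.reach.base) auto
  next
    case (step a b)
    have "lat.stp N ?S' (a + v) (b + v)" using step(2) by (simp add: lat.stp_def ladj_def)
    then show ?case using step.IH by (rule lat.reach.step[rotated])
  qed
  then have "(\<lambda>a. a + v) ` lreach N {z} ?S \<subseteq> lreach N {z + v} ?S'" by blast
  moreover have "infinite ((\<lambda>a. a + v) ` lreach N {z} ?S)"
    using assms finite_imageD[of "\<lambda>a. a + v" "lreach N {z} ?S"] by (auto simp: infc_def)
  ultimately show ?thesis unfolding infc_def by (rule infinite_super)
qed

lemma ltheta_shift: "ltheta N q (\<lambda>u. \<sigma> (u - v)) (z + v) = ltheta N q \<sigma> z"
proof -
  let ?g = "\<lambda>e :: site set. (\<lambda>u. u + v) ` e"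
  let ?h = "\<lambda>(\<eta> :: site set \<Rightarrow> bool) e. \<eta> (?g e)"
  have inv: "(\<lambda>u. u + v) ` ((\<lambda>u. u + - v) ` e) = e" "(\<lambda>u. u + - v) ` ((\<lambda>u. u + v) ` e) = e" for e :: "site set"
    by (simp_all add: image_image)
  have "infc N (\<lambda>u. \<sigma> (u - v)) \<eta> (z + v) \<longleftrightarrow> infc N \<sigma> (?h \<eta>) z" for \<eta>
  proof
    assume "infc N (\<lambda>u. \<sigma> (u - v)) \<eta> (z + v)"
    then have "infc N (\<lambda>u. \<sigma> (u - v)) (\<lambda>e. ?h \<eta> ((\<lambda>u. u + - v) ` e)) (z + v)" unfolding inv .
    from infc_shift_le[OF this] show "infc N \<sigma> (?h \<eta>) z" by simp
  qed (rule infc_shift_le)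
  then have "{\<eta>. infc N (\<lambda>u. \<sigma> (u - v)) \<eta> (z + v)} = ?h -` {\<eta>. infc N \<sigma> \<eta> z}" by auto
  moreover have hm: "?h \<in> measurable (Bern q) (Bern q)" by (rule measurable_PiM_single') auto
  moreover have "bij ?g" by (rule bij_betwI[where g = "\<lambda>e. (\<lambda>u. u + - v) ` e"]) (use inv in auto)
  then have "distr (Bern q) (Bern q) ?h = Bern q" by (rule distr_PiM_shift[OF measure_pmf.prob_space_axioms])
  ultimately show ?thesis
    unfolding ltheta_def using emeasure_distr[OF hm infc_sets, of N \<sigma> z] by simp
qed

text \<open>A condition on indices alone: \<open>x\<close> and \<open>y\<close> range over the whole
  squares, whether or not the process has points there. At fine levels it approximates closeness of
  actual points.\<close>

definition nearc :: "real \<Rightarrow> site \<Rightarrow> site \<Rightarrow> bool" where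
  "nearc t a b \<longleftrightarrow> (\<exists>x\<in>cell t a. \<exists>y\<in>cell t b. dist x y \<le> 1)"

lemma nearc_shift:
  assumes t: "0 < t" shows "nearc t (a + c) (b + c) \<longleftrightarrow> nearc t a b"
proof -
  define \<tau> :: "site \<Rightarrow> pt" where "\<tau> c = vector [t * of_int (fst c), t * of_int (snd c)]" for c
  have ci: "cellidx t (x + \<tau> c) = cellidx t x + c" for x c
    using t by (simp add: cellidx_def \<tau>_def vector_2 add_divide_distrib prod_eq_iff)
  have le: "nearc t (a + c) (b + c)" if n: "nearc t a b" for a b c
  proof -
    obtain x y where xy: "x \<in> cell t a" "y \<in> cell t b" "dist x y \<le> 1" using n by (auto simp: nearc_def)
    have "x + \<tau> c \<in> cell t (a + c)" "y + \<tau> c \<in> cell t (b + c)" using xy ci by (auto simp: cell_def)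
    moreover have "dist (x + \<tau> c) (y + \<tau> c) \<le> 1" using xy by (simp add: dist_norm)
    ultimately show ?thesis unfolding nearc_def by blast
  qed
  show ?thesis using le[of a b c] le[of "a + c" "b + c" "- c"] by auto
qed

text \<open>For the patterns of a locally finite set, the condition at all levels \<open>m\<close> says that the two cells
  contain points at distance at most 1. The case \<open>supd z w = 1\<close> follows from it for such patterns, but not for
  arbitrary \<open>c\<close> and \<open>d\<close>.\<close>

definition linked :: "real \<Rightarrow> site \<Rightarrow> site \<Rightarrow> (nat \<times> site \<Rightarrow> bool) \<times> (nat \<times> site \<Rightarrow> bool) \<Rightarrow>
    (nat \<times> site \<Rightarrow> bool) \<times> (nat \<times> site \<Rightarrow> bool) \<Rightarrow> bool" where
  "linked s z w c d \<longleftrightarrow> (fst c (0, 0) \<or> snd c (0, 0)) \<and> (fst d (0, 0) \<or> snd d (0, 0)) \<and>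
     (supd z w = 1 \<or> (\<forall>m. \<exists>a b. (fst c (m, a) \<or> snd c (m, a)) \<and> (fst d (m, b) \<or> snd d (m, b)) \<and>
        nearc (s / 2 ^ m) (a + scl m z) (b + scl m w)))"

lemma enc_0: "enc s T z (0, 0) \<longleftrightarrow> occ s T z"
proof -
  have "0 \<in> Wn 0" "scl 0 z = z" by (simp_all add: Wn_def scl_def zero_prod_def)
  then show ?thesis by (simp add: enc_def)
qed

lemma enc_pointI:
  assumes "x \<in> T" "x \<in> cell s z"
  shows "enc s T z (m, cellidx (s / 2 ^ m) x - scl m z)"
proof -
  have "par m (cellidx (s / 2 ^ m) x) = z" using cellidx_par[of s 0 x m] assms(2) by (simp add: cell_def)
  then have "par m (cellidx (s / 2 ^ m) x - scl m z) = 0"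
    using par_shift[of m "cellidx (s / 2 ^ m) x - scl m z" 0 z] by (simp add: scl_def)
  then show ?thesis using assms(1) by (auto simp: enc_def Wn_par occ_def cell_def)
qed

lemma enc_pointE:
  assumes "enc s T z (m, a)"
  obtains x where "x \<in> T" "x \<in> cell s z" "x \<in> cell (s / 2 ^ m) (a + scl m z)"
proof -
  obtain x where x: "x \<in> T" "cellidx (s / 2 ^ m) x = a + scl m z" and a: "a \<in> Wn m"
    using assms by (auto simp: enc_def occ_def cell_def)
  have "cellidx s x = z" using cellidx_par[of s 0 x m] x(2) scl_par[OF a] by simp
  then show ?thesis using x that by (simp add: cell_def)
qed

lemma linkedI:
  assumes x: "x \<in> T \<union> U" "x \<in> cell s z" and y: "y \<in> T \<union> U" "y \<in> cell s w" and d: "dist x y \<le> 1"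
  shows "linked s z w (enc s T z, enc s U z) (enc s T w, enc s U w)"
proof -
  have ne: "enc s T z (0, 0) \<or> enc s U z (0, 0)" "enc s T w (0, 0) \<or> enc s U w (0, 0)"
    unfolding enc_0 using x y by (auto simp: occ_def)
  have "\<exists>a b. (enc s T z (m, a) \<or> enc s U z (m, a)) \<and> (enc s T w (m, b) \<or> enc s U w (m, b)) \<and>
        nearc (s / 2 ^ m) (a + scl m z) (b + scl m w)" for m
  proof (intro exI conjI)
    let ?a = "cellidx (s / 2 ^ m) x - scl m z" and ?b = "cellidx (s / 2 ^ m) y - scl m w"
    show "enc s T z (m, ?a) \<or> enc s U z (m, ?a)" using x enc_pointI[of x _ s z m] by blast
    show "enc s T w (m, ?b) \<or> enc s U w (m, ?b)" using y enc_pointI[of y _ s w m] by blast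
    show "nearc (s / 2 ^ m) (?a + scl m z) (?b + scl m w)"
      unfolding nearc_def using d by (intro bexI[of _ x] bexI[of _ y]) (simp_all add: cell_def)
  qed
  then show ?thesis using ne by (simp add: linked_def)
qed

lemma cell_diam: "x \<in> cell t a \<Longrightarrow> y \<in> cell t a \<Longrightarrow> 0 < t \<Longrightarrow> dist x y \<le> t * sqrt 2"
  using cell_dist(2)[of x t a y a] by simp

text \<open>At level \<open>m\<close> the patterns yield points of the two cells at distance at most
  1 up to two diameters of subcells. Both cells hold finitely many points, so the least distance is
  attained and cannot exceed 1. Sup distance 1 is covered by \<open>ladj_dist\<close>.\<close>

lemma linkedE:
  assumes l: "linked s z w (enc s T z, enc s U z) (enc s T w, enc s U w)"
    and lf: "loc_finite (T \<union> U)" and s: "0 < s" "s * (4 * real N + sqrt 2) \<le> 1" and N: "1 \<le> N"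
  obtains x y where "x \<in> T \<union> U" "x \<in> cell s z" "y \<in> T \<union> U" "y \<in> cell s w" "dist x y \<le> 1"
proof (cases "supd z w = 1")
  case True
  obtain x where x: "x \<in> T \<union> U" "x \<in> cell s z" using l by (auto simp: linked_def enc_0 occ_def)
  obtain y where y: "y \<in> T \<union> U" "y \<in> cell s w" using l by (auto simp: linked_def enc_0 occ_def)
  have ab: "\<bar>fst z - fst w\<bar> \<le> 1" "\<bar>snd z - snd w\<bar> \<le> 1" using True supd_le_iff[of z w 1] by auto
  have "(fst z - fst w)\<^sup>2 \<le> 1" "(snd z - snd w)\<^sup>2 \<le> 1" using ab by (simp_all add: abs_square_le_1)
  moreover have "(2::int) \<le> (4 * int N)\<^sup>2"
  proof -
    have "(4::int)\<^sup>2 \<le> (4 * int N)\<^sup>2" using N by (intro power_mono) auto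
    moreover have "(2::int) \<le> 4\<^sup>2" by simp
    ultimately show ?thesis by (rule order_trans[rotated])
  qed
  ultimately have "z = w \<or> ladj N z w" unfolding ladj_def by linarith
  from ladj_dist[OF this x(2) y(2) s] show ?thesis using x y that by blast
next
  case False
  let ?X = "(T \<union> U) \<inter> cell s z" and ?Y = "(T \<union> U) \<inter> cell s w"
  have fin: "finite ?X" "finite ?Y" using lf bounded_cell[OF s(1)] by (simp_all add: loc_finite_def)
  have close: "\<exists>x\<in>?X. \<exists>y\<in>?Y. dist x y \<le> 1 + 2 * (s / 2 ^ m * sqrt 2)" for m
  proof -
    let ?t = "s / 2 ^ m"
    obtain a b where ab: "enc s T z (m, a) \<or> enc s U z (m, a)" "enc s T w (m, b) \<or> enc s U w (m, b)"
      "nearc ?t (a + scl m z) (b + scl m w)" using l False unfolding linked_def fst_conv snd_conv by blast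
    obtain x' y' where xy': "x' \<in> cell ?t (a + scl m z)" "y' \<in> cell ?t (b + scl m w)" "dist x' y' \<le> 1"
      using ab(3) by (auto simp: nearc_def)
    obtain x where x: "x \<in> ?X" "x \<in> cell ?t (a + scl m z)" using ab(1) by (auto elim!: enc_pointE)
    obtain y where y: "y \<in> ?Y" "y \<in> cell ?t (b + scl m w)" using ab(2) by (auto elim!: enc_pointE)
    have t: "0 < ?t" using s by simp
    have "dist x y \<le> dist x x' + dist x' y' + dist y' y"
      using dist_triangle[of x y x'] dist_triangle[of x' y y'] by linarith
    also have "\<dots> \<le> ?t * sqrt 2 + 1 + ?t * sqrt 2"
      using cell_diam[OF x(2) xy'(1) t] cell_diam[OF xy'(2) y(2) t] xy'(3) by linarith
    finally show ?thesis using x(1) y(1) by (intro bexI[of _ x] bexI[of _ y]) auto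
  qed
  have "\<exists>x\<in>?X. \<exists>y\<in>?Y. dist x y \<le> 1"
  proof (rule ccontr)
    assume n: "\<not> ?thesis"
    let ?D = "(\<lambda>(x, y). dist x y - 1) ` (?X \<times> ?Y)"
    have D: "finite ?D" "?D \<noteq> {}" using fin close[of 0] by auto
    define e where "e = Min ?D"
    have "e \<in> ?D" unfolding e_def using D by (rule Min_in)
    then have e0: "0 < e" using n by force
    have e: "e \<le> dist x y - 1" if "x \<in> ?X" "y \<in> ?Y" for x y
      unfolding e_def using D(1) that by (intro Min_le) force+
    have "(\<lambda>m. 2 * (s / 2 ^ m * sqrt 2)) \<longlonglongrightarrow> 0" by real_asymp
    from order_tendstoD(2)[OF this e0] obtain m :: nat where "2 * (s / 2 ^ m * sqrt 2) < e"
      using eventually_happens'[OF sequentially_bot] by blast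
    then show False using close[of m] e by fastforce
  qed
  then show ?thesis using that by blast
qed

text \<open>Distinct points of one cell are adjacent, so a component contains all points of every
  cell that it meets, and chains of linked cells stay inside the component.\<close>

lemma component_meets_cell:
  assumes lf: "loc_finite (T \<union> U)" and s: "0 < s" "s * (4 * real N + sqrt 2) \<le> 1" and N: "1 \<le> N"
    and C: "is_inf_component (T \<union> U) C"
    and I: "\<And>z. infinite {w. (\<lambda>z w. linked s z w (enc s T z, enc s U z) (enc s T w, enc s U w))\<^sup>*\<^sup>* z w} \<Longrightarrow>
       \<exists>w. (\<lambda>z w. linked s z w (enc s T z, enc s U z) (enc s T w, enc s U w))\<^sup>*\<^sup>* z w \<and> I w"
  shows "\<exists>w. I w \<and> (T \<union> U) \<inter> cell s w \<subseteq> C"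
proof -
  let ?S = "T \<union> U"
  let ?G = "\<lambda>z w. linked s z w (enc s T z, enc s U z) (enc s T w, enc s U w)"
  obtain x where x: "x \<in> ?S" "C = {y. (gadj ?S)\<^sup>*\<^sup>* x y}" "infinite C"
    using C by (auto simp: is_inf_component_def)
  define z0 where "z0 = cellidx s x"
  have reach: "y \<in> ?S \<and> ?G\<^sup>*\<^sup>* z0 (cellidx s y)" if "(gadj ?S)\<^sup>*\<^sup>* x y" for y
    using that
  proof (induction rule: rtranclp_induct)
    case (step y w)
    have g: "y \<in> ?S" "w \<in> ?S" "dist y w \<le> 1" using step(2) by (auto simp: gadj_def)
    have "?G (cellidx s y) (cellidx s w)" by (rule linkedI[of y T U s _ w]) (use g in \<open>auto simp: cell_def\<close>)
    with step.IH have "?G\<^sup>*\<^sup>* z0 (cellidx s w)" by (meson rtranclp.rtrancl_into_rtrancl)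
    then show ?case using g by simp
  qed (use x in \<open>simp add: z0_def\<close>)
  have "infinite {w. ?G\<^sup>*\<^sup>* z0 w}"
  proof
    assume fin: "finite {w. ?G\<^sup>*\<^sup>* z0 w}"
    have "C \<subseteq> (\<Union>w\<in>{w. ?G\<^sup>*\<^sup>* z0 w}. ?S \<inter> cell s w)"
    proof
      fix y assume "y \<in> C"
      then have "y \<in> ?S \<and> ?G\<^sup>*\<^sup>* z0 (cellidx s y)" using reach x(2) by blast
      then show "y \<in> (\<Union>w\<in>{w. ?G\<^sup>*\<^sup>* z0 w}. ?S \<inter> cell s w)" by (simp add: cell_def)
    qed
    moreover have "finite (\<Union>w\<in>{w. ?G\<^sup>*\<^sup>* z0 w}. ?S \<inter> cell s w)"
      by (rule finite_UN_I[OF fin]) (use lf bounded_cell[OF s(1)] in \<open>simp add: loc_finite_def\<close>)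
    ultimately show False using x(3) by (meson finite_subset)
  qed
  from I[OF this] obtain w where w: "?G\<^sup>*\<^sup>* z0 w" "I w" by blast
  have closed: "y \<in> C" if "u \<in> C" "y \<in> ?S" "dist u y \<le> 1" for u y
  proof (cases "u = y")
    case False
    have "u \<in> ?S" using reach that(1) x(2) by blast
    then have "gadj ?S u y" using that False by (simp add: gadj_def)
    then show ?thesis using that(1) x(2) by (auto intro: rtranclp.rtrancl_into_rtrancl)
  qed (use that in simp)
  have same: "dist u y \<le> 1" if "u \<in> cell s v" "y \<in> cell s v" for u y v
    by (rule ladj_dist[of v v N, OF _ that s]) simp
  have "?S \<inter> cell s w \<subseteq> C"
    using w(1)
  proof (induction rule: rtranclp_induct)
    case base
    have "x \<in> C" using x(2) by simp
    then show ?case using closed same[of x z0] by (auto simp: z0_def cell_def)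
  next
    case (step v w)
    obtain a b where ab: "a \<in> ?S" "a \<in> cell s v" "b \<in> ?S" "b \<in> cell s w" "dist a b \<le> 1"
      using linkedE[OF step(2) lf s N] .
    have "b \<in> C" using closed[of a b] step.IH ab by blast
    then show ?case using closed[of b] same[OF ab(4)] by blast
  qed
  then show ?thesis using w(2) by blast
qed

lemma measurable_linked:
  assumes [measurable_cong]: "sets A = sets encM" "sets B = sets encM"
  shows "Measurable.pred ((A \<Otimes>\<^sub>M B) \<Otimes>\<^sub>M (A \<Otimes>\<^sub>M B)) (\<lambda>x. linked s z w (fst x) (snd x))"
proof -
  have [measurable]: "Measurable.pred A (\<lambda>c. c i)" "Measurable.pred B (\<lambda>c. c i)" for i by measurable
  show ?thesis unfolding linked_def by measurable
qed

context lf_poisson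
begin

text \<open>The instance of \<open>sprinkling\<close>: the contents of a cell are the dyadic
  patterns of its retained and removed points, and \<open>I\<close> consists of the cells with
  positive \<open>ltheta\<close> for the retained ones.\<close>

lemma AE_component_meets_ltheta:
  assumes p: "0 < p" "p < 1" and N: "1 \<le> N" and L: "AE x in marked p. lperc N q (occ (s_dn N) (Tin x))"
  shows "AE x in marked p. \<forall>C. is_inf_component (P (fst x)) C \<longrightarrow>
     (\<exists>w. 0 < ltheta N q (occ (s_dn N) (Tin x)) w \<and> P (fst x) \<inter> cell (s_dn N) w \<subseteq> C)"
proof -
  let ?s = "s_dn N"
  have s: "0 < ?s" by (rule s_pos)
  interpret Q: prob_space "marked p" by (rule prob_space_marked)
  interpret B: lf_poisson "marked p" "lam * pr p False" "Tb False" by (rule lf_poisson_Tb[OF p])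
  have sets_encL [measurable_cong]: "sets (encL ?s p b) = sets encM" for b by (simp add: encL_def)
  have coord: "Measurable.pred (encL ?s p b) (\<lambda>c. c i)" for b i by measurable
  let ?I = "\<lambda>\<sigma> z. 0 < ltheta N q \<sigma> z"
  interpret S: sprinkling "encL ?s p True" "encL ?s p False" "linked ?s" "\<lambda>c. c (0, 0)" "\<lambda>c. c (0, 0)" ?I
  proof (rule sprinkling.intro)
    show "prob_space (encL ?s p True)" "prob_space (encL ?s p False)"
      unfolding encL_def by (intro Q.prob_space_distr measurable_enc s)+
    show "Measurable.pred ((encL ?s p True \<Otimes>\<^sub>M encL ?s p False) \<Otimes>\<^sub>M (encL ?s p True \<Otimes>\<^sub>M encL ?s p False))
      (\<lambda>x. linked ?s z w (fst x) (snd x))" for z w by (rule measurable_linked[OF sets_encL sets_encL])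
    show "linked ?s w z d c" if "linked ?s z w c d" for z w c d
    proof -
      have nc: "nearc t a b \<Longrightarrow> nearc t b a" for t a b unfolding nearc_def by (metis dist_commute)
      show ?thesis using that unfolding linked_def supd_commute[of w z] by (meson nc)
    qed
    show "linked ?s (z + v) (w + v) c d \<longleftrightarrow> linked ?s z w c d" for z w v c d
    proof -
      have sc: "a + scl m (z + v) = (a + scl m z) + scl m v" for a m z by (simp add: scl_def algebra_simps prod_eq_iff)
      have "nearc (?s / 2 ^ m) (a + scl m (z + v)) (b + scl m (w + v)) \<longleftrightarrow> nearc (?s / 2 ^ m) (a + scl m z) (b + scl m w)" for m a b
        unfolding sc by (rule nearc_shift) (use s in simp)
      then show ?thesis unfolding linked_def by simp
    qed
    show "fst c (0, 0) \<or> snd c (0, 0)" if "linked ?s z w c d" for z w c d using that by (simp add: linked_def)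
    show "linked ?s z w c d" if "supd z w = 1" "fst c (0, 0) \<or> snd c (0, 0)" "fst d (0, 0) \<or> snd d (0, 0)" for z w c d
      using that by (simp add: linked_def)
    show "Measurable.pred (encL ?s p True) (\<lambda>c. c (0, 0))" "Measurable.pred (encL ?s p False) (\<lambda>c. c (0, 0))"
      by (rule coord)+
    show "0 < measure (encL ?s p False) {c\<in>space (encL ?s p False). c (0, 0)}"
    proof -
      have coord0: "Measurable.pred (encL ?s p False) (\<lambda>c. c (0, 0))" by (rule coord)
      have "{c\<in>space (encL ?s p False). c (0, 0)} \<in> sets encM"
        using coord0 sets_encL by (simp add: pred_def)
      then have "measure (encL ?s p False) {c\<in>space (encL ?s p False). c (0, 0)} =
          Q.prob ((\<lambda>x. enc ?s (Tb False x) 0) -` {c\<in>space (encL ?s p False). c (0, 0)} \<inter> space (marked p))"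
        unfolding encL_def by (intro measure_distr measurable_enc s) simp
      also have "(\<lambda>x. enc ?s (Tb False x) 0) -` {c\<in>space (encL ?s p False). c (0, 0)} \<inter> space (marked p) =
         space (marked p) - {x\<in>space (marked p). card (Tb False x \<inter> cell ?s 0) = 0}"
        using B.occ_iff[OF s, of _ 0] by (auto simp: encL_def space_PiM enc_0 simp del: Tb_simps)
      also have "Q.prob \<dots> = 1 - pois (lam * pr p False * measure lborel (cell ?s 0)) 0"
      proof -
        note [measurable] = B.count_measurable[OF cell_borel bounded_cell[OF s]]
        have "{x\<in>space (marked p). card (Tb False x \<inter> cell ?s 0) = 0} \<in> Q.events" by measurable
        from Q.prob_compl[OF this] show ?thesis using B.count_prob[OF cell_borel bounded_cell[OF s]] by simp
      qed
      also have "\<dots> > 0" using B.lam_pos s by (simp add: pois_def measure_cell)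
      finally show ?thesis .
    qed
    show "Measurable.pred (PiM UNIV (\<lambda>_. count_space UNIV)) (\<lambda>\<sigma>. ?I \<sigma> z)" for z by measurable
    show "?I (\<lambda>u. \<sigma> (u - v)) (z + v) \<longleftrightarrow> ?I \<sigma> z" for \<sigma> z v unfolding ltheta_shift ..
    have m: "Measurable.pred (PiM UNIV (\<lambda>_::site. encL ?s p True)) (\<lambda>f. \<exists>z. ?I (\<lambda>u. f u (0, 0)) z)"
    proof -
      have cT: "Measurable.pred (encL ?s p True) (\<lambda>c. c (0, 0))" by (rule coord)
      have [measurable]: "Measurable.pred (PiM UNIV (\<lambda>_::site. encL ?s p True)) (\<lambda>f. f u (0, 0))" for u
        by (rule measurable_compose[OF _ cT]) (rule measurable_component_singleton, simp)
      show ?thesis by measurable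
    qed
    have "AE x in marked p. \<exists>z. ?I (\<lambda>u. enc ?s (Tb True x) u (0, 0)) z"
      using L by (simp add: enc_0 lperc_def)
    then have "AE f in distr (marked p) (PiM UNIV (\<lambda>_. encM)) (\<lambda>x. enc ?s (Tb True x)). \<exists>z. ?I (\<lambda>u. f u (0, 0)) z"
    proof (subst AE_distr_iff[OF measurable_enc_family[OF s]])
      have "sets (PiM UNIV (\<lambda>_::site. encL ?s p True)) = sets (PiM UNIV (\<lambda>_::site. encM))"
        by (intro sets_PiM_cong refl sets_encL)
      from m[unfolded pred_def] this sets_eq_imp_space_eq[OF this]
      show "{f\<in>space (PiM UNIV (\<lambda>_. encM)). \<exists>z. ?I (\<lambda>u. f u (0, 0)) z} \<in> sets (PiM UNIV (\<lambda>_. encM))"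
        by simp
    qed
    then show "AE f in PiM UNIV (\<lambda>_. encL ?s p True). \<exists>z. ?I (\<lambda>u. f u (0, 0)) z"
      unfolding distr_enc_family[OF s p] .
  qed
  have pm: "(\<lambda>x. (enc ?s (Tb True x), enc ?s (Tb False x))) \<in>
      measurable (marked p) (PiM UNIV (\<lambda>_. encM) \<Otimes>\<^sub>M PiM UNIV (\<lambda>_. encM))"
    by (intro measurable_Pair measurable_enc_family s)
  from AE_distrD[OF pm, unfolded distr_enc_pair[OF s p], OF S.AE_infinite_component_meets_I]
  show ?thesis
  proof eventually_elim
    case (elim x)
    define T where "T = Tin x"
    define U where "U = Tout x"
    have PT: "P (fst x) = T \<union> U" by (auto simp: T_def U_def thinned_def)
    show ?case unfolding T_def[symmetric]
    proof (intro allI impI)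
      fix C assume C: "is_inf_component (P (fst x)) C"
      have "\<exists>w. ?I (occ ?s T) w \<and> (T \<union> U) \<inter> cell ?s w \<subseteq> C"
      proof (rule component_meets_cell[OF _ s s_dn_eq N])
        show "loc_finite (T \<union> U)" using lf[of "fst x"] unfolding PT .
        show "is_inf_component (T \<union> U) C" using C unfolding PT .
      qed (use elim in \<open>auto simp: S.G_def[abs_def] enc_0 T_def U_def\<close>)
      then show "\<exists>w. 0 < ltheta N q (occ ?s T) w \<and> P (fst x) \<inter> cell ?s w \<subseteq> C" unfolding PT .
    qed
  qed
qed

end

section \<open>Critical probabilities of a component\<close>

lemma bernoulli_and:
  assumes "0 \<le> r" "r \<le> 1" "0 \<le> t" "t \<le> 1"
  shows "map_pmf (\<lambda>x. fst x \<and> snd x) (pair_pmf (bernoulli_pmf r) (bernoulli_pmf t)) = bernoulli_pmf (r * t)"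
proof -
  define m where "m = map_pmf (\<lambda>x. fst x \<and> snd x) (pair_pmf (bernoulli_pmf r) (bernoulli_pmf t))"
  have rt: "0 \<le> r * t" "r * t \<le> 1" using assms by (auto intro: mult_le_one)
  have v: "(\<lambda>x. fst x \<and> snd x) -` {True} = {(True, True)}" by (intro set_eqI) (simp add: prod_eq_iff)
  have "pmf m True = pmf (pair_pmf (bernoulli_pmf r) (bernoulli_pmf t)) (True, True)"
    unfolding m_def pmf_map v by (rule measure_pmf_single)
  also have "\<dots> = r * t" unfolding pmf_pair using assms by simp
  finally have T: "pmf m True = r * t" .
  have F: "pmf m False = 1 - r * t" using pmf_False_conv_True[of m] T by simp
  have "m = bernoulli_pmf (r * t)"
  proof (rule pmf_eqI)
    fix b show "pmf m b = pmf (bernoulli_pmf (r * t)) b" using T F rt by (cases b) simp_all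
  qed
  then show ?thesis by (simp only: m_def)
qed

text \<open>Coupling: each bond open at parameter \<open>r\<close> is kept by an independent coin of
  bias \<open>q / r\<close>.\<close>

lemma ltheta_mono:
  assumes q: "0 \<le> q" "q \<le> r" "r \<le> 1"
  shows "ltheta N q \<sigma> z \<le> ltheta N r \<sigma> z"
proof (cases "r = 0")
  case False
  define t where "t = q / r"
  have t: "0 \<le> t" "t \<le> 1" "r * t = q" "0 \<le> r" using q False by (auto simp: t_def field_simps)
  define m where "m = pair_pmf (bernoulli_pmf r) (bernoulli_pmf t)"
  let ?P = "PiM UNIV (\<lambda>_ :: site set. measure_pmf m)"
  have dm: "distr ?P (Bern p) (\<lambda>\<omega> i. f (\<omega> i)) = Bern p" "(\<lambda>\<omega> i. f (\<omega> i)) \<in> measurable ?P (Bern p)"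
    if "map_pmf f m = bernoulli_pmf p" for f p
  proof -
    have "distr (measure_pmf m) (measure_pmf (bernoulli_pmf p)) f = measure_pmf (bernoulli_pmf p)"
      unfolding that[symmetric] map_pmf_rep_eq by (rule distr_cong) auto
    then show "distr ?P (Bern p) (\<lambda>\<omega> i. f (\<omega> i)) = Bern p"
      by (intro distr_PiM_map measure_pmf.prob_space_axioms) auto
    show "(\<lambda>\<omega> i. f (\<omega> i)) \<in> measurable ?P (Bern p)"
      by (rule measurable_PiM_single') (auto intro: measurable_compose[OF measurable_component_singleton])
  qed
  have m1: "map_pmf fst m = bernoulli_pmf r" unfolding m_def by (rule map_fst_pair_pmf)
  have m2: "map_pmf (\<lambda>x. fst x \<and> snd x) m = bernoulli_pmf q"
    unfolding m_def using bernoulli_and[of r t] t q by simp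
  have "ltheta N q \<sigma> z = emeasure ?P ((\<lambda>\<omega> i. fst (\<omega> i) \<and> snd (\<omega> i)) -` {\<eta>. infc N \<sigma> \<eta> z} \<inter> space ?P)"
    unfolding ltheta_def by (subst dm(1)[OF m2, symmetric], subst emeasure_distr[OF dm(2)[OF m2] infc_sets]) simp
  also have "\<dots> \<le> emeasure ?P ((\<lambda>\<omega> i. fst (\<omega> i)) -` {\<eta>. infc N \<sigma> \<eta> z} \<inter> space ?P)"
  proof (rule emeasure_mono)
    show "(\<lambda>\<omega> i. fst (\<omega> i) \<and> snd (\<omega> i)) -` {\<eta>. infc N \<sigma> \<eta> z} \<inter> space ?P \<subseteq> (\<lambda>\<omega> i. fst (\<omega> i)) -` {\<eta>. infc N \<sigma> \<eta> z} \<inter> space ?P"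
      using infc_mono[of N \<sigma> _ z] by auto
    show "(\<lambda>\<omega> i. fst (\<omega> i)) -` {\<eta>. infc N \<sigma> \<eta> z} \<inter> space ?P \<in> sets ?P"
      by (rule measurable_sets[OF dm(2)[OF m1] infc_sets])
  qed
  also have "\<dots> = ltheta N r \<sigma> z"
    unfolding ltheta_def by (subst dm(1)[OF m1, symmetric], subst emeasure_distr[OF dm(2)[OF m1] infc_sets]) simp
  finally show ?thesis .
next
  case True
  then have "q = r" using q by simp
  then show ?thesis by simp
qed

text \<open>The lattice bonds \<open>E\<close> between representatives in \<open>C\<close> inject
  into the edges of \<open>C\<close>. Pulled back along this injection, the edge states have the
  same law as \<open>Bern q\<close> restricted to \<open>E\<close>.\<close>

lemma bond_perc_of_ltheta:
  assumes s: "0 < s" "s * (4 * real N + sqrt 2) \<le> 1" and TS: "T \<subseteq> S"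
    and C: "\<And>x y. x \<in> C \<Longrightarrow> gadj S x y \<Longrightarrow> y \<in> C" and w: "S \<inter> cell s w \<subseteq> C" "0 < ltheta N q (occ s T) w"
  shows "\<not> (AE \<eta> in PiM (gedges C) (\<lambda>_. measure_pmf (bernoulli_pmf q)). \<not> bond_perc C \<eta>)"
proof
  assume ae: "AE \<eta> in PiM (gedges C) (\<lambda>_. measure_pmf (bernoulli_pmf q)). \<not> bond_perc C \<eta>"
  let ?B = "\<lambda>_. measure_pmf (bernoulli_pmf q)"
  define E where "E = {{a, b} | a b. occ s T a \<and> occ s T b \<and> ladj N a b \<and> rep s T a \<in> C \<and> rep s T b \<in> C}"
  let ?f = "\<lambda>e. rep s T ` e"
  \<comment> \<open>Bonds outside \<open>E\<close> count as open. This only enlarges the event, and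
    \<open>bond_embed\<close> compares bonds only between representatives in
    \<open>C\<close>.\<close>
  define V where "V \<zeta> \<longleftrightarrow> infc N (occ s T) (\<lambda>e. e \<in> E \<longrightarrow> \<zeta> e) w" for \<zeta>
  have inj: "inj_on ?f E"
  proof (rule inj_on_subset[OF inj_on_image_Pow])
    show "inj_on (rep s T) {a. occ s T a}" using rep_inj by (auto intro: inj_onI)
    show "E \<subseteq> Pow {a. occ s T a}" by (auto simp: E_def)
  qed
  have fE: "?f \<in> E \<rightarrow> gedges C"
  proof
    fix e assume "e \<in> E"
    then obtain a b where e: "e = {a, b}" "occ s T a" "occ s T b" "ladj N a b" "rep s T a \<in> C" "rep s T b \<in> C"
      by (auto simp: E_def)
    have "dist (rep s T a) (rep s T b) \<le> 1"
      by (rule ladj_dist[of a b N _ s]) (use e rep_in s in auto)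
    moreover have "rep s T a \<noteq> rep s T b" using rep_inj[OF e(2,3)] e(4) by (auto simp: ladj_def)
    ultimately have "gadj C (rep s T a) (rep s T b)" using e by (simp add: gadj_def)
    then show "?f e \<in> gedges C" unfolding gedges_def e(1) by auto
  qed
  have d1: "distr (PiM (gedges C) ?B) (PiM E ?B) (\<lambda>\<eta>. \<lambda>e\<in>E. \<eta> (?f e)) = PiM E ?B"
    using distr_PiM_reindex[of "gedges C" ?B ?f E] inj fE by (simp add: measure_pmf.prob_space_axioms)
  have d2: "distr (Bern q) (PiM E ?B) (\<lambda>\<eta>. \<lambda>e\<in>E. \<eta> e) = PiM E ?B"
    using distr_PiM_reindex[of UNIV ?B "\<lambda>e. e" E] by (simp add: measure_pmf.prob_space_axioms)
  have m1: "(\<lambda>\<eta>. \<lambda>e\<in>E. \<eta> (?f e)) \<in> measurable (PiM (gedges C) ?B) (PiM E ?B)"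
    by (rule measurable_restrict, rule measurable_component_singleton) (use fE in blast)
  have m2: "(\<lambda>\<eta>. \<lambda>e\<in>E. \<eta> e) \<in> measurable (Bern q) (PiM E ?B)"
    by (rule measurable_restrict) auto
  have Vm: "Measurable.pred (PiM E ?B) V"
    unfolding V_def
  proof (rule measurable_infc)
    fix e show "Measurable.pred (PiM E ?B) (\<lambda>\<zeta>. e \<in> E \<longrightarrow> \<zeta> e)" by (cases "e \<in> E") auto
  qed simp
  have wo: "occ s T w"
  proof -
    obtain \<eta> where "infc N (occ s T) \<eta> w"
    proof (cases "\<exists>\<eta>. infc N (occ s T) \<eta> w")
      case False
      then have "ltheta N q (occ s T) w = 0" by (simp add: ltheta_def)
      then show ?thesis using w(2) by simp
    qed blast
    then show ?thesis by (rule infc_open)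
  qed
  have emb: "bond_perc C \<eta>" if V: "V (\<lambda>e\<in>E. \<eta> (?f e))" for \<eta>
  proof (rule bond_embed[OF s TS])
    show "y \<in> C" if "x \<in> C" "gadj S x y" for x y using that by (rule C)
    show "rep s T w \<in> C" using rep_in[OF wo] w(1) TS by blast
    show "infc N (occ s T) (\<lambda>e. e \<in> E \<longrightarrow> (\<lambda>e\<in>E. \<eta> (?f e)) e) w" using V unfolding V_def .
    fix a b assume ab: "occ s T a" "occ s T b" "ladj N a b" "rep s T a \<in> C" "rep s T b \<in> C"
      "{a, b} \<in> E \<longrightarrow> (\<lambda>e\<in>E. \<eta> (?f e)) {a, b}"
    have "{a, b} \<in> E" using ab by (auto simp: E_def)
    then show "\<eta> {rep s T a, rep s T b}" using ab(6) by simp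
  qed
  have "AE \<eta> in PiM (gedges C) ?B. \<not> V (\<lambda>e\<in>E. \<eta> (?f e))" using ae by eventually_elim (use emb in blast)
  then have "AE \<zeta> in distr (PiM (gedges C) ?B) (PiM E ?B) (\<lambda>\<eta>. \<lambda>e\<in>E. \<eta> (?f e)). \<not> V \<zeta>"
    by (subst AE_distr_iff[OF m1]) (use Vm in \<open>auto simp: pred_def\<close>)
  then have "AE \<zeta> in distr (Bern q) (PiM E ?B) (\<lambda>\<eta>. \<lambda>e\<in>E. \<eta> e). \<not> V \<zeta>" unfolding d1 d2 .
  from AE_distrD[OF m2 this] have "AE \<eta> in Bern q. \<not> infc N (occ s T) \<eta> w"
  proof eventually_elim
    case (elim \<eta>)
    then show ?case using infc_mono[of N "occ s T" \<eta> w "\<lambda>e. e \<in> E \<longrightarrow> (\<lambda>e\<in>E. \<eta> e) e"] by (auto simp: V_def)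
  qed
  then have "emeasure (Bern q) {\<eta>. infc N (occ s T) \<eta> w} = 0"
    by (subst (asm) AE_iff_measurable[OF infc_sets]) auto
  then show False using w(2) by (simp add: ltheta_def)
qed

text \<open>By \<open>ltheta_mono\<close> no parameter above \<open>q\<close> belongs to the set
  whose supremum is \<open>pc_bond C\<close>. Parameter 0 belongs to it, so the supremum is not that
  of an empty set.\<close>

lemma pc_bond_le:
  assumes s: "0 < s" "s * (4 * real N + sqrt 2) \<le> 1" and TS: "T \<subseteq> S"
    and C: "\<And>x y. x \<in> C \<Longrightarrow> gadj S x y \<Longrightarrow> y \<in> C" and w: "S \<inter> cell s w \<subseteq> C" "0 < ltheta N q (occ s T) w"
    and q: "0 \<le> q" and cnt: "countable C"
  shows "pc_bond C \<le> q"
  unfolding pc_bond_def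
proof (rule cSup_least)
  let ?B = "\<lambda>p _. measure_pmf (bernoulli_pmf p)"
  interpret prob_space "PiM (gedges C) (?B 0)" by (intro prob_space_PiM measure_pmf.prob_space_axioms)
  let ?A = "{p \<in> {0..1}. AE \<eta> in PiM (gedges C) (?B p). \<not> bond_perc C \<eta>}"
  show "p \<le> q" if p: "p \<in> ?A" for p
  proof (rule ccontr)
    assume n: "\<not> p \<le> q"
    have "ltheta N q (occ s T) w \<le> ltheta N p (occ s T) w" by (rule ltheta_mono) (use n p q in auto)
    then have "0 < ltheta N p (occ s T) w" using w(2) by (rule less_le_trans[rotated])
    from p have ae: "AE \<eta> in PiM (gedges C) (?B p). \<not> bond_perc C \<eta>" by simp
    have "\<not> (AE \<eta> in PiM (gedges C) (?B p). \<not> bond_perc C \<eta>)"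
      by (rule bond_perc_of_ltheta[OF s TS _ w(1) \<open>0 < ltheta N p (occ s T) w\<close>]) (rule C)
    then show False using ae by (rule notE)
  qed
  have "gedges C \<subseteq> (\<lambda>(x, y). {x, y}) ` (C \<times> C)" by (auto simp: gedges_def gadj_def)
  then have cE: "countable (gedges C)" by (rule countable_subset) (use cnt in auto)
  have "AE \<eta> in PiM (gedges C) (?B 0). \<forall>e\<in>gedges C. \<not> \<eta> e"
  proof (rule AE_ball_countable'[OF _ cE])
    fix e assume e: "e \<in> gedges C"
    interpret P: product_prob_space "?B 0" "gedges C" by unfold_locales
    show "AE \<eta> in PiM (gedges C) (?B 0). \<not> \<eta> e"
      by (rule P.AE_component[OF e]) (auto simp: AE_measure_pmf_iff set_pmf_iff)
  qed
  then have "AE \<eta> in PiM (gedges C) (?B 0). \<not> bond_perc C \<eta>"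
  proof eventually_elim
    case (elim \<eta>)
    have "y = x" if "(\<lambda>a b. gadj C a b \<and> \<eta> {a, b})\<^sup>*\<^sup>* x y" for x y
      using that by (cases rule: converse_rtranclpE) (use elim in \<open>auto simp: gedges_def\<close>)
    then have "{y. (\<lambda>a b. gadj C a b \<and> \<eta> {a, b})\<^sup>*\<^sup>* x y} \<subseteq> {x}" for x by blast
    from finite_subset[OF this] show ?case by (simp add: bond_perc_def)
  qed
  then have "0 \<in> ?A" by simp
  then show "?A \<noteq> {}" by blast
qed

section \<open>The site threshold of a component\<close>

lemma countable_loc_finite: "loc_finite S \<Longrightarrow> countable S"
proof -
  assume S: "loc_finite S"
  have "S \<subseteq> (\<Union>n. S \<inter> ball 0 (real n))"
    using reals_Archimedean2 by (auto simp: dist_norm)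
  moreover have "countable (\<Union>n. S \<inter> ball 0 (real n))"
  proof (rule countable_UN)
    show "countable (S \<inter> ball 0 (real n))" for n using S by (intro countable_finite) (simp add: loc_finite_def)
  qed simp
  ultimately show ?thesis by (rule countable_subset)
qed

lemma has_inf_comp_mono: "has_inf_comp V \<Longrightarrow> V \<subseteq> V' \<Longrightarrow> has_inf_comp V'"
proof -
  assume "has_inf_comp V" and sub: "V \<subseteq> V'"
  then obtain x where x: "x \<in> V" "infinite {y. (gadj V)\<^sup>*\<^sup>* x y}" by (auto simp: has_inf_comp_def)
  have "gadj V \<le> gadj V'" using sub by (auto simp: gadj_def)
  from rtranclp_mono[OF this] have "{y. (gadj V)\<^sup>*\<^sup>* x y} \<subseteq> {y. (gadj V')\<^sup>*\<^sup>* x y}" by blast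
  from infinite_super[OF this x(2)] show ?thesis using x(1) sub by (auto simp: has_inf_comp_def)
qed

lemma pred_countable_bounded:
  assumes X: "countable X" and P: "\<And>i. i \<in> X \<Longrightarrow> Measurable.pred M (P i)"
  shows "Measurable.pred M (\<lambda>x. \<exists>i\<in>X. P i x)" "Measurable.pred M (\<lambda>x. \<forall>i\<in>X. P i x)"
proof -
  have ex: "Measurable.pred M (\<lambda>x. \<exists>i\<in>X. Q i x)" if "\<And>i. i \<in> X \<Longrightarrow> Measurable.pred M (Q i)" for Q
  proof -
    have "{x\<in>space M. \<exists>i\<in>X. Q i x} = (\<Union>i\<in>X. {x\<in>space M. Q i x})" by auto
    also have "\<dots> \<in> sets M" by (rule sets.countable_UN'[OF X]) (use that in \<open>auto simp: pred_def\<close>)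
    finally show ?thesis by (simp add: pred_def)
  qed
  show "Measurable.pred M (\<lambda>x. \<exists>i\<in>X. P i x)" by (rule ex[OF P])
  have "Measurable.pred M (\<lambda>x. \<exists>i\<in>X. \<not> P i x)" by (rule ex) (use P in simp)
  then have "Measurable.pred M (\<lambda>x. \<not> (\<exists>i\<in>X. \<not> P i x))" by (rule pred_intros_logic(2))
  then show "Measurable.pred M (\<lambda>x. \<forall>i\<in>X. P i x)" by simp
qed

text \<open>The plane is uncountable, so unions over points are taken inside the countable
  \<open>C\<close>, and infinity is tested against the countably many finite subsets of
  \<open>C\<close>.\<close>

lemma measurable_has_inf_comp:
  assumes C: "countable C"
  shows "Measurable.pred (PiM C (\<lambda>_. measure_pmf (bernoulli_pmf p))) (\<lambda>\<xi>. has_inf_comp {v\<in>C. \<xi> v})"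
proof -
  let ?M = "PiM C (\<lambda>_. measure_pmf (bernoulli_pmf p))"
  define R where "R \<xi> = gadj {v\<in>C. \<xi> v}" for \<xi>
  have v: "Measurable.pred ?M (\<lambda>\<xi>. a \<in> C \<and> \<xi> a)" for a by (cases "a \<in> C") auto
  have g [measurable]: "Measurable.pred ?M (\<lambda>\<xi>. R \<xi> a b)" for a b
  proof -
    note [measurable] = v[of a] v[of b]
    have "R \<xi> a b \<longleftrightarrow> (a \<in> C \<and> \<xi> a) \<and> (b \<in> C \<and> \<xi> b) \<and> a \<noteq> b \<and> dist a b \<le> 1" for \<xi>
      by (auto simp: R_def gadj_def)
    then show ?thesis by simp
  qed
  have pw: "Measurable.pred ?M (\<lambda>\<xi>. (R \<xi> ^^ n) a b)" for n a b
  proof (induction n arbitrary: b)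
    case (Suc n)
    have "(R \<xi> ^^ Suc n) a b \<longleftrightarrow> (\<exists>c\<in>C. (R \<xi> ^^ n) a c \<and> R \<xi> c b)" for \<xi>
      by (auto simp: OO_def R_def gadj_def)
    moreover have "Measurable.pred ?M (\<lambda>\<xi>. \<exists>c\<in>C. (R \<xi> ^^ n) a c \<and> R \<xi> c b)"
      by (rule pred_countable_bounded(1)[OF C]) (intro pred_intros_logic(3) Suc g)
    ultimately show ?case by simp
  qed simp
  have rt: "Measurable.pred ?M (\<lambda>\<xi>. (R \<xi>)\<^sup>*\<^sup>* a b)" for a b
    unfolding rtranclp_power by (intro pred_intros_countable pw)
  have inC: "y \<in> C" if "(R \<xi>)\<^sup>*\<^sup>* x y" "x \<in> C" for \<xi> x y
    using that by (cases rule: rtranclp.cases) (auto simp: R_def gadj_def)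
  have inf: "infinite A \<longleftrightarrow> (\<forall>F\<in>{F. finite F \<and> F \<subseteq> C}. \<exists>y\<in>C. y \<notin> F \<and> y \<in> A)" if "A \<subseteq> C" for A
  proof
    assume a: "infinite A"
    show "\<forall>F\<in>{F. finite F \<and> F \<subseteq> C}. \<exists>y\<in>C. y \<notin> F \<and> y \<in> A"
    proof
      fix F assume "F \<in> {F. finite F \<and> F \<subseteq> C}"
      then have "infinite (A - F)" using a by simp
      then have "A - F \<noteq> {}" by (rule infinite_imp_nonempty)
      then obtain y where "y \<in> A - F" by blast
      then show "\<exists>y\<in>C. y \<notin> F \<and> y \<in> A" using that by blast
    qed
  next
    assume a: "\<forall>F\<in>{F. finite F \<and> F \<subseteq> C}. \<exists>y\<in>C. y \<notin> F \<and> y \<in> A"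
    show "infinite A" using bspec[OF a, of A] that by blast
  qed
  have "has_inf_comp {v\<in>C. \<xi> v} \<longleftrightarrow> (\<exists>x\<in>C. (x \<in> C \<and> \<xi> x) \<and>
      (\<forall>F\<in>{F. finite F \<and> F \<subseteq> C}. \<exists>y\<in>C. y \<notin> F \<and> (R \<xi>)\<^sup>*\<^sup>* x y))" for \<xi>
  proof -
    have "infinite {y. (R \<xi>)\<^sup>*\<^sup>* x y} \<longleftrightarrow> (\<forall>F\<in>{F. finite F \<and> F \<subseteq> C}. \<exists>y\<in>C. y \<notin> F \<and> (R \<xi>)\<^sup>*\<^sup>* x y)" if "x \<in> C" for x
      using inf[of "{y. (R \<xi>)\<^sup>*\<^sup>* x y}"] inC that by blast
    then show ?thesis unfolding has_inf_comp_def R_def[symmetric] by auto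
  qed
  moreover have "Measurable.pred ?M (\<lambda>\<xi>. \<exists>x\<in>C. (x \<in> C \<and> \<xi> x) \<and>
      (\<forall>F\<in>{F. finite F \<and> F \<subseteq> C}. \<exists>y\<in>C. y \<notin> F \<and> (R \<xi>)\<^sup>*\<^sup>* x y))"
  proof (rule pred_countable_bounded(1)[OF C])
    fix x
    have "Measurable.pred ?M (\<lambda>\<xi>. \<exists>y\<in>C. y \<notin> F \<and> (R \<xi>)\<^sup>*\<^sup>* x y)" for F
      by (rule pred_countable_bounded(1)[OF C]) (use rt[of x] in simp)
    then have "Measurable.pred ?M (\<lambda>\<xi>. \<forall>F\<in>{F. finite F \<and> F \<subseteq> C}. \<exists>y\<in>C. y \<notin> F \<and> (R \<xi>)\<^sup>*\<^sup>* x y)"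
      by (rule pred_countable_bounded(2)[OF countable_Collect_finite_subset[OF C]])
    note [measurable] = this v[of x]
    show "Measurable.pred ?M (\<lambda>\<xi>. (x \<in> C \<and> \<xi> x) \<and>
      (\<forall>F\<in>{F. finite F \<and> F \<subseteq> C}. \<exists>y\<in>C. y \<notin> F \<and> (R \<xi>)\<^sup>*\<^sup>* x y))" by measurable
  qed
  ultimately show ?thesis by simp
qed

lemma midpoint_between: "x < y \<Longrightarrow> x < (x + y) / 2 \<and> (x + y) / 2 < y" for x y :: real
  by simp

context lf_poisson
begin

text \<open>Marks indexed by labels restrict to independent marks of the points of \<open>C\<close>,
  so site percolation on \<open>C\<close> lies inside the thinned process, whose intensity
  \<open>lam * p\<close> is subcritical.\<close>

lemma pc_site_ge:
  assumes p: "0 < p" "p < 1" and sub: "lam * p < gilbert_lambda_c" and sup: "gilbert_lambda_c < lam"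
  shows "AE \<omega> in M. \<forall>C. is_inf_component (P \<omega>) C \<longrightarrow> p \<le> pc_site C"
proof -
  \<comment> \<open>\<open>inf_comp_perc_intensity\<close> needs a strictly larger intensity, so
    \<open>lam * p2\<close> is taken strictly between \<open>lam * p\<close> and
    \<open>gilbert_lambda_c\<close>.\<close>
  define p2 where "p2 = (p + gilbert_lambda_c / lam) / 2"
  have "p < gilbert_lambda_c / lam" "gilbert_lambda_c / lam < 1" using sub sup lam_pos by (auto simp: field_simps)
  then have p2: "p < p2 \<and> p2 < gilbert_lambda_c / lam \<and> p2 < 1" unfolding p2_def using midpoint_between by (meson less_trans)
  have "AE x in marked p. \<not> has_inf_comp (Tin x)"
  proof (rule ccontr)
    assume n: "\<not> ?thesis"
    have "lam * p2 \<in> perc_intensities"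
      by (rule inf_comp_perc_intensity[OF lf_poisson_thinned[of p] lf_poisson_thinned[of p2] _ n]) (use p p2 lam_pos in simp_all)
    from gilbert_le[OF this] show False using p2 lam_pos by (simp add: field_simps)
  qed
  then have ae: "AE x in M \<Otimes>\<^sub>M Bern p. \<not> has_inf_comp (thinned (P (fst x)) (snd x))" unfolding marked_def .
  interpret U: prob_space "Bern p :: (site \<times> nat \<times> site \<Rightarrow> bool) measure" by (rule prob_space_Bern)
  interpret X: pair_sigma_finite M "Bern p :: (site \<times> nat \<times> site \<Rightarrow> bool) measure" by unfold_locales
  from X.AE_pair[OF ae] show ?thesis
  proof eventually_elim
    case (elim \<omega>)
    show ?case
    proof (intro allI impI)
      fix C assume "is_inf_component (P \<omega>) C"
      then obtain x where x: "x \<in> P \<omega>" "C = {y. (gadj (P \<omega>))\<^sup>*\<^sup>* x y}" by (auto simp: is_inf_component_def)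
      have CP: "C \<subseteq> P \<omega>"
      proof
        fix y assume "y \<in> C"
        then have "(gadj (P \<omega>))\<^sup>*\<^sup>* x y" using x by simp
        then show "y \<in> P \<omega>" by (cases rule: rtranclp.cases) (use x in \<open>auto simp: gadj_def\<close>)
      qed
      have cC: "countable C" using countable_loc_finite[OF lf] CP by (rule countable_subset[rotated])
      let ?B = "\<lambda>_. measure_pmf (bernoulli_pmf p)"
      let ?l = "label (P \<omega>)"
      have "AE u in Bern p. \<not> has_inf_comp {v\<in>C. (\<lambda>v\<in>C. u (?l v)) v}"
        using elim
      proof eventually_elim
        case (elim u)
        have sub: "{v\<in>C. (\<lambda>v\<in>C. u (?l v)) v} \<subseteq> thinned (P \<omega>) u" using CP by (auto simp: thinned_def)
        show ?case
        proof
          assume "has_inf_comp {v\<in>C. (\<lambda>v\<in>C. u (?l v)) v}"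
          from has_inf_comp_mono[OF this sub] show False using elim by simp
        qed
      qed
      moreover have m: "(\<lambda>u. \<lambda>v\<in>C. u (?l v)) \<in> measurable (Bern p) (PiM C ?B)"
        by (rule measurable_restrict) auto
      ultimately have A: "AE \<xi> in distr (Bern p) (PiM C ?B) (\<lambda>u. \<lambda>v\<in>C. u (?l v)). \<not> has_inf_comp {v\<in>C. \<xi> v}"
        using measurable_has_inf_comp[OF cC, of p] by (subst AE_distr_iff[OF m]) (auto simp: pred_def)
      have d: "distr (Bern p) (PiM C ?B) (\<lambda>u. \<lambda>v\<in>C. u (?l v)) = PiM C ?B"
        using distr_PiM_reindex[of UNIV ?B ?l C] inj_on_subset[OF inj_on_label[OF lf] CP]
        by (simp add: measure_pmf.prob_space_axioms)
      from A have "AE \<xi> in PiM C ?B. \<not> has_inf_comp {v\<in>C. \<xi> v}" unfolding d .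
      then show "p \<le> pc_site C" unfolding pc_site_def
        by (intro cSup_upper) (use p in \<open>auto intro!: bdd_aboveI[of _ 1]\<close>)
    qed
  qed
qed

text \<open>An intensity above \<open>lam\<close>, needed to exclude that \<open>gilbert_lambda_c\<close> is the infimum of the empty set.\<close>

lemma lf_poisson_scaled: "lf_poisson M (4 * lam) (\<lambda>\<omega>. (\<lambda>x. (1 / 2) *\<^sub>R x) ` P \<omega>)"
proof (rule poisson_ppI)
  let ?d = "\<lambda>A. (\<lambda>x. (1 / 2) *\<^sub>R x) -` A :: pt set"
  show "prob_space M" by (rule prob_space_axioms)
  show "0 < 4 * lam" using lam_pos by simp
  have bd: "bounded (?d A)" if "bounded A" for A
  proof -
    have "?d A = (\<lambda>x. 2 *\<^sub>R x) ` A" by (force simp: image_iff)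
    then show ?thesis using bounded_scaling[OF that] by simp
  qed
  have bo: "?d A \<in> sets borel" if "A \<in> sets borel" for A
    using measurable_sets[of "\<lambda>x. (1 / 2) *\<^sub>R x :: pt" borel borel A] that by simp
  have im: "(\<lambda>x. (1 / 2) *\<^sub>R x) ` S \<inter> A = (\<lambda>x. (1 / 2) *\<^sub>R x) ` (S \<inter> ?d A)" for S A by auto
  have cd: "card ((\<lambda>x. (1 / 2) *\<^sub>R x) ` S \<inter> A) = card (S \<inter> ?d A)" for S A
    unfolding im by (rule card_image) (simp add: inj_on_def)
  have ms: "lam * measure lborel (?d A) = 4 * lam * measure lborel A" if A: "A \<in> sets borel" for A
  proof -
    have "lborel = density (distr lborel borel (\<lambda>x. 0 + (1 / 2) *\<^sub>R x :: pt)) (\<lambda>_. ennreal (\<bar>1 / 2\<bar> ^ DIM(pt)))"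
      by (rule lborel_affine) simp
    then have "emeasure lborel A = emeasure (density (distr lborel borel (\<lambda>x. (1 / 2) *\<^sub>R x :: pt)) (\<lambda>_. ennreal (1 / 4))) A"
      by (simp add: power2_eq_square)
    also have "\<dots> = ennreal (1 / 4) * emeasure lborel (?d A)"
      using A by (simp add: emeasure_density_const emeasure_distr)
    finally have "measure lborel A = 1 / 4 * measure lborel (?d A)" by (simp add: measure_def enn2real_mult)
    then show ?thesis by simp
  qed
  show "loc_finite ((\<lambda>x. (1 / 2) *\<^sub>R x) ` P \<omega>)" for \<omega>
    unfolding loc_finite_def im using lf bd by (auto simp: loc_finite_def)
  show "(\<lambda>\<omega>. card ((\<lambda>x. (1 / 2) *\<^sub>R x) ` P \<omega> \<inter> A)) \<in> measurable M (count_space UNIV)"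
    if "A \<in> sets borel" "bounded A" for A unfolding cd using count_measurable[OF bo bd] that by blast
  fix J :: "nat set" and A :: "nat \<Rightarrow> pt set" and k :: "nat \<Rightarrow> nat"
  assume J: "finite J" and A: "\<And>j. j \<in> J \<Longrightarrow> A j \<in> sets borel \<and> bounded (A j)" and dj: "disjoint_family_on A J"
  have "prob {\<omega>\<in>space M. \<forall>j\<in>J. card (P \<omega> \<inter> ?d (A j)) = k j} = (\<Prod>j\<in>J. pois (lam * measure lborel (?d (A j))) (k j))"
  proof (rule count_joint[OF J])
    show "?d (A j) \<in> sets borel \<and> bounded (?d (A j))" if "j \<in> J" for j using A[OF that] bo bd by blast
    show "disjoint_family_on (\<lambda>j. ?d (A j)) J" using dj by (fastforce simp: disjoint_family_on_def)
  qed
  also have "\<dots> = (\<Prod>j\<in>J. pois (4 * lam * measure lborel (A j)) (k j))"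
    by (intro prod.cong refl) (use A in \<open>simp add: ms\<close>)
  finally show "prob {\<omega>\<in>space M. \<forall>j\<in>J. card ((\<lambda>x. (1 / 2) *\<^sub>R x) ` P \<omega> \<inter> A j) = k j} =
     (\<Prod>j\<in>J. pois (4 * lam * measure lborel (A j)) (k j))" unfolding cd .
qed

lemma site_gt_bond:
  assumes sup: "gilbert_lambda_c < lam" and perc: "\<not> (AE \<omega> in M. \<not> has_inf_comp (P \<omega>))"
  shows "AE \<omega> in M. \<forall>C. is_inf_component (P \<omega>) C \<longrightarrow> pc_bond C < pc_site C"
proof -
  have "4 * lam \<in> perc_intensities"
    by (rule inf_comp_perc_intensity[OF lf_poisson_axioms lf_poisson_scaled _ perc]) (use lam_pos in simp)
  then have ne: "perc_intensities \<noteq> {}" by blast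
  have pos: "0 < gilbert_lambda_c" by (rule gilbert_pos[OF ne])
  obtain q p N where q: "0 < q" "q < gilbert_lambda_c / lam" and p: "0 < p" "p < 1" and N: "2 \<le> N"
    and L: "AE x in marked p. lperc N q (occ (s_dn N) (Tin x))"
    by (rule supercritical_bond[OF pos sup ne])
  \<comment> \<open>\<open>pc_site_ge\<close> reaches only parameters strictly below
    \<open>gilbert_lambda_c / lam\<close>; any such value above \<open>q\<close> separates the two
    thresholds.\<close>
  define r where "r = (q + gilbert_lambda_c / lam) / 2"
  have r: "q < r \<and> r < gilbert_lambda_c / lam" unfolding r_def using q midpoint_between by blast
  have "gilbert_lambda_c / lam < 1" using sup lam_pos by simp
  then have r1: "r < 1" using r by (meson less_trans)
  have site: "AE \<omega> in M. \<forall>C. is_inf_component (P \<omega>) C \<longrightarrow> r \<le> pc_site C"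
    by (intro pc_site_ge) (use r r1 q sup lam_pos in \<open>auto simp: field_simps\<close>)
  have N1: "1 \<le> N" using N by simp
  interpret U: prob_space "Bern p :: (site \<times> nat \<times> site \<Rightarrow> bool) measure" by (rule prob_space_Bern)
  interpret X: pair_sigma_finite M "Bern p :: (site \<times> nat \<times> site \<Rightarrow> bool) measure" by unfold_locales
  have "AE \<omega> in M. AE u in Bern p. \<forall>C. is_inf_component (P \<omega>) C \<longrightarrow>
     (\<exists>w. 0 < ltheta N q (occ (s_dn N) (thinned (P \<omega>) u)) w \<and> P \<omega> \<inter> cell (s_dn N) w \<subseteq> C)"
    using X.AE_pair[OF AE_component_meets_ltheta[OF p N1 L, unfolded marked_def]] by (simp only: fst_conv snd_conv)
  with site show ?thesis
  proof eventually_elim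
    case (elim \<omega>)
    \<comment> \<open>The marks are auxiliary: the thresholds of \<open>C\<close> do not mention
      them, so for almost every outcome a single suitable \<open>u\<close> is enough.\<close>
    obtain u where u: "\<forall>C. is_inf_component (P \<omega>) C \<longrightarrow>
       (\<exists>w. 0 < ltheta N q (occ (s_dn N) (thinned (P \<omega>) u)) w \<and> P \<omega> \<inter> cell (s_dn N) w \<subseteq> C)"
    proof (rule ccontr)
      assume n: "\<not> thesis"
      from elim(2) have "AE u in (Bern p :: (site \<times> nat \<times> site \<Rightarrow> bool) measure). False"
        by eventually_elim (use n that in blast)
      then show False by simp
    qed
    show ?case
    proof (intro allI impI)
      fix C assume C: "is_inf_component (P \<omega>) C"
      then obtain x where x: "x \<in> P \<omega>" "C = {y. (gadj (P \<omega>))\<^sup>*\<^sup>* x y}" by (auto simp: is_inf_component_def)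
      obtain w where w: "0 < ltheta N q (occ (s_dn N) (thinned (P \<omega>) u)) w" "P \<omega> \<inter> cell (s_dn N) w \<subseteq> C"
        using u C by blast
      have CP: "C \<subseteq> P \<omega>"
      proof
        fix y assume "y \<in> C"
        then have "(gadj (P \<omega>))\<^sup>*\<^sup>* x y" using x by simp
        then show "y \<in> P \<omega>" by (cases rule: rtranclp.cases) (use x in \<open>auto simp: gadj_def\<close>)
      qed
      have "pc_bond C \<le> q"
      proof (rule pc_bond_le[OF s_pos(2) s_dn_eq _ _ w(2,1)])
        show "thinned (P \<omega>) u \<subseteq> P \<omega>" by (auto simp: thinned_def)
        show "b \<in> C" if "a \<in> C" "gadj (P \<omega>) a b" for a b
          using that x by (auto intro: rtranclp.rtrancl_into_rtrancl)
        show "countable C" using countable_loc_finite[OF lf] CP by (rule countable_subset[rotated])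
      qed (use q in simp)
      then show "pc_bond C < pc_site C" using elim(1) C r by fastforce
    qed
  qed
qed

end

theorem theorem1:
  fixes M :: "'a measure" and P :: "'a \<Rightarrow> pt set" and lam :: real
  assumes "poisson_pp M lam P"
    and "lam > gilbert_lambda_c"
  shows "AE \<omega> in M. \<forall>C. is_inf_component (P \<omega>) C \<longrightarrow> pc_site C > pc_bond C"
proof -
  obtain P' where P': "lf_poisson M lam P'" "AE \<omega> in M. P' \<omega> = P \<omega>" using poisson_pp_lf[OF assms(1)] .
  interpret lf_poisson M lam P' by fact
  \<comment> \<open>If infinite components have positive probability, \<open>site_gt_bond\<close>
    can show that \<open>perc_intensities\<close> is nonempty, so that
    \<open>gilbert_lambda_c\<close> is a genuine infimum. Otherwise the claim is almost surely
    vacuous.\<close>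
  have "AE \<omega> in M. \<forall>C. is_inf_component (P' \<omega>) C \<longrightarrow> pc_bond C < pc_site C"
  proof (cases "AE \<omega> in M. \<not> has_inf_comp (P' \<omega>)")
    case True
    then show ?thesis
    proof eventually_elim
      case (elim \<omega>)
      then show ?case by (auto simp: has_inf_comp_def is_inf_component_def)
    qed
  qed (rule site_gt_bond[OF assms(2)])
  with P'(2) show ?thesis by eventually_elim simp
qed

end
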